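(* Let $k\ge1$ and $k-1\le l\le k$, and let $\mu\in\mathcal P$. For every $T\in\mathcal T_H$ let $Q_{\rm red}^T\subset Q_h^{k,T}$ be a local reduced space (a linear subspace) containing the constant function $1$, let $Q_{\rm red}(\mathcal T_H):=\{q\in Q_h^k: q|_T\in Q_{\rm red}^T\ \forall T\in\mathcal T_H\}$, and let $C_P^T>0$ denote the constant from the Poincaré inequality $\|\varphi-\Pi_0^T\varphi\|_{L^2(T)}^2\le C_P^Th_T^2\|\nabla\varphi\|_{L^2(T)}^2$ for all $\varphi\in H^1(T)$, where $\Pi_0^T$ is the $L^2(T)$-orthogonal projection onto the constants. Let $p(\mu)\in H^1_0(\Omega)$ be the weak solution, i.e. $b(p(\mu),q;\mu)=\int_\Omega fq\,dx$ for all $q\in H^1_0(\Omega)$; let $p_h(\mu)\in Q_h^1$ be the DG solution, i.e. $b_h(p_h(\mu),q_h;\mu)=\int_\Omega fq_h\,dx$ for all $q_h\in Q_h^1$; and let $p_{\rm red}(\mu)\in Q_{\rm red}(\mathcal T_H)$ be the reduced solution, i.e. $b_h(p_{\rm red}(\mu),q_{\rm red};\mu)=\int_\Omega fq_{\rm red}\,dx$ for all $q_{\rm red}\in Q_{\rm red}(\mathcal T_H)$. Then for arbitrary $\overline\mu,\hat\mu\in\mathcal P$, $$|||p(\mu)-p_h(\mu)|||_{\overline\mu}\le\eta(p_h(\mu);\mu,\overline\mu,\hat\mu),\qquad |||p(\mu)-p_{\rm red}(\mu)|||_{\overline\mu}\le\eta(p_{\rm red}(\mu);\mu,\overline\mu,\hat\mu),$$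 where $$\eta(q;\mu,\overline\mu,\hat\mu):=\frac1{\sqrt{\alpha(\mu,\overline\mu)}}\Bigg[\sqrt{\gamma(\mu,\overline\mu)}\Big(\sum_{T\in\mathcal T_H}\eta_{\rm nc}^T(q;\overline\mu)^2\Big)^{1/2}+\Big(\sum_{T\in\mathcal T_H}\eta_{\rm r}^T(q;\mu)^2\Big)^{1/2}+\frac1{\sqrt{\alpha(\mu,\hat\mu)}}\Big(\sum_{T\in\mathcal T_H}\eta_{\rm df}^T(q;\mu,\hat\mu)^2\Big)^{1/2}\Bigg]$$ and, for each $T\in\mathcal T_H$, $$\eta_{\rm nc}^T(q;\overline\mu):=|||q-I_{\rm os}[q]|||_{\overline\mu,T},\qquad \eta_{\rm r}^T(q;\mu):=\big(C_P^T/c_\varepsilon^T\big)^{1/2}h_T\,\|f-\nabla\cdot R_h^l[q;\mu]\|_{L^2(T)},$$ $$\eta_{\rm df}^T(q;\mu,\hat\mu):=\big\|(\lambda(\hat\mu)\kappa_\varepsilon)^{-1/2}\big(\lambda(\mu)\kappa_\varepsilon\nabla_hq+R_h^l[q;\mu]\big)\big\|_{L^2(T)},$$ with $I_{\rm os}$ the Oswald interpolation operator and $R_h^l$ the diffusive flux reconstruction operator.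
   Context: Meshes. $\Omega\subset\mathbb R^d$, $d\in\{2,3\}$, is a bounded connected domain with polygonal boundary; $\tau_h$ is a shape-regular simplicial triangulation of $\Omega$ without hanging nodes. $\mathcal T_H$ is a coarse partition of $\Omega$ such that each $T\in\mathcal T_H$ is covered by the fine elements in a subset $\tau_h^T\subset\tau_h$ (the partitions are nested); $h_T$ is the diameter of $T$. A fine face $e$ (with diameter $h_e$) is either an inner face $e=\partial t^-\cap\partial t^+$, with unit normal $n_e$ pointing from $t^-$ to $t^+$, or a boundary face $e=\partial t^-\cap\partial\Omega$, with $n_e$ the unit outward normal to $\partial\Omega$. $\mathcal F_h^t$ is the set of faces of $t\in\tau_h$; for $T\in\mathcal T_H$, $\mathring{\mathcal F}_h^T$ is the set of fine faces lying in the interior of $T$. $\mathcal F_H$ is the set of coarse faces (interfaces of two coarse elements, or of a coarse element with $\partial\Omega$), and for $E\in\mathcal F_H$, $\mathcal F_h^E$ is the set of fine faces covering $E$. Data. $\mathcal P\subset\mathbb R^m$, $m\in\mathbb N$, is the parameter set. $f\in L^2(\Omega)$ is bounded; $\lambda(\mu)\in L^\infty(\Omega)$ is strictly positive for every $\mu\in\mathcal P$; $\kappa_\varepsilon\in[L^\infty(\Omega)]^{d\times d}$ is symmetric, uniformly positive definite, and constant on each $t\in\tau_h$; $\lambda(\mu)\kappa_\varepsilon$ is bounded from below (away from $0$) and above for every $\mu\in\mathcal P$. For $t\in\tau_h$, $c_\varepsilon^t(\mu)>0$ denotes the smallest eigenvalue of $(\lambda(\mu)\kappa_\varepsilon)|_t$;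 $0<c_\varepsilon^t:=\min_{\mu\in\mathcal P}c_\varepsilon^t(\mu)$ and $c_\varepsilon^T:=\min_{t\in\tau_h^T}c_\varepsilon^t$. Parameter dependence. $\lambda$ is affinely decomposable: $\lambda(x;\mu)=\sum_{\xi=1}^{\Xi}\theta_\xi(\mu)\lambda_\xi(x)$ with strictly positive coefficients $\theta_\xi:\mathcal P\to\mathbb R$ and components $\lambda_\xi\in L^\infty(\Omega)$. The equivalence constants are $\alpha(\mu,\overline\mu):=\min_{\xi}\theta_\xi(\mu)\theta_\xi(\overline\mu)^{-1}$ and $\gamma(\mu,\overline\mu):=\max_{\xi}\theta_\xi(\mu)\theta_\xi(\overline\mu)^{-1}$; they are used to compare $\alpha(\mu,\overline\mu)\lambda(\overline\mu)\le\lambda(\mu)\le\gamma(\mu,\overline\mu)\lambda(\overline\mu)$, which is presented as a consequence of the decomposition and not as a separate hypothesis. Energy norms. $H^1(\tau_h):=\{q\in L^2(\Omega): q|_t\in H^1(t)\ \forall t\in\tau_h\}$, with element-wise gradient $\nabla_h$. For $p,q\in H^1(\tau_h)$ and $\omega=T\in\mathcal T_H$ or $\omega=t\in\tau_h$: $b^\omega(p,q;\mu):=\int_\omega(\lambda(\mu)\kappa_\varepsilon\nabla_hp)\cdot\nabla_hq\,dx$; $b:=\sum_{T\in\mathcal T_H}b^T$, $|||q|||_{\mu,T}:=b^T(q,q;\mu)^{1/2}$, $|||q|||_\mu:=\big(\sum_{T\in\mathcal T_H}|||q|||_{\mu,T}^2\big)^{1/2}$. Jumps and averages. With $q^\pm:=q|_{t^\pm}$: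 on an inner face $[[q]]_e:=q^--q^+$ and $\{\{q\}\}_e:=\omega_e^-q^-+\omega_e^+q^+$ with weights $\omega_e^\pm>0$, $\omega_e^-+\omega_e^+=1$; on a boundary face $\omega_e^-=1$, $\omega_e^+=0$ and $[[q]]_e:=\{\{q\}\}_e:=q$. Let $\delta_e^\pm:=n_e\cdot\kappa_\varepsilon|_{t^\pm}n_e$. The SWIPDG weights are $\omega_e^-:=\delta_e^+/(\delta_e^++\delta_e^-)$, $\omega_e^+:=\delta_e^-/(\delta_e^++\delta_e^-)$. The penalty is $\sigma_e(\mu):=\sigma h_e^{-1}\{\{\lambda(\mu)\}\}_e\,\sigma_\varepsilon^e$ with $\sigma\ge1$ a user-dependent parameter, $\sigma_\varepsilon^e:=\delta_e^+\delta_e^-/(\delta_e^++\delta_e^-)$ on inner faces and $\sigma_\varepsilon^e:=\delta_e^-$ on boundary faces. For $p,q\in H^1(\tau_h)$, $$b_c^e(p,q;\mu):=\int_e-\{\{(\lambda(\mu)\kappa_\varepsilon\nabla p)\cdot n_e\}\}_e[[q]]_e\,ds,\qquad b_p^e(p,q;\mu):=\int_e\sigma_e(\mu)[[p]]_e[[q]]_e\,ds.$$ Discretization. On each $T\in\mathcal T_H$ a local discretization is chosen, with $\vartheta\in\{-1,0,1\}$ and weights on $e\in\mathring{\mathcal F}_h^T$: NIPDG ($\vartheta=-1$, $\omega_e^\pm=\frac12$), IIPDG ($\vartheta=0$, $\omega_e^\pm=\frac12$), SIPDG ($\vartheta=1$, $\omega_e^\pm=\frac12$), or SWIPDG ($\vartheta=1$,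 SWIPDG weights). With $\mathbb P_k$ denoting polynomials of total degree at most $k$, the local space $Q_h^{k,T}$ is either the continuous space $\{q\in C^0(T): q|_t\in\mathbb P_k(t)\ \forall t\in\tau_h^T\}$ (for which the jump terms inside $T$ vanish) or the discontinuous space $\{q\in L^2(T): q|_t\in\mathbb P_k(t)\ \forall t\in\tau_h^T\}$. The global space is $Q_h^k:=\{q\in H^1(\tau_h): q|_T\in Q_h^{k,T}\ \forall T\in\mathcal T_H\}$. On fine faces lying on coarse faces the SWIPDG weights are used. The bilinear form is $$b_h(p,q;\mu):=\sum_{T\in\mathcal T_H}\Big[b^T(p,q;\mu)+\sum_{e\in\mathring{\mathcal F}_h^T}\big(\vartheta\, b_c^e(q,p;\mu)+b_c^e(p,q;\mu)+b_p^e(q,p;\mu)\big)\Big]+\sum_{E\in\mathcal F_H}\sum_{e\in\mathcal F_h^E}\big(b_c^e(q,p;\mu)+b_c^e(p,q;\mu)+b_p^e(q,p;\mu)\big).$$ The parameter $\sigma$ is large enough that $b_h(\cdot,\cdot;\mu)$ is continuous and coercive for all $\mu\in\mathcal P$ (coercivity understood with respect to a DG norm, i.e. the $H^1$ semi-norm combined with a jump norm). Oswald interpolation. $I_{\rm os}:Q_h^k\to Q_h^k\cap H^1_0(\Omega)$ is defined by prescribing the values of $I_{\rm os}[q]$ at the Lagrange nodes $\nu$ of $\tau_h$: $I_{\rm os}[q](\nu):=q|_t(\nu)$ for nodes inside an element $t$; $I_{\rm os}[q](\nu):=\frac1{|\tau_h^\nu|}\sum_{t\in\tau_h^\nu}q|_t(\nu)$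 for inner nodes of $\tau_h$, where $\tau_h^\nu$ is the set of elements of $\tau_h$ sharing $\nu$ as a node; and $I_{\rm os}[q](\nu):=0$ for boundary nodes. Diffusive flux reconstruction. $V_h^l(\tau_h):=\{v\in H_{\rm div}(\Omega): v|_t\in[\mathbb P_l(t)]^d+\boldsymbol x\,\mathbb P_l(t)\ \forall t\in\tau_h\}$ is the Raviart-Thomas-Nédélec space, where $H_{\rm div}(\Omega)$ consists of the $v\in[L^2(\Omega)]^d$ with $\nabla\cdot v\in L^2(\Omega)$. For $q_h\in Q_h^k$, $R_h^l[q_h;\mu]\in V_h^l(\tau_h)$ is specified locally, for all $t\in\tau_h$, by $$(R_h^l[q_h;\mu]\cdot n_e,q)_{L^2(e)}=b_c^e(q_h,q;\mu)+b_p^e(q_h,q;\mu)\qquad\text{for all }q\in\mathbb P_l(e)\text{ and all }e\in\mathcal F_h^t,$$ $$(R_h^l[q_h;\mu],\nabla q)_{L^2(t)}=-b^t(q_h,q;\mu)-\sum_{e\in\mathcal F_h^t}\vartheta_e\,b_c^e(q,q_h;\mu)\qquad\text{for all }\nabla q\in[\mathbb P_{l-1}(t)]^d\text{ with }q\in\mathbb P_l(t),$$ where $\vartheta_e$ is the $\vartheta$ of the local discretization on $T$ if $e\in\mathring{\mathcal F}_h^T$, and $\vartheta_e=1$ if $e$ lies on a coarse face. In the first condition $q\in\mathbb P_l(e)$ takes the place of the jump $[[q]]_e$; in the second, $q\in\mathbb P_l(t)$ is regarded as extended by zero outside $t$.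
   Formalization: The components λ_ξ of the affine decomposition are additionally assumed nonnegative almost everywhere; without this the comparison αλ(μ̄) ≤ λ(μ) ≤ γλ(μ̄) and the stated bounds can fail. *)

theory Defs
  imports "HOL-Analysis.Analysis"
begin

section \<open>Function spaces\<close>

text \<open>Functions on a set of positive measure stand for their almost-everywhere classes; point values
  and values on faces are always taken through the operator \<open>trace\<close> below.\<close>

definition L2 :: "(real^'d) set \<Rightarrow> (real^'d \<Rightarrow> 'b::{real_normed_vector, second_countable_topology}) \<Rightarrow> bool" where
  "L2 S u \<longleftrightarrow> u \<in> borel_measurable (lebesgue_on S) \<and> integrable (lebesgue_on S) (\<lambda>x. (norm (u x))\<^sup>2)"

definition Linf :: "(real^'d) set \<Rightarrow> (real^'d \<Rightarrow> 'b::{real_normed_vector, second_countable_topology}) \<Rightarrow> bool" where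
  "Linf S u \<longleftrightarrow> u \<in> borel_measurable (lebesgue_on S) \<and> (\<exists>C. AE x in lebesgue_on S. norm (u x) \<le> C)"

definition l2norm :: "(real^'d) set \<Rightarrow> (real^'d \<Rightarrow> 'b::real_normed_vector) \<Rightarrow> real" where
  "l2norm S u = sqrt (LINT x|lebesgue_on S. (norm (u x))\<^sup>2)"

definition partial :: "'d \<Rightarrow> (real^'d \<Rightarrow> real) \<Rightarrow> real^'d \<Rightarrow> real" where
  "partial i f x = frechet_derivative f (at x) (axis i 1)"

fun cont_diff :: "nat \<Rightarrow> (real^'d \<Rightarrow> real) \<Rightarrow> bool" where
  "cont_diff 0 f \<longleftrightarrow> continuous_on UNIV f"
| "cont_diff (Suc m) f \<longleftrightarrow> (\<forall>x. f differentiable (at x)) \<and> (\<forall>i. cont_diff m (partial i f))"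

definition test_functions :: "(real^'d) set \<Rightarrow> (real^'d \<Rightarrow> real) set" where
  "test_functions U = {\<phi>. (\<forall>m. cont_diff m \<phi>) \<and>
     compact (closure {x. \<phi> x \<noteq> 0}) \<and> closure {x. \<phi> x \<noteq> 0} \<subseteq> U}"

definition has_weak_grad :: "(real^'d) set \<Rightarrow> (real^'d \<Rightarrow> real) \<Rightarrow> (real^'d \<Rightarrow> real^'d) \<Rightarrow> bool" where
  "has_weak_grad U u g \<longleftrightarrow> L2 U u \<and> L2 U g \<and>
     (\<forall>\<phi>\<in>test_functions U. \<forall>i.
        (LINT x|lebesgue_on U. u x * partial i \<phi> x) = - (LINT x|lebesgue_on U. g x $ i * \<phi> x))"

definition wgrad :: "(real^'d) set \<Rightarrow> (real^'d \<Rightarrow> real) \<Rightarrow> real^'d \<Rightarrow> real^'d" where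
  "wgrad U u = (SOME g. has_weak_grad U u g)"

text \<open>\<^term>\<open>H1 U\<close> is the Sobolev space over the open set \<^term>\<open>U\<close>;
  \<open>H10\<close> is the closure of the test functions in it.\<close>

definition H1 :: "(real^'d) set \<Rightarrow> (real^'d \<Rightarrow> real) \<Rightarrow> bool" where
  "H1 U u \<longleftrightarrow> (\<exists>g. has_weak_grad U u g)"

definition H10 :: "(real^'d) set \<Rightarrow> (real^'d \<Rightarrow> real) \<Rightarrow> bool" where
  "H10 U u \<longleftrightarrow> H1 U u \<and>
     (\<forall>\<epsilon>>0. \<exists>\<phi>\<in>test_functions U.
        (l2norm U (\<lambda>x. u x - \<phi> x))\<^sup>2 + (l2norm U (\<lambda>x. wgrad U u x - wgrad U \<phi> x))\<^sup>2 < \<epsilon>)"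

definition has_weak_div :: "(real^'d) set \<Rightarrow> (real^'d \<Rightarrow> real^'d) \<Rightarrow> (real^'d \<Rightarrow> real) \<Rightarrow> bool" where
  "has_weak_div U v g \<longleftrightarrow> L2 U v \<and> L2 U g \<and>
     (\<forall>\<phi>\<in>test_functions U.
        (LINT x|lebesgue_on U. v x \<bullet> (\<chi> i. partial i \<phi> x)) = - (LINT x|lebesgue_on U. g x * \<phi> x))"

definition wdiv :: "(real^'d) set \<Rightarrow> (real^'d \<Rightarrow> real^'d) \<Rightarrow> real^'d \<Rightarrow> real" where
  "wdiv U v = (SOME g. has_weak_div U v g)"

text \<open>Polynomials of total degree at most \<^term>\<open>k\<close>, as functions on the whole space;
  \<open>\<bbbP>\<^sub>k\<close> of an element or of a face consists of their restrictions.\<close>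

definition Poly :: "nat \<Rightarrow> (real^'d \<Rightarrow> real) set" where
  "Poly k = {\<pi>. \<exists>c. \<forall>x. \<pi> x =
     (\<Sum>a | sum a (UNIV :: 'd set) \<le> k. c a * (\<Prod>i\<in>UNIV. x $ i ^ a i))}"

text \<open>\<^term>\<open>proj_const T \<phi>\<close> is the orthogonal projection of \<^term>\<open>\<phi>\<close> onto the constants
  in the space of square integrable functions on \<^term>\<open>T\<close>.\<close>

definition proj_const :: "(real^'d) set \<Rightarrow> (real^'d \<Rightarrow> real) \<Rightarrow> real" where
  "proj_const T \<phi> = (THE c. \<forall>d. (LINT x|lebesgue_on T. (\<phi> x - c) * d) = 0)"

definition poincare :: "(real^'d) set \<Rightarrow> real \<Rightarrow> bool" where
  "poincare T C \<longleftrightarrow> (\<forall>\<phi>. H1 (interior T) \<phi> \<longrightarrow>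
     (l2norm T (\<lambda>x. \<phi> x - proj_const T \<phi>))\<^sup>2
       \<le> C * (diameter T)\<^sup>2 * (l2norm T (wgrad (interior T) \<phi>))\<^sup>2)"

text \<open>One-sided boundary values from an element \<^term>\<open>t\<close>, as limits of averages. This is the usual
  trace wherever \<^term>\<open>u\<close> restricted to \<^term>\<open>t\<close> extends continuously to the point, and
  the Sobolev trace (at almost every point of a face) for \<^term>\<open>u\<close> in \<open>H\<^sup>1(t)\<close>. For a merely bounded
  function the limit need not exist, and then the value is unspecified; this concerns the
  coefficient \<open>\<lambda>(\<mu>)\<close>, whose face values are presupposed by the bilinear form.\<close>

definition trace :: "(real^'d) set \<Rightarrow> (real^'d \<Rightarrow> 'b::{banach, second_countable_topology}) \<Rightarrow> real^'d \<Rightarrow> 'b" where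
  "trace t u x = Lim (at_right 0)
     (\<lambda>r. (LINT y|lebesgue_on (t \<inter> cball x r). u y) /\<^sub>R measure lebesgue (t \<inter> cball x r))"

definition outer_normal :: "(real^'d) set \<Rightarrow> (real^'d) set \<Rightarrow> real^'d" where
  "outer_normal t e = (SOME n. norm n = 1 \<and> (\<forall>x\<in>t. \<forall>y\<in>e. n \<bullet> (x - y) \<le> 0))"

text \<open>Surface integral over a flat face \<^term>\<open>e\<close> with unit normal \<^term>\<open>n\<close>. The \<open>(d-1)\<close>-dimensional
  measure of a subset of a hyperplane is the \<open>d\<close>-dimensional measure of the prism of
  height 1 over it, so the integrand is extended to the prism constantly along \<^term>\<open>n\<close>.\<close>

definition face_integral :: "real^'d \<Rightarrow> (real^'d) set \<Rightarrow> (real^'d \<Rightarrow> real) \<Rightarrow> real" where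
  "face_integral n e g =
     (LINT y|lebesgue_on {x + s *\<^sub>R n |x s. x \<in> e \<and> 0 \<le> s \<and> s \<le> 1}.
        g (y - (n \<bullet> (y - (SOME a. a \<in> e))) *\<^sub>R n))"

section \<open>Matrices\<close>

definition sym_posdef :: "real^'d^'d \<Rightarrow> bool" where
  "sym_posdef A \<longleftrightarrow> transpose A = A \<and> (\<forall>v. v \<noteq> 0 \<longrightarrow> v \<bullet> (A *v v) > 0)"

text \<open>The inverse square root is determined uniquely for symmetric positive definite
  \<^term>\<open>A\<close>.\<close>

definition inv_sqrt :: "real^'d^'d \<Rightarrow> real^'d^'d" where
  "inv_sqrt A = (SOME B. sym_posdef B \<and> B ** B = matrix_inv A)"

definition min_eigenvalue :: "real^'d^'d \<Rightarrow> real" where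
  "min_eigenvalue A = (LEAST s. \<exists>v. v \<noteq> 0 \<and> A *v v = s *\<^sub>R v)"

section \<open>Problem setting\<close>

datatype dg_scheme = NIPDG | IIPDG | SIPDG | SWIPDG

text \<open>Grid elements and faces are closed sets. The field \<open>elem_minus e\<close> is the element
  \<open>t\<^sup>-\<close> at the fine face \<open>e\<close>, and \<open>elem_plus e\<close> is \<open>t\<^sup>+\<close>
  (relevant for inner faces only). The flag \<open>cont_space T\<close> selects the continuous
  local space on the coarse element \<open>T\<close>. The parameter set is \<open>params\<close>, and
  \<open>theta\<close>, \<open>lam_comp\<close> are the coefficients and components of the affine decomposition,
  indexed by \<open>{1..num_comp}\<close>. The mesh is shape regular with constant \<open>shape_const\<close>.\<close>

record ('d, 'm) dg_data =
  Omega :: "(real^'d) set"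
  fine_mesh :: "(real^'d) set set"
  shape_const :: real
  coarse_mesh :: "(real^'d) set set"
  elem_minus :: "(real^'d) set \<Rightarrow> (real^'d) set"
  elem_plus :: "(real^'d) set \<Rightarrow> (real^'d) set"
  params :: "(real^'m) set"
  num_comp :: nat
  theta :: "nat \<Rightarrow> real^'m \<Rightarrow> real"
  lam_comp :: "nat \<Rightarrow> real^'d \<Rightarrow> real"
  kappa :: "real^'d \<Rightarrow> real^'d^'d"
  rhs :: "real^'d \<Rightarrow> real"
  penalty :: real
  scheme :: "(real^'d) set \<Rightarrow> dg_scheme"
  cont_space :: "(real^'d) set \<Rightarrow> bool"

subsection \<open>Meshes and faces\<close>

text \<open>The condition \<^term>\<open>interior (closure U) = U\<close> says that the domain lies on one side of
  its boundary (no slits).\<close>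

definition polygonal_domain :: "(real^'d) set \<Rightarrow> bool" where
  "polygonal_domain U \<longleftrightarrow> open U \<and> U \<noteq> {} \<and> bounded U \<and> connected U \<and> interior (closure U) = U \<and>
     (\<exists>\<F>. finite \<F> \<and> (\<forall>F\<in>\<F>. polytope F \<and> aff_dim F = int CARD('d) - 1) \<and> frontier U = \<Union>\<F>)"

definition elem_faces :: "(real^'d) set \<Rightarrow> (real^'d) set set" where
  "elem_faces t = {e. e facet_of t}"

definition fine_faces :: "('d::finite, 'm::finite) dg_data \<Rightarrow> (real^'d) set set" where
  "fine_faces D = (\<Union>t\<in>fine_mesh D. elem_faces t)"

definition boundary_face :: "('d::finite, 'm::finite) dg_data \<Rightarrow> (real^'d) set \<Rightarrow> bool" where
  "boundary_face D e \<longleftrightarrow> e \<subseteq> frontier (Omega D)"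

definition fine_in :: "('d::finite, 'm::finite) dg_data \<Rightarrow> (real^'d) set \<Rightarrow> (real^'d) set set" where
  "fine_in D T = {t \<in> fine_mesh D. t \<subseteq> T}"

definition interior_faces :: "('d::finite, 'm::finite) dg_data \<Rightarrow> (real^'d) set \<Rightarrow> (real^'d) set set" where
  "interior_faces D T = {e \<in> fine_faces D. rel_interior e \<subseteq> interior T}"

text \<open>Two coarse elements may also meet in a lower-dimensional set, which is not a face.\<close>

definition coarse_faces :: "('d::finite, 'm::finite) dg_data \<Rightarrow> (real^'d) set set" where
  "coarse_faces D =
     {T \<inter> T' |T T'. T \<in> coarse_mesh D \<and> T' \<in> coarse_mesh D \<and> T \<noteq> T' \<and> (\<exists>e\<in>fine_faces D. e \<subseteq> T \<inter> T')} \<union>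
     {T \<inter> frontier (Omega D) |T. T \<in> coarse_mesh D \<and> (\<exists>e\<in>fine_faces D. e \<subseteq> T \<inter> frontier (Omega D))}"

definition faces_covering :: "('d::finite, 'm::finite) dg_data \<Rightarrow> (real^'d) set \<Rightarrow> (real^'d) set set" where
  "faces_covering D E = {e \<in> fine_faces D. e \<subseteq> E}"

definition mesh_assms :: "('d::finite, 'm::finite) dg_data \<Rightarrow> bool" where
  "mesh_assms D \<longleftrightarrow>
     triangulation (fine_mesh D) \<and> (\<forall>t\<in>fine_mesh D. int CARD('d) simplex t) \<and>
     \<Union>(fine_mesh D) = closure (Omega D) \<and>
     shape_const D > 0 \<and> (\<forall>t\<in>fine_mesh D. \<exists>x. ball x (diameter t / shape_const D) \<subseteq> t) \<and>
     (\<forall>T\<in>coarse_mesh D. \<exists>S. S \<subseteq> fine_mesh D \<and> S \<noteq> {} \<and> T = \<Union>S) \<and>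
     \<Union>(coarse_mesh D) = closure (Omega D) \<and>
     (\<forall>T\<in>coarse_mesh D. \<forall>T'\<in>coarse_mesh D. T \<noteq> T' \<longrightarrow> interior T \<inter> interior T' = {}) \<and>
     (\<forall>e\<in>fine_faces D. elem_minus D e \<in> fine_mesh D \<and> e facet_of elem_minus D e) \<and>
     (\<forall>e\<in>fine_faces D. \<not> boundary_face D e \<longrightarrow>
        elem_plus D e \<in> fine_mesh D \<and> e facet_of elem_plus D e \<and> elem_plus D e \<noteq> elem_minus D e)"

definition face_normal :: "('d::finite, 'm::finite) dg_data \<Rightarrow> (real^'d) set \<Rightarrow> real^'d" where
  "face_normal D e = outer_normal (elem_minus D e) e"

subsection \<open>Coefficients\<close>

definition lam :: "('d::finite, 'm::finite) dg_data \<Rightarrow> real^'m \<Rightarrow> real^'d \<Rightarrow> real" where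
  "lam D \<mu> x = (\<Sum>\<xi>=1..num_comp D. theta D \<xi> \<mu> * lam_comp D \<xi> x)"

definition diff_tensor :: "('d::finite, 'm::finite) dg_data \<Rightarrow> real^'m \<Rightarrow> real^'d \<Rightarrow> real^'d^'d" where
  "diff_tensor D \<mu> x = lam D \<mu> x *\<^sub>R kappa D x"

definition kappa_on :: "('d::finite, 'm::finite) dg_data \<Rightarrow> (real^'d) set \<Rightarrow> real^'d^'d" where
  "kappa_on D t = (THE K. AE x in lebesgue_on t. kappa D x = K)"

text \<open>Since \<open>\<lambda>(\<mu>)\<close> may vary inside an element, the smallest eigenvalue over the element is
  the essential infimum of the pointwise smallest eigenvalues.\<close>

definition c_elem :: "('d::finite, 'm::finite) dg_data \<Rightarrow> (real^'d) set \<Rightarrow> real^'m \<Rightarrow> real" where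
  "c_elem D t \<mu> = Sup {c. AE x in lebesgue_on t. c \<le> min_eigenvalue (diff_tensor D \<mu> x)}"

definition c_eps :: "('d::finite, 'm::finite) dg_data \<Rightarrow> (real^'d) set \<Rightarrow> real" where
  "c_eps D t = (INF \<mu>\<in>params D. c_elem D t \<mu>)"

definition c_coarse :: "('d::finite, 'm::finite) dg_data \<Rightarrow> (real^'d) set \<Rightarrow> real" where
  "c_coarse D T = Min (c_eps D ` fine_in D T)"

definition alpha :: "('d::finite, 'm::finite) dg_data \<Rightarrow> real^'m \<Rightarrow> real^'m \<Rightarrow> real" where
  "alpha D \<mu> \<nu> = Min ((\<lambda>\<xi>. theta D \<xi> \<mu> * inverse (theta D \<xi> \<nu>)) ` {1..num_comp D})"

definition gamma :: "('d::finite, 'm::finite) dg_data \<Rightarrow> real^'m \<Rightarrow> real^'m \<Rightarrow> real" where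
  "gamma D \<mu> \<nu> = Max ((\<lambda>\<xi>. theta D \<xi> \<mu> * inverse (theta D \<xi> \<nu>)) ` {1..num_comp D})"

text \<open>The components \<open>\<lambda>\<^sub>\<xi>\<close> are taken to be nonnegative. Without a sign condition the comparison
  \<open>\<alpha>(\<mu>,\<nu>) \<lambda>(\<nu>) \<le> \<lambda>(\<mu>) \<le> \<gamma>(\<mu>,\<nu>) \<lambda>(\<nu>)\<close> does not follow from the affine
  decomposition.\<close>

definition data_assms :: "('d::finite, 'm::finite) dg_data \<Rightarrow> bool" where
  "data_assms D \<longleftrightarrow>
     L2 (Omega D) (rhs D) \<and> Linf (Omega D) (rhs D) \<and>
     num_comp D \<ge> 1 \<and>
     (\<forall>\<xi>\<in>{1..num_comp D}. (\<forall>\<mu>\<in>params D. theta D \<xi> \<mu> > 0) \<and> Linf (Omega D) (lam_comp D \<xi>) \<and>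
        (AE x in lebesgue_on (Omega D). lam_comp D \<xi> x \<ge> 0)) \<and>
     (\<forall>\<mu>\<in>params D. Linf (Omega D) (lam D \<mu>) \<and> (AE x in lebesgue_on (Omega D). lam D \<mu> x > 0)) \<and>
     Linf (Omega D) (kappa D) \<and>
     (AE x in lebesgue_on (Omega D). transpose (kappa D x) = kappa D x) \<and>
     (\<exists>c>0. AE x in lebesgue_on (Omega D). \<forall>v. v \<bullet> (kappa D x *v v) \<ge> c * (v \<bullet> v)) \<and>
     (\<forall>t\<in>fine_mesh D. \<exists>K. AE x in lebesgue_on t. kappa D x = K) \<and>
     (\<forall>\<mu>\<in>params D. \<exists>c>0. \<exists>C. AE x in lebesgue_on (Omega D). \<forall>v.
        c * (v \<bullet> v) \<le> v \<bullet> (diff_tensor D \<mu> x *v v) \<and> v \<bullet> (diff_tensor D \<mu> x *v v) \<le> C * (v \<bullet> v)) \<and>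
     (\<forall>t\<in>fine_mesh D. \<exists>\<mu>\<^sub>0\<in>params D. c_elem D t \<mu>\<^sub>0 > 0 \<and> (\<forall>\<mu>\<in>params D. c_elem D t \<mu>\<^sub>0 \<le> c_elem D t \<mu>)) \<and>
     penalty D \<ge> 1"

subsection \<open>Broken Sobolev space and energy norms\<close>

definition H1_broken :: "('d::finite, 'm::finite) dg_data \<Rightarrow> (real^'d \<Rightarrow> real) \<Rightarrow> bool" where
  "H1_broken D q \<longleftrightarrow> L2 (Omega D) q \<and> (\<forall>t\<in>fine_mesh D. H1 (interior t) q)"

definition broken_grad :: "('d::finite, 'm::finite) dg_data \<Rightarrow> (real^'d \<Rightarrow> real) \<Rightarrow> real^'d \<Rightarrow> real^'d" where
  "broken_grad D q x = (if \<exists>t\<in>fine_mesh D. x \<in> interior t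
     then wgrad (interior (THE t. t \<in> fine_mesh D \<and> x \<in> interior t)) q x else 0)"

definition b_loc :: "('d::finite, 'm::finite) dg_data \<Rightarrow> real^'m \<Rightarrow> (real^'d) set \<Rightarrow>
    (real^'d \<Rightarrow> real) \<Rightarrow> (real^'d \<Rightarrow> real) \<Rightarrow> real" where
  "b_loc D \<mu> \<omega> p q =
     (LINT x|lebesgue_on \<omega>. (diff_tensor D \<mu> x *v broken_grad D p x) \<bullet> broken_grad D q x)"

definition b_form :: "('d::finite, 'm::finite) dg_data \<Rightarrow> real^'m \<Rightarrow> (real^'d \<Rightarrow> real) \<Rightarrow> (real^'d \<Rightarrow> real) \<Rightarrow> real" where
  "b_form D \<mu> p q = (\<Sum>T\<in>coarse_mesh D. b_loc D \<mu> T p q)"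

definition energy_loc :: "('d::finite, 'm::finite) dg_data \<Rightarrow> real^'m \<Rightarrow> (real^'d) set \<Rightarrow> (real^'d \<Rightarrow> real) \<Rightarrow> real" where
  "energy_loc D \<mu> T q = sqrt (b_loc D \<mu> T q q)"

definition energy :: "('d::finite, 'm::finite) dg_data \<Rightarrow> real^'m \<Rightarrow> (real^'d \<Rightarrow> real) \<Rightarrow> real" where
  "energy D \<mu> q = sqrt (\<Sum>T\<in>coarse_mesh D. (energy_loc D \<mu> T q)\<^sup>2)"

subsection \<open>Discontinuous Galerkin discretization\<close>

definition delta_minus :: "('d::finite, 'm::finite) dg_data \<Rightarrow> (real^'d) set \<Rightarrow> real" where
  "delta_minus D e = face_normal D e \<bullet> (kappa_on D (elem_minus D e) *v face_normal D e)"

definition delta_plus :: "('d::finite, 'm::finite) dg_data \<Rightarrow> (real^'d) set \<Rightarrow> real" where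
  "delta_plus D e = face_normal D e \<bullet> (kappa_on D (elem_plus D e) *v face_normal D e)"

definition weight_minus :: "('d::finite, 'm::finite) dg_data \<Rightarrow> (real^'d) set \<Rightarrow> real" where
  "weight_minus D e =
     (if boundary_face D e then 1
      else if \<exists>T\<in>coarse_mesh D. e \<in> interior_faces D T \<and> scheme D T \<noteq> SWIPDG then 1/2
      else delta_plus D e / (delta_plus D e + delta_minus D e))"

definition weight_plus :: "('d::finite, 'm::finite) dg_data \<Rightarrow> (real^'d) set \<Rightarrow> real" where
  "weight_plus D e =
     (if boundary_face D e then 0
      else if \<exists>T\<in>coarse_mesh D. e \<in> interior_faces D T \<and> scheme D T \<noteq> SWIPDG then 1/2
      else delta_minus D e / (delta_plus D e + delta_minus D e))"

definition jump :: "('d::finite, 'm::finite) dg_data \<Rightarrow> (real^'d) set \<Rightarrow> (real^'d \<Rightarrow> real) \<Rightarrow> real^'d \<Rightarrow> real" where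
  "jump D e q x =
     (if boundary_face D e then trace (elem_minus D e) q x
      else trace (elem_minus D e) q x - trace (elem_plus D e) q x)"

definition average :: "('d::finite, 'm::finite) dg_data \<Rightarrow> (real^'d) set \<Rightarrow> (real^'d \<Rightarrow> real) \<Rightarrow> real^'d \<Rightarrow> real" where
  "average D e q x =
     (if boundary_face D e then trace (elem_minus D e) q x
      else weight_minus D e * trace (elem_minus D e) q x + weight_plus D e * trace (elem_plus D e) q x)"

definition sigma_eps :: "('d::finite, 'm::finite) dg_data \<Rightarrow> (real^'d) set \<Rightarrow> real" where
  "sigma_eps D e =
     (if boundary_face D e then delta_minus D e
      else delta_plus D e * delta_minus D e / (delta_plus D e + delta_minus D e))"

definition sigma_face :: "('d::finite, 'm::finite) dg_data \<Rightarrow> real^'m \<Rightarrow> (real^'d) set \<Rightarrow> real^'d \<Rightarrow> real" where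
  "sigma_face D \<mu> e x = penalty D * inverse (diameter e) * average D e (lam D \<mu>) x * sigma_eps D e"

text \<open>In \<open>bc_face\<close> and \<open>bp_face\<close> the last argument is a function \<^term>\<open>w\<close> on the face,
  which takes the place of the jump of the second argument of the bilinear form.\<close>

definition bc_face :: "('d::finite, 'm::finite) dg_data \<Rightarrow> real^'m \<Rightarrow> (real^'d) set \<Rightarrow>
    (real^'d \<Rightarrow> real) \<Rightarrow> (real^'d \<Rightarrow> real) \<Rightarrow> real" where
  "bc_face D \<mu> e p w = face_integral (face_normal D e) e
     (\<lambda>x. - average D e (\<lambda>y. (diff_tensor D \<mu> y *v broken_grad D p y) \<bullet> face_normal D e) x * w x)"

definition bp_face :: "('d::finite, 'm::finite) dg_data \<Rightarrow> real^'m \<Rightarrow> (real^'d) set \<Rightarrow>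
    (real^'d \<Rightarrow> real) \<Rightarrow> (real^'d \<Rightarrow> real) \<Rightarrow> real" where
  "bp_face D \<mu> e p w = face_integral (face_normal D e) e
     (\<lambda>x. sigma_face D \<mu> e x * jump D e p x * w x)"

definition b_c :: "('d::finite, 'm::finite) dg_data \<Rightarrow> real^'m \<Rightarrow> (real^'d) set \<Rightarrow>
    (real^'d \<Rightarrow> real) \<Rightarrow> (real^'d \<Rightarrow> real) \<Rightarrow> real" where
  "b_c D \<mu> e p q = bc_face D \<mu> e p (jump D e q)"

definition b_p :: "('d::finite, 'm::finite) dg_data \<Rightarrow> real^'m \<Rightarrow> (real^'d) set \<Rightarrow>
    (real^'d \<Rightarrow> real) \<Rightarrow> (real^'d \<Rightarrow> real) \<Rightarrow> real" where
  "b_p D \<mu> e p q = bp_face D \<mu> e p (jump D e q)"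

fun vartheta :: "dg_scheme \<Rightarrow> real" where
  "vartheta NIPDG = -1"
| "vartheta IIPDG = 0"
| "vartheta SIPDG = 1"
| "vartheta SWIPDG = 1"

definition vartheta_face :: "('d::finite, 'm::finite) dg_data \<Rightarrow> (real^'d) set \<Rightarrow> real" where
  "vartheta_face D e = (if \<exists>T\<in>coarse_mesh D. e \<in> interior_faces D T
     then vartheta (scheme D (THE T. T \<in> coarse_mesh D \<and> e \<in> interior_faces D T)) else 1)"

definition b_h :: "('d::finite, 'm::finite) dg_data \<Rightarrow> real^'m \<Rightarrow> (real^'d \<Rightarrow> real) \<Rightarrow> (real^'d \<Rightarrow> real) \<Rightarrow> real" where
  "b_h D \<mu> p q =
     (\<Sum>T\<in>coarse_mesh D. b_loc D \<mu> T p q +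
        (\<Sum>e\<in>interior_faces D T.
           vartheta (scheme D T) * b_c D \<mu> e q p + b_c D \<mu> e p q + b_p D \<mu> e q p)) +
     (\<Sum>E\<in>coarse_faces D. \<Sum>e\<in>faces_covering D E.
        b_c D \<mu> e q p + b_c D \<mu> e p q + b_p D \<mu> e q p)"

definition local_space :: "('d::finite, 'm::finite) dg_data \<Rightarrow> nat \<Rightarrow> (real^'d) set \<Rightarrow> (real^'d \<Rightarrow> real) set" where
  "local_space D k T = {q. L2 T q \<and>
     (\<forall>t\<in>fine_in D T. \<exists>\<pi>\<in>Poly k. AE x in lebesgue_on t. q x = \<pi> x) \<and>
     (cont_space D T \<longrightarrow> (\<exists>g. continuous_on T g \<and> (AE x in lebesgue_on T. q x = g x)))}"

definition Qh :: "('d::finite, 'm::finite) dg_data \<Rightarrow> nat \<Rightarrow> (real^'d \<Rightarrow> real) set" where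
  "Qh D k = {q. H1_broken D q \<and> (\<forall>T\<in>coarse_mesh D. q \<in> local_space D k T)}"

definition dg_norm :: "('d::finite, 'm::finite) dg_data \<Rightarrow> (real^'d \<Rightarrow> real) \<Rightarrow> real" where
  "dg_norm D q = sqrt ((\<Sum>t\<in>fine_mesh D. (l2norm t (broken_grad D q))\<^sup>2) +
     (\<Sum>e\<in>fine_faces D. inverse (diameter e) * face_integral (face_normal D e) e (\<lambda>x. (jump D e q x)\<^sup>2)))"

definition continuous_coercive :: "('d::finite, 'm::finite) dg_data \<Rightarrow> nat \<Rightarrow> bool" where
  "continuous_coercive D k \<longleftrightarrow> (\<forall>\<mu>\<in>params D.
     (\<exists>C. \<forall>p\<in>Qh D k. \<forall>q\<in>Qh D k. \<bar>b_h D \<mu> p q\<bar> \<le> C * dg_norm D p * dg_norm D q) \<and>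
     (\<exists>c>0. \<forall>q\<in>Qh D k. b_h D \<mu> q q \<ge> c * (dg_norm D q)\<^sup>2))"

text \<open>Reduced spaces are given by a family \<^term>\<open>Qred\<close> of local spaces; as functions on a coarse
  element \<^term>\<open>T\<close>, their members matter only almost everywhere on \<^term>\<open>T\<close>.\<close>

definition reduced_space :: "('d::finite, 'm::finite) dg_data \<Rightarrow> nat \<Rightarrow> (real^'d) set \<Rightarrow> (real^'d \<Rightarrow> real) set \<Rightarrow> bool" where
  "reduced_space D k T Q \<longleftrightarrow> Q \<subseteq> local_space D k T \<and> (\<lambda>x. 1) \<in> Q \<and>
     (\<forall>u\<in>Q. \<forall>v\<in>Q. \<forall>a b. (\<lambda>x. a * u x + b * v x) \<in> Q)"

definition Q_red :: "('d::finite, 'm::finite) dg_data \<Rightarrow> nat \<Rightarrow> ((real^'d) set \<Rightarrow> (real^'d \<Rightarrow> real) set) \<Rightarrow>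
    (real^'d \<Rightarrow> real) set" where
  "Q_red D k Qred = {q \<in> Qh D k. \<forall>T\<in>coarse_mesh D. \<exists>r\<in>Qred T. AE x in lebesgue_on T. q x = r x}"

definition weak_solution :: "('d::finite, 'm::finite) dg_data \<Rightarrow> real^'m \<Rightarrow> (real^'d \<Rightarrow> real) \<Rightarrow> bool" where
  "weak_solution D \<mu> p \<longleftrightarrow> H10 (Omega D) p \<and>
     (\<forall>q. H10 (Omega D) q \<longrightarrow> b_form D \<mu> p q = (LINT x|lebesgue_on (Omega D). rhs D x * q x))"

definition dg_solution :: "('d::finite, 'm::finite) dg_data \<Rightarrow> real^'m \<Rightarrow> (real^'d \<Rightarrow> real) set \<Rightarrow> (real^'d \<Rightarrow> real) \<Rightarrow> bool" where
  "dg_solution D \<mu> V p \<longleftrightarrow> p \<in> V \<and>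
     (\<forall>q\<in>V. b_h D \<mu> p q = (LINT x|lebesgue_on (Omega D). rhs D x * q x))"

section \<open>Reconstructions and the error estimator\<close>

subsection \<open>Oswald interpolation\<close>

text \<open>The Lagrange nodes of order \<^term>\<open>k\<close> in a simplex are the points whose barycentric coordinates
  are multiples of \<open>1/k\<close>.\<close>

definition lagrange_nodes :: "nat \<Rightarrow> (real^'d) set \<Rightarrow> (real^'d) set" where
  "lagrange_nodes k t = {(\<Sum>v | v extreme_point_of t. (real (c v) / real k) *\<^sub>R v) |c :: real^'d \<Rightarrow> nat.
     (\<Sum>v | v extreme_point_of t. c v) = k}"

text \<open>A node inside an element belongs to this element only, and the average is the value
  itself.\<close>

definition oswald_value :: "('d::finite, 'm::finite) dg_data \<Rightarrow> nat \<Rightarrow> (real^'d \<Rightarrow> real) \<Rightarrow> real^'d \<Rightarrow> real" where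
  "oswald_value D k q \<nu> = (if \<nu> \<in> frontier (Omega D) then 0
     else (\<Sum>t | t \<in> fine_mesh D \<and> \<nu> \<in> lagrange_nodes k t. trace t q \<nu>) /
          real (card {t \<in> fine_mesh D. \<nu> \<in> lagrange_nodes k t}))"

definition oswald :: "('d::finite, 'm::finite) dg_data \<Rightarrow> nat \<Rightarrow> (real^'d \<Rightarrow> real) \<Rightarrow> real^'d \<Rightarrow> real" where
  "oswald D k q x = (if \<exists>t\<in>fine_mesh D. x \<in> interior t
     then let t = (THE t. t \<in> fine_mesh D \<and> x \<in> interior t)
          in (SOME \<pi>. \<pi> \<in> Poly k \<and> (\<forall>\<nu>\<in>lagrange_nodes k t. \<pi> \<nu> = oswald_value D k q \<nu>)) x
     else 0)"

subsection \<open>Diffusive flux reconstruction\<close>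

definition RTN_space :: "('d::finite, 'm::finite) dg_data \<Rightarrow> nat \<Rightarrow> (real^'d \<Rightarrow> real^'d) set" where
  "RTN_space D l = {v. (\<exists>g. has_weak_div (Omega D) v g) \<and>
     (\<forall>t\<in>fine_mesh D. \<exists>a. \<exists>b\<in>Poly l. (\<forall>i. a i \<in> Poly l) \<and>
        (AE x in lebesgue_on t. v x = (\<chi> i. a i x) + b x *\<^sub>R x))}"

text \<open>\<open>\<bbbP>\<^sub>l(e)\<close> is represented by restrictions of polynomials on the whole space. In the second
  condition \<^term>\<open>q\<close> ranges over \<open>\<bbbP>\<^sub>l\<close>, so its gradient has components
  in \<open>\<bbbP>\<^bsub>l-1\<^esub>\<close>. For \<open>l = 0\<close> the condition is empty.\<close>

definition is_flux :: "('d::finite, 'm::finite) dg_data \<Rightarrow> nat \<Rightarrow> (real^'d \<Rightarrow> real) \<Rightarrow> real^'m \<Rightarrow> (real^'d \<Rightarrow> real^'d) \<Rightarrow> bool" where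
  "is_flux D l qh \<mu> v \<longleftrightarrow> v \<in> RTN_space D l \<and>
     (\<forall>t\<in>fine_mesh D.
        (\<forall>e\<in>elem_faces t. \<forall>q\<in>Poly l.
           face_integral (face_normal D e) e (\<lambda>x. trace t (\<lambda>y. v y \<bullet> face_normal D e) x * q x)
             = bc_face D \<mu> e qh q + bp_face D \<mu> e qh q) \<and>
        (\<forall>q\<in>Poly l.
           (LINT x|lebesgue_on t. v x \<bullet> broken_grad D q x)
             = - b_loc D \<mu> t qh q
               - (\<Sum>e\<in>elem_faces t. vartheta_face D e * b_c D \<mu> e (\<lambda>x. if x \<in> t then q x else 0) qh)))"

definition flux_reconstruction :: "('d::finite, 'm::finite) dg_data \<Rightarrow> nat \<Rightarrow> nat \<Rightarrow>
    ((real^'d \<Rightarrow> real) \<Rightarrow> real^'m \<Rightarrow> real^'d \<Rightarrow> real^'d) \<Rightarrow> bool" where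
  "flux_reconstruction D k l R \<longleftrightarrow> (\<forall>qh\<in>Qh D k. \<forall>\<mu>\<in>params D. is_flux D l qh \<mu> (R qh \<mu>))"

subsection \<open>Estimator\<close>

definition eta_nc :: "('d::finite, 'm::finite) dg_data \<Rightarrow> nat \<Rightarrow> (real^'d) set \<Rightarrow> (real^'d \<Rightarrow> real) \<Rightarrow> real^'m \<Rightarrow> real" where
  "eta_nc D k T q \<mu>bar = energy_loc D \<mu>bar T (\<lambda>x. q x - oswald D k q x)"

definition eta_r :: "('d::finite, 'm::finite) dg_data \<Rightarrow> ((real^'d \<Rightarrow> real) \<Rightarrow> real^'m \<Rightarrow> real^'d \<Rightarrow> real^'d) \<Rightarrow>
    ((real^'d) set \<Rightarrow> real) \<Rightarrow> (real^'d) set \<Rightarrow> (real^'d \<Rightarrow> real) \<Rightarrow> real^'m \<Rightarrow> real" where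
  "eta_r D R CP T q \<mu> = sqrt (CP T / c_coarse D T) * diameter T *
     l2norm T (\<lambda>x. rhs D x - wdiv (Omega D) (R q \<mu>) x)"

definition eta_df :: "('d::finite, 'm::finite) dg_data \<Rightarrow> ((real^'d \<Rightarrow> real) \<Rightarrow> real^'m \<Rightarrow> real^'d \<Rightarrow> real^'d) \<Rightarrow>
    (real^'d) set \<Rightarrow> (real^'d \<Rightarrow> real) \<Rightarrow> real^'m \<Rightarrow> real^'m \<Rightarrow> real" where
  "eta_df D R T q \<mu> \<mu>hat = l2norm T (\<lambda>x. inv_sqrt (diff_tensor D \<mu>hat x) *v
     (diff_tensor D \<mu> x *v broken_grad D q x + R q \<mu> x))"

definition eta :: "('d::finite, 'm::finite) dg_data \<Rightarrow> nat \<Rightarrow> ((real^'d \<Rightarrow> real) \<Rightarrow> real^'m \<Rightarrow> real^'d \<Rightarrow> real^'d) \<Rightarrow>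
    ((real^'d) set \<Rightarrow> real) \<Rightarrow> (real^'d \<Rightarrow> real) \<Rightarrow> real^'m \<Rightarrow> real^'m \<Rightarrow> real^'m \<Rightarrow> real" where
  "eta D k R CP q \<mu> \<mu>bar \<mu>hat = 1 / sqrt (alpha D \<mu> \<mu>bar) *
     (sqrt (gamma D \<mu> \<mu>bar) * sqrt (\<Sum>T\<in>coarse_mesh D. (eta_nc D k T q \<mu>bar)\<^sup>2)
      + sqrt (\<Sum>T\<in>coarse_mesh D. (eta_r D R CP T q \<mu>)\<^sup>2)
      + 1 / sqrt (alpha D \<mu> \<mu>hat) * sqrt (\<Sum>T\<in>coarse_mesh D. (eta_df D R T q \<mu> \<mu>hat)\<^sup>2))"

end

theory Submission
  imports Defs
begin

text \<open>Both discrete solutions satisfy the DG equation for the indicator functions of the coarse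
  elements. The reconstructed flux has the same normal component from both sides of a fine face,
  so the divergence theorem on the simplices turns this equation into local conservation: the
  divergence of the flux and the right-hand side have the same integral over every coarse element.
  Hence the mean value of a test function can be subtracted in the residual, and the Poincare
  inequality together with the Cauchy--Schwarz inequality for the inverse square root of the
  diffusion tensor bounds the residual on \<open>H\<^sup>1\<^sub>0\<close>. The Oswald interpolant is continuous, piecewise
  polynomial and zero on the boundary, hence lies in \<open>H\<^sup>1\<^sub>0\<close>. Testing with the difference of the weak
  solution and this interpolant splits the error into a residual part and a nonconforming part, and
  the affine decomposition of \<open>\<lambda>\<close> changes the parameter of the norms.\<close>

section \<open>Polynomials and simplices\<close>

text \<open>\<open>H10\<close> is the closure of the test functions, so membership of the Oswald
  interpolant calls for explicit smooth approximations. The interpolant is only Lipschitz, piecewise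
  smooth and zero outside the domain, and near the boundary it has to be pushed away from it before
  it can be mollified.

  Traces of \<lambda> on faces may fail to exist, so the face terms of a discrete solution are never
  evaluated. They enter as one number \<open>face_flux\<close> per fine face, which the DG equation
  for a coarse indicator function and the reconstruction condition for the polynomial 1 have in
  common; conservation is a comparison of the signs with which it occurs. Surface integrals are
  volume integrals over prisms, hence the divergence theorem is derived from thin strips along the
  faces.

  The nonconforming term carries no factor 2 because the error is split by a projection in the
  energy product: its square is at most the square of the residual bound plus the square of the
  nonconforming part. Two triangle inequalities would count the latter twice.\<close>

lemma finite_multi_index: "finite {a :: 'd::finite \<Rightarrow> nat. sum a UNIV \<le> k}"
proof (rule finite_subset)
  show "{a :: 'd \<Rightarrow> nat. sum a UNIV \<le> k} \<subseteq> PiE UNIV (\<lambda>_. {..k})"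
  proof
    fix a :: "'d \<Rightarrow> nat" assume "a \<in> {a. sum a UNIV \<le> k}"
    then have "a i \<le> k" for i
      using member_le_sum[of i UNIV a] by (simp add: order_trans)
    then show "a \<in> PiE UNIV (\<lambda>_. {..k})" by auto
  qed
qed (auto intro: finite_PiE)

lemma Poly_add: "f \<in> Poly k \<Longrightarrow> g \<in> Poly k \<Longrightarrow> (\<lambda>x. f x + g x) \<in> Poly k"
proof -
  assume "f \<in> Poly k" "g \<in> Poly k"
  then obtain c d where "\<And>x. f x = (\<Sum>a | sum a UNIV \<le> k. c a * (\<Prod>i\<in>UNIV. x $ i ^ a i))"
    "\<And>x. g x = (\<Sum>a | sum a UNIV \<le> k. d a * (\<Prod>i\<in>UNIV. x $ i ^ a i))"
    unfolding Poly_def by blast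
  then have "f x + g x = (\<Sum>a | sum a UNIV \<le> k. (c a + d a) * (\<Prod>i\<in>UNIV. x $ i ^ a i))" for x
    by (simp add: distrib_right sum.distrib)
  then show ?thesis unfolding Poly_def mem_Collect_eq by (intro exI[of _ "\<lambda>a. c a + d a"]) auto
qed

lemma Poly_scale: "f \<in> Poly k \<Longrightarrow> (\<lambda>x. r * f x) \<in> Poly k"
proof -
  assume "f \<in> Poly k"
  then obtain c where "\<And>x. f x = (\<Sum>a | sum a UNIV \<le> k. c a * (\<Prod>i\<in>UNIV. x $ i ^ a i))"
    unfolding Poly_def by blast
  then have "r * f x = (\<Sum>a | sum a UNIV \<le> k. (r * c a) * (\<Prod>i\<in>UNIV. x $ i ^ a i))" for x
    by (simp add: sum_distrib_left mult.assoc)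
  then show ?thesis unfolding Poly_def mem_Collect_eq by (intro exI[of _ "\<lambda>a. r * c a"]) auto
qed

lemma Poly_monomial:
  assumes "sum a UNIV \<le> k"
  shows "(\<lambda>x::real^'d. \<Prod>i\<in>UNIV. x $ i ^ a i) \<in> Poly k"
proof -
  have "(\<Prod>i\<in>UNIV. x $ i ^ a i) =
      (\<Sum>b | sum b UNIV \<le> k. (if b = a then 1 else 0) * (\<Prod>i\<in>UNIV. x $ i ^ b i))" for x :: "real^'d"
    using assms finite_multi_index
    by (subst sum.remove[of _ a]) (auto intro!: sum.neutral)
  then show ?thesis unfolding Poly_def mem_Collect_eq by (intro exI[of _ "\<lambda>b. if b = a then 1 else 0"]) auto
qed

lemma Poly_const [simp]: "(\<lambda>x. c) \<in> Poly k"
  using Poly_scale[OF Poly_monomial[of "\<lambda>_. 0" k], of c] by simp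

lemma Poly_sum: "(\<And>i. i \<in> I \<Longrightarrow> f i \<in> Poly k) \<Longrightarrow> (\<lambda>x. \<Sum>i\<in>I. f i x) \<in> Poly k"
  by (induction I rule: infinite_finite_induct) (auto intro: Poly_add)

lemma Poly_diff: "f \<in> Poly k \<Longrightarrow> g \<in> Poly k \<Longrightarrow> (\<lambda>x. f x - g x) \<in> Poly k"
  using Poly_add[OF _ Poly_scale[of g k "-1"], of f] by simp

lemma Poly_coord:
  fixes f :: "real^'d \<Rightarrow> real"
  assumes "f \<in> Poly k"
  shows "(\<lambda>x. x $ i * f x) \<in> Poly (Suc k)"
proof -
  obtain c where c: "\<And>x. f x = (\<Sum>a | sum a UNIV \<le> k. c a * (\<Prod>j\<in>UNIV. x $ j ^ a j))"
    using assms unfolding Poly_def by blast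
  have m: "x $ i * (\<Prod>j\<in>UNIV. x $ j ^ a j) = (\<Prod>j\<in>UNIV. x $ j ^ (a(i := Suc (a i))) j)" for x :: "real^'d" and a
    by (subst (1 2) prod.remove[of _ i]) (auto intro!: prod.cong)
  have s: "sum (a(i := Suc (a i))) UNIV = Suc (sum a UNIV)" for a :: "'d \<Rightarrow> nat"
    by (subst (1 2) sum.remove[of _ i]) auto
  have "(\<lambda>x. \<Sum>a | sum a UNIV \<le> k. c a * (x $ i * (\<Prod>j\<in>UNIV. x $ j ^ a j))) \<in> Poly (Suc k)"
    unfolding m by (intro Poly_sum Poly_scale Poly_monomial) (simp add: s del: fun_upd_apply)
  then show ?thesis by (simp add: c sum_distrib_left mult_ac)
qed

lemma Poly_mono: "f \<in> Poly k \<Longrightarrow> k \<le> n \<Longrightarrow> f \<in> Poly n"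
proof -
  assume f: "f \<in> Poly k" and kn: "k \<le> n"
  then obtain c where c: "\<And>x. f x = (\<Sum>a | sum a UNIV \<le> k. c a * (\<Prod>j\<in>UNIV. x $ j ^ a j))"
    unfolding Poly_def by blast
  have "(\<lambda>x. \<Sum>a | sum a UNIV \<le> k. c a * (\<Prod>j\<in>UNIV. x $ j ^ a j)) \<in> Poly n"
    using kn by (intro Poly_sum Poly_scale Poly_monomial) auto
  then show ?thesis by (simp flip: c)
qed

text \<open>Every polynomial arises from constants by addition and multiplication with a coordinate.
  The degree bound is an argument of the predicate because the coordinate step raises it.
  Translations, differences, derivatives and restrictions to lines are all treated along this
  scheme.\<close>

lemma Poly_induct [consumes 1, case_names const add coord]:
  fixes f :: "real^'d \<Rightarrow> real"
  assumes "f \<in> Poly k"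
    and const: "\<And>k c. P k (\<lambda>x. c)"
    and add: "\<And>k f g. f \<in> Poly k \<Longrightarrow> g \<in> Poly k \<Longrightarrow> P k f \<Longrightarrow> P k g \<Longrightarrow> P k (\<lambda>x. f x + g x)"
    and coord: "\<And>k f i. f \<in> Poly k \<Longrightarrow> P k f \<Longrightarrow> P (Suc k) (\<lambda>x. x $ i * f x)"
  shows "P k f"
proof -
  have mon: "P k (\<lambda>x. c * (\<Prod>i\<in>UNIV. x $ i ^ a i))"
    if "sum a UNIV \<le> k" for a :: "'d \<Rightarrow> nat" and k c
    using that
  proof (induction "sum a UNIV" arbitrary: a k)
    case 0
    then have "(\<lambda>x. c * (\<Prod>i\<in>UNIV. x $ i ^ a i)) = (\<lambda>x::real^'d. c)" by auto
    then show ?case using const by simp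
  next
    case (Suc n)
    then obtain i where i: "a i \<noteq> 0" by fastforce
    then obtain m where m: "a i = Suc m" using not0_implies_Suc by blast
    define b where "b = a(i := m)"
    have a: "a = b(i := Suc (b i))" using m by (auto simp: b_def)
    have s: "sum a UNIV = Suc (sum b UNIV)"
      unfolding a by (subst (1 2) sum.remove[of _ i]) auto
    obtain k' where k': "k = Suc k'" using Suc by (cases k) auto
    have bk: "sum b UNIV \<le> k'" using s Suc k' by auto
    have *: "P (Suc k') (\<lambda>x. x $ i * (c * (\<Prod>j\<in>UNIV. x $ j ^ b j)))"
      using Suc(1)[of b k'] Suc(2) s bk by (intro coord Poly_scale Poly_monomial) auto
    have "x $ i * (c * (\<Prod>j\<in>UNIV. x $ j ^ b j)) = c * (\<Prod>j\<in>UNIV. x $ j ^ a j)" for x :: "real^'d"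
      unfolding a by (subst (1 2) prod.remove[of _ i]) (auto intro!: prod.cong)
    with * show ?case by (simp add: k')
  qed
  obtain c where c: "\<And>x. f x = (\<Sum>a | sum a UNIV \<le> k. c a * (\<Prod>j\<in>UNIV. x $ j ^ a j))"
    using assms unfolding Poly_def by blast
  have "P k (\<lambda>x. \<Sum>a\<in>A. c a * (\<Prod>j\<in>UNIV. x $ j ^ a j))" if "A \<subseteq> {a. sum a UNIV \<le> k}" for A
    using finite_subset[OF that finite_multi_index] that
  proof (induction A rule: finite_induct)
    case empty
    then show ?case using const by simp
  next
    case (insert a A)
    then show ?case
      by (auto intro!: add mon Poly_sum Poly_scale Poly_monomial)
  qed
  from this[of "{a. sum a UNIV \<le> k}"] show ?thesis by (simp flip: c)
qed

lemma Poly_0: "f \<in> Poly 0 \<Longrightarrow> f x = f y"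
proof -
  assume "f \<in> Poly 0"
  then have "0 = (0::nat) \<longrightarrow> (\<forall>x y. f x = f y)"
    by (induction rule: Poly_induct[where P = "\<lambda>k f. k = 0 \<longrightarrow> (\<forall>x y. f x = f y)"]) (auto, metis)
  then show ?thesis by auto
qed

text \<open>The partial derivatives are asserted in the same \<open>Poly k\<close>, not one degree
  lower: this avoids the case k = 0 and lets repeated differentiation stay in one set, as the
  induction in \<open>cont_diff_Poly\<close> requires.\<close>

lemma Poly_has_derivative:
  fixes f :: "real^'d \<Rightarrow> real"
  assumes "f \<in> Poly k"
  shows "\<exists>D. (\<forall>i. D i \<in> Poly k) \<and> (\<forall>x. (f has_derivative (\<lambda>h. \<Sum>i\<in>UNIV. D i x * h $ i)) (at x))"
  using assms
proof (induction rule: Poly_induct)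
  case (const k c)
  then show ?case by (intro exI[of _ "\<lambda>i x. 0"]) auto
next
  case (add k f g)
  then obtain D E where D: "\<forall>i. D i \<in> Poly k" "\<And>x. (f has_derivative (\<lambda>h. \<Sum>i\<in>UNIV. D i x * h $ i)) (at x)"
    and E: "\<forall>i. E i \<in> Poly k" "\<And>x. (g has_derivative (\<lambda>h. \<Sum>i\<in>UNIV. E i x * h $ i)) (at x)" by blast
  show ?case
    using D(1) E(1) has_derivative_add[OF D(2) E(2)]
    by (intro exI[of _ "\<lambda>i x. D i x + E i x"]) (auto simp: distrib_right sum.distrib intro: Poly_add)
next
  case (coord k f i)
  then obtain D where D: "\<forall>i. D i \<in> Poly k" "\<And>x. (f has_derivative (\<lambda>h. \<Sum>i\<in>UNIV. D i x * h $ i)) (at x)"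
    by blast
  have s: "(\<Sum>j\<in>UNIV. (x $ i * D j x + (if j = i then f x else 0)) * h $ j) =
    x $ i * (\<Sum>j\<in>UNIV. D j x * h $ j) + h $ i * f x" for x h :: "real^'d"
  proof -
    have "(\<Sum>j\<in>UNIV. (if j = i then f x else 0) * h $ j) = (\<Sum>j\<in>UNIV. if j = i then f x * h $ j else 0)"
      by (intro sum.cong) auto
    then show ?thesis by (simp add: distrib_right sum.distrib sum_distrib_left mult.assoc)
  qed
  have "((\<lambda>x. x $ i * f x) has_derivative
      (\<lambda>h. \<Sum>j\<in>UNIV. (x $ i * D j x + (if j = i then f x else 0)) * h $ j)) (at x)" for x
    unfolding s
    by (rule has_derivative_mult[OF bounded_linear_imp_has_derivative[OF bounded_linear_vec_nth] D(2)])
  moreover have "(\<lambda>x. x $ i * D j x + (if j = i then f x else 0)) \<in> Poly (Suc k)" for j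
    using D(1) coord by (cases "j = i") (auto intro!: Poly_add Poly_coord intro: Poly_mono)
  ultimately show ?case
    by (intro exI[of _ "\<lambda>j x. x $ i * D j x + (if j = i then f x else 0)"] conjI allI)
qed

lemma Poly_continuous:
  assumes "f \<in> Poly k"
  shows "continuous_on S f"
proof -
  obtain D where "\<And>x. (f has_derivative (\<lambda>h. \<Sum>i\<in>UNIV. D i x * h $ i)) (at x)"
    using Poly_has_derivative[OF assms] by blast
  then show ?thesis
    using has_derivative_continuous by (intro continuous_at_imp_continuous_on ballI) blast
qed

lemma Poly_translate: "f \<in> Poly k \<Longrightarrow> (\<lambda>x. f (x + u)) \<in> Poly k"
proof (induction rule: Poly_induct)
  case (coord k f i)
  have "(\<lambda>x. x $ i * f (x + u) + u $ i * f (x + u)) \<in> Poly (Suc k)"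
    by (intro Poly_add Poly_coord coord Poly_scale Poly_mono[OF coord(2)]) auto
  then show ?case by (simp add: distrib_right)
qed (auto intro: Poly_add)

lemma Poly_difference:
  assumes "f \<in> Poly (Suc k)"
  shows "(\<lambda>x. f (x + u) - f x) \<in> Poly k"
proof -
  \<comment> \<open>The coordinate step passes from k to k + 1 and has to know that the difference
    vanishes for k = 0, so both cases are carried through the induction together.\<close>
  have "(\<forall>n. k = Suc n \<longrightarrow> (\<lambda>x. f (x + u) - f x) \<in> Poly n) \<and> (k = 0 \<longrightarrow> (\<forall>x. f (x + u) = f x))"
    if "f \<in> Poly k" for k and f :: "real^'a \<Rightarrow> real"
    using that
  proof (induction rule: Poly_induct)
    case (add k f g)
    have "(\<lambda>x. f (x + u) + g (x + u) - (f x + g x)) = (\<lambda>x. f (x + u) - f x + (g (x + u) - g x))"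
      by auto
    with add show ?case by (auto intro!: Poly_add simp del: add_diff_add)
  next
    case (coord k f i)
    have "(\<lambda>x. x $ i * (f (x + u) - f x)) \<in> Poly k"
    proof (cases k)
      case 0
      with coord have "(\<lambda>x. x $ i * (f (x + u) - f x)) = (\<lambda>x. 0)" by auto
      then show ?thesis by simp
    next
      case (Suc n)
      then show ?thesis using coord by (auto intro!: Poly_coord)
    qed
    then have "(\<lambda>x. x $ i * (f (x + u) - f x) + u $ i * f (x + u)) \<in> Poly k"
      by (intro Poly_add Poly_scale Poly_translate coord)
    moreover have "(\<lambda>x. x $ i * (f (x + u) - f x) + u $ i * f (x + u)) =
        (\<lambda>x. (x + u) $ i * f (x + u) - x $ i * f x)"
      by (auto simp: algebra_simps)
    ultimately show ?case by auto
  qed auto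
  with assms show ?thesis by blast
qed

lemma Poly_on_line:
  assumes "f \<in> Poly k"
  obtains p where "\<And>t. f (y + t *\<^sub>R u) = poly p t"
proof -
  have "\<exists>p. \<forall>t. f (y + t *\<^sub>R u) = poly p t"
    using assms
  proof (induction rule: Poly_induct)
    case (const k c)
    then show ?case by (intro exI[of _ "[:c:]"]) auto
  next
    case (add k f g)
    then obtain p q where "\<forall>t. f (y + t *\<^sub>R u) = poly p t" "\<forall>t. g (y + t *\<^sub>R u) = poly q t" by blast
    then show ?case by (intro exI[of _ "p + q"]) auto
  next
    case (coord k f i)
    then obtain p where "\<forall>t. f (y + t *\<^sub>R u) = poly p t" by blast
    then show ?case by (intro exI[of _ "[:y $ i, u $ i:] * p"]) (auto simp: algebra_simps)
  qed
  with that show ?thesis by blast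
qed

text \<open>A polynomial of degree \<open>k\<close> that vanishes on the principal lattice of order \<open>k\<close> of an affine
  subspace vanishes on the subspace: the difference in a lattice direction \<open>u w\<close> has degree \<open>k - 1\<close>
  and vanishes on the lattice of order \<open>k - 1\<close>, so the polynomial is periodic in that direction.\<close>

lemma Poly_lattice_unisolvent:
  fixes f :: "real^'d \<Rightarrow> real" and u :: "'i \<Rightarrow> real^'d"
  assumes "finite W" "f \<in> Poly k"
    and "\<And>c. (\<Sum>w\<in>W. c w) \<le> k \<Longrightarrow> f (x0 + (\<Sum>w\<in>W. real (c w) *\<^sub>R u w)) = 0"
  shows "f (x0 + (\<Sum>w\<in>W. s w *\<^sub>R u w)) = 0"
  using assms
proof (induction W arbitrary: f k s rule: finite_induct)
  case empty
  then show ?case by auto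
next
  case (insert w W)
  from insert.prems show ?case
  proof (induction k arbitrary: f s)
    case 0
    have "f x0 = 0" using 0(2)[of "\<lambda>_. 0"] by simp
    then show ?case using Poly_0[OF 0(1)] by metis
  next
    case (Suc k)
    define g where "g = (\<lambda>x. f (x + u w) - f x)"
    have ins: "(\<Sum>v\<in>insert w W. c v *\<^sub>R u v) = c w *\<^sub>R u w + (\<Sum>v\<in>W. c v *\<^sub>R u v)" for c :: "'i \<Rightarrow> real"
      using insert by simp
    have per: "f (x0 + (\<Sum>v\<in>insert w W. s v *\<^sub>R u v) + u w) = f (x0 + (\<Sum>v\<in>insert w W. s v *\<^sub>R u v))" for s
    proof -
      have "g (x0 + (\<Sum>v\<in>insert w W. s v *\<^sub>R u v)) = 0"
      proof (rule Suc.IH)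
        show "g \<in> Poly k" unfolding g_def by (rule Poly_difference[OF Suc.prems(1)])
        fix c :: "'i \<Rightarrow> nat" assume c: "sum c (insert w W) \<le> k"
        \<comment> \<open>One more step in direction \<open>u w\<close>. The index sum grows by one,
          so lattice points of order k for \<open>g\<close> lead to lattice points of order
          \<open>Suc k\<close> for \<open>f\<close>.\<close>
        define c' where "c' = c(w := Suc (c w))"
        have "sum c' (insert w W) = Suc (sum c (insert w W))"
          using insert unfolding c'_def by (auto intro!: sum.cong)
        then have "f (x0 + (\<Sum>v\<in>insert w W. real (c' v) *\<^sub>R u v)) = 0"
          using c by (intro Suc.prems(2)) auto
        moreover have "(\<Sum>v\<in>insert w W. real (c' v) *\<^sub>R u v) = u w + (\<Sum>v\<in>insert w W. real (c v) *\<^sub>R u v)"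
        proof -
          have "(\<Sum>v\<in>W. real (c' v) *\<^sub>R u v) = (\<Sum>v\<in>W. real (c v) *\<^sub>R u v)"
            using insert by (auto intro!: sum.cong simp: c'_def)
          then show ?thesis unfolding ins by (simp add: c'_def scaleR_add_left)
        qed
        moreover have "f (x0 + (\<Sum>v\<in>insert w W. real (c v) *\<^sub>R u v)) = 0"
          using c by (intro Suc.prems(2)) auto
        ultimately show "g (x0 + (\<Sum>v\<in>insert w W. real (c v) *\<^sub>R u v)) = 0"
          by (simp add: g_def add_ac)
      qed
      then show ?thesis by (simp add: g_def)
    qed
    define y where "y = x0 + (\<Sum>v\<in>W. s v *\<^sub>R u v)"
    obtain p where p: "\<And>t. f (y + t *\<^sub>R u w) = poly p t"
      using Poly_on_line[OF Suc.prems(1)] by blast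
    \<comment> \<open>The start value comes from the induction hypothesis on \<open>W\<close>,
      applied to the lattice points with coefficient 0 at w; periodicity carries it to all n. A
      univariate polynomial with infinitely many roots is zero.\<close>
    have "poly p (real n) = 0" for n
    proof (induction n)
      case 0
      have "f y = 0" unfolding y_def
      proof (rule insert.IH[OF Suc.prems(1)])
        fix c :: "'i \<Rightarrow> nat" assume c: "sum c W \<le> Suc k"
        define c' where "c' = c(w := 0)"
        have e: "sum c' W = sum c W" "(\<Sum>v\<in>W. real (c' v) *\<^sub>R u v) = (\<Sum>v\<in>W. real (c v) *\<^sub>R u v)"
          using insert by (auto intro!: sum.cong simp: c'_def)
        have "f (x0 + (\<Sum>v\<in>insert w W. real (c' v) *\<^sub>R u v)) = 0"
          using c e insert by (intro Suc.prems(2)) (auto simp: c'_def)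
        then show "f (x0 + (\<Sum>v\<in>W. real (c v) *\<^sub>R u v)) = 0"
          using e unfolding ins by (simp add: c'_def)
      qed
      then show ?case using p[of 0] by simp
    next
      case (Suc n)
      define s' where "s' = s(w := real n)"
      have "(\<Sum>v\<in>W. s' v *\<^sub>R u v) = (\<Sum>v\<in>W. s v *\<^sub>R u v)"
        using insert by (auto intro!: sum.cong simp: s'_def)
      then have "x0 + (\<Sum>v\<in>insert w W. s' v *\<^sub>R u v) = y + real n *\<^sub>R u w"
        unfolding ins y_def by (simp add: s'_def add_ac)
      with per[of s'] have "f (y + real n *\<^sub>R u w + u w) = f (y + real n *\<^sub>R u w)" by simp
      moreover have "y + real n *\<^sub>R u w + u w = y + real (Suc n) *\<^sub>R u w"
        by (simp add: algebra_simps)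
      ultimately show ?case using p Suc by metis
    qed
    then have "range real \<subseteq> {t. poly p t = 0}" by auto
    then have "infinite {t. poly p t = 0}"
      using infinite_UNIV_nat finite_imageD[of real UNIV] by (auto dest: finite_subset simp: inj_on_def)
    then have "p = 0" using poly_roots_finite by blast
    then show ?case using p[of "s w"] by (simp add: ins y_def add_ac)
  qed
qed

section \<open>Barycentric coordinates on a simplex\<close>

text \<open>An affine function is encoded by its constant term and its gradient. This makes
  \<open>bary_grad\<close> a fixed vector and extends each coordinate to the whole space.\<close>

definition bary_coeff :: "(real^'d) set \<Rightarrow> real^'d \<Rightarrow> real \<times> (real^'d)" where
  "bary_coeff V v = (SOME q. \<forall>w\<in>V. fst q + snd q \<bullet> w = (if w = v then 1 else 0))"

definition bary :: "(real^'d) set \<Rightarrow> real^'d \<Rightarrow> real^'d \<Rightarrow> real" where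
  "bary V v x = fst (bary_coeff V v) + snd (bary_coeff V v) \<bullet> x"

abbreviation bary_grad :: "(real^'d) set \<Rightarrow> real^'d \<Rightarrow> real^'d" where
  "bary_grad V v \<equiv> snd (bary_coeff V v)"

text \<open>After a translation that moves a vertex other than v to the origin, the remaining
  vertices are linearly independent, so a linear functional can be prescribed on them.\<close>

lemma bary_vertex:
  fixes V :: "(real^'d::finite) set"
  assumes V: "\<not> affine_dependent V" and v: "v \<in> V" and w: "w \<in> V"
  shows "bary V v w = (if w = v then 1 else 0)"
proof -
  have "\<exists>q::real \<times> (real^'d). \<forall>w\<in>V. fst q + snd q \<bullet> w = (if w = v then 1 else 0)"
  proof (cases "V = {v}")
    case True
    then show ?thesis by (intro exI[of _ "(1, 0)"]) auto
  next
    case False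
    then obtain x0 where x0: "x0 \<in> V" "x0 \<noteq> v" using v by blast
    have ind: "independent ((\<lambda>x. - x0 + x) ` (V - {x0}))"
      using V affine_dependent_iff_dependent2[OF x0(1)] by auto
    obtain f :: "real^'d \<Rightarrow> real" where f: "linear f"
      "\<And>y. y \<in> (\<lambda>x. - x0 + x) ` (V - {x0}) \<Longrightarrow> f y = (if y = - x0 + v then 1 else 0)"
      using linear_independent_extend[OF ind, of "\<lambda>y. if y = - x0 + v then 1 else (0::real)"] by blast
    \<comment> \<open>The vector representing the functional f; the value 0 at the base vertex then
      fixes the constant term.\<close>
    define g where "g = adjoint f 1"
    have g: "f x = g \<bullet> x" for x
      using adjoint_works[OF f(1), of x 1] by (simp add: g_def inner_commute)
    have "- (g \<bullet> x0) + g \<bullet> w = (if w = v then 1 else 0)" if "w \<in> V" for w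
    proof (cases "w = x0")
      case False
      then have "f (- x0 + w) = (if w = v then 1 else 0)" using that f(2)[of "- x0 + w"] by auto
      then show ?thesis unfolding g inner_add_right by simp
    qed (use x0 in auto)
    then show ?thesis by (intro exI[of _ "(- (g \<bullet> x0), g)"]) auto
  qed
  from someI_ex[OF this] show ?thesis
    using w unfolding bary_def bary_coeff_def by blast
qed

lemma bary_affine: "bary V v (x + h) = bary V v x + bary_grad V v \<bullet> h"
  by (simp add: bary_def inner_add_right)

lemma bary_sum:
  assumes "finite W" "sum u W = 1"
  shows "bary V v (\<Sum>w\<in>W. u w *\<^sub>R w) = (\<Sum>w\<in>W. u w * bary V v w)"
proof -
  have "(\<Sum>w\<in>W. u w * bary V v w) = (\<Sum>w\<in>W. u w) * fst (bary_coeff V v) + (\<Sum>w\<in>W. u w * (bary_grad V v \<bullet> w))"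
    by (simp add: bary_def distrib_left sum.distrib sum_distrib_right)
  then show ?thesis using assms by (simp add: bary_def inner_sum_right)
qed

lemma bary_combination:
  assumes "\<not> affine_dependent V" "v \<in> V" "sum u V = 1"
  shows "bary V v (\<Sum>w\<in>V. u w *\<^sub>R w) = u v"
proof -
  have fin: "finite V" using assms aff_independent_finite by blast
  have "(\<Sum>w\<in>V. u w * bary V v w) = (\<Sum>w\<in>V. if w = v then u w else 0)"
    using bary_vertex[OF assms(1,2)] by (intro sum.cong) auto
  then show ?thesis using bary_sum[OF fin assms(3)] fin assms by simp
qed

lemma continuous_bary [continuous_intros]: "continuous_on S (bary V v)"
  unfolding bary_def by (intro continuous_intros)

locale full_simplex =
  fixes V :: "(real^'d::finite) set"
  assumes independent: "\<not> affine_dependent V" and card_V: "card V = Suc CARD('d)"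
begin

lemma finite_V: "finite V"
  using independent aff_independent_finite by blast

lemma bary_repr: "(\<Sum>v\<in>V. bary V v x) = 1" "(\<Sum>v\<in>V. bary V v x *\<^sub>R v) = x"
proof -
  have "affine hull V = UNIV"
    using affine_independent_span_eq[OF independent] card_V by simp
  then have "x \<in> affine hull V" by simp
  then obtain u where u: "sum u V = 1" "(\<Sum>v\<in>V. u v *\<^sub>R v) = x"
    using affine_hull_finite[OF finite_V] by blast
  have "bary V v x = u v" if "v \<in> V" for v
    using bary_combination[OF independent that u(1)] u(2) by simp
  with u show "(\<Sum>v\<in>V. bary V v x) = 1" "(\<Sum>v\<in>V. bary V v x *\<^sub>R v) = x" by simp_all
qed

text \<open>The linear parts of the identities in \<open>bary_repr\<close>. The shape of facet
  normals and the summation over the vertices in the divergence theorem both rest on them.\<close>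

lemma bary_grad_sum: "(\<Sum>v\<in>V. bary_grad V v \<bullet> h) = 0" "(\<Sum>v\<in>V. (bary_grad V v \<bullet> h) *\<^sub>R v) = h"
proof -
  have e: "bary_grad V v \<bullet> h = bary V v (0 + h) - bary V v 0" for v
    unfolding bary_affine by simp
  show "(\<Sum>v\<in>V. bary_grad V v \<bullet> h) = 0" unfolding e sum_subtractf by (simp add: bary_repr)
  show "(\<Sum>v\<in>V. (bary_grad V v \<bullet> h) *\<^sub>R v) = h"
    unfolding e scaleR_diff_left sum_subtractf bary_repr by simp
qed

lemma hull_eq: "W \<subseteq> V \<Longrightarrow> convex hull W = {x. (\<forall>v\<in>V. 0 \<le> bary V v x) \<and> (\<forall>v\<in>V - W. bary V v x = 0)}"
proof (intro equalityI subsetI)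
  assume W: "W \<subseteq> V"
  have fW: "finite W" using W finite_V finite_subset by blast
  fix x assume "x \<in> convex hull W"
  then obtain u where u: "\<forall>w\<in>W. 0 \<le> u w" "sum u W = 1" "(\<Sum>w\<in>W. u w *\<^sub>R w) = x"
    using convex_hull_finite[OF fW] by blast
  define u' where "u' = (\<lambda>v. if v \<in> W then u v else 0)"
  have s: "sum u' V = 1" "(\<Sum>v\<in>V. u' v *\<^sub>R v) = x"
    using u(2,3) W finite_V unfolding u'_def
    by (simp_all add: sum.inter_restrict[symmetric] if_distrib[of "\<lambda>a. a *\<^sub>R _"] Int_absorb1 cong: if_cong)
  have "bary V v x = u' v" if "v \<in> V" for v
    using bary_combination[OF independent that s(1)] s(2) by simp
  then show "x \<in> {x. (\<forall>v\<in>V. 0 \<le> bary V v x) \<and> (\<forall>v\<in>V - W. bary V v x = 0)}"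
    using u(1) by (auto simp: u'_def)
next
  fix x assume W: "W \<subseteq> V" and x: "x \<in> {x. (\<forall>v\<in>V. 0 \<le> bary V v x) \<and> (\<forall>v\<in>V - W. bary V v x = 0)}"
  have fW: "finite W" using W finite_V finite_subset by blast
  have "(\<Sum>v\<in>W. bary V v x) = (\<Sum>v\<in>V. bary V v x)" "(\<Sum>v\<in>W. bary V v x *\<^sub>R v) = (\<Sum>v\<in>V. bary V v x *\<^sub>R v)"
    using x W by (auto intro!: sum.mono_neutral_left finite_V)
  then show "x \<in> convex hull W"
    unfolding convex_hull_finite[OF fW] using x W bary_repr[of x] by (intro CollectI exI[of _ "\<lambda>v. bary V v x"]) auto
qed

lemma simplex_eq: "convex hull V = {x. \<forall>v\<in>V. 0 \<le> bary V v x}"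
  using hull_eq[of V] by auto

lemma open_positive: "A \<subseteq> V \<Longrightarrow> open {x. \<forall>v\<in>A. 0 < bary V v x}"
proof -
  assume "A \<subseteq> V"
  then have "finite A" using finite_V finite_subset by blast
  moreover have "{x. \<forall>v\<in>A. 0 < bary V v x} = (\<Inter>v\<in>A. {x. 0 < bary V v x})" by auto
  ultimately show ?thesis
    by (auto intro!: open_INT open_Collect_less continuous_intros)
qed

lemma positive_subset_interior: "{x. \<forall>v\<in>V. 0 < bary V v x} \<subseteq> interior (convex hull V)"
  using open_positive[of V] by (intro interior_maximal) (auto simp: simplex_eq less_imp_le)

lemma bary_grad_nonzero: "v \<in> V \<Longrightarrow> bary_grad V v \<noteq> 0"
proof
  assume v: "v \<in> V" and "bary_grad V v = 0"
  have "V \<noteq> {v}" using card_V by auto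
  then obtain w where "w \<in> V" "w \<noteq> v" using v by blast
  then have "bary V v w = 0" "bary V v v = 1" using bary_vertex[OF independent] v by auto
  then show False using \<open>bary_grad V v = 0\<close> by (simp add: bary_def)
qed

text \<open>The coordinate of v is 1 at v and 0 on the opposite facet, so it decreases across that
  facet to the outside. The negative gradient, normalised, is the outer unit normal there.\<close>

definition nrm :: "real^'d \<Rightarrow> real^'d" where
  "nrm v = - (bary_grad V v /\<^sub>R norm (bary_grad V v))"

lemma norm_nrm: "v \<in> V \<Longrightarrow> norm (nrm v) = 1"
  using bary_grad_nonzero by (simp add: nrm_def)

lemma bary_grad_nrm: "v \<in> V \<Longrightarrow> bary_grad V v = - (norm (bary_grad V v) *\<^sub>R nrm v)"
  using bary_grad_nonzero by (simp add: nrm_def)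

lemma facet_iff: "e facet_of (convex hull V) \<longleftrightarrow> (\<exists>v\<in>V. e = convex hull (V - {v}))"
proof -
  have "2 \<le> card V" using card_V by simp
  then show ?thesis using facet_of_convex_hull_affine_independent_alt[OF independent] by auto
qed

lemma bary_facet: "v \<in> V \<Longrightarrow> y \<in> convex hull (V - {v}) \<Longrightarrow> bary V v y = 0"
  using hull_eq[of "V - {v}"] by auto

text \<open>By \<open>bary_grad_sum\<close>, \<open>n \<bullet> h\<close> is a combination of the
  values \<open>n \<bullet> w\<close> at the vertices. These coincide for all w except v, and since
  the gradients sum to zero, only a multiple of the gradient of v remains.\<close>

lemma normal_eq:
  assumes v: "v \<in> V" and n: "norm n = 1"
    and const: "\<And>x y. x \<in> convex hull (V - {v}) \<Longrightarrow> y \<in> convex hull (V - {v}) \<Longrightarrow> n \<bullet> (x - y) = 0"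
  shows "n = nrm v \<or> n = - nrm v"
proof -
  obtain w0 where w0: "w0 \<in> V" "w0 \<noteq> v"
    using card_V v by (metis card.empty card_insert_disjoint empty_iff finite.emptyI insertI1 is_singletonI' is_singleton_def
      nat.inject singletonD zero_neq_one CARD_1 zero_less_card_finite One_nat_def less_irrefl)
  have c: "n \<bullet> w = n \<bullet> w0" if "w \<in> V - {v}" for w
    using const[of w w0] that w0 by (auto simp: hull_inc inner_diff_right)
  have "n \<bullet> h = ((n \<bullet> v - n \<bullet> w0) *\<^sub>R bary_grad V v) \<bullet> h" for h
  proof -
    have "n \<bullet> h = (\<Sum>w\<in>V. (bary_grad V w \<bullet> h) * (n \<bullet> w))"
      by (subst (1) bary_grad_sum(2)[of h, symmetric]) (simp add: inner_sum_right)
    also have "\<dots> = (bary_grad V v \<bullet> h) * (n \<bullet> v) + (\<Sum>w\<in>V - {v}. bary_grad V w \<bullet> h) * (n \<bullet> w0)"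
      using v finite_V c by (simp add: sum.remove[of V v] sum_distrib_right)
    also have "(\<Sum>w\<in>V - {v}. bary_grad V w \<bullet> h) = - (bary_grad V v \<bullet> h)"
      using bary_grad_sum(1)[of h] v finite_V by (simp add: sum.remove[of V v])
    finally show ?thesis by (simp add: algebra_simps)
  qed
  then obtain b where e: "n = b *\<^sub>R bary_grad V v"
    by (metis vector_eq_rdot)
  then have "\<bar>b\<bar> * norm (bary_grad V v) = 1" using n by simp
  then have "b = inverse (norm (bary_grad V v)) \<or> b = - inverse (norm (bary_grad V v))"
    using bary_grad_nonzero[OF v] by (auto simp: field_simps abs_if split: if_splits)
  then show ?thesis using e unfolding nrm_def by auto
qed

lemma nrm_outer:
  assumes "v \<in> V" "x \<in> convex hull V" "y \<in> convex hull (V - {v})"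
  shows "nrm v \<bullet> (x - y) \<le> 0"
proof -
  have "bary V v (y + (x - y)) \<ge> 0" using assms simplex_eq by auto
  then have "bary_grad V v \<bullet> (x - y) \<ge> 0" unfolding bary_affine using bary_facet assms by auto
  then show ?thesis by (simp add: nrm_def)
qed

text \<open>Applied to two points of the facet in both orders, the inequality in
  \<open>outer_normal\<close> forces orthogonality to the facet. Two unit vectors are left, and the
  vertex v decides the sign, so the choice has a single candidate.\<close>

lemma outer_normal_eq:
  assumes v: "v \<in> V"
  shows "outer_normal (convex hull V) (convex hull (V - {v})) = nrm v"
proof -
  let ?P = "\<lambda>n. norm n = 1 \<and> (\<forall>x\<in>convex hull V. \<forall>y\<in>convex hull (V - {v}). n \<bullet> (x - y) \<le> 0)"
  have 1: "?P (nrm v)" using nrm_outer norm_nrm v by blast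
  have 2: "n = nrm v" if n: "?P n" for n
  proof -
    have sub: "convex hull (V - {v}) \<subseteq> convex hull V" by (simp add: hull_mono)
    have "n \<bullet> (x - y) = 0" if "x \<in> convex hull (V - {v})" "y \<in> convex hull (V - {v})" for x y
    proof -
      have "n \<bullet> (x - y) \<le> 0" "n \<bullet> (y - x) \<le> 0" using n that sub by blast+
      then show ?thesis by (simp add: inner_diff_right)
    qed
    then have "n = nrm v \<or> n = - nrm v" using normal_eq[OF v] n by blast
    moreover have "n \<noteq> - nrm v"
    proof
      assume neg: "n = - nrm v"
      obtain w where w: "w \<in> V - {v}" using card_V finite_V
        by (metis One_nat_def card.empty card_Diff_singleton diff_Suc_1 ex_in_conv v zero_less_card_finite less_irrefl)
      then have "bary V v w = 0" "bary V v v = 1" using bary_vertex[OF independent] v by auto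
      then have g: "bary_grad V v \<bullet> (v - w) = 1" using bary_affine[of V v w "v - w"] by simp
      have "n \<bullet> (v - w) \<le> 0" using n v w by (auto simp: hull_inc)
      then have "bary_grad V v \<bullet> (v - w) / norm (bary_grad V v) \<le> 0"
        unfolding neg nrm_def by (simp add: divide_inverse_commute)
      then show False using g bary_grad_nonzero[OF v] by (simp add: field_simps)
    qed
    ultimately show ?thesis by blast
  qed
  show ?thesis unfolding outer_normal_def by (rule some_equality) (use 1 2 in blast)+
qed

text \<open>At a relative interior point of a facet all other coordinates are positive and remain so
  nearby. Locally the simplex is therefore the half space where the coordinate of v is nonnegative.
  This picture decides later how elements lie at a common face.\<close>

lemma half_ball:
  assumes v: "v \<in> V" and x: "x \<in> rel_interior (convex hull (V - {v}))"
  obtains r where "r > 0" "\<And>y. dist x y < r \<Longrightarrow> nrm v \<bullet> (y - x) \<le> 0 \<Longrightarrow> y \<in> convex hull V"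
    "\<And>y. dist x y < r \<Longrightarrow> nrm v \<bullet> (y - x) < 0 \<Longrightarrow> y \<in> interior (convex hull V)"
proof -
  have ind: "\<not> affine_dependent (V - {v})" using independent affine_dependent_subset by blast
  obtain u where u: "\<forall>w\<in>V - {v}. 0 < u w" "sum u (V - {v}) = 1" "(\<Sum>w\<in>V - {v}. u w *\<^sub>R w) = x"
    using x rel_interior_convex_hull_explicit[OF ind] by auto
  define u' where "u' = u(v := 0)"
  have s: "sum u' V = 1" "(\<Sum>w\<in>V. u' w *\<^sub>R w) = x"
    using u finite_V v by (simp_all add: sum.remove[of V v] u'_def)
  have b: "bary V w x = u' w" if "w \<in> V" for w
    using bary_combination[OF independent that s(1)] s(2) by simp
  have pos: "x \<in> {x. \<forall>w\<in>V - {v}. 0 < bary V w x}" using u(1) b by (auto simp: u'_def)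
  then obtain r where r: "r > 0" "ball x r \<subseteq> {x. \<forall>w\<in>V - {v}. 0 < bary V w x}"
    using open_positive[of "V - {v}"] by (meson Diff_subset open_contains_ball)
  have bv: "bary V v y = - (norm (bary_grad V v) * (nrm v \<bullet> (y - x)))" for y
  proof -
    have "bary V v (x + (y - x)) = bary_grad V v \<bullet> (y - x)"
      unfolding bary_affine using b[OF v] by (simp add: u'_def)
    then show ?thesis by (subst (asm) bary_grad_nrm[OF v]) simp
  qed
  show ?thesis
  proof (rule that[of r])
    show "r > 0" by (rule r(1))
  next
    fix y assume y: "dist x y < r" and "nrm v \<bullet> (y - x) \<le> 0"
    then have "0 \<le> bary V v y" unfolding bv by (simp add: mult_nonneg_nonpos)
    moreover have "\<forall>w\<in>V - {v}. 0 < bary V w y" using y r by auto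
    ultimately show "y \<in> convex hull V" unfolding simplex_eq mem_Collect_eq
      by (metis Diff_iff less_imp_le singletonD)
  next
    fix y assume y: "dist x y < r" and "nrm v \<bullet> (y - x) < 0"
    then have "0 < bary V v y" unfolding bv using bary_grad_nonzero[OF v] by (simp add: mult_pos_neg)
    moreover have "\<forall>w\<in>V - {v}. 0 < bary V w y" using y r by auto
    ultimately have "\<forall>w\<in>V. 0 < bary V w y" by auto
    then show "y \<in> interior (convex hull V)" using positive_subset_interior by blast
  qed
qed

end

section \<open>Lagrange interpolation on a simplex\<close>

lemma Poly_affine_mult:
  fixes f :: "real^'d \<Rightarrow> real"
  assumes "f \<in> Poly k"
  shows "(\<lambda>x. (c + g \<bullet> x) * f x) \<in> Poly (Suc k)"
proof -
  have "(\<lambda>x. (\<Sum>i\<in>UNIV. g $ i * (x $ i * f x)) + c * f x) \<in> Poly (Suc k)"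
    using assms by (intro Poly_add Poly_sum Poly_scale Poly_coord) (auto intro: Poly_mono)
  moreover have "(\<Sum>i\<in>UNIV. g $ i * (x $ i * f x)) + c * f x = (c + g \<bullet> x) * f x" for x
    by (simp add: inner_vec_def sum_distrib_right distrib_right mult.assoc)
  ultimately show ?thesis by simp
qed

lemma Poly_prod_affine:
  assumes "finite A" "\<And>a. a \<in> A \<Longrightarrow> \<exists>c g. \<forall>x. f a x = c + g \<bullet> x"
  shows "(\<lambda>x. \<Prod>a\<in>A. f a x) \<in> Poly (card A)"
  using assms
proof (induction A rule: finite_induct)
  case (insert a A)
  obtain c g where cg: "\<forall>x. f a x = c + g \<bullet> x" using insert by blast
  have "(\<lambda>x. (c + g \<bullet> x) * (\<Prod>a\<in>A. f a x)) \<in> Poly (Suc (card A))"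
    using insert by (intro Poly_affine_mult) auto
  then show ?case using insert cg by simp
qed simp

lemma simplex_full_simplex:
  fixes t :: "(real^'d::finite) set"
  assumes "int CARD('d) simplex t"
  shows "full_simplex {v. v extreme_point_of t}" "t = convex hull {v. v extreme_point_of t}"
proof -
  obtain C where C: "\<not> affine_dependent C" "int (card C) = int CARD('d) + 1" "t = convex hull C"
    using assms unfolding simplex_def by blast
  then have "{v. v extreme_point_of t} = C" by (simp add: extreme_point_of_convex_hull_affine_independent)
  with C show "full_simplex {v. v extreme_point_of t}" "t = convex hull {v. v extreme_point_of t}"
    unfolding full_simplex_def by auto
qed

text \<open>The basis polynomial of the node with index c is the normalised product of
  \<open>k * bary V v x - j\<close> over all vertices v and all j below \<open>c v\<close>; its
  degree is the index sum k. At a different node some index \<open>c' v\<close> is smaller than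
  \<open>c v\<close>, since both sums are k, and the factor with j equal to \<open>c' v\<close>
  vanishes.\<close>

lemma lagrange_interpolation:
  fixes t :: "(real^'d::finite) set"
  assumes t: "int CARD('d) simplex t" and k: "k \<ge> 1"
  shows "\<exists>\<pi>\<in>Poly k. \<forall>\<nu>\<in>lagrange_nodes k t. \<pi> \<nu> = val \<nu>"
proof -
  define V where "V = {v. v extreme_point_of t}"
  interpret full_simplex V using simplex_full_simplex[OF t] by (simp add: V_def)
  define node where "node = (\<lambda>c. \<Sum>v\<in>V. (real (c v) / real k) *\<^sub>R v)"
  \<comment> \<open>Extensional functions, so that an index is determined by its values on
    V.\<close>
  define C where "C = {c \<in> PiE V (\<lambda>_. {..k}). sum c V = k}"
  define L where "L = (\<lambda>c x. \<Prod>(v, j)\<in>Sigma V (\<lambda>v. {..<c v}). (real k * bary V v x - real j) / (real (c v) - real j))"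
  have finC: "finite C" unfolding C_def
    by (rule finite_subset[OF _ finite_PiE[OF finite_V, of "\<lambda>_. {..k}"]]) auto
  have bn: "bary V v (node c) = real (c v) / real k" if "c \<in> C" "v \<in> V" for c v
  proof -
    have "(\<Sum>v\<in>V. real (c v) / real k) = 1"
      using that k unfolding C_def by (simp flip: sum_divide_distrib of_nat_sum)
    then show ?thesis unfolding node_def by (rule bary_combination[OF independent that(2)])
  qed
  have Lp: "L c \<in> Poly k" if "c \<in> C" for c
  proof -
    have cd: "card (Sigma V (\<lambda>v. {..<c v})) = k" using that finite_V by (simp add: C_def)
    have "(\<lambda>x. \<Prod>p\<in>Sigma V (\<lambda>v. {..<c v}). (real k * bary V (fst p) x - real (snd p)) / (real (c (fst p)) - real (snd p)))
        \<in> Poly (card (Sigma V (\<lambda>v. {..<c v})))"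
    proof (rule Poly_prod_affine)
      fix p assume "p \<in> Sigma V (\<lambda>v. {..<c v})"
      let ?d = "real (c (fst p)) - real (snd p)"
      have "(real k * bary V (fst p) x - real (snd p)) / ?d = (real k * fst (bary_coeff V (fst p)) - real (snd p)) / ?d
         + ((real k / ?d) *\<^sub>R bary_grad V (fst p)) \<bullet> x" for x
        by (simp add: bary_def algebra_simps add_divide_distrib diff_divide_distrib)
      then show "\<exists>b g. \<forall>x. (real k * bary V (fst p) x - real (snd p)) / ?d = b + g \<bullet> x" by blast
    qed (use finite_V in auto)
    then show ?thesis unfolding cd L_def by (simp add: case_prod_beta')
  qed
  have Ln: "L c (node c') = (if c = c' then 1 else 0)" if "c \<in> C" "c' \<in> C" for c c'
  proof (cases "c = c'")
    case True
    have "(real k * bary V v (node c') - real j) / (real (c v) - real j) = 1" if "v \<in> V" "j < c v" for v j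
      using bn[OF \<open>c' \<in> C\<close> that(1)] k that True by simp
    then have "(case p of (v, j) \<Rightarrow> (real k * bary V v (node c') - real j) / (real (c v) - real j)) = 1"
      if "p \<in> Sigma V (\<lambda>v. {..<c v})" for p using that by force
    then show ?thesis unfolding L_def using True by (simp add: prod.neutral)
  next
    case False
    have "\<exists>v\<in>V. c' v < c v"
    proof (rule ccontr)
      assume "\<not> ?thesis"
      then have le: "\<forall>v\<in>V. c v \<le> c' v" by force
      have "c v = c' v" if "v \<in> V" for v
      proof (rule ccontr)
        assume "c v \<noteq> c' v"
        then have "sum c V < sum c' V" using le that finite_V by (intro sum_strict_mono_ex1) force+
        then show False using \<open>c \<in> C\<close> \<open>c' \<in> C\<close> by (simp add: C_def)
      qed
      then have "c = c'" using that unfolding C_def by (auto intro: PiE_ext)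
      with False show False by simp
    qed
    then obtain v where v: "v \<in> V" "c' v < c v" by blast
    then have "(real k * bary V v (node c') - real (c' v)) / (real (c v) - real (c' v)) = 0"
      using bn[OF that(2) v(1)] k by simp
    moreover have "(v, c' v) \<in> Sigma V (\<lambda>v. {..<c v})" using v by auto
    ultimately have "L c (node c') = 0" unfolding L_def using finite_V
      by (intro prod_zero) (auto intro!: bexI[of _ "(v, c' v)"])
    then show ?thesis using False by simp
  qed
  define \<pi> where "\<pi> = (\<lambda>x. \<Sum>c\<in>C. val (node c) * L c x)"
  have "\<pi> \<in> Poly k" unfolding \<pi>_def by (intro Poly_sum Poly_scale Lp)
  moreover have "\<pi> \<nu> = val \<nu>" if \<nu>: "\<nu> \<in> lagrange_nodes k t" for \<nu>
  proof -
    obtain c where c: "\<nu> = (\<Sum>v\<in>V. (real (c v) / real k) *\<^sub>R v)" "sum c V = k"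
      using \<nu> unfolding lagrange_nodes_def V_def by blast
    define c' where "c' = restrict c V"
    have c': "c' \<in> C" "node c' = \<nu>"
      using c member_le_sum[of _ V c] finite_V by (auto simp: c'_def C_def node_def)
    have "\<pi> (node c') = (\<Sum>c\<in>C. if c = c' then val (node c) else 0)"
      unfolding \<pi>_def using c' Ln by (intro sum.cong) auto
    then show ?thesis using c' finC by simp
  qed
  ultimately show ?thesis by blast
qed

text \<open>The lattice result is applied with base point \<open>w0\<close> and directions
  \<open>(w - w0) / k\<close>. Giving \<open>w0\<close> the remaining weight turns lattice points of
  index sum at most k into the points with weights \<open>c w / k\<close>, and real coefficients
  then reach the whole hull.\<close>

lemma Poly_vanish_on_hull:
  fixes f :: "real^'d \<Rightarrow> real"
  assumes W: "finite W" and k: "k \<ge> 1" and f: "f \<in> Poly k"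
    and z: "\<And>c. sum c W = k \<Longrightarrow> f (\<Sum>w\<in>W. (real (c w) / real k) *\<^sub>R w) = 0"
    and x: "x \<in> convex hull W"
  shows "f x = 0"
proof -
  obtain u where u: "sum u W = 1" "(\<Sum>w\<in>W. u w *\<^sub>R w) = x"
    using x convex_hull_finite[OF W] by blast
  have "W \<noteq> {}" using x by auto
  then obtain w0 where w0: "w0 \<in> W" by blast
  have shift: "w0 + (\<Sum>w\<in>W - {w0}. s w *\<^sub>R ((1 / real k) *\<^sub>R (w - w0))) =
      (\<Sum>w\<in>W. ((s(w0 := real k - sum s (W - {w0}))) w / real k) *\<^sub>R w)" (is "?l = ?r") for s
  proof -
    have "(\<Sum>w\<in>W - {w0}. s w *\<^sub>R ((1 / real k) *\<^sub>R (w - w0))) =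
        (\<Sum>w\<in>W - {w0}. (s w / real k) *\<^sub>R w) - (sum s (W - {w0}) / real k) *\<^sub>R w0"
      by (simp add: algebra_simps sum_subtractf scaleR_sum_left[symmetric] sum_divide_distrib)
    moreover have "?r = (\<Sum>w\<in>W - {w0}. (s w / real k) *\<^sub>R w) + ((real k - sum s (W - {w0})) / real k) *\<^sub>R w0"
      using W w0 by (subst sum.remove[of W w0]) auto
    ultimately show ?thesis using k by (simp add: diff_divide_distrib scaleR_diff_left)
  qed
  have "f (w0 + (\<Sum>w\<in>W - {w0}. (real k * u w) *\<^sub>R ((1 / real k) *\<^sub>R (w - w0)))) = 0"
  proof (rule Poly_lattice_unisolvent[OF _ f])
    fix c :: "real^'d \<Rightarrow> nat" assume c: "sum c (W - {w0}) \<le> k"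
    define c' where "c' = c(w0 := k - sum c (W - {w0}))"
    have "sum c' W = k" using W w0 c by (simp add: sum.remove[of W w0] c'_def)
    from z[OF this] show "f (w0 + (\<Sum>w\<in>W - {w0}. real (c w) *\<^sub>R ((1 / real k) *\<^sub>R (w - w0)))) = 0"
      unfolding shift using c
      by (simp add: c'_def if_distrib[of real] fun_upd_def of_nat_diff cong: if_cong)
  qed (use W in simp)
  moreover have "w0 + (\<Sum>w\<in>W - {w0}. (real k * u w) *\<^sub>R ((1 / real k) *\<^sub>R (w - w0))) = x"
  proof -
    have "u w0 = 1 - sum u (W - {w0})" using u(1) W w0 by (simp add: sum.remove[of W w0])
    then have "real k - (\<Sum>w\<in>W - {w0}. real k * u w) = real k * u w0"
      by (simp add: sum_distrib_left[symmetric] right_diff_distrib)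
    then have "w0 + (\<Sum>w\<in>W - {w0}. (real k * u w) *\<^sub>R ((1 / real k) *\<^sub>R (w - w0))) = (\<Sum>w\<in>W. u w *\<^sub>R w)"
      unfolding shift using k by (auto intro!: sum.cong)
    then show ?thesis using u(2) by simp
  qed
  ultimately show ?thesis by simp
qed

text \<open>An index on a face, extended by zero, is an index on the simplex. Thus two elements that
  share a face share the nodes on it.\<close>

lemma lagrange_node_of_face:
  fixes t :: "(real^'d::finite) set"
  assumes t: "int CARD('d) simplex t" and W: "W \<subseteq> {v. v extreme_point_of t}" and c: "sum c W = k"
  shows "(\<Sum>w\<in>W. (real (c w) / real k) *\<^sub>R w) \<in> lagrange_nodes k t"
proof -
  define V where "V = {v. v extreme_point_of t}"
  interpret full_simplex V using simplex_full_simplex[OF t] by (simp add: V_def)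
  define c' where "c' = (\<lambda>w. if w \<in> W then c w else 0)"
  have "sum c' V = k" "(\<Sum>w\<in>V. (real (c' w) / real k) *\<^sub>R w) = (\<Sum>w\<in>W. (real (c w) / real k) *\<^sub>R w)"
    using W c finite_V unfolding V_def[symmetric] c'_def
    by (auto simp: sum.inter_restrict[symmetric] Int_absorb1 if_distrib[of real] if_distrib[of "\<lambda>a. a / _"] if_distrib[of "\<lambda>a. a *\<^sub>R _"] cong: if_cong)
  then show ?thesis unfolding lagrange_nodes_def V_def[symmetric] by (metis (mono_tags, lifting) mem_Collect_eq)
qed

section \<open>Test functions and weak derivatives\<close>

text \<open>The polynomial is evaluated at \<open>1 / t\<close>. In this form the family is closed
  under differentiation, and \<open>flat [:1:]\<close> is the classical smooth function that
  vanishes exactly for nonpositive arguments.\<close>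

definition flat :: "real poly \<Rightarrow> real \<Rightarrow> real" where
  "flat p t = (if t > 0 then poly p (1 / t) * exp (- (1 / t)) else 0)"

lemma flat_tendsto_0: "(flat p \<longlongrightarrow> 0) (at_right 0)"
proof -
  have "((\<lambda>x. poly p x / exp x) \<longlongrightarrow> 0) at_top"
  proof (induction p)
    case (pCons a p)
    have "((\<lambda>x. (\<Sum>i\<le>degree (pCons a p). coeff (pCons a p) i * (x ^ i / exp x))) \<longlongrightarrow>
      (\<Sum>i\<le>degree (pCons a p). coeff (pCons a p) i * 0)) at_top"
      by (intro tendsto_sum tendsto_mult tendsto_const tendsto_power_div_exp_0)
    then show ?case by (simp only: poly_altdef sum_divide_distrib times_divide_eq_right mult_zero_right sum.neutral_const)
  qed auto
  then have "((\<lambda>t. poly p (inverse t) / exp (inverse t)) \<longlongrightarrow> 0) (at_right 0)"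
    by (rule filterlim_compose) (rule filterlim_inverse_at_top_right)
  then show ?thesis
    by (rule Lim_transform_eventually)
       (auto simp: eventually_at_right_field flat_def exp_minus inverse_eq_divide intro!: exI[of _ 1])
qed

text \<open>With s = 1 / t the derivative of p(s) exp(-s) is s^2 (p - p')(s) exp(-s), since ds/dt =
  - s^2. At 0 the difference quotient from the right is the member of the family for s p(s), which
  tends to 0.\<close>

lemma flat_DERIV: "(flat p has_real_derivative flat ([:0, 0, 1:] * (p - pderiv p)) t) (at t)"
proof (cases t "0::real" rule: linorder_cases)
  case greater
  have "((\<lambda>t. poly p (1 / t) * exp (- (1 / t))) has_real_derivative flat ([:0, 0, 1:] * (p - pderiv p)) t) (at t)"
  proof (rule DERIV_cong)
    have i: "((\<lambda>t. 1 / t) has_real_derivative - (1 / t\<^sup>2)) (at t)"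
      using greater by (auto intro!: derivative_eq_intros simp: power2_eq_square)
    show "((\<lambda>t. poly p (1 / t) * exp (- (1 / t))) has_real_derivative
        poly (pderiv p) (1 / t) * (- (1 / t\<^sup>2)) * exp (- (1 / t)) + exp (- (1 / t)) * - (- (1 / t\<^sup>2)) * poly p (1 / t)) (at t)"
      by (intro DERIV_mult DERIV_chain2[OF poly_DERIV] DERIV_chain2[OF DERIV_exp] DERIV_minus i)
    show "poly (pderiv p) (1 / t) * (- (1 / t\<^sup>2)) * exp (- (1 / t)) + exp (- (1 / t)) * - (- (1 / t\<^sup>2)) * poly p (1 / t)
        = flat ([:0, 0, 1:] * (p - pderiv p)) t"
      using greater by (simp add: flat_def power2_eq_square algebra_simps)
  qed
  then show ?thesis
    by (rule has_field_derivative_transform_within[of _ _ _ _ t]) (use greater in \<open>auto simp: flat_def dist_real_def\<close>)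
next
  case less
  have "(flat p has_real_derivative 0) (at t)"
    by (rule has_field_derivative_transform_within_open[of "\<lambda>t. 0" _ _ "{..<0}"])
       (use less in \<open>auto simp: flat_def\<close>)
  then show ?thesis using less by (simp add: flat_def)
next
  case equal
  have "((\<lambda>h. (flat p (0 + h) - flat p 0) / h) \<longlongrightarrow> 0) (at 0)"
  proof (rule filterlim_split_at)
    have "eventually (\<lambda>h. 0 = (flat p (0 + h) - flat p 0) / h) (at_left (0::real))"
      by (auto simp: eventually_at_left_field flat_def intro!: exI[of _ "-1"])
    then show "((\<lambda>h. (flat p (0 + h) - flat p 0) / h) \<longlongrightarrow> 0) (at_left 0)"
      by (rule Lim_transform_eventually[OF tendsto_const])
    have "eventually (\<lambda>h. flat ([:0, 1:] * p) h = (flat p (0 + h) - flat p 0) / h) (at_right (0::real))"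
      by (auto simp: eventually_at_right_field flat_def intro!: exI[of _ 1])
    then show "((\<lambda>h. (flat p (0 + h) - flat p 0) / h) \<longlongrightarrow> 0) (at_right 0)"
      by (rule Lim_transform_eventually[OF flat_tendsto_0])
  qed
  then show ?thesis unfolding equal DERIV_def by (simp add: flat_def)
qed

abbreviation bump1 :: "real \<Rightarrow> real" where "bump1 \<equiv> flat [:1:]"

lemma bump1_bounds: "0 \<le> bump1 t" "bump1 t \<le> 1" "bump1 t = 0 \<longleftrightarrow> t \<le> 0"
  by (auto simp: flat_def)

lemma bump1_tendsto: "t > 0 \<Longrightarrow> (\<lambda>n. bump1 (real (Suc n) * t)) \<longlonglongrightarrow> 1"
proof -
  assume t: "t > 0"
  have "(\<lambda>n. exp (- (1 / t * (1 / real (Suc n))))) \<longlonglongrightarrow> exp (- (1 / t * 0))"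
    by (intro tendsto_intros LIMSEQ_Suc lim_1_over_n)
  moreover have "bump1 (real (Suc n) * t) = exp (- (1 / t * (1 / real (Suc n))))" for n
    using t by (simp add: flat_def del: of_nat_Suc)
  ultimately show ?thesis by (simp del: of_nat_Suc)
qed

lemma partial_eq: "(f has_derivative f') (at x) \<Longrightarrow> partial i f x = f' (axis i 1)"
  unfolding partial_def using frechet_derivative_at by metis

lemma differentiable_has_partials:
  assumes "f differentiable (at x)"
  shows "(f has_derivative (\<lambda>h. (\<chi> i. partial i f x) \<bullet> h)) (at x)"
proof -
  let ?f' = "frechet_derivative f (at x)"
  have d: "(f has_derivative ?f') (at x)" using assms frechet_derivative_works by blast
  interpret bounded_linear ?f' using d has_derivative_bounded_linear by blast
  have "?f' h = (\<chi> i. partial i f x) \<bullet> h" for h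
  proof -
    have "?f' h = ?f' (\<Sum>i\<in>UNIV. (h $ i) *\<^sub>R axis i 1)" using basis_expansion[of h]
      by (simp add: scalar_mult_eq_scaleR)
    then show ?thesis by (simp add: sum scaleR inner_vec_def partial_def mult.commute)
  qed
  then have "?f' = (\<lambda>h. (\<chi> i. partial i f x) \<bullet> h)" by blast
  with d show ?thesis by simp
qed

lemma cont_diff_Suc_imp: "cont_diff (Suc m) f \<Longrightarrow> cont_diff m f"
proof (induction m arbitrary: f)
  case 0
  then show ?case by (auto intro: continuous_at_imp_continuous_on differentiable_imp_continuous_within)
next
  case (Suc m)
  then show ?case by (metis cont_diff.simps(2))
qed

lemma cont_diff_const [simp]: "cont_diff m (\<lambda>x::real^'d. c)"
proof (induction m arbitrary: c)
  case (Suc m)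
  have "partial i (\<lambda>x::real^'d. c) = (\<lambda>x. 0)" for i using partial_eq[OF has_derivative_const] by blast
  with Suc show ?case by simp
qed simp

lemma partial_mult:
  assumes "f differentiable (at x)" "g differentiable (at x)"
  shows "partial i (\<lambda>x. f x * g x) x = f x * partial i g x + partial i f x * g x"
  using partial_eq[OF has_derivative_mult[OF assms[unfolded frechet_derivative_works]], of i]
  by (simp add: partial_def)

lemma partial_add:
  assumes "f differentiable (at x)" "g differentiable (at x)"
  shows "partial i (\<lambda>x. f x + g x) x = partial i f x + partial i g x"
  using partial_eq[OF has_derivative_add[OF assms[unfolded frechet_derivative_works]], of i]
  by (simp add: partial_def)

lemma cont_diff_add: "cont_diff m f \<Longrightarrow> cont_diff m g \<Longrightarrow> cont_diff m (\<lambda>x. f x + g x)"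
proof (induction m arbitrary: f g)
  case (Suc m)
  then have "partial i (\<lambda>x. f x + g x) = (\<lambda>x. partial i f x + partial i g x)" for i
    by (auto intro!: partial_add)
  with Suc show ?case by auto
qed (auto intro: continuous_on_add)

lemma cont_diff_mult: "cont_diff m f \<Longrightarrow> cont_diff m g \<Longrightarrow> cont_diff m (\<lambda>x. f x * g x)"
proof (induction m arbitrary: f g)
  case (Suc m)
  then have "partial i (\<lambda>x. f x * g x) = (\<lambda>x. f x * partial i g x + partial i f x * g x)" for i
    by (auto intro!: partial_mult)
  moreover have "cont_diff m f" "cont_diff m g" using Suc.prems cont_diff_Suc_imp by blast+
  ultimately show ?case using Suc by (auto intro!: cont_diff_add differentiable_mult)
qed (auto intro: continuous_on_mult)

lemma cont_diff_prod: "(\<And>i. i \<in> I \<Longrightarrow> cont_diff m (f i)) \<Longrightarrow> cont_diff m (\<lambda>x. \<Prod>i\<in>I. f i x)"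
  by (induction I rule: infinite_finite_induct) (auto intro: cont_diff_mult)

text \<open>The polynomial is left arbitrary so that the induction applies to the partial
  derivatives, which are multiples of another member of the family.\<close>

lemma cont_diff_flat: "cont_diff m (\<lambda>x. flat p (c * x $ i + d))"
proof (induction m arbitrary: p)
  case 0
  have "continuous_on UNIV (flat p)"
    using flat_DERIV DERIV_isCont by (blast intro: continuous_at_imp_continuous_on)
  then have "continuous_on UNIV (flat p \<circ> (\<lambda>x. c * x $ i + d))"
    by (intro continuous_on_compose) (auto intro!: continuous_intros intro: continuous_on_subset)
  then show ?case by (simp add: o_def)
next
  case (Suc m)
  define q where "q = [:0, 0, 1:] * (p - pderiv p)"
  have *: "((\<lambda>x. flat p (c * x $ i + d)) has_derivative (\<lambda>h. flat q (c * x $ i + d) * (c * h $ i))) (at x)" for x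
  proof -
    have "((\<lambda>x. c * x $ i + d) has_derivative (\<lambda>h. c * h $ i)) (at x)"
      by (auto intro!: derivative_eq_intros bounded_linear_imp_has_derivative[OF bounded_linear_vec_nth])
    from has_derivative_compose[OF this flat_DERIV[unfolded has_field_derivative_def]]
    show ?thesis unfolding q_def .
  qed
  have p: "partial j (\<lambda>x. flat p (c * x $ i + d)) = (\<lambda>x. flat q (c * x $ i + d) * (if j = i then c else 0))" for j
    using partial_eq[OF *, of j] by (auto simp: axis_def)
  show ?case using * cont_diff_mult[OF Suc[of q] cont_diff_const]
    by (auto simp: p differentiable_def)
qed

lemma cont_diff_Poly: "f \<in> Poly k \<Longrightarrow> cont_diff m f"
proof (induction m arbitrary: f)
  case 0
  then show ?case by (simp add: Poly_continuous)
next
  case (Suc m)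
  then obtain D where D: "\<forall>i. D i \<in> Poly k" "\<And>x. (f has_derivative (\<lambda>h. \<Sum>i\<in>UNIV. D i x * h $ i)) (at x)"
    using Poly_has_derivative by blast
  have "partial i f x = D i x" for i x
    using partial_eq[OF D(2), of i x] by (simp add: axis_def if_distrib cong: if_cong)
  then have "partial i f = D i" for i by blast
  moreover have "f differentiable (at x)" for x using D(2) differentiable_def by blast
  ultimately show ?case using Suc D by simp
qed

lemma test_functionsI:
  fixes f :: "real^'d \<Rightarrow> real"
  assumes "\<And>m. cont_diff m f" "compact K" "K \<subseteq> U" "\<And>x. f x \<noteq> 0 \<Longrightarrow> x \<in> K"
  shows "f \<in> test_functions U"
proof -
  have "{x. f x \<noteq> 0} \<subseteq> K" using assms(4) by blast
  then have s: "closure {x. f x \<noteq> 0} \<subseteq> K" "bounded {x. f x \<noteq> 0}"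
    using closure_minimal compact_imp_closed[OF assms(2)] bounded_subset compact_imp_bounded[OF assms(2)] by metis+
  then show ?thesis using assms(1,3) by (auto simp: test_functions_def compact_closure)
qed

lemma test_functionsD:
  assumes "f \<in> test_functions U"
  shows "cont_diff m f" "f differentiable (at x)" "continuous_on S f" "x \<notin> U \<Longrightarrow> f x = 0"
    "(f has_derivative (\<lambda>h. (\<chi> i. partial i f x) \<bullet> h)) (at x)"
proof -
  show "cont_diff m f" using assms by (simp add: test_functions_def)
  have "cont_diff (Suc 0) f" using assms unfolding test_functions_def by blast
  then show d: "f differentiable (at x)" for x by simp
  show "continuous_on S f"
    using d by (simp add: continuous_at_imp_continuous_on differentiable_imp_continuous_within)
  show "x \<notin> U \<Longrightarrow> f x = 0" using assms closure_subset[of "{x. f x \<noteq> 0}"]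
    by (auto simp: test_functions_def)
  show "(f has_derivative (\<lambda>h. (\<chi> i. partial i f x) \<bullet> h)) (at x)"
    by (rule differentiable_has_partials[OF d])
qed

lemma test_functions_support:
  assumes "f \<in> test_functions U"
  obtains K where "compact K" "K \<subseteq> U" "\<And>x. x \<notin> K \<Longrightarrow> f x = 0" "\<And>x i. x \<notin> K \<Longrightarrow> partial i f x = 0"
proof -
  let ?K = "closure {x. f x \<noteq> 0}"
  show thesis
  proof (rule that[of ?K])
    show "compact ?K" "?K \<subseteq> U" using assms by (auto simp: test_functions_def)
    show "f x = 0" if "x \<notin> ?K" for x using that closure_subset[of "{x. f x \<noteq> 0}"] by auto
    show "partial i f x = 0" if "x \<notin> ?K" for x i
    proof -
      have "((\<lambda>x. 0) has_derivative (\<lambda>h. 0)) (at x)" by simp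
      then have "(f has_derivative (\<lambda>h. 0)) (at x)"
      proof (rule has_derivative_transform_within_open)
        show "open (- ?K)" "x \<in> - ?K" using that by auto
        show "0 = f y" if "y \<in> - ?K" for y using that closure_subset[of "{x. f x \<noteq> 0}"] by auto
      qed
      then show ?thesis using partial_eq by fastforce
    qed
  qed
qed

lemma test_functions_partial: "f \<in> test_functions U \<Longrightarrow> partial i f \<in> test_functions U"
proof -
  assume f: "f \<in> test_functions U"
  obtain K where K: "compact K" "K \<subseteq> U" "\<And>x. x \<notin> K \<Longrightarrow> f x = 0" "\<And>x i. x \<notin> K \<Longrightarrow> partial i f x = 0"
    using test_functions_support[OF f] by metis
  have "cont_diff m (partial i f)" for m using test_functionsD(1)[OF f, of "Suc m"] by simp
  then show ?thesis by (rule test_functionsI[OF _ K(1,2)]) (use K(4) in blast)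
qed

lemma test_functions_mono: "f \<in> test_functions U \<Longrightarrow> U \<subseteq> U' \<Longrightarrow> f \<in> test_functions U'"
  by (auto simp: test_functions_def)

lemma test_functions_mult:
  assumes f: "f \<in> test_functions U" and g: "\<And>m. cont_diff m g"
  shows "(\<lambda>x. g x * f x) \<in> test_functions U"
proof -
  obtain K where K: "compact K" "K \<subseteq> U" "\<And>x. x \<notin> K \<Longrightarrow> f x = 0"
    using test_functions_support[OF f] by metis
  show ?thesis by (rule test_functionsI[OF cont_diff_mult[OF g test_functionsD(1)[OF f]] K(1,2)]) (use K(3) in auto)
qed

lemma test_functions_add:
  assumes f: "f \<in> test_functions U" and g: "g \<in> test_functions U"
  shows "(\<lambda>x. f x + g x) \<in> test_functions U"
proof -
  obtain K where K: "compact K" "K \<subseteq> U" "\<And>x. x \<notin> K \<Longrightarrow> f x = 0"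
    using test_functions_support[OF f] by metis
  obtain K' where K': "compact K'" "K' \<subseteq> U" "\<And>x. x \<notin> K' \<Longrightarrow> g x = 0"
    using test_functions_support[OF g] by metis
  show ?thesis
    by (rule test_functionsI[OF cont_diff_add[OF test_functionsD(1)[OF f] test_functionsD(1)[OF g]], of "K \<union> K'"])
       (use K K' in fastforce)+
qed

lemma test_functions_bounded:
  assumes "f \<in> test_functions U"
  obtains B where "B \<ge> 0" "\<And>x. \<bar>f x\<bar> \<le> B"
proof -
  obtain K where K: "compact K" "K \<subseteq> U" "\<And>x. x \<notin> K \<Longrightarrow> f x = 0"
    using test_functions_support[OF assms] by metis
  have "compact (f ` K)" using K test_functionsD(3)[OF assms] compact_continuous_image by blast
  then obtain B where B: "\<And>y. y \<in> f ` K \<Longrightarrow> norm y \<le> B"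
    using compact_imp_bounded bounded_iff by metis
  have "\<bar>f x\<bar> \<le> max B 0" for x using B[of "f x"] K(3)[of x] by (cases "x \<in> K") (auto simp: le_max_iff_disj)
  then show thesis using that[of "max B 0"] by auto
qed

lemma test_functions_lipschitz:
  assumes "f \<in> test_functions U"
  obtains L where "L \<ge> 0" "\<And>x y. \<bar>f x - f y\<bar> \<le> L * norm (x - y)"
proof -
  have "\<exists>B. \<forall>x. \<bar>partial i f x\<bar> \<le> B" for i
    using test_functions_bounded[OF test_functions_partial[OF assms], of i] by metis
  then have "\<exists>B. \<forall>i. \<forall>x. \<bar>partial i f x\<bar> \<le> B i" by metis
  then obtain B where B: "\<And>i x. \<bar>partial i f x\<bar> \<le> B i" by blast
  have B0: "(\<Sum>i\<in>UNIV. B i) \<ge> 0" using B by (intro sum_nonneg) (meson abs_ge_zero order_trans)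
  have "norm (f x - f y) \<le> (\<Sum>i\<in>UNIV. B i) * norm (x - y)" for x y
  proof (rule differentiable_bound[of UNIV])
    show "(f has_derivative (\<lambda>h. (\<chi> i. partial i f x) \<bullet> h)) (at x within UNIV)" for x
      using test_functionsD(5)[OF assms] by simp
    show "onorm (\<lambda>h. (\<chi> i. partial i f x) \<bullet> h) \<le> (\<Sum>i\<in>UNIV. B i)" for x
    proof (rule onorm_bound[OF B0])
      fix h
      have "norm ((\<chi> i. partial i f x) \<bullet> h) \<le> norm (\<chi> i. partial i f x) * norm h"
        using Cauchy_Schwarz_ineq2 by auto
      also have "norm (\<chi> i. partial i f x) \<le> (\<Sum>i\<in>UNIV. B i)"
        by (rule order_trans[OF norm_le_l1_cart]) (auto intro!: sum_mono B)
      finally show "norm ((\<chi> i. partial i f x) \<bullet> h) \<le> (\<Sum>i\<in>UNIV. B i) * norm h" by (simp add: mult_right_mono)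
    qed
  qed auto
  then show thesis using that B0 by auto
qed

text \<open>Positive exactly on the open box, and convergent to its indicator function as n
  grows.\<close>

definition box_bump :: "nat \<Rightarrow> real^'d \<Rightarrow> real^'d \<Rightarrow> real^'d \<Rightarrow> real" where
  "box_bump n a b x = (\<Prod>i\<in>UNIV. bump1 (real (Suc n) * (x $ i - a $ i)) * bump1 (real (Suc n) * (b $ i - x $ i)))"

lemma box_bump_bounds: "0 \<le> box_bump n a b x" "box_bump n a b x \<le> 1"
  unfolding box_bump_def
  by (auto intro!: prod_nonneg prod_le_1 mult_nonneg_nonneg mult_le_one bump1_bounds)

lemma box_bump_eq_0: "box_bump n a b x = 0 \<longleftrightarrow> x \<notin> box a b"
  by (auto simp: box_bump_def mem_box_cart bump1_bounds mult_le_0_iff not_less)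

lemma box_bump_test:
  assumes "cbox a b \<subseteq> U"
  shows "box_bump n a b \<in> test_functions U"
proof (rule test_functionsI[OF _ compact_cbox assms])
  fix m
  have e: "real (Suc n) * (x $ i - a $ i) = real (Suc n) * x $ i + - (real (Suc n) * a $ i)"
    "real (Suc n) * (b $ i - x $ i) = - real (Suc n) * x $ i + real (Suc n) * b $ i" for x and i
    by (auto simp: algebra_simps)
  show "cont_diff m (box_bump n a b)"
    unfolding box_bump_def[abs_def] e by (intro cont_diff_prod cont_diff_mult cont_diff_flat)
qed (use box_bump_eq_0 box_subset_cbox in blast)

lemma box_bump_tendsto:
  fixes x :: "real^'a"
  shows "(\<lambda>n. box_bump n a b x) \<longlonglongrightarrow> indicator (box a b) x"
proof (cases "x \<in> box a b")
  case True
  have "(\<lambda>n. box_bump n a b x) \<longlonglongrightarrow> (\<Prod>i\<in>(UNIV :: 'a set). 1 * 1)"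
    unfolding box_bump_def using True
    by (intro tendsto_prod tendsto_mult bump1_tendsto) (auto simp: mem_box_cart)
  then show ?thesis using True by simp
next
  case False
  then have "box_bump n a b x = 0" for n using box_bump_eq_0 by blast
  then show ?thesis using False by simp
qed

section \<open>Affine substitutions in Lebesgue integrals\<close>

lemma lebesgue_affine_map:
  fixes t :: "real^'d::finite" and r :: real
  assumes "r \<noteq> 0"
  shows lebesgue_affine_eq: "lebesgue = density (distr lebesgue lebesgue (\<lambda>x. t + r *\<^sub>R x)) (\<lambda>_. ennreal (\<bar>r\<bar> ^ CARD('d)))"
    and measurable_affine: "(\<lambda>x. t + r *\<^sub>R x) \<in> lebesgue \<rightarrow>\<^sub>M lebesgue"
proof -
  have e: "(\<lambda>x::real^'d. t + (\<Sum>j\<in>Basis. (r * (x \<bullet> j)) *\<^sub>R j)) = (\<lambda>x. t + r *\<^sub>R x)"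
    by (simp add: scaleR_scaleR[symmetric] scaleR_sum_right[symmetric] euclidean_representation del: scaleR_scaleR)
  show "lebesgue = density (distr lebesgue lebesgue (\<lambda>x. t + r *\<^sub>R x)) (\<lambda>_. ennreal (\<bar>r\<bar> ^ CARD('d)))"
    using lebesgue_affine_euclidean[of "\<lambda>_. r" t] assms unfolding e by simp
  show "(\<lambda>x. t + r *\<^sub>R x) \<in> lebesgue \<rightarrow>\<^sub>M lebesgue"
    using lebesgue_affine_measurable[of "\<lambda>_. r" t] assms unfolding e by simp
qed

lemma integrable_scaleR_iff:
  fixes f :: "'a \<Rightarrow> 'b::{banach, second_countable_topology}"
  assumes "c \<noteq> 0"
  shows "integrable M (\<lambda>x. c *\<^sub>R f x) \<longleftrightarrow> integrable M f"
  using integrable_scaleR_right[of "inverse c" M "\<lambda>x. c *\<^sub>R f x"] integrable_scaleR_right[of c M f] assms by auto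

lemma lebesgue_integral_affine:
  fixes f :: "real^'d::finite \<Rightarrow> 'b::{banach, second_countable_topology}"
  assumes r: "r \<noteq> 0" and f: "f \<in> borel_measurable lebesgue"
  shows "integral\<^sup>L lebesgue f = \<bar>r\<bar> ^ CARD('d) *\<^sub>R integral\<^sup>L lebesgue (\<lambda>x. f (t + r *\<^sub>R x))"
    and "integrable lebesgue f \<longleftrightarrow> integrable lebesgue (\<lambda>x. f (t + r *\<^sub>R x))"
proof -
  note [measurable] = measurable_affine[OF r, of t] f
  show "integral\<^sup>L lebesgue f = \<bar>r\<bar> ^ CARD('d) *\<^sub>R integral\<^sup>L lebesgue (\<lambda>x. f (t + r *\<^sub>R x))"
    by (subst lebesgue_affine_eq[OF r, of t]) (simp add: integral_density integral_distr)
  show "integrable lebesgue f \<longleftrightarrow> integrable lebesgue (\<lambda>x. f (t + r *\<^sub>R x))"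
    by (subst lebesgue_affine_eq[OF r, of t]) (use r in \<open>simp add: integrable_density integrable_distr_eq integrable_scaleR_iff\<close>)
qed

lemma AE_lebesgue_affine:
  assumes r: "r \<noteq> 0" and "AE x in lebesgue. P x"
  shows "AE x in lebesgue. P (t + r *\<^sub>R (x :: real^'d::finite))"
proof -
  have "AE x in distr lebesgue lebesgue (\<lambda>x. t + r *\<^sub>R x). 0 < ennreal (\<bar>r\<bar> ^ CARD('d)) \<longrightarrow> P x"
    using assms(2) by (subst (asm) lebesgue_affine_eq[OF r, of t]) (simp add: AE_density)
  then have "AE x in distr lebesgue lebesgue (\<lambda>x. t + r *\<^sub>R x). P x" using r by simp
  then show ?thesis by (rule AE_distrD[OF measurable_affine[OF r]])
qed

lemma measurable_reflect:
  fixes f :: "real^'d::finite \<Rightarrow> 'b::topological_space"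
  assumes "f \<in> borel_measurable lebesgue"
  shows "(\<lambda>y. f (x - y)) \<in> borel_measurable lebesgue"
  using measurable_compose[OF measurable_affine[of "-1" x] assms] by simp

lemma lebesgue_integral_reflect:
  fixes f :: "real^'d::finite \<Rightarrow> 'b::{banach, second_countable_topology}"
  assumes "f \<in> borel_measurable lebesgue"
  shows "integral\<^sup>L lebesgue (\<lambda>y. f (x - y)) = integral\<^sup>L lebesgue f"
    and "integrable lebesgue (\<lambda>y. f (x - y)) \<longleftrightarrow> integrable lebesgue f"
  using lebesgue_integral_affine[OF _ assms, of "-1" x] by simp_all

lemma AE_reflect: "AE y in lebesgue. P y \<Longrightarrow> AE y in lebesgue. P (x - (y :: real^'d::finite))"
  using AE_lebesgue_affine[of "-1" P x] by simp

lemma lebesgue_integral_translate: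
  fixes f :: "real^'d::finite \<Rightarrow> 'b::{banach, second_countable_topology}"
  assumes "f \<in> borel_measurable lebesgue"
  shows "integral\<^sup>L lebesgue (\<lambda>y. f (y + x)) = integral\<^sup>L lebesgue f"
    and "integrable lebesgue (\<lambda>y. f (y + x)) \<longleftrightarrow> integrable lebesgue f"
  using lebesgue_integral_affine[OF _ assms, of 1 x] by (simp_all add: add.commute)

lemma continuous_lebesgue_measurable:
  fixes f :: "real^'d::finite \<Rightarrow> 'b::topological_space"
  assumes "continuous_on UNIV f"
  shows "f \<in> borel_measurable lebesgue"
  using borel_measurable_continuous_onI[OF assms] by (simp add: measurable_completion)

lemma borel_lebesgue: "f \<in> borel_measurable borel \<Longrightarrow> f \<in> borel_measurable lebesgue"
  by (simp add: measurable_completion)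

section \<open>Convolution with a Lipschitz function\<close>

lemma lipschitz_derivative_bound:
  fixes f :: "'a::real_normed_vector \<Rightarrow> real"
  assumes d: "(f has_derivative f') (at x)" and L: "\<And>x y. \<bar>f x - f y\<bar> \<le> L * norm (x - y)"
  shows "\<bar>f' h\<bar> \<le> L * norm h"
proof -
  interpret bounded_linear f' using d has_derivative_bounded_linear by blast
  have "((\<lambda>t. x + t *\<^sub>R h) has_derivative (\<lambda>t. t *\<^sub>R h)) (at 0)"
    by (auto intro!: derivative_eq_intros)
  then have "((\<lambda>t::real. f (x + t *\<^sub>R h)) has_derivative (\<lambda>t. f' (t *\<^sub>R h))) (at 0)"
    using has_derivative_compose[of "\<lambda>t. x + t *\<^sub>R h" _ 0 UNIV f f'] d by simp
  then have "((\<lambda>t::real. f (x + t *\<^sub>R h)) has_real_derivative f' h) (at 0)"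
    by (simp add: has_field_derivative_def scaleR mult.commute[of _ "f' h"])
  then have "((\<lambda>t. (f (x + t *\<^sub>R h) - f x) / t) \<longlongrightarrow> f' h) (at 0)" by (simp add: DERIV_def)
  then have "((\<lambda>t. \<bar>(f (x + t *\<^sub>R h) - f x) / t\<bar>) \<longlongrightarrow> \<bar>f' h\<bar>) (at 0)" by (rule tendsto_rabs)
  then show ?thesis
  proof (rule tendsto_upperbound)
    show "\<forall>\<^sub>F t in at 0. \<bar>(f (x + t *\<^sub>R h) - f x) / t\<bar> \<le> L * norm h"
    proof (rule eventually_at_filter[THEN iffD2, OF always_eventually], intro allI impI)
      fix t :: real assume "t \<noteq> 0"
      then show "\<bar>(f (x + t *\<^sub>R h) - f x) / t\<bar> \<le> L * norm h"
        using L[of "x + t *\<^sub>R h" x] by (simp add: field_simps)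
    qed
  qed auto
qed

lemma lipschitz_gradient_bound:
  fixes f :: "real^'d::finite \<Rightarrow> real"
  assumes "(f has_derivative (\<lambda>h. g \<bullet> h)) (at x)" "\<And>x y. \<bar>f x - f y\<bar> \<le> L * norm (x - y)"
  shows "norm g \<le> L"
proof (cases "g = 0")
  case True
  have "\<bar>f (axis undefined 1) - f 0\<bar> \<le> L" using assms(2)[of "axis undefined 1" 0] by simp
  then have "0 \<le> L" by linarith
  then show ?thesis using True by simp
next
  case False
  then show ?thesis using lipschitz_derivative_bound[OF assms, of g]
    by (simp add: power2_norm_eq_inner[symmetric] power2_eq_square)
qed

lemma lipschitz_continuous:
  fixes f :: "'a::real_normed_vector \<Rightarrow> real"
  assumes "\<And>x y. \<bar>f x - f y\<bar> \<le> L * norm (x - y)"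
  shows "continuous_on UNIV f"
proof -
  have "\<bar>f x - f y\<bar> \<le> \<bar>L\<bar> * norm (x - y)" for x y
    using assms[of x y] mult_right_mono[OF abs_ge_self[of L] norm_ge_zero[of "x - y"]] by linarith
  then have "(\<bar>L\<bar>)-lipschitz_on UNIV f" by (intro lipschitz_onI) (auto simp: dist_norm)
  then show ?thesis by (rule lipschitz_on_continuous_on)
qed

text \<open>The remainder is kept without a norm around it, so that it can be written as an integral
  and treated by dominated convergence.\<close>

lemma has_derivative_at_scaled:
  "(f has_derivative D) (at x) \<longleftrightarrow>
    bounded_linear D \<and> ((\<lambda>h. (f (x + h) - f x - D h) /\<^sub>R norm h) \<longlongrightarrow> 0) (at 0)"
proof -
  have "norm (f (x + h) - f x - D h) / norm h = norm ((f (x + h) - f x - D h) /\<^sub>R norm h)" for h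
    by (simp add: divide_inverse mult.commute)
  then show ?thesis
    unfolding has_derivative_at using tendsto_norm_zero_iff[of "\<lambda>h. (f (x + h) - f x - D h) /\<^sub>R norm h" "at 0"] by presburger
qed

text \<open>This serves both orders of a convolution: \<open>f\<close> is either the smooth kernel or the
  Lipschitz function that is mollified.\<close>

lemma convolution_has_derivative:
  fixes f g :: "real^'d::finite \<Rightarrow> real" and D :: "real^'d \<Rightarrow> real^'d"
  assumes L: "\<And>x y. \<bar>f x - f y\<bar> \<le> L * norm (x - y)" and B: "\<And>x. \<bar>f x\<bar> \<le> B"
    and d: "AE y in lebesgue. (f has_derivative (\<lambda>h. D y \<bullet> h)) (at y)"
    and D: "D \<in> borel_measurable borel" and g: "integrable lebesgue g"
  shows "integrable lebesgue (\<lambda>y. f (x - y) * g y)"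
    and "integrable lebesgue (\<lambda>y. g y *\<^sub>R D (x - y))"
    and "((\<lambda>x. LINT y|lebesgue. f (x - y) * g y) has_derivative (\<lambda>h. (LINT y|lebesgue. g y *\<^sub>R D (x - y)) \<bullet> h)) (at x)"
proof -
  have fm: "(\<lambda>y. f (x - y)) \<in> borel_measurable lebesgue" for x
    by (intro measurable_reflect continuous_lebesgue_measurable lipschitz_continuous[OF L])
  have Dm: "(\<lambda>y. D (x - y)) \<in> borel_measurable lebesgue" for x
    by (intro measurable_reflect borel_lebesgue D)
  have gm: "g \<in> borel_measurable lebesgue" using g by auto
  show fi: "integrable lebesgue (\<lambda>y. f (x - y) * g y)" for x
    by (rule Bochner_Integration.integrable_bound[of _ "\<lambda>y. B * g y"])
       (use g fm gm B in \<open>auto simp: abs_mult intro!: mult_right_mono order_trans[OF B] intro: abs_ge_self\<close>)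
  have d': "AE y in lebesgue. (f has_derivative (\<lambda>h. D (x - y) \<bullet> h)) (at (x - y))" for x
    using AE_reflect[OF d, of x] by simp
  have Db: "AE y in lebesgue. norm (D (x - y)) \<le> L" for x
    using d'[of x] by (rule AE_mp) (auto intro!: AE_I2 lipschitz_gradient_bound L)
  show Di: "integrable lebesgue (\<lambda>y. g y *\<^sub>R D (x - y))" for x
  proof (rule Bochner_Integration.integrable_bound[of _ "\<lambda>y. L * g y"])
    show "AE y in lebesgue. norm (g y *\<^sub>R D (x - y)) \<le> norm (L * g y)"
      using Db[of x] by (rule AE_mp)
        (auto intro!: AE_I2 mult_left_mono intro: order_trans[OF _ abs_ge_self] simp: abs_mult mult.commute[of "\<bar>L\<bar>"])
  qed (use g Dm gm in auto)
  define F where "F = (\<lambda>x. LINT y|lebesgue. f (x - y) * g y)"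
  define E where "E = (LINT y|lebesgue. g y *\<^sub>R D (x - y))"
  have "((\<lambda>h. (F (x + h) - F x - E \<bullet> h) /\<^sub>R norm h) \<longlongrightarrow> 0) (at 0)"
    unfolding tendsto_at_iff_sequentially o_def
  proof (intro allI impI)
    fix h :: "nat \<Rightarrow> real^'d" assume h: "\<forall>i. h i \<in> UNIV - {0}" "h \<longlonglongrightarrow> 0"
    \<comment> \<open>The integrand of the scaled remainder of the differential. The difference
      quotient of f and the gradient D are both bounded by L, which gives the majorant
      \<open>2 * L * \<bar>g y\<bar>\<close>; the limit is 0 wherever f is differentiable at
      \<open>x - y\<close>.\<close>
    define s where "s = (\<lambda>n y. ((f (x + h n - y) - f (x - y) - D (x - y) \<bullet> h n) / norm (h n)) * g y)"
    have eq: "(F (x + h n) - F x - E \<bullet> h n) /\<^sub>R norm (h n) = (LINT y|lebesgue. s n y)" for n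
    proof -
      have i: "integrable lebesgue (\<lambda>y. (g y *\<^sub>R D (x - y)) \<bullet> h n)"
        by (intro integrable_inner_left Di)
      have "E \<bullet> h n = (LINT y|lebesgue. (g y *\<^sub>R D (x - y)) \<bullet> h n)"
        unfolding E_def by (rule integral_inner_left[symmetric]) (rule Di)
      moreover have "(LINT y|lebesgue. f (x + h n - y) * g y) - (LINT y|lebesgue. f (x - y) * g y) -
          (LINT y|lebesgue. (g y *\<^sub>R D (x - y)) \<bullet> h n) =
          (LINT y|lebesgue. f (x + h n - y) * g y - f (x - y) * g y - (g y *\<^sub>R D (x - y)) \<bullet> h n)"
        by (subst Bochner_Integration.integral_diff[OF Bochner_Integration.integrable_diff[OF fi fi] i])
           (simp add: Bochner_Integration.integral_diff[OF fi fi])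
      ultimately have "F (x + h n) - F x - E \<bullet> h n =
          (LINT y|lebesgue. f (x + h n - y) * g y - f (x - y) * g y - (g y *\<^sub>R D (x - y)) \<bullet> h n)"
        by (simp add: F_def)
      then have "(F (x + h n) - F x - E \<bullet> h n) / norm (h n) =
          (LINT y|lebesgue. (f (x + h n - y) * g y - f (x - y) * g y - (g y *\<^sub>R D (x - y)) \<bullet> h n) / norm (h n))"
        by simp
      also have "\<dots> = (LINT y|lebesgue. s n y)"
        by (intro Bochner_Integration.integral_cong) (auto simp: s_def field_simps)
      finally show ?thesis by (simp add: divide_inverse_commute)
    qed
    have "(\<lambda>n. LINT y|lebesgue. s n y) \<longlonglongrightarrow> (LINT y|(lebesgue :: (real^'d) measure). 0)"
    proof (rule integral_dominated_convergence[where w = "\<lambda>y. 2 * L * \<bar>g y\<bar>"])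
      show "s n \<in> borel_measurable lebesgue" for n
        unfolding s_def using fm[of "x + h n"] fm[of x] Dm[of x] gm by simp
      show "AE y in lebesgue. (\<lambda>n. s n y) \<longlonglongrightarrow> 0"
        using d'[of x]
      proof (rule AE_mp, intro AE_I2 impI)
        fix y assume "(f has_derivative (\<lambda>h. D (x - y) \<bullet> h)) (at (x - y))"
        then have "((\<lambda>h. (f (x - y + h) - f (x - y) - D (x - y) \<bullet> h) /\<^sub>R norm h) \<longlongrightarrow> 0) (at 0)"
          unfolding has_derivative_at_scaled by blast
        then have "(\<lambda>n. (f (x - y + h n) - f (x - y) - D (x - y) \<bullet> h n) /\<^sub>R norm (h n)) \<longlonglongrightarrow> 0"
          using h unfolding tendsto_at_iff_sequentially o_def by blast
        then have "(\<lambda>n. ((f (x - y + h n) - f (x - y) - D (x - y) \<bullet> h n) /\<^sub>R norm (h n)) * g y) \<longlonglongrightarrow> 0"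
          by (rule tendsto_mult_left_zero)
        then show "(\<lambda>n. s n y) \<longlonglongrightarrow> 0"
          by (simp add: s_def divide_inverse_commute algebra_simps)
      qed
      show "AE y in lebesgue. norm (s n y) \<le> 2 * L * \<bar>g y\<bar>" for n
        using Db[of x]
      proof (rule AE_mp, intro AE_I2 impI)
        fix y assume "norm (D (x - y)) \<le> L"
        then have "\<bar>D (x - y) \<bullet> h n\<bar> \<le> L * norm (h n)"
          by (meson Cauchy_Schwarz_ineq2 mult_right_mono norm_ge_zero order_trans)
        moreover have "\<bar>f (x + h n - y) - f (x - y)\<bar> \<le> L * norm (h n)"
          using L[of "x + h n - y" "x - y"] by simp
        ultimately have "\<bar>f (x + h n - y) - f (x - y) - D (x - y) \<bullet> h n\<bar> \<le> 2 * L * norm (h n)" by linarith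
        then have le: "\<bar>(f (x + h n - y) - f (x - y) - D (x - y) \<bullet> h n) / norm (h n)\<bar> \<le> 2 * L"
          using h by (simp add: divide_le_eq)
        show "norm (s n y) \<le> 2 * L * \<bar>g y\<bar>"
          using mult_right_mono[OF le abs_ge_zero[of "g y"]] unfolding s_def by (simp add: abs_mult)
      qed
    qed (use g in auto)
    then show "(\<lambda>n. (F (x + h n) - F x - E \<bullet> h n) /\<^sub>R norm (h n)) \<longlonglongrightarrow> 0"
      unfolding eq by simp
  qed
  then have "(F has_derivative (\<lambda>h. E \<bullet> h)) (at x)"
    unfolding has_derivative_at_scaled by (simp add: bounded_linear_inner_right)
  then show "((\<lambda>x. LINT y|lebesgue. f (x - y) * g y) has_derivative (\<lambda>h. (LINT y|lebesgue. g y *\<^sub>R D (x - y)) \<bullet> h)) (at x)"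
    unfolding F_def E_def .
qed

lemma bounded_support_integrable:
  fixes f :: "real^'d::finite \<Rightarrow> 'b::{banach, second_countable_topology}"
  assumes "f \<in> borel_measurable lebesgue" "bounded K" "\<And>x. x \<notin> K \<Longrightarrow> f x = 0" "AE x in lebesgue. norm (f x) \<le> B"
  shows "integrable lebesgue f"
proof -
  obtain a b where ab: "K \<subseteq> cbox a b" using bounded_subset_cbox_symmetric[OF assms(2)] by blast
  have "integrable lebesgue (\<lambda>x. indicat_real (cbox a b) x *\<^sub>R B)"
    using lmeasurable_iff_integrable[of "cbox a b"] by (intro integrable_scaleR_left) auto
  then show ?thesis
  proof (rule Bochner_Integration.integrable_bound)
    show "AE x in lebesgue. norm (f x) \<le> norm (indicat_real (cbox a b) x *\<^sub>R B)"
      using assms(4) by (rule AE_mp) (use assms(3) ab in \<open>auto intro!: AE_I2 split: split_indicator\<close>)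
  qed (use assms in auto)
qed

text \<open>The convolution of \<open>f\<close> with the indicator function of a large ball is constant near the origin,
  so its gradient vanishes there.\<close>

lemma integral_gradient_zero:
  fixes f :: "real^'d::finite \<Rightarrow> real" and D :: "real^'d \<Rightarrow> real^'d"
  assumes L: "\<And>x y. \<bar>f x - f y\<bar> \<le> L * norm (x - y)" and K: "bounded K" "\<And>x. x \<notin> K \<Longrightarrow> f x = 0"
    and d: "AE y in lebesgue. (f has_derivative (\<lambda>h. D y \<bullet> h)) (at y)"
    and D: "D \<in> borel_measurable borel" "\<And>x. x \<notin> K \<Longrightarrow> D x = 0"
  shows "(LINT y|lebesgue. D y \<bullet> e) = 0"
proof -
  have fm: "f \<in> borel_measurable lebesgue"
    by (intro continuous_lebesgue_measurable lipschitz_continuous[OF L])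
  have "compact (closure K)" using K(1) by (simp add: compact_closure)
  then have "compact (f ` closure K)" using lipschitz_continuous[OF L] compact_continuous_image continuous_on_subset by blast
  then obtain B where "\<forall>y\<in>f ` closure K. norm y \<le> B" using compact_imp_bounded bounded_iff by metis
  then have B: "\<bar>f x\<bar> \<le> max B 0" for x
    using K(2)[of x] closure_subset[of K] by (cases "x \<in> K") (auto simp: le_max_iff_disj)
  obtain R where R: "\<And>x. x \<in> K \<Longrightarrow> norm x \<le> R" using K(1) bounded_iff by metis
  \<comment> \<open>K lies in the ball of radius R. For x in the unit ball, every y with
    \<open>x - y \<in> K\<close> has norm at most R + 1, so near the origin nothing is cut off and
    the convolution is the full integral of f.\<close>
  define g where "g = indicat_real (cball 0 (R + 1) :: (real^'d) set)"
  have g: "integrable lebesgue g" unfolding g_def using lmeasurable_iff_integrable[of "cball 0 (R + 1)"] by simp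
  have g1: "g y = 1" if "norm x \<le> 1" "x - y \<in> K" for x y
    using R[OF that(2)] that(1) norm_triangle_ineq4[of x "x - y"] by (simp add: g_def)
  note conv = convolution_has_derivative[OF L B d D(1) g, of 0]
  let ?E = "LINT y|lebesgue. g y *\<^sub>R D (0 - y)"
  have "((\<lambda>x. LINT y|lebesgue. f (x - y) * g y) has_derivative (\<lambda>h. 0)) (at 0)"
  proof (rule has_derivative_transform_within_open[OF has_derivative_const open_ball])
    show "0 \<in> ball (0 :: real^'d) 1" by simp
    fix x :: "real^'d" assume "x \<in> ball 0 1"
    then have "f (x - y) * g y = f (x - y)" for y using g1[of x y] K(2)[of "x - y"] by (cases "x - y \<in> K") auto
    then show "integral\<^sup>L lebesgue f = (LINT y|lebesgue. f (x - y) * g y)"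
      by (simp only: lebesgue_integral_reflect(1)[OF fm])
  qed
  from has_derivative_unique[OF conv(3) this] have "?E \<bullet> e = 0" by metis
  moreover have "g y *\<^sub>R D (0 - y) = D (0 - y)" for y
    using g1[of 0 y] D(2)[of "0 - y"] by (cases "0 - y \<in> K") auto
  ultimately have "(LINT y|lebesgue. D (0 - y) \<bullet> e) = 0"
    using integral_inner_left[OF conv(2), of e] by simp
  moreover have "(\<lambda>y. D y \<bullet> e) \<in> borel_measurable lebesgue" using borel_lebesgue[OF D(1)] by simp
  ultimately show ?thesis using lebesgue_integral_reflect(1)[of "\<lambda>y. D y \<bullet> e" 0] by simp
qed

section \<open>Functions orthogonal to all test functions\<close>

lemma integrable_indicator_lebesgue_on:
  fixes f :: "real^'d::finite \<Rightarrow> 'b::{banach, second_countable_topology}"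
  assumes "S \<in> sets lebesgue"
  shows "integral\<^sup>L (lebesgue_on S) f = integral\<^sup>L lebesgue (\<lambda>x. indicator S x *\<^sub>R f x)"
    "integrable (lebesgue_on S) f \<longleftrightarrow> integrable lebesgue (\<lambda>x. indicator S x *\<^sub>R f x)"
  using assms by (simp_all add: integral_restrict_space integrable_restrict_space)

lemma AE_lebesgue_on: "S \<in> sets lebesgue \<Longrightarrow> (AE x in lebesgue_on S. P x) \<longleftrightarrow> (AE x in lebesgue. x \<in> S \<longrightarrow> P x)"
  by (simp add: AE_restrict_space_iff)

lemma compact_sets_lebesgue: "compact (S :: (real^'d::finite) set) \<Longrightarrow> S \<in> sets lebesgue"
  by (auto intro: lmeasurable_compact fmeasurableD)

text \<open>Boxes are an intersection-stable generator of the Borel sets, so a Dynkin argument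
  extends the vanishing of the integral to all Borel sets. The step to complements needs the
  integral over the whole space, which is the limit along growing cubes.\<close>

lemma zero_integral_boxes_imp_AE_zero:
  fixes f :: "real^'d::finite \<Rightarrow> real"
  assumes f: "integrable lebesgue f" and z: "\<And>a b. (LINT x|lebesgue. indicator (box a b) x * f x) = 0"
  shows "AE x in lebesgue. f x = 0"
proof -
  obtain g where g: "g \<in> borel_measurable lborel" "AE x in lborel. f x = g x"
    using completion_ex_borel_measurable_real[of f lborel] f by blast
  have fg: "AE x in lebesgue. f x = g x" using g(2) by (rule AE_completion)
  have gi': "integrable lebesgue g"
    using f fg g(1) by (subst integrable_cong_AE[of g lebesgue f]) (auto simp: measurable_completion)
  then have gi: "integrable lborel g" using integrable_completion[OF g(1)] by simp
  have gb: "set_lebesgue_integral lborel (box a b) g = 0" for a b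
  proof -
    have "set_lebesgue_integral lborel (box a b) g = (LINT x|lebesgue. indicator (box a b) x * g x)"
      unfolding set_lebesgue_integral_def using g(1) by (subst integral_completion[symmetric]) auto
    also have "\<dots> = (LINT x|lebesgue. indicator (box a b) x * f x)"
      by (rule integral_cong_AE)
         (use fg f gi' in \<open>auto intro!: borel_measurable_times borel_measurable_indicator elim!: AE_mp\<close>)
    finally show ?thesis using z by simp
  qed
  have gS: "set_integrable lborel A g" if "A \<in> sets borel" for A
    unfolding set_integrable_def using that gi by (intro integrable_mult_indicator) auto
  have tot: "integral\<^sup>L lborel g = 0"
  proof -
    let ?B = "\<lambda>n. box (\<chi> i. - real n) (\<chi> i. real n) :: (real^'d) set"
    have "(\<lambda>n. set_lebesgue_integral lborel (?B n) g) \<longlonglongrightarrow> integral\<^sup>L lborel g"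
      unfolding set_lebesgue_integral_def
    proof (rule integral_dominated_convergence[where w = "\<lambda>x. \<bar>g x\<bar>"])
      show "AE x in lborel. (\<lambda>n. indicat_real (?B n) x *\<^sub>R g x) \<longlonglongrightarrow> g x"
      proof (intro AE_I2)
        fix x :: "real^'d"
        obtain N :: nat where N: "norm x < real N" using reals_Archimedean2 by blast
        have "x \<in> ?B n" if "n \<ge> N" for n
        proof -
          have "\<bar>x $ i\<bar> < real n" for i using component_le_norm_cart[of x i] N that by linarith
          then show ?thesis by (auto simp: mem_box_cart abs_less_iff minus_less_iff)
        qed
        then have "eventually (\<lambda>n. indicat_real (?B n) x *\<^sub>R g x = g x) sequentially"
          unfolding eventually_sequentially by (intro exI[of _ N]) auto
        then show "(\<lambda>n. indicat_real (?B n) x *\<^sub>R g x) \<longlonglongrightarrow> g x"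
          by (rule tendsto_eventually)
      qed
    qed (use gi g(1) in \<open>auto split: split_indicator\<close>)
    then show ?thesis unfolding gb by (simp add: LIMSEQ_const_iff)
  qed
  have "set_lebesgue_integral lborel A g = 0" if A: "A \<in> sets borel" for A
  proof -
    have "Int_stable (range (\<lambda>(a, b). box a b :: (real^'d) set))"
      by (auto simp: Int_stable_def box_Int_box)
    moreover have "(range (\<lambda>(a, b). box a b :: (real^'d) set)) \<subseteq> Pow UNIV" by auto
    moreover have "A \<in> sigma_sets UNIV (range (\<lambda>(a, b). box a b))"
      using A unfolding borel_eq_box by simp
    ultimately show ?thesis
    proof (induction rule: sigma_sets_induct_disjoint)
      case (basic A)
      then show ?case using gb by auto
    next
      case empty
      then show ?case by (simp add: set_lebesgue_integral_def)
    next
      case (compl A)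
      then have [measurable]: "A \<in> sets borel" by (simp add: borel_eq_box)
      have "set_lebesgue_integral lborel (A \<union> (UNIV - A)) g =
          set_lebesgue_integral lborel A g + set_lebesgue_integral lborel (UNIV - A) g"
        by (rule set_integral_Un) (auto intro!: gS)
      then show ?case using compl tot by (simp add: set_lebesgue_integral_def)
    next
      case (union F)
      then have [measurable]: "\<And>i. F i \<in> sets borel" by (simp add: borel_eq_box subset_eq)
      have "set_lebesgue_integral lborel (\<Union>i. F i) g = (\<Sum>i. set_lebesgue_integral lborel (F i) g)"
        by (rule lebesgue_integral_countable_add) (use union(1) in \<open>auto intro!: gS simp: disjoint_family_on_def\<close>)
      then show ?case using union by simp
    qed
  qed
  then have "AE x in lborel. g x = 0" using sigma_finite_measure.density_zero[OF sigma_finite_lborel gi] by simp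
  then have "AE x in lebesgue. g x = 0" by (rule AE_completion)
  with fg show ?thesis by eventually_elim simp
qed

text \<open>Smooth approximations of the indicator functions of boxes serve as test functions.\<close>

lemma test_orthogonal_imp_AE_zero:
  fixes h :: "real^'d::finite \<Rightarrow> real"
  assumes U: "open U" and h: "\<And>a b. cbox a b \<subseteq> U \<Longrightarrow> integrable (lebesgue_on (cbox a b)) h"
    and z: "\<And>\<phi>. \<phi> \<in> test_functions U \<Longrightarrow> (LINT x|lebesgue_on U. h x * \<phi> x) = 0"
  shows "AE x in lebesgue_on U. h x = 0"
proof -
  have Um: "U \<in> sets lebesgue" using U by auto
  have box: "(LINT x|lebesgue. indicator (box a b) x * h x) = 0" if ab: "cbox a b \<subseteq> U" for a b
  proof -
    have hi: "integrable lebesgue (\<lambda>x. indicat_real (cbox a b) x *\<^sub>R h x)"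
      using h[OF ab] by (simp add: integrable_indicator_lebesgue_on)
    then have hm: "(\<lambda>x. indicat_real (cbox a b) x * h x) \<in> borel_measurable lebesgue" by auto
    have e: "box_bump n a b x * h x = box_bump n a b x * (indicat_real (cbox a b) x * h x)" for n x
      using box_bump_eq_0[of n a b x] box_subset_cbox[of a b] by (auto split: split_indicator)
    have e2: "indicator (box a b) x * h x = indicator (box a b) x * (indicat_real (cbox a b) x * h x)" for x
      using box_subset_cbox[of a b] by (auto split: split_indicator)
    have "(\<lambda>n. LINT x|lebesgue. box_bump n a b x * h x) \<longlonglongrightarrow> (LINT x|lebesgue. indicator (box a b) x * h x)"
      unfolding e e2
    proof (rule integral_dominated_convergence[where w = "\<lambda>x. \<bar>indicat_real (cbox a b) x * h x\<bar>"])
      show "(\<lambda>x. box_bump n a b x * (indicat_real (cbox a b) x * h x)) \<in> borel_measurable lebesgue" for n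
        by (rule borel_measurable_times[OF continuous_lebesgue_measurable[OF test_functionsD(3)[OF box_bump_test[OF ab]]] hm])
      show "AE x in lebesgue. norm (box_bump n a b x * (indicat_real (cbox a b) x * h x)) \<le> \<bar>indicat_real (cbox a b) x * h x\<bar>" for n
        using box_bump_bounds[of n a b] by (intro AE_I2) (simp add: abs_mult mult_left_le_one_le)
      show "AE x in lebesgue. (\<lambda>n. box_bump n a b x * (indicat_real (cbox a b) x * h x)) \<longlonglongrightarrow> indicat_real (box a b) x * (indicat_real (cbox a b) x * h x)"
        by (intro AE_I2 tendsto_mult_right box_bump_tendsto)
      show "(\<lambda>x. indicat_real (box a b) x * (indicat_real (cbox a b) x * h x)) \<in> borel_measurable lebesgue"
        by (rule borel_measurable_times[OF borel_measurable_indicator hm]) simp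
    qed (use hi in auto)
    moreover have "(LINT x|lebesgue. box_bump n a b x * h x) = 0" for n
    proof -
      have "(LINT x|lebesgue. box_bump n a b x * h x) = (LINT x|lebesgue. indicat_real U x *\<^sub>R (h x * box_bump n a b x))"
        using box_bump_eq_0[of n a b] ab box_subset_cbox[of a b]
        by (intro Bochner_Integration.integral_cong) (auto split: split_indicator)
      then show ?thesis using z[OF box_bump_test[OF ab]] Um by (simp add: integrable_indicator_lebesgue_on)
    qed
    ultimately show ?thesis by (simp add: LIMSEQ_const_iff)
  qed
  \<comment> \<open>On one closed box the function is cut off to the open box. Intersections of
    boxes are boxes, so all box integrals of the cut-off function vanish by the fact
    \<open>box\<close> and the criterion for boxes applies; the boundary is a null set. Countably
    many closed boxes then cover U.\<close>
  have cb: "AE x in lebesgue. x \<in> cbox c d \<longrightarrow> h x = 0" if cd: "cbox c d \<subseteq> U" for c d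
  proof -
    let ?f = "\<lambda>x. indicator (box c d) x * h x"
    have hi: "integrable lebesgue (\<lambda>x. indicat_real (cbox c d) x *\<^sub>R h x)"
      using h[OF cd] by (simp add: integrable_indicator_lebesgue_on)
    have "?f = (\<lambda>x. indicator (box c d) x *\<^sub>R (indicat_real (cbox c d) x *\<^sub>R h x))"
      using box_subset_cbox[of c d] by (auto simp: fun_eq_iff indicator_def)
    then have "integrable lebesgue ?f" using integrable_mult_indicator[OF _ hi, of "box c d"] by auto
    moreover have "(LINT x|lebesgue. indicator (box a b) x * ?f x) = 0" for a b
    proof -
      obtain a' b' where ab: "box a b \<inter> box c d = box a' b'" using box_Int_box by blast
      have e: "indicator (box a b) x * ?f x = indicator (box a' b') x * h x" for x
        unfolding ab[symmetric] by (simp add: indicator_inter_arith mult.assoc)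
      show ?thesis
      proof (cases "box a' b' = {}")
        case True
        then show ?thesis unfolding e by simp
      next
        case False
        then have "cbox a' b' = closure (box a' b')" by simp
        also have "\<dots> \<subseteq> cbox c d" using ab box_subset_cbox[of c d] by (intro closure_minimal) auto
        finally show ?thesis unfolding e using box cd by blast
      qed
    qed
    ultimately have "AE x in lebesgue. ?f x = 0" by (rule zero_integral_boxes_imp_AE_zero)
    moreover have "AE x in lebesgue. x \<notin> frontier (cbox c d)"
      using negligible_convex_frontier[OF convex_box(1), of c d]
      by (auto simp: negligible_iff_null_sets intro: AE_not_in)
    ultimately show ?thesis
      by eventually_elim (auto simp: frontier_def interior_cbox split: split_indicator_asm)
  qed
  obtain \<D> where D: "countable \<D>" "\<D> \<subseteq> Pow U" "\<And>X. X \<in> \<D> \<Longrightarrow> \<exists>a b. X = cbox a b" "\<Union>\<D> = U"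
    using open_countable_Union_open_cbox[OF U] by blast
  have "AE x in lebesgue. \<forall>X\<in>\<D>. x \<in> X \<longrightarrow> h x = 0"
  proof (subst AE_ball_countable[OF D(1)], intro ballI)
    fix X assume X: "X \<in> \<D>"
    then obtain c d where "X = cbox c d" using D(3) by blast
    then show "AE x in lebesgue. x \<in> X \<longrightarrow> h x = 0" using cb X D(2) by blast
  qed
  then show ?thesis unfolding AE_lebesgue_on[OF Um] by eventually_elim (use D(4) in auto)
qed

section \<open>Square integrable functions\<close>

lemma L2_cong_AE:
  assumes "L2 S u" "AE x in lebesgue_on S. u x = v x" "v \<in> borel_measurable (lebesgue_on S)"
  shows "L2 S v"
proof -
  have ae: "AE x in lebesgue_on S. (norm (u x))\<^sup>2 = (norm (v x))\<^sup>2" using assms(2) by eventually_elim simp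
  have m: "(\<lambda>x. (norm (v x))\<^sup>2) \<in> borel_measurable (lebesgue_on S)"
    by (rule borel_measurable_power[OF measurable_compose[OF assms(3) borel_measurable_continuous_onI[OF continuous_on_norm_id]]])
  have i: "integrable (lebesgue_on S) (\<lambda>x. (norm (u x))\<^sup>2)" using assms(1) unfolding L2_def by (rule conjunct2)
  show ?thesis unfolding L2_def by (rule conjI[OF assms(3) integrable_cong_AE_imp[OF i m ae]])
qed

lemma L2_measurable: "L2 S u \<Longrightarrow> u \<in> borel_measurable (lebesgue_on S)"
  by (simp add: L2_def)

lemma L2_inner_integrable:
  fixes u v :: "real^'d \<Rightarrow> 'b::{real_inner, second_countable_topology}"
  assumes "L2 S u" "L2 S v"
  shows "integrable (lebesgue_on S) (\<lambda>x. u x \<bullet> v x)"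
proof (rule Bochner_Integration.integrable_bound[of _ "\<lambda>x. (norm (u x))\<^sup>2 + (norm (v x))\<^sup>2"])
  show "AE x in lebesgue_on S. norm (u x \<bullet> v x) \<le> norm ((norm (u x))\<^sup>2 + (norm (v x))\<^sup>2)"
  proof (intro AE_I2)
    fix x
    have "\<bar>u x \<bullet> v x\<bar> \<le> norm (u x) * norm (v x)" by (rule Cauchy_Schwarz_ineq2)
    also have "\<dots> \<le> (norm (u x))\<^sup>2 + (norm (v x))\<^sup>2"
      using sum_squares_bound[of "norm (u x)" "norm (v x)"]
        mult_nonneg_nonneg[OF norm_ge_zero[of "u x"] norm_ge_zero[of "v x"]] by linarith
    finally show "norm (u x \<bullet> v x) \<le> norm ((norm (u x))\<^sup>2 + (norm (v x))\<^sup>2)" by simp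
  qed
qed (use assms in \<open>auto simp: L2_def\<close>)

lemma L2_mult_integrable:
  fixes u v :: "real^'d \<Rightarrow> real"
  shows "L2 S u \<Longrightarrow> L2 S v \<Longrightarrow> integrable (lebesgue_on S) (\<lambda>x. u x * v x)"
  using L2_inner_integrable[of S u v] by simp

lemma L2_bound:
  fixes v :: "real^'d \<Rightarrow> 'b::{real_normed_vector, second_countable_topology}"
  assumes "v \<in> borel_measurable (lebesgue_on S)" "integrable (lebesgue_on S) g"
    "AE x in lebesgue_on S. (norm (v x))\<^sup>2 \<le> g x"
  shows "L2 S v"
  unfolding L2_def
proof (intro conjI assms(1) Bochner_Integration.integrable_bound[OF assms(2)])
  show "(\<lambda>x. (norm (v x))\<^sup>2) \<in> borel_measurable (lebesgue_on S)"
    by (rule borel_measurable_power[OF measurable_compose[OF assms(1) borel_measurable_continuous_onI[OF continuous_on_norm_id]]])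
  show "AE x in lebesgue_on S. norm ((norm (v x))\<^sup>2) \<le> norm (g x)"
    using assms(3) by eventually_elim simp
qed

lemma L2_add:
  fixes u v :: "real^'d \<Rightarrow> 'b::{real_inner, second_countable_topology}"
  assumes "L2 S u" "L2 S v"
  shows "L2 S (\<lambda>x. u x + v x)"
proof (rule L2_bound[of _ _ "\<lambda>x. 2 * (norm (u x))\<^sup>2 + 2 * (norm (v x))\<^sup>2"])
  show "AE x in lebesgue_on S. (norm (u x + v x))\<^sup>2 \<le> 2 * (norm (u x))\<^sup>2 + 2 * (norm (v x))\<^sup>2"
  proof (intro AE_I2)
    fix x
    have "(norm (u x + v x))\<^sup>2 + (norm (u x - v x))\<^sup>2 = 2 * (norm (u x))\<^sup>2 + 2 * (norm (v x))\<^sup>2"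
      by (simp add: power2_norm_eq_inner inner_add inner_diff inner_commute)
    then show "(norm (u x + v x))\<^sup>2 \<le> 2 * (norm (u x))\<^sup>2 + 2 * (norm (v x))\<^sup>2"
      using zero_le_power2[of "norm (u x - v x)"] by linarith
  qed
qed (use assms in \<open>auto simp: L2_def\<close>)

lemma L2_scaleR:
  fixes u :: "real^'d \<Rightarrow> 'b::{real_inner, second_countable_topology}"
  shows "L2 S u \<Longrightarrow> L2 S (\<lambda>x. c *\<^sub>R u x)"
  by (auto simp: L2_def power_mult_distrib)

lemma L2_diff:
  fixes u v :: "real^'d \<Rightarrow> 'b::{real_inner, second_countable_topology}"
  shows "L2 S u \<Longrightarrow> L2 S v \<Longrightarrow> L2 S (\<lambda>x. u x - v x)"
  using L2_add[of S u "\<lambda>x. (-1) *\<^sub>R v x"] L2_scaleR[of S v "-1"] by simp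

lemma L2_component:
  fixes g :: "real^'d \<Rightarrow> real^'n"
  assumes "L2 S g" shows "L2 S (\<lambda>x. g x $ i)"
proof (rule L2_bound[of _ _ "\<lambda>x. (norm (g x))\<^sup>2"])
  show "(\<lambda>x. g x $ i) \<in> borel_measurable (lebesgue_on S)"
    using measurable_compose[OF L2_measurable[OF assms] borel_measurable_continuous_onI[of "\<lambda>y. y $ i"]]
    by (simp add: continuous_on_component)
  show "AE x in lebesgue_on S. (norm (g x $ i))\<^sup>2 \<le> (norm (g x))\<^sup>2"
    using power_mono[OF component_le_norm_cart abs_ge_zero, of _ _ 2] by (intro AE_I2) simp
qed (use assms in \<open>auto simp: L2_def\<close>)

text \<open>Inclusion up to a null set is the form in which closed mesh elements lie in the open
  domain: an element at the boundary contains points of the boundary.\<close>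

lemma AE_subset_transfer:
  fixes A B :: "(real^'d::finite) set"
  assumes A: "A \<in> sets lebesgue" and B: "B \<in> sets lebesgue" and AB: "AE x in lebesgue. x \<in> A \<longrightarrow> x \<in> B"
  shows AE_lebesgue_on_sub: "AE x in lebesgue_on B. P x \<Longrightarrow> AE x in lebesgue_on A. P x"
    and measurable_lebesgue_on_sub: "(f :: real^'d \<Rightarrow> 'b::euclidean_space) \<in> borel_measurable (lebesgue_on B) \<Longrightarrow> f \<in> borel_measurable (lebesgue_on A)"
    and integrable_lebesgue_on_sub: "integrable (lebesgue_on B) (f :: real^'d \<Rightarrow> 'b::euclidean_space) \<Longrightarrow> integrable (lebesgue_on A) f"
    and L2_sub: "L2 B (f :: real^'d \<Rightarrow> 'b::euclidean_space) \<Longrightarrow> L2 A f"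
proof -
  show "AE x in lebesgue_on B. P x \<Longrightarrow> AE x in lebesgue_on A. P x"
    unfolding AE_lebesgue_on[OF A] AE_lebesgue_on[OF B] using AB by (auto elim!: AE_mp)
  have ae: "AE x in lebesgue. indicator A x *\<^sub>R (indicator B x *\<^sub>R g x) = indicator A x *\<^sub>R g x"
    for g :: "real^'d \<Rightarrow> 'z::euclidean_space"
    using AB by eventually_elim (auto simp: indicator_def)
  have m: "(\<lambda>x. indicator A x *\<^sub>R g x) \<in> borel_measurable lebesgue"
    if "g \<in> borel_measurable (lebesgue_on B)" for g :: "real^'d \<Rightarrow> 'z::euclidean_space"
  proof -
    have "(\<lambda>x. indicat_real B x *\<^sub>R g x) \<in> borel_measurable lebesgue"
      using that B by (simp add: borel_measurable_restrict_space_iff)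
    from borel_measurable_scaleR[OF borel_measurable_indicator[OF A] this]
    have "(\<lambda>x. indicator A x *\<^sub>R (indicator B x *\<^sub>R g x)) \<in> borel_measurable lebesgue" .
    then show ?thesis using ae by (rule borel_measurable_AE)
  qed
  then show mf: "f \<in> borel_measurable (lebesgue_on B) \<Longrightarrow> f \<in> borel_measurable (lebesgue_on A)"
    for f :: "real^'d \<Rightarrow> 'z::euclidean_space"
    using A by (simp add: borel_measurable_restrict_space_iff)
  show i: "integrable (lebesgue_on B) g \<Longrightarrow> integrable (lebesgue_on A) g" for g :: "real^'d \<Rightarrow> 'z::euclidean_space"
  proof -
    assume g: "integrable (lebesgue_on B) g"
    show ?thesis unfolding integrable_indicator_lebesgue_on(2)[OF A]
      by (rule integrable_cong_AE_imp[OF integrable_mult_indicator[OF A g[unfolded integrable_indicator_lebesgue_on(2)[OF B]]]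
            m[OF borel_measurable_integrable[OF g]] ae])
  qed
  show "L2 B f \<Longrightarrow> L2 A f" unfolding L2_def using mf[of f] i[of "\<lambda>x. (norm (f x))\<^sup>2"] by blast
qed

lemma lebesgue_on_mono_facts:
  fixes A B :: "(real^'d::finite) set"
  assumes "A \<in> sets lebesgue" "B \<in> sets lebesgue" "A \<subseteq> B"
  shows AE_lebesgue_on_mono: "AE x in lebesgue_on B. P x \<Longrightarrow> AE x in lebesgue_on A. P x"
    and measurable_lebesgue_on_mono: "(f :: real^'d \<Rightarrow> 'b::euclidean_space) \<in> borel_measurable (lebesgue_on B) \<Longrightarrow> f \<in> borel_measurable (lebesgue_on A)"
    and integrable_lebesgue_on_mono: "integrable (lebesgue_on B) (f :: real^'d \<Rightarrow> 'b::euclidean_space) \<Longrightarrow> integrable (lebesgue_on A) f"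
proof -
  have "AE x in lebesgue. x \<in> A \<longrightarrow> x \<in> B" using assms(3) by auto
  note sub = AE_subset_transfer[OF assms(1,2) this]
  show "AE x in lebesgue_on B. P x \<Longrightarrow> AE x in lebesgue_on A. P x" by (rule sub(1))
  show "f \<in> borel_measurable (lebesgue_on B) \<Longrightarrow> f \<in> borel_measurable (lebesgue_on A)" by (rule sub(2))
  show "integrable (lebesgue_on B) f \<Longrightarrow> integrable (lebesgue_on A) f" by (rule sub(3))
qed

lemma L2_mono:
  fixes u :: "real^'d::finite \<Rightarrow> 'b::euclidean_space"
  assumes "L2 B u" "A \<in> sets lebesgue" "B \<in> sets lebesgue" "A \<subseteq> B"
  shows "L2 A u"
  by (rule L2_sub[OF assms(2,3) _ assms(1)]) (use assms(4) in auto)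

lemma integral_lebesgue_on_support:
  fixes f :: "real^'d::finite \<Rightarrow> 'b::{banach, second_countable_topology}"
  assumes "A \<in> sets lebesgue" "B \<in> sets lebesgue" "A \<subseteq> B" "\<And>x. x \<in> B - A \<Longrightarrow> f x = 0"
  shows "integral\<^sup>L (lebesgue_on B) f = integral\<^sup>L (lebesgue_on A) f"
proof -
  have "(\<lambda>x. indicator A x *\<^sub>R f x) = (\<lambda>x. indicator B x *\<^sub>R f x)"
    using assms by (auto simp: fun_eq_iff indicator_def)
  then show ?thesis
    unfolding integrable_indicator_lebesgue_on(1)[OF assms(1)] integrable_indicator_lebesgue_on(1)[OF assms(2)] by metis
qed

lemma test_functions_L2:
  fixes \<phi> :: "real^'d::finite \<Rightarrow> real"
  assumes "\<phi> \<in> test_functions U" "S \<in> sets lebesgue"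
  shows "L2 S \<phi>"
proof -
  obtain K where K: "compact K" "K \<subseteq> U" "\<And>x. x \<notin> K \<Longrightarrow> \<phi> x = 0" "\<And>x i. x \<notin> K \<Longrightarrow> partial i \<phi> x = 0"
    by (rule test_functions_support[OF assms(1)], rule that)
  obtain B where B: "B \<ge> 0" "\<And>x. \<bar>\<phi> x\<bar> \<le> B" using test_functions_bounded[OF assms(1)] by blast
  have m: "\<phi> \<in> borel_measurable lebesgue" using test_functionsD(3)[OF assms(1)] continuous_lebesgue_measurable by blast
  have "integrable lebesgue (\<lambda>x. (norm (\<phi> x))\<^sup>2)"
    by (rule bounded_support_integrable[OF _ compact_imp_bounded[OF K(1)], of _ "B\<^sup>2"])
       (use m K B in \<open>auto intro!: AE_I2 power_mono simp: abs_le_square_iff[symmetric]\<close>)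
  then have "L2 UNIV \<phi>" unfolding L2_def using m by (simp add: lebesgue_on_UNIV_eq)
  then show ?thesis by (rule L2_mono) (use assms(2) in auto)
qed

section \<open>Weak gradients\<close>

abbreviation grad :: "(real^'d \<Rightarrow> real) \<Rightarrow> real^'d \<Rightarrow> real^'d" where
  "grad \<phi> x \<equiv> \<chi> i. partial i \<phi> x"

lemma vec_measurable:
  assumes "\<And>i. (\<lambda>x. g x $ i) \<in> borel_measurable M"
  shows "(g :: _ \<Rightarrow> real^'n::finite) \<in> borel_measurable M"
proof -
  have "(\<lambda>x. \<Sum>i\<in>UNIV. g x $ i *\<^sub>R (axis i 1 :: real^'n)) \<in> borel_measurable M"
    by (intro borel_measurable_sum borel_measurable_scaleR borel_measurable_const assms)
  moreover have "(\<Sum>i\<in>UNIV. g x $ i *\<^sub>R (axis i 1 :: real^'n)) = g x" for x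
    using basis_expansion[of "g x"] by (simp add: scalar_mult_eq_scaleR)
  ultimately show ?thesis by simp
qed

lemma L2_vec:
  fixes g :: "real^'d \<Rightarrow> real^'n"
  assumes "\<And>i. L2 S (\<lambda>x. g x $ i)"
  shows "L2 S g"
proof (rule L2_bound[of _ _ "\<lambda>x. \<Sum>i\<in>UNIV. (g x $ i)\<^sup>2"])
  show "g \<in> borel_measurable (lebesgue_on S)" by (rule vec_measurable) (use assms in \<open>auto simp: L2_def\<close>)
  show "integrable (lebesgue_on S) (\<lambda>x. \<Sum>i\<in>UNIV. (g x $ i)\<^sup>2)"
    using assms by (intro Bochner_Integration.integrable_sum) (auto simp: L2_def)
  show "AE x in lebesgue_on S. (norm (g x))\<^sup>2 \<le> (\<Sum>i\<in>UNIV. (g x $ i)\<^sup>2)"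
    by (intro AE_I2) (simp add: norm_vec_def L2_set_def sum_nonneg)
qed

lemma test_partial_integral_zero:
  fixes w :: "real^'d::finite \<Rightarrow> real"
  assumes w: "w \<in> test_functions S" and S: "open S"
  shows "(LINT x|lebesgue_on S. partial i w x) = 0"
proof -
  obtain L where L: "L \<ge> 0" "\<And>x y. \<bar>w x - w y\<bar> \<le> L * norm (x - y)"
    by (rule test_functions_lipschitz[OF w], rule that)
  obtain K where K: "compact K" "K \<subseteq> S" "\<And>x. x \<notin> K \<Longrightarrow> w x = 0" "\<And>x i. x \<notin> K \<Longrightarrow> partial i w x = 0"
    by (rule test_functions_support[OF w], rule that)
  have gm: "grad w \<in> borel_measurable borel"
    by (intro borel_measurable_continuous_onI continuous_on_vec_lambda test_functionsD(3)[OF test_functions_partial[OF w]])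
  have "(LINT y|lebesgue. grad w y \<bullet> axis i 1) = 0"
    by (rule integral_gradient_zero[OF L(2) compact_imp_bounded[OF K(1)] K(3) _ gm])
       (use K(4) test_functionsD(5)[OF w] in \<open>auto simp: vec_eq_iff\<close>)
  then have 0: "(LINT y|lebesgue. partial i w y) = 0" by (simp add: inner_axis)
  then show ?thesis
    using integral_lebesgue_on_support[of S UNIV "partial i w"] S K(2,4) by (auto simp: lebesgue_on_UNIV_eq)
qed

text \<open>The product of \<phi> with a test function is a test function, and the integrals of its
  partial derivatives vanish; the product rule turns this into integration by parts.\<close>

lemma has_weak_grad_test:
  fixes \<phi> :: "real^'d::finite \<Rightarrow> real"
  assumes \<phi>: "\<phi> \<in> test_functions U" and S: "open S"
  shows "has_weak_grad S \<phi> (grad \<phi>)"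
  unfolding has_weak_grad_def
proof (intro conjI ballI allI)
  show "L2 S \<phi>" "L2 S (grad \<phi>)"
    using test_functions_L2[OF \<phi>] test_functions_L2[OF test_functions_partial[OF \<phi>]] S by (auto intro!: L2_vec)
  fix \<psi> i assume \<psi>: "\<psi> \<in> test_functions S"
  define w where "w = (\<lambda>x. \<phi> x * \<psi> x)"
  have w: "w \<in> test_functions S" unfolding w_def by (intro test_functions_mult \<psi> test_functionsD(1)[OF \<phi>])
  have pw: "partial i w x = \<phi> x * partial i \<psi> x + partial i \<phi> x * \<psi> x" for x
    unfolding w_def by (rule partial_mult) (use test_functionsD(2) \<phi> \<psi> in blast)+
  have "(LINT x|lebesgue_on S. partial i w x) =
      (LINT x|lebesgue_on S. \<phi> x * partial i \<psi> x) + (LINT x|lebesgue_on S. partial i \<phi> x * \<psi> x)"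
    unfolding pw using S
    by (intro Bochner_Integration.integral_add L2_mult_integrable test_functions_L2[OF \<phi>] test_functions_L2[OF \<psi>]
        test_functions_L2[OF test_functions_partial[OF \<phi>]] test_functions_L2[OF test_functions_partial[OF \<psi>]]) auto
  then show "(LINT x|lebesgue_on S. \<phi> x * partial i \<psi> x) = - (LINT x|lebesgue_on S. grad \<phi> x $ i * \<psi> x)"
    using test_partial_integral_zero[OF w S, of i] by simp
qed

lemma has_weak_grad_lincomb:
  fixes u v :: "real^'d::finite \<Rightarrow> real"
  assumes u: "has_weak_grad U u g" and v: "has_weak_grad U v h" and U: "open U"
  shows "has_weak_grad U (\<lambda>x. a * u x + b * v x) (\<lambda>x. a *\<^sub>R g x + b *\<^sub>R h x)"
  unfolding has_weak_grad_def
proof (intro conjI ballI allI)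
  have Lu: "L2 U u" "L2 U g" "L2 U v" "L2 U h" using u v by (auto simp: has_weak_grad_def)
  show "L2 U (\<lambda>x. a * u x + b * v x)" using L2_add[OF L2_scaleR[OF Lu(1)] L2_scaleR[OF Lu(3)]] by simp
  show "L2 U (\<lambda>x. a *\<^sub>R g x + b *\<^sub>R h x)" using L2_add[OF L2_scaleR[OF Lu(2)] L2_scaleR[OF Lu(4)]] by simp
  fix \<phi> i assume \<phi>: "\<phi> \<in> test_functions U"
  have p: "L2 U (partial i \<phi>)" "L2 U \<phi>"
    using test_functions_L2[OF \<phi>] test_functions_L2[OF test_functions_partial[OF \<phi>]] U by auto
  note I = L2_mult_integrable[OF Lu(1) p(1)] L2_mult_integrable[OF Lu(3) p(1)]
    L2_mult_integrable[OF L2_component[OF Lu(2)] p(2), of i] L2_mult_integrable[OF L2_component[OF Lu(4)] p(2), of i]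
  have "(LINT x|lebesgue_on U. (a * u x + b * v x) * partial i \<phi> x) =
      (LINT x|lebesgue_on U. a * (u x * partial i \<phi> x) + b * (v x * partial i \<phi> x))"
    by (simp add: algebra_simps)
  also have "\<dots> = a * (LINT x|lebesgue_on U. u x * partial i \<phi> x) + b * (LINT x|lebesgue_on U. v x * partial i \<phi> x)"
    using I by simp
  also have "\<dots> = - (a * (LINT x|lebesgue_on U. g x $ i * \<phi> x) + b * (LINT x|lebesgue_on U. h x $ i * \<phi> x))"
    using u v \<phi> by (simp add: has_weak_grad_def)
  also have "a * (LINT x|lebesgue_on U. g x $ i * \<phi> x) + b * (LINT x|lebesgue_on U. h x $ i * \<phi> x) =
      (LINT x|lebesgue_on U. a * (g x $ i * \<phi> x) + b * (h x $ i * \<phi> x))"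
    using I by simp
  also have "\<dots> = (LINT x|lebesgue_on U. (a *\<^sub>R g x + b *\<^sub>R h x) $ i * \<phi> x)"
    by (simp add: algebra_simps)
  finally show "(LINT x|lebesgue_on U. (a * u x + b * v x) * partial i \<phi> x) =
      - (LINT x|lebesgue_on U. (a *\<^sub>R g x + b *\<^sub>R h x) $ i * \<phi> x)" .
qed

lemma has_weak_grad_mono:
  fixes u :: "real^'d::finite \<Rightarrow> real"
  assumes u: "has_weak_grad U u g" and U: "open U" "open V" "V \<subseteq> U"
  shows "has_weak_grad V u g"
  unfolding has_weak_grad_def
proof (intro conjI ballI allI)
  have m: "V \<in> sets lebesgue" "U \<in> sets lebesgue" using U by auto
  show "L2 V u" "L2 V g" using u L2_mono[OF _ m U(3)] by (auto simp: has_weak_grad_def)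
  fix \<phi> i assume \<phi>: "\<phi> \<in> test_functions V"
  have "(LINT x|lebesgue_on U. u x * partial i \<phi> x) = - (LINT x|lebesgue_on U. g x $ i * \<phi> x)"
    using u test_functions_mono[OF \<phi> U(3)] by (simp add: has_weak_grad_def)
  moreover have "(LINT x|lebesgue_on U. u x * partial i \<phi> x) = (LINT x|lebesgue_on V. u x * partial i \<phi> x)"
    by (rule integral_lebesgue_on_support[OF m U(3)]) (use test_functionsD(4)[OF test_functions_partial[OF \<phi>]] in auto)
  moreover have "(LINT x|lebesgue_on U. g x $ i * \<phi> x) = (LINT x|lebesgue_on V. g x $ i * \<phi> x)"
    by (rule integral_lebesgue_on_support[OF m U(3)]) (use test_functionsD(4)[OF \<phi>] in auto)
  ultimately show "(LINT x|lebesgue_on V. u x * partial i \<phi> x) = - (LINT x|lebesgue_on V. g x $ i * \<phi> x)" by simp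
qed

lemma has_weak_grad_cong:
  fixes u v :: "real^'d::finite \<Rightarrow> real"
  assumes u: "has_weak_grad U u g" and U: "open U"
    and uv: "AE x in lebesgue_on U. u x = v x" and v: "v \<in> borel_measurable (lebesgue_on U)"
  shows "has_weak_grad U v g"
proof -
  have L: "L2 U u" "L2 U v" using u L2_cong_AE[OF _ uv v] by (auto simp: has_weak_grad_def)
  have "(LINT x|lebesgue_on U. u x * partial i \<phi> x) = (LINT x|lebesgue_on U. v x * partial i \<phi> x)"
    if "\<phi> \<in> test_functions U" for \<phi> i
    using L2_measurable[OF test_functions_L2[OF test_functions_partial[OF that]], of U i] U L uv
    by (intro integral_cong_AE borel_measurable_times) (auto dest: L2_measurable elim!: AE_mp)
  then show ?thesis using u L by (simp add: has_weak_grad_def)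
qed

lemma finite_measure_lebesgue_on_bounded:
  "bounded S \<Longrightarrow> S \<in> sets lebesgue \<Longrightarrow> finite_measure (lebesgue_on S)"
  using bounded_set_imp_lmeasurable by (blast intro: finite_measure_lebesgue_on)

lemma L2_const:
  fixes c :: "'b::{real_normed_vector, second_countable_topology}"
  assumes "bounded (S :: (real^'d::finite) set)" "S \<in> sets lebesgue"
  shows "L2 S (\<lambda>x. c)"
proof -
  interpret finite_measure "lebesgue_on S" using finite_measure_lebesgue_on_bounded assms by blast
  show ?thesis by (simp add: L2_def)
qed

lemma L2_bounded:
  fixes v :: "real^'d::finite \<Rightarrow> 'b::{real_normed_vector, second_countable_topology}"
  assumes "v \<in> borel_measurable (lebesgue_on S)" "bounded S" "S \<in> sets lebesgue"
    "AE x in lebesgue_on S. norm (v x) \<le> B"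
  shows "L2 S v"
proof -
  interpret finite_measure "lebesgue_on S" using finite_measure_lebesgue_on_bounded assms by blast
  show ?thesis
  proof (rule L2_bound[OF assms(1), of "\<lambda>x. B\<^sup>2"])
    show "AE x in lebesgue_on S. (norm (v x))\<^sup>2 \<le> B\<^sup>2" using assms(4) by eventually_elim (simp add: power_mono)
  qed simp
qed

lemma L2_integrable_bounded:
  fixes u :: "real^'d::finite \<Rightarrow> real"
  assumes "L2 S u" "bounded S" "S \<in> sets lebesgue"
  shows "integrable (lebesgue_on S) u"
  using L2_mult_integrable[OF assms(1) L2_const[OF assms(2,3), of 1]] by simp

lemma has_weak_grad_unique:
  fixes u :: "real^'d::finite \<Rightarrow> real"
  assumes g: "has_weak_grad U u g" and h: "has_weak_grad U u h" and U: "open U"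
  shows "AE x in lebesgue_on U. g x = h x"
proof -
  have L: "L2 U g" "L2 U h" using g h by (auto simp: has_weak_grad_def)
  have "AE x in lebesgue_on U. g x $ i - h x $ i = 0" for i
  proof (rule test_orthogonal_imp_AE_zero[OF U])
    have Ld: "L2 U (\<lambda>x. g x $ i - h x $ i)" by (intro L2_diff L2_component L)
    show "integrable (lebesgue_on (cbox a b)) (\<lambda>x. g x $ i - h x $ i)" if "cbox a b \<subseteq> U" for a b
      using L2_integrable_bounded[OF L2_mono[OF Ld _ _ that]] U by auto
    fix \<phi> assume \<phi>: "\<phi> \<in> test_functions U"
    have p: "L2 U \<phi>" using test_functions_L2[OF \<phi>] U by auto
    have "(LINT x|lebesgue_on U. g x $ i * \<phi> x) = (LINT x|lebesgue_on U. h x $ i * \<phi> x)"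
      using g h \<phi> by (simp add: has_weak_grad_def)
    then show "(LINT x|lebesgue_on U. (g x $ i - h x $ i) * \<phi> x) = 0"
      using L2_mult_integrable[OF L2_component[OF L(1)] p, of i] L2_mult_integrable[OF L2_component[OF L(2)] p, of i]
      by (simp add: left_diff_distrib)
  qed
  then have "AE x in lebesgue_on U. \<forall>i\<in>UNIV. g x $ i - h x $ i = 0"
    by (subst AE_ball_countable) (auto simp: countable_finite)
  then show ?thesis by eventually_elim (simp add: vec_eq_iff)
qed

lemma H1_wgrad: "H1 U u \<Longrightarrow> has_weak_grad U u (wgrad U u)"
  using someI_ex[of "has_weak_grad U u"] by (simp add: H1_def wgrad_def)

text \<open>\<open>wgrad\<close> is a choice among almost everywhere equal functions; here it is
  replaced by a weak gradient that is known explicitly.\<close>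

lemma wgrad_eq:
  fixes u :: "real^'d::finite \<Rightarrow> real"
  assumes "has_weak_grad U u g" "open U"
  shows "AE x in lebesgue_on U. wgrad U u x = g x"
  using has_weak_grad_unique[OF H1_wgrad assms(1) assms(2)] assms(1) unfolding H1_def by blast

lemma l2norm_nonneg: "0 \<le> l2norm S u"
  by (simp add: l2norm_def integral_nonneg)

lemma l2norm_sq: "(l2norm S u)\<^sup>2 = (LINT x|lebesgue_on S. (norm (u x))\<^sup>2)"
  by (simp add: l2norm_def integral_nonneg)

lemma l2norm_diff_sq:
  fixes u v :: "real^'d \<Rightarrow> 'b::{real_inner, second_countable_topology}"
  assumes u: "L2 S u" and v: "L2 S v"
  shows "(l2norm S (\<lambda>x. u x - v x))\<^sup>2 \<le> 2 * (l2norm S u)\<^sup>2 + 2 * (l2norm S v)\<^sup>2"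
proof -
  have i: "integrable (lebesgue_on S) (\<lambda>x. (norm (u x))\<^sup>2)" "integrable (lebesgue_on S) (\<lambda>x. (norm (v x))\<^sup>2)"
    using u v by (auto simp: L2_def)
  have "(l2norm S (\<lambda>x. u x - v x))\<^sup>2 \<le> (LINT x|lebesgue_on S. 2 * (norm (u x))\<^sup>2 + 2 * (norm (v x))\<^sup>2)"
    unfolding l2norm_sq
  proof (rule integral_mono)
    show "integrable (lebesgue_on S) (\<lambda>x. (norm (u x - v x))\<^sup>2)" using L2_diff[OF u v] by (simp add: L2_def)
    show "(norm (u x - v x))\<^sup>2 \<le> 2 * (norm (u x))\<^sup>2 + 2 * (norm (v x))\<^sup>2" for x
    proof -
      have "(norm (u x - v x))\<^sup>2 + (norm (u x + v x))\<^sup>2 = 2 * (norm (u x))\<^sup>2 + 2 * (norm (v x))\<^sup>2"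
        by (simp add: power2_norm_eq_inner inner_add inner_diff inner_commute)
      then show ?thesis using zero_le_power2[of "norm (u x + v x)"] by linarith
    qed
  qed (use i in simp)
  also have "\<dots> = 2 * (l2norm S u)\<^sup>2 + 2 * (l2norm S v)\<^sup>2" unfolding l2norm_sq using i by simp
  finally show ?thesis .
qed

lemma l2norm_dominated_convergence:
  fixes f :: "real^'d \<Rightarrow> 'b::{real_inner, second_countable_topology}"
  assumes m: "\<And>n. (\<lambda>x. f x - s n x) \<in> borel_measurable (lebesgue_on S)"
    and g: "integrable (lebesgue_on S) (\<lambda>x. (g x)\<^sup>2)" and b: "\<And>n. AE x in lebesgue_on S. norm (f x - s n x) \<le> g x"
    and lim: "AE x in lebesgue_on S. (\<lambda>n. f x - s n x) \<longlonglongrightarrow> 0"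
  shows "(\<lambda>n. (l2norm S (\<lambda>x. f x - s n x))\<^sup>2) \<longlonglongrightarrow> 0"
proof -
  have "(\<lambda>n. (l2norm S (\<lambda>x. f x - s n x))\<^sup>2) \<longlonglongrightarrow> (LINT x|lebesgue_on S. 0)"
    unfolding l2norm_sq
  proof (rule integral_dominated_convergence[OF _ _ g])
    show "(\<lambda>x. (norm (f x - s n x))\<^sup>2) \<in> borel_measurable (lebesgue_on S)" for n
      by (rule measurable_compose[OF m borel_measurable_continuous_onI]) (intro continuous_intros)
    show "AE x in lebesgue_on S. (\<lambda>n. (norm (f x - s n x))\<^sup>2) \<longlonglongrightarrow> 0"
      using lim by eventually_elim (use tendsto_power[OF tendsto_norm_zero, of _ _ 2] in fastforce)
    show "AE x in lebesgue_on S. norm ((norm (f x - s n x))\<^sup>2) \<le> (g x)\<^sup>2" for n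
      using b[of n] by eventually_elim (simp add: power_mono)
  qed simp
  then show ?thesis by simp
qed

section \<open>Mollification\<close>

text \<open>Differentiation falls on the kernel, whose partial derivatives are again test functions;
  the induction therefore runs over all kernels at once.\<close>

lemma convolution_test_smooth:
  fixes \<rho> w :: "real^'d::finite \<Rightarrow> real"
  assumes "\<rho> \<in> test_functions U" and w: "integrable lebesgue w"
  shows "cont_diff m (\<lambda>x. LINT y|lebesgue. \<rho> (x - y) * w y)"
  using assms(1)
proof (induction m arbitrary: \<rho>)
  case (0 \<rho>)
  obtain L where L: "L \<ge> 0" "\<And>x y. \<bar>\<rho> x - \<rho> y\<bar> \<le> L * norm (x - y)"
    by (rule test_functions_lipschitz[OF 0], rule that)
  obtain B where B: "B \<ge> 0" "\<And>x. \<bar>\<rho> x\<bar> \<le> B" by (rule test_functions_bounded[OF 0], rule that)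
  have m: "grad \<rho> \<in> borel_measurable borel"
    by (intro borel_measurable_continuous_onI continuous_on_vec_lambda test_functionsD(3)[OF test_functions_partial[OF 0]])
  note d = convolution_has_derivative(3)[OF L(2) B(2) AE_I2[OF test_functionsD(5)[OF 0]] m w]
  show ?case by (simp, intro continuous_at_imp_continuous_on ballI) (rule has_derivative_continuous[OF d])
next
  case (Suc m \<rho>)
  obtain L where L: "L \<ge> 0" "\<And>x y. \<bar>\<rho> x - \<rho> y\<bar> \<le> L * norm (x - y)"
    by (rule test_functions_lipschitz[OF Suc.prems], rule that)
  obtain B where B: "B \<ge> 0" "\<And>x. \<bar>\<rho> x\<bar> \<le> B" by (rule test_functions_bounded[OF Suc.prems], rule that)
  have m: "grad \<rho> \<in> borel_measurable borel"
    by (intro borel_measurable_continuous_onI continuous_on_vec_lambda test_functionsD(3)[OF test_functions_partial[OF Suc.prems]])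
  note d = convolution_has_derivative(2,3)[OF L(2) B(2) AE_I2[OF test_functionsD(5)[OF Suc.prems]] m w]
  have p: "partial i (\<lambda>x. LINT y|lebesgue. \<rho> (x - y) * w y) = (\<lambda>x. LINT y|lebesgue. partial i \<rho> (x - y) * w y)" for i
  proof
    fix x
    have "partial i (\<lambda>x. LINT y|lebesgue. \<rho> (x - y) * w y) x = (LINT y|lebesgue. w y *\<^sub>R grad \<rho> (x - y)) \<bullet> axis i 1"
      by (rule partial_eq[OF d(2)])
    also have "\<dots> = (LINT y|lebesgue. (w y *\<^sub>R grad \<rho> (x - y)) \<bullet> axis i 1)"
      by (rule integral_inner_left[symmetric]) (rule d(1))
    finally show "partial i (\<lambda>x. LINT y|lebesgue. \<rho> (x - y) * w y) x = (LINT y|lebesgue. partial i \<rho> (x - y) * w y)"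
      by (simp add: inner_axis mult.commute)
  qed
  have "(\<lambda>x. LINT y|lebesgue. \<rho> (x - y) * w y) differentiable (at x)" for x
    using d(2) unfolding differentiable_def by blast
  then show ?case using Suc.IH[OF test_functions_partial[OF Suc.prems]] by (simp add: p)
qed

lemma mollifier_exists:
  assumes "r > 0"
  obtains \<rho> :: "real^'d::finite \<Rightarrow> real" where "\<rho> \<in> test_functions UNIV" "\<And>x. 0 \<le> \<rho> x"
    "\<And>x. \<rho> x \<noteq> 0 \<Longrightarrow> norm x \<le> r" "integrable lebesgue \<rho>" "integral\<^sup>L lebesgue \<rho> = 1"
proof -
  \<comment> \<open>The norm is at most the sum of the d absolute coordinates, so the cube with half
    side r / d lies in the ball of radius r.\<close>
  define s where "s = r / real CARD('d)"
  have s: "s > 0" using assms by (simp add: s_def)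
  define a b :: "real^'d" where "a = (\<chi> i. - s)" and "b = (\<chi> i. s)"
  define \<eta> where "\<eta> = box_bump 0 a b"
  have \<eta>: "\<eta> \<in> test_functions UNIV" unfolding \<eta>_def by (rule box_bump_test) simp
  have "L2 UNIV \<eta>" by (rule test_functions_L2[OF \<eta>]) simp
  have i: "integrable lebesgue \<eta>"
  proof (rule bounded_support_integrable[of _ "box a b" 1])
    show "\<eta> \<in> borel_measurable lebesgue" by (rule continuous_lebesgue_measurable[OF test_functionsD(3)[OF \<eta>]])
    show "\<eta> x = 0" if "x \<notin> box a b" for x using that box_bump_eq_0 unfolding \<eta>_def by blast
    show "AE x in lebesgue. norm (\<eta> x) \<le> 1" using box_bump_bounds[of 0 a b] by (intro AE_I2) (simp add: \<eta>_def)
  qed simp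
  have c: "integral\<^sup>L lebesgue \<eta> > 0"
  proof (rule ccontr)
    have nn: "AE x in lebesgue. 0 \<le> \<eta> x" using box_bump_bounds by (intro AE_I2) (simp add: \<eta>_def)
    assume "\<not> ?thesis"
    then have "integral\<^sup>L lebesgue \<eta> = 0" using integral_nonneg_AE[OF nn] by simp
    then have "AE x in lebesgue. \<eta> x = 0" using integral_nonneg_eq_0_iff_AE[OF i nn] by simp
    then have "AE x in lebesgue. x \<notin> box a b" by eventually_elim (use box_bump_eq_0 in \<open>auto simp: \<eta>_def\<close>)
    then have "negligible (box a b)"
      by (simp add: negligible_iff_null_sets AE_iff_null_sets)
    moreover have "0 \<in> box a b" using s by (simp add: mem_box_cart a_def b_def)
    then have "box a b \<noteq> {}" by blast
    ultimately show False using open_not_negligible[OF open_box] by blast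
  qed
  show thesis
  proof (rule that[of "\<lambda>x. inverse (integral\<^sup>L lebesgue \<eta>) * \<eta> x"])
    show "(\<lambda>x. inverse (integral\<^sup>L lebesgue \<eta>) * \<eta> x) \<in> test_functions UNIV"
      by (rule test_functions_mult[OF \<eta> cont_diff_const])
    show "0 \<le> inverse (integral\<^sup>L lebesgue \<eta>) * \<eta> x" for x
      using c box_bump_bounds(1)[of 0 a b x] unfolding \<eta>_def by (intro mult_nonneg_nonneg) auto
    show "integrable lebesgue (\<lambda>x. inverse (integral\<^sup>L lebesgue \<eta>) * \<eta> x)" using i by simp
    show "(LINT x|lebesgue. inverse (integral\<^sup>L lebesgue \<eta>) * \<eta> x) = 1" using c by simp
    fix x assume "inverse (integral\<^sup>L lebesgue \<eta>) * \<eta> x \<noteq> 0"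
    then have "\<eta> x \<noteq> 0" by auto
    then have "x \<in> box a b" using box_bump_eq_0 unfolding \<eta>_def by blast
    then have "\<bar>x $ i\<bar> \<le> s" for i by (auto simp: mem_box_cart a_def b_def abs_le_iff minus_le_iff less_imp_le)
    then have "(\<Sum>i\<in>UNIV. \<bar>x $ i\<bar>) \<le> (\<Sum>i\<in>(UNIV :: 'd set). s)" by (intro sum_mono)
    then show "norm x \<le> r" using norm_le_l1_cart[of x] by (simp add: s_def)
  qed
qed

text \<open>The gradient of the mollified function is a local average of D. It converges at every
  continuity point of D, hence almost everywhere, and the Lipschitz constant dominates both
  gradients. Piecewise polynomials have gradients of just this regularity.\<close>

lemma mollify_approx:
  fixes w :: "real^'d::finite \<Rightarrow> real" and D :: "real^'d \<Rightarrow> real^'d"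
  assumes U: "open U" "bounded U" and L: "\<And>x y. \<bar>w x - w y\<bar> \<le> L * norm (x - y)"
    and K: "compact K" "K \<subseteq> U" "\<And>x. x \<notin> K \<Longrightarrow> w x = 0"
    and D: "D \<in> borel_measurable borel" and d: "AE y in lebesgue. (w has_derivative (\<lambda>h. D y \<bullet> h)) (at y)"
    and cD: "AE y in lebesgue. isCont D y" and \<epsilon>: "\<epsilon> > 0"
  shows "\<exists>\<phi>\<in>test_functions U. (l2norm U (\<lambda>x. w x - \<phi> x))\<^sup>2 + (l2norm U (\<lambda>x. D x - grad \<phi> x))\<^sup>2 < \<epsilon>"
proof -
  obtain e where e: "e > 0" "(\<Union>x\<in>K. ball x e) \<subseteq> U"
    using compact_subset_open_imp_ball_epsilon_subset[OF K(1) U(1) K(2)] by blast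
  \<comment> \<open>The e-neighbourhood of K lies in U; radii of at most e / 2 keep the support of
    the mollified function in a compact subset of U.\<close>
  define r where "r = (\<lambda>n. e / 2 / real (Suc n))"
  have r: "r n > 0" "r n \<le> e / 2" for n using e by (auto simp: r_def field_simps)
  have r0: "r \<longlonglongrightarrow> 0" unfolding r_def by (rule LIMSEQ_Suc[OF lim_const_over_n])
  have "\<exists>\<rho>. \<rho> \<in> test_functions UNIV \<and> (\<forall>x::real^'d. 0 \<le> \<rho> x) \<and> (\<forall>x. \<rho> x \<noteq> 0 \<longrightarrow> norm x \<le> r n) \<and>
      integrable lebesgue \<rho> \<and> integral\<^sup>L lebesgue \<rho> = 1" for n
    using mollifier_exists[OF r(1)[of n]] by metis
  then obtain \<rho> where \<rho>: "\<And>n. \<rho> n \<in> test_functions (UNIV :: (real^'d) set)" "\<And>n x. 0 \<le> \<rho> n x"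
    "\<And>n x. \<rho> n x \<noteq> 0 \<Longrightarrow> norm x \<le> r n" "\<And>n. integrable lebesgue (\<rho> n)" "\<And>n. integral\<^sup>L lebesgue (\<rho> n) = 1"
    by metis
  have L0: "0 \<le> L"
    using L[of "axis undefined 1" 0] abs_ge_zero[of "w (axis undefined 1) - w 0"] by simp
  have wm: "w \<in> borel_measurable lebesgue" by (intro continuous_lebesgue_measurable lipschitz_continuous[OF L])
  have Dm: "D \<in> borel_measurable lebesgue" by (rule borel_lebesgue[OF D])
  have "compact (w ` K)" using lipschitz_continuous[OF L] K(1) compact_continuous_image continuous_on_subset by blast
  then obtain B where "\<forall>y\<in>w ` K. norm y \<le> B" using compact_imp_bounded bounded_iff by metis
  then have B: "\<bar>w x\<bar> \<le> max B 0" for x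
    using K(3)[of x] by (cases "x \<in> K") (auto simp: le_max_iff_disj)
  have wi: "integrable lebesgue w"
    by (rule bounded_support_integrable[OF wm compact_imp_bounded[OF K(1)] K(3)]) (use B in auto)
  have Db: "AE y in lebesgue. norm (D y) \<le> L"
    using d by (rule AE_mp) (auto intro!: AE_I2 lipschitz_gradient_bound L)
  define \<phi> where "\<phi> = (\<lambda>n x. LINT y|lebesgue. \<rho> n (x - y) * w y)"
  \<comment> \<open>Two forms of one convolution: with the kernel at \<open>x - y\<close> smoothness
    is visible, with \<open>w\<close> at \<open>x - y\<close> the gradient becomes the average of
    D.\<close>
  have \<phi>': "\<phi> n x = (LINT y|lebesgue. w (x - y) * \<rho> n y)" for n x
  proof -
    have "(\<lambda>y. w (x - y) * \<rho> n y) \<in> borel_measurable lebesgue"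
      using measurable_reflect[OF wm] \<rho>(4)[of n] by auto
    from lebesgue_integral_reflect(1)[OF this, of x] show ?thesis by (simp add: \<phi>_def mult.commute)
  qed
  note conv = convolution_has_derivative[OF L B d D \<rho>(4)]
  have grad\<phi>: "grad (\<phi> n) x = (LINT y|lebesgue. \<rho> n y *\<^sub>R D (x - y))" for n x
  proof -
    have "(\<phi> n has_derivative (\<lambda>h. (LINT y|lebesgue. \<rho> n y *\<^sub>R D (x - y)) \<bullet> h)) (at x)"
      using conv(3)[of n x] unfolding \<phi>' .
    from partial_eq[OF this] show ?thesis by (simp add: vec_eq_iff inner_axis)
  qed
  have test: "\<phi> n \<in> test_functions U" for n
  proof (rule test_functionsI)
    show "cont_diff m (\<phi> n)" for m unfolding \<phi>_def by (rule convolution_test_smooth[OF \<rho>(1) wi])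
    let ?K = "{x + y |x y. x \<in> K \<and> y \<in> cball 0 (e / 2)}"
    show "compact ?K" by (rule compact_sums[OF K(1) compact_cball])
    show "?K \<subseteq> U"
    proof
      fix z assume "z \<in> ?K"
      then obtain x y where xy: "z = x + y" "x \<in> K" "norm y \<le> e / 2" by auto
      then have "z \<in> ball x e" using e(1) by (simp add: dist_norm)
      then show "z \<in> U" using e xy by blast
    qed
    fix x assume "\<phi> n x \<noteq> 0"
    show "x \<in> ?K"
    proof (rule ccontr)
      assume x: "x \<notin> ?K"
      have "\<rho> n (x - y) * w y = 0" for y
      proof (cases "y \<in> K")
        case True
        then have "x - y \<notin> cball 0 (e / 2)" using x by (smt (verit) add_diff_cancel_left' diff_add_cancel mem_Collect_eq)
        then have "\<rho> n (x - y) = 0" using \<rho>(3)[of n "x - y"] r(2)[of n] by force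
        then show ?thesis by simp
      qed (use K in simp)
      then have "\<phi> n x = 0" unfolding \<phi>_def by (simp only: Bochner_Integration.integral_zero)
      with \<open>\<phi> n x \<noteq> 0\<close> show False by simp
    qed
  qed
  have close: "\<bar>w x - \<phi> n x\<bar> \<le> L * r n" for n x
  proof -
    have i1: "integrable lebesgue (\<lambda>y. w x * \<rho> n y)" using \<rho>(4) by simp
    have "w x - \<phi> n x = (LINT y|lebesgue. w x * \<rho> n y) - (LINT y|lebesgue. w (x - y) * \<rho> n y)"
      using \<rho>(5) by (simp add: \<phi>')
    also have "\<dots> = (LINT y|lebesgue. w x * \<rho> n y - w (x - y) * \<rho> n y)"
      by (rule Bochner_Integration.integral_diff[OF i1 conv(1), symmetric])
    also have "\<bar>\<dots>\<bar> \<le> (LINT y|lebesgue. (L * r n) * \<rho> n y)"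
    proof (rule integral_abs_bound[THEN order_trans], rule integral_mono)
      show "integrable lebesgue (\<lambda>y. \<bar>w x * \<rho> n y - w (x - y) * \<rho> n y\<bar>)"
        by (intro integrable_abs Bochner_Integration.integrable_diff i1 conv(1))
      show "integrable lebesgue (\<lambda>y. (L * r n) * \<rho> n y)" using \<rho>(4) by simp
      fix y
      show "\<bar>w x * \<rho> n y - w (x - y) * \<rho> n y\<bar> \<le> (L * r n) * \<rho> n y"
      proof (cases "\<rho> n y = 0")
        case False
        have "\<bar>w x - w (x - y)\<bar> \<le> L * norm y" using L[of x "x - y"] by simp
        also have "\<dots> \<le> L * r n" using \<rho>(3)[OF False] L0 by (rule mult_left_mono)
        finally show ?thesis using \<rho>(2)[of n y]
          by (simp add: left_diff_distrib[symmetric] abs_mult mult_right_mono)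
      qed simp
    qed
    also have "\<dots> = L * r n" using \<rho>(5) by simp
    finally show ?thesis .
  qed
  have gb: "norm (grad (\<phi> n) x) \<le> L" for n x
  proof -
    have "norm (grad (\<phi> n) x) \<le> (LINT y|lebesgue. L * \<rho> n y)"
      unfolding grad\<phi>
    proof (rule integral_norm_bound[THEN order_trans], rule integral_mono_AE)
      show "integrable lebesgue (\<lambda>y. norm (\<rho> n y *\<^sub>R D (x - y)))" using conv(2) by (rule integrable_norm)
      show "integrable lebesgue (\<lambda>y. L * \<rho> n y)" using \<rho>(4) by simp
      show "AE y in lebesgue. norm (\<rho> n y *\<^sub>R D (x - y)) \<le> L * \<rho> n y"
        using AE_reflect[OF Db, of x] by eventually_elim (use \<rho>(2) in \<open>simp add: mult.commute[of L] mult_left_mono\<close>)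
    qed
    then show ?thesis using \<rho>(5) by simp
  qed
  have glim: "(\<lambda>n. norm (D x - grad (\<phi> n) x)) \<longlonglongrightarrow> 0" if c: "isCont D x" for x
  proof (rule LIMSEQ_I)
    fix \<epsilon>' :: real assume e': "\<epsilon>' > 0"
    then obtain s where s: "s > 0" "\<And>y. norm (y - x) < s \<Longrightarrow> norm (D y - D x) < \<epsilon>' / 2"
      using c[unfolded continuous_at_eps_delta] half_gt_zero[OF e'] by (metis dist_norm)
    obtain N where N: "\<And>n. n \<ge> N \<Longrightarrow> r n < s"
      using order_tendstoD(2)[OF r0 s(1)] unfolding eventually_sequentially by blast
    have "norm (norm (D x - grad (\<phi> n) x) - 0) < \<epsilon>'" if "n \<ge> N" for n
    proof -
      have i1: "integrable lebesgue (\<lambda>y. \<rho> n y *\<^sub>R D x)" using \<rho>(4) by simp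
      have "D x = (LINT y|lebesgue. \<rho> n y *\<^sub>R D x)"
        using \<rho>(4,5) by simp
      then have "D x - grad (\<phi> n) x = (LINT y|lebesgue. \<rho> n y *\<^sub>R D x - \<rho> n y *\<^sub>R D (x - y))"
        unfolding grad\<phi> by (simp add: Bochner_Integration.integral_diff[OF i1 conv(2)])
      also have "norm \<dots> \<le> (LINT y|lebesgue. \<epsilon>' / 2 * \<rho> n y)"
      proof (rule integral_norm_bound[THEN order_trans], rule integral_mono)
        show "integrable lebesgue (\<lambda>y. norm (\<rho> n y *\<^sub>R D x - \<rho> n y *\<^sub>R D (x - y)))"
          by (intro integrable_norm Bochner_Integration.integrable_diff i1 conv(2))
        show "integrable lebesgue (\<lambda>y. \<epsilon>' / 2 * \<rho> n y)" using \<rho>(4) by simp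
        fix y
        show "norm (\<rho> n y *\<^sub>R D x - \<rho> n y *\<^sub>R D (x - y)) \<le> \<epsilon>' / 2 * \<rho> n y"
        proof (cases "\<rho> n y = 0")
          case False
          then have "norm ((x - y) - x) < s" using \<rho>(3)[OF False] N[OF that] by simp
          then have "norm (D x - D (x - y)) \<le> \<epsilon>' / 2" using s(2)[of "x - y"] by (simp add: norm_minus_commute)
          from mult_left_mono[OF this \<rho>(2)]
          have "\<rho> n y * norm (D x - D (x - y)) \<le> \<epsilon>' / 2 * \<rho> n y" by (simp only: mult.commute)
          then show ?thesis using \<rho>(2)[of n y] by (simp add: scaleR_diff_right[symmetric])
        qed simp
      qed
      also have "\<dots> < \<epsilon>'" using \<rho>(5) e' by simp
      finally show ?thesis by simp
    qed
    then show "\<exists>N. \<forall>n\<ge>N. norm (norm (D x - grad (\<phi> n) x) - 0) < \<epsilon>'" by blast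
  qed
  have Um: "U \<in> sets lebesgue" using U by auto
  interpret finite_measure "lebesgue_on U" using finite_measure_lebesgue_on_bounded U(2) Um by blast
  have "(\<lambda>n. (l2norm U (\<lambda>x. w x - \<phi> n x))\<^sup>2) \<longlonglongrightarrow> 0"
  proof (rule l2norm_dominated_convergence[where g = "\<lambda>x. L * (e / 2)"])
    show "(\<lambda>x. w x - \<phi> n x) \<in> borel_measurable (lebesgue_on U)" for n
      by (intro measurable_restrict_space1 continuous_lebesgue_measurable continuous_intros
          lipschitz_continuous[OF L] test_functionsD(3)[OF test])
    show "AE x in lebesgue_on U. norm (w x - \<phi> n x) \<le> L * (e / 2)" for n
      using order_trans[OF close mult_left_mono[OF r(2) L0]] by (intro AE_I2) simp
    have "(\<lambda>n. L * r n) \<longlonglongrightarrow> 0" by (rule tendsto_mult_right_zero[OF r0])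
    then have "(\<lambda>n. w x - \<phi> n x) \<longlonglongrightarrow> 0" for x
      by (rule Lim_null_comparison[rotated]) (simp add: close)
    then show "AE x in lebesgue_on U. (\<lambda>n. w x - \<phi> n x) \<longlonglongrightarrow> 0" by simp
  qed simp
  moreover have "(\<lambda>n. (l2norm U (\<lambda>x. D x - grad (\<phi> n) x))\<^sup>2) \<longlonglongrightarrow> 0"
  proof (rule l2norm_dominated_convergence[where g = "\<lambda>x. 2 * L"])
    show "(\<lambda>x. D x - grad (\<phi> n) x) \<in> borel_measurable (lebesgue_on U)" for n
      by (intro measurable_restrict_space1 borel_measurable_diff Dm continuous_lebesgue_measurable
          continuous_on_vec_lambda test_functionsD(3)[OF test_functions_partial[OF test]])
    show "AE x in lebesgue_on U. (\<lambda>n. D x - grad (\<phi> n) x) \<longlonglongrightarrow> 0"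
      unfolding AE_lebesgue_on[OF Um] using cD by eventually_elim (use tendsto_norm_zero_cancel[OF glim] in auto)
    show "AE x in lebesgue_on U. norm (D x - grad (\<phi> n) x) \<le> 2 * L" for n
      unfolding AE_lebesgue_on[OF Um] using Db
    proof eventually_elim
      case (elim x)
      then show ?case using gb[of n x] norm_triangle_ineq4[of "D x" "grad (\<phi> n) x"] by linarith
    qed
  qed simp
  ultimately have "(\<lambda>n. (l2norm U (\<lambda>x. w x - \<phi> n x))\<^sup>2 + (l2norm U (\<lambda>x. D x - grad (\<phi> n) x))\<^sup>2) \<longlonglongrightarrow> 0"
    using tendsto_add by fastforce
  then have "eventually (\<lambda>n. (l2norm U (\<lambda>x. w x - \<phi> n x))\<^sup>2 + (l2norm U (\<lambda>x. D x - grad (\<phi> n) x))\<^sup>2 < \<epsilon>) sequentially"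
    using \<epsilon> order_tendstoD(2) by blast
  then show ?thesis using test unfolding eventually_sequentially by blast
qed

section \<open>Lipschitz functions that vanish outside the domain\<close>

definition soft_threshold :: "real \<Rightarrow> real \<Rightarrow> real" where
  "soft_threshold c s = s - max (- c) (min c s)"

lemma soft_threshold:
  assumes "c > 0"
  shows "\<bar>soft_threshold c s - soft_threshold c t\<bar> \<le> \<bar>s - t\<bar>" "\<bar>s - soft_threshold c s\<bar> \<le> c"
    "\<bar>s\<bar> < c \<Longrightarrow> soft_threshold c s = 0"
  using assms by (auto simp: soft_threshold_def max_def min_def abs_if split: if_splits)

lemma soft_threshold_DERIV:
  assumes c: "c > 0" and s: "\<bar>s\<bar> \<noteq> c"
  shows "(soft_threshold c has_real_derivative of_bool (c < \<bar>s\<bar>)) (at s)"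
proof -
  consider "\<bar>s\<bar> < c" | "s > c" | "s < - c" using s by linarith
  then show ?thesis
  proof cases
    case 1
    show ?thesis
      by (rule has_field_derivative_transform_within_open[of "\<lambda>x. 0" _ s "{- c<..<c}"])
         (use c 1 in \<open>auto simp: soft_threshold_def\<close>)
  next
    case 2
    show ?thesis
      by (rule has_field_derivative_transform_within_open[of "\<lambda>x. x - c" _ s "{c<..}"])
         (use c 2 in \<open>auto simp: soft_threshold_def intro!: derivative_eq_intros\<close>)
  next
    case 3
    show ?thesis
      by (rule has_field_derivative_transform_within_open[of "\<lambda>x. x + c" _ s "{..<- c}"])
         (use c 3 in \<open>auto simp: soft_threshold_def intro!: derivative_eq_intros\<close>)
  qed
qed

text \<open>Levels attained with positive measure are atoms of the image measure. A finite measure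
  has at most countably many atoms, while the interval of admissible levels is uncountable.\<close>

lemma null_level:
  fixes f :: "'a \<Rightarrow> real"
  assumes "finite_measure M" and f: "f \<in> borel_measurable M" and \<epsilon>: "\<epsilon> > 0"
  obtains c where "0 < c" "c < \<epsilon>" "AE x in M. f x \<noteq> c"
proof -
  interpret N: finite_measure "distr M borel f" by (rule finite_measure.finite_measure_distr[OF assms(1) f])
  have "uncountable {0<..<\<epsilon>}" using \<epsilon> by (simp add: uncountable_open_interval)
  then have "\<not> {0<..<\<epsilon>} \<subseteq> {c. measure (distr M borel f) {c} \<noteq> 0}" using N.countable_support countable_subset by blast
  then obtain c where c: "0 < c" "c < \<epsilon>" "measure (distr M borel f) {c} = 0" by auto
  then have "{c} \<in> null_sets (distr M borel f)" by (simp add: null_sets_def N.emeasure_eq_measure)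
  then have "AE y in distr M borel f. y \<notin> {c}" by (rule AE_not_in)
  from AE_distrD[OF f this] show thesis using that[OF c(1,2)] by simp
qed

text \<open>The product of u with a test function is Lipschitz with compact support, so its gradient
  has integral zero; the product rule splits this into the two sides of the weak
  formulation.\<close>

lemma lipschitz_has_weak_grad:
  fixes u :: "real^'d::finite \<Rightarrow> real" and D :: "real^'d \<Rightarrow> real^'d"
  assumes U: "open U" "bounded U" and L: "\<And>x y. \<bar>u x - u y\<bar> \<le> L * norm (x - y)" and B: "\<And>x. \<bar>u x\<bar> \<le> B"
    and D: "D \<in> borel_measurable borel" and d: "AE y in lebesgue. (u has_derivative (\<lambda>h. D y \<bullet> h)) (at y)"
  shows "has_weak_grad U u D"
  unfolding has_weak_grad_def
proof (intro conjI ballI allI)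
  have Um: "U \<in> sets lebesgue" using U by auto
  have um: "u \<in> borel_measurable lebesgue" by (intro continuous_lebesgue_measurable lipschitz_continuous[OF L])
  have Db: "AE y in lebesgue. norm (D y) \<le> L"
    using d by (rule AE_mp) (auto intro!: AE_I2 lipschitz_gradient_bound L)
  show Lu: "L2 U u"
    by (rule L2_bounded[OF measurable_restrict_space1[OF um] U(2) Um, of B]) (use B in simp)
  show LD: "L2 U D"
    by (rule L2_bounded[OF measurable_restrict_space1[OF borel_lebesgue[OF D]] U(2) Um, of L])
       (use Db in \<open>auto simp: AE_lebesgue_on[OF Um]\<close>)
  fix \<phi> i assume \<phi>: "\<phi> \<in> test_functions U"
  obtain M where M: "M \<ge> 0" "\<And>x y. \<bar>\<phi> x - \<phi> y\<bar> \<le> M * norm (x - y)"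
    by (rule test_functions_lipschitz[OF \<phi>], rule that)
  obtain C where C: "C \<ge> 0" "\<And>x. \<bar>\<phi> x\<bar> \<le> C" by (rule test_functions_bounded[OF \<phi>], rule that)
  obtain K where K: "compact K" "K \<subseteq> U" "\<And>x. x \<notin> K \<Longrightarrow> \<phi> x = 0" "\<And>x i. x \<notin> K \<Longrightarrow> partial i \<phi> x = 0"
    by (rule test_functions_support[OF \<phi>], rule that)
  define w where "w = (\<lambda>x. u x * \<phi> x)"
  define E where "E = (\<lambda>x. u x *\<^sub>R grad \<phi> x + \<phi> x *\<^sub>R D x)"
  have lip: "\<bar>w x - w y\<bar> \<le> (B * M + C * L) * norm (x - y)" for x y
  proof -
    have "w x - w y = u x * (\<phi> x - \<phi> y) + \<phi> y * (u x - u y)" by (simp add: w_def algebra_simps)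
    also have "\<bar>\<dots>\<bar> \<le> \<bar>u x\<bar> * \<bar>\<phi> x - \<phi> y\<bar> + \<bar>\<phi> y\<bar> * \<bar>u x - u y\<bar>"
      using abs_triangle_ineq[of "u x * (\<phi> x - \<phi> y)" "\<phi> y * (u x - u y)"] by (simp add: abs_mult)
    also have "\<dots> \<le> B * (M * norm (x - y)) + C * (L * norm (x - y))"
      by (intro add_mono mult_mono B M C L) (use B[of x] C in auto)
    finally show ?thesis by (simp add: algebra_simps)
  qed
  have der: "AE y in lebesgue. (w has_derivative (\<lambda>h. E y \<bullet> h)) (at y)"
    using d
  proof (rule AE_mp, intro AE_I2 impI)
    fix y assume "(u has_derivative (\<lambda>h. D y \<bullet> h)) (at y)"
    from has_derivative_mult[OF this test_functionsD(5)[OF \<phi>, of y]]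
    show "(w has_derivative (\<lambda>h. E y \<bullet> h)) (at y)"
      unfolding w_def E_def by (simp add: inner_add_left mult.commute)
  qed
  have Em: "E \<in> borel_measurable borel" unfolding E_def
    by (intro borel_measurable_add borel_measurable_scaleR D borel_measurable_continuous_onI lipschitz_continuous[OF L]
        continuous_on_vec_lambda test_functionsD(3)[OF test_functions_partial[OF \<phi>]] test_functionsD(3)[OF \<phi>])
  have E0: "E x = 0" if "x \<notin> K" for x using K(3,4)[OF that] by (simp add: E_def vec_eq_iff)
  have "(LINT y|lebesgue. E y \<bullet> axis i 1) = 0"
    by (rule integral_gradient_zero[OF lip compact_imp_bounded[OF K(1)] _ der Em E0]) (use K(3) in \<open>simp_all add: w_def\<close>)
  then have 0: "(LINT y|lebesgue. E y $ i) = 0" by (simp add: inner_axis)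
  have "(LINT x|lebesgue_on UNIV. E x $ i) = (LINT x|lebesgue_on U. E x $ i)"
  proof (rule integral_lebesgue_on_support)
    fix x assume "x \<in> UNIV - U"
    then have "x \<notin> K" using K(2) by blast
    then show "E x $ i = 0" using E0 by simp
  qed (use Um in auto)
  then have "(LINT x|lebesgue_on U. E x $ i) = 0" using 0 by (simp add: lebesgue_on_UNIV_eq)
  moreover have "(LINT x|lebesgue_on U. E x $ i) =
      (LINT x|lebesgue_on U. u x * partial i \<phi> x) + (LINT x|lebesgue_on U. D x $ i * \<phi> x)"
    unfolding E_def using Um
    by (simp add: mult.commute[of "\<phi> _"])
       (intro Bochner_Integration.integral_add L2_mult_integrable Lu L2_component[OF LD] test_functions_L2[OF \<phi>] test_functions_L2[OF test_functions_partial[OF \<phi>]] Um)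
  ultimately show "(LINT x|lebesgue_on U. u x * partial i \<phi> x) = - (LINT x|lebesgue_on U. D x $ i * \<phi> x)"
    by simp
qed

lemma l2norm_cong_AE:
  fixes u v :: "real^'d::finite \<Rightarrow> 'b::real_normed_vector"
  assumes "AE x in lebesgue_on S. norm (u x) = norm (v x)"
    "(\<lambda>x. norm (u x)) \<in> borel_measurable (lebesgue_on S)" "(\<lambda>x. norm (v x)) \<in> borel_measurable (lebesgue_on S)"
  shows "l2norm S u = l2norm S v"
proof -
  have "(LINT x|lebesgue_on S. (norm (u x))\<^sup>2) = (LINT x|lebesgue_on S. (norm (v x))\<^sup>2)"
    by (rule integral_cong_AE)
       (use assms in \<open>auto elim!: AE_mp intro!: borel_measurable_power\<close>)
  then show ?thesis by (simp add: l2norm_def)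
qed

lemma L2_norm_measurable:
  fixes u :: "real^'d \<Rightarrow> 'b::{real_normed_vector, second_countable_topology}"
  assumes "L2 S u" shows "(\<lambda>x. norm (u x)) \<in> borel_measurable (lebesgue_on S)"
  by (rule measurable_compose[OF L2_measurable[OF assms] borel_measurable_continuous_onI[OF continuous_on_norm_id]])

lemma wgrad_test_diff:
  fixes u :: "real^'d::finite \<Rightarrow> real"
  assumes U: "open U" and u: "has_weak_grad U u D" and \<phi>: "\<phi> \<in> test_functions U"
  shows "l2norm U (\<lambda>x. wgrad U u x - wgrad U \<phi> x) = l2norm U (\<lambda>x. D x - grad \<phi> x)"
proof -
  have h: "has_weak_grad U \<phi> (grad \<phi>)" by (rule has_weak_grad_test[OF \<phi> U])
  have w: "L2 U (wgrad U u)" "L2 U D" "L2 U (wgrad U \<phi>)" "L2 U (grad \<phi>)"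
  proof -
    have "H1 U u" "H1 U \<phi>" using u h unfolding H1_def by blast+
    then have "has_weak_grad U u (wgrad U u)" "has_weak_grad U \<phi> (wgrad U \<phi>)" by (auto intro: H1_wgrad)
    then show "L2 U (wgrad U u)" "L2 U D" "L2 U (wgrad U \<phi>)" "L2 U (grad \<phi>)"
      using u h unfolding has_weak_grad_def by blast+
  qed
  show ?thesis
  proof (rule l2norm_cong_AE)
    show "AE x in lebesgue_on U. norm (wgrad U u x - wgrad U \<phi> x) = norm (D x - grad \<phi> x)"
      using wgrad_eq[OF u U] wgrad_eq[OF h U] by eventually_elim simp
  qed (intro L2_norm_measurable L2_diff w)+
qed

text \<open>The soft thresholds of \<open>u\<close> have compact support and can be mollified. Only countably many
  thresholds are attained by \<open>\<bar>u\<bar>\<close> on a set of positive measure; at the others the kinks are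
  negligible.\<close>

lemma lipschitz_zero_outside_H10:
  fixes u :: "real^'d::finite \<Rightarrow> real" and D :: "real^'d \<Rightarrow> real^'d"
  assumes U: "open U" "bounded U" and L: "\<And>x y. \<bar>u x - u y\<bar> \<le> L * norm (x - y)" and u0: "\<And>x. x \<notin> U \<Longrightarrow> u x = 0"
    and D: "D \<in> borel_measurable borel" and d: "AE y in lebesgue. (u has_derivative (\<lambda>h. D y \<bullet> h)) (at y)"
    and cD: "AE y in lebesgue. isCont D y"
  shows "H10 U u" "has_weak_grad U u D"
proof -
  have Um: "U \<in> sets lebesgue" using U by auto
  interpret finite_measure "lebesgue_on U" using finite_measure_lebesgue_on_bounded U(2) Um by blast
  have uc: "continuous_on UNIV u" by (rule lipschitz_continuous[OF L])
  have "compact (u ` closure U)"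
    using uc U(2) by (intro compact_continuous_image) (auto intro: continuous_on_subset simp: compact_closure)
  then obtain B where "\<forall>y\<in>u ` closure U. norm y \<le> B" using compact_imp_bounded bounded_iff by metis
  then have B: "\<bar>u x\<bar> \<le> max B 0" for x
    using u0[of x] closure_subset[of U] by (cases "x \<in> U") (auto simp: le_max_iff_disj)
  show wg: "has_weak_grad U u D" by (rule lipschitz_has_weak_grad[OF U L B D d])
  then have LD: "L2 U u" "L2 U D" by (auto simp: has_weak_grad_def)
  have "\<exists>c. 0 < c \<and> c < 1 / real (Suc n) \<and> (AE x in lebesgue. \<bar>u x\<bar> \<noteq> c)" for n
  proof -
    have m: "(\<lambda>x. \<bar>u x\<bar>) \<in> borel_measurable (lebesgue_on U)"
      by (intro measurable_restrict_space1 continuous_lebesgue_measurable continuous_intros uc)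
    obtain c where c: "0 < c" "c < 1 / real (Suc n)" "AE x in lebesgue_on U. \<bar>u x\<bar> \<noteq> c"
      by (rule null_level[OF finite_measure_axioms m, of "1 / real (Suc n)"], simp, rule that)
    from c(3) have "AE x in lebesgue. \<bar>u x\<bar> \<noteq> c" unfolding AE_lebesgue_on[OF Um]
      by eventually_elim (use u0 c(1) in force)
    then show ?thesis using c by blast
  qed
  then obtain \<delta> where \<delta>: "\<And>n. 0 < \<delta> n" "\<And>n. \<delta> n < 1 / real (Suc n)" "\<And>n. AE x in lebesgue. \<bar>u x\<bar> \<noteq> \<delta> n" by metis
  have \<delta>0: "\<delta> \<longlonglongrightarrow> 0"
    by (rule tendsto_sandwich[OF _ _ tendsto_const LIMSEQ_Suc[OF lim_1_over_n]]) (use less_imp_le[OF \<delta>(1)] less_imp_le[OF \<delta>(2)] in \<open>simp_all del: of_nat_Suc\<close>)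
  define w where "w = (\<lambda>n x. soft_threshold (\<delta> n) (u x))"
  define G where "G = (\<lambda>n. {x. \<delta> n < \<bar>u x\<bar>})"
  define E where "E = (\<lambda>n x. indicat_real (G n) x *\<^sub>R D x)"
  define K where "K = (\<lambda>n. {x. \<delta> n \<le> \<bar>u x\<bar>})"
  have wL: "\<bar>w n x - w n y\<bar> \<le> L * norm (x - y)" for n x y
    using soft_threshold(1)[OF \<delta>(1)] L unfolding w_def by (rule order_trans)
  have KU: "K n \<subseteq> U" for n using u0 \<delta>(1)[of n] unfolding K_def by force
  have "closed (K n)" for n unfolding K_def by (intro closed_Collect_le continuous_intros uc)
  then have K: "compact (K n)" for n
    using bounded_subset[OF U(2) KU] compact_eq_bounded_closed by blast
  have w0: "w n x = 0" if "x \<notin> K n" for n x using that soft_threshold(3)[OF \<delta>(1)] by (auto simp: w_def K_def)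
  have Go: "open (G n)" "open (- K n)" for n
    using \<open>\<And>n. closed (K n)\<close> unfolding G_def by (auto intro!: open_Collect_less continuous_intros uc)
  have Em: "E n \<in> borel_measurable borel" for n
    unfolding E_def by (intro borel_measurable_scaleR D borel_measurable_indicator borel_open Go)
  have Ed: "AE y in lebesgue. (w n has_derivative (\<lambda>h. E n y \<bullet> h)) (at y)" for n
    using d \<delta>(3)[of n]
  proof eventually_elim
    case (elim y)
    from has_derivative_compose[OF elim(1) soft_threshold_DERIV[OF \<delta>(1) elim(2), unfolded has_field_derivative_def]]
    show ?case by (simp add: w_def E_def G_def indicator_def of_bool_def)
  qed
  \<comment> \<open>\<open>G n\<close> and the complement of \<open>K n\<close> are open, and what
    lies between them is the level set of \<open>\<delta> n\<close>, a null set by the choice of the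
    threshold. \<open>E n\<close> is D on the first set and 0 on the second.\<close>
  have Ec: "AE y in lebesgue. isCont (E n) y" for n
    using cD \<delta>(3)[of n]
  proof eventually_elim
    case (elim y)
    consider "y \<in> G n" | "y \<in> - K n" using elim(2) unfolding G_def K_def by fastforce
    then show ?case
    proof cases
      case 1
      have "eventually (\<lambda>x. E n x = D x) (nhds y)"
        by (rule eventually_mono[OF eventually_nhds_in_open[OF Go(1) 1]]) (simp add: E_def)
      then show ?thesis using isCont_cong elim(1) by blast
    next
      case 2
      have "eventually (\<lambda>x. E n x = 0) (nhds y)"
        by (rule eventually_mono[OF eventually_nhds_in_open[OF Go(2) 2]]) (auto simp: E_def K_def G_def)
      then show ?thesis using isCont_cong[of "E n" "\<lambda>x. 0"] by simp
    qed
  qed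
  have wb: "\<bar>w n x\<bar> \<le> \<bar>u x\<bar>" for n x
    using soft_threshold(1)[OF \<delta>(1), of n "u x" 0] soft_threshold(3)[OF \<delta>(1), of 0 n] \<delta>(1)[of n] by (simp add: w_def)
  have wB: "\<bar>w n x\<bar> \<le> max B 0" for n x using order_trans[OF wb B] .
  have wwg: "has_weak_grad U (w n) (E n)" for n
    by (rule lipschitz_has_weak_grad[OF U wL wB Em Ed])
  have um: "u \<in> borel_measurable (lebesgue_on U)" "D \<in> borel_measurable (lebesgue_on U)"
    using LD by (auto dest: L2_measurable)
  have wEm: "w n \<in> borel_measurable (lebesgue_on U)" "E n \<in> borel_measurable (lebesgue_on U)" for n
    using wwg[of n] by (auto simp: has_weak_grad_def dest: L2_measurable)
  \<comment> \<open>The pointwise limit of the gradients \<open>E n\<close>: D with the zero set of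
    u cut out. It is also a weak gradient of u, so uniqueness shows that D vanishes almost
    everywhere on the zero set, and \<open>E n\<close> converges to D itself.\<close>
  define D0 where "D0 = (\<lambda>x. (if u x = 0 then 0 else 1) *\<^sub>R D x)"
  have D0m: "D0 \<in> borel_measurable (lebesgue_on U)"
    unfolding D0_def using um by measurable
  have LD0: "L2 U D0"
  proof (rule L2_bound[OF D0m, of "\<lambda>x. (norm (D x))\<^sup>2"])
    show "integrable (lebesgue_on U) (\<lambda>x. (norm (D x))\<^sup>2)" using LD by (simp add: L2_def)
  qed (simp add: D0_def)
  have wl: "(\<lambda>n. w n x) \<longlonglongrightarrow> u x" for x
  proof -
    have "norm (w n x - u x) \<le> \<delta> n" for n using soft_threshold(2)[OF \<delta>(1)] by (simp add: w_def abs_minus_commute)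
    then have "(\<lambda>n. w n x - u x) \<longlonglongrightarrow> 0" by (intro Lim_null_comparison[OF always_eventually \<delta>0] allI)
    then show ?thesis by (rule LIM_zero_cancel)
  qed
  have El: "(\<lambda>n. E n x) \<longlonglongrightarrow> D0 x" for x
  proof (rule tendsto_eventually)
    have "eventually (\<lambda>n. \<bar>u x\<bar> > 0 \<longrightarrow> \<delta> n < \<bar>u x\<bar>) sequentially"
      using order_tendstoD(2)[OF \<delta>0] by (cases "\<bar>u x\<bar> > 0") auto
    then show "eventually (\<lambda>n. E n x = D0 x) sequentially"
    proof eventually_elim
      case (elim n)
      then show ?case using \<delta>(1)[of n] by (auto simp: E_def D0_def G_def)
    qed
  qed
  have Eb: "norm (E n x) \<le> norm (D x)" for n x by (simp add: E_def indicator_def)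
  have "has_weak_grad U u D0"
    unfolding has_weak_grad_def
  proof (intro conjI ballI allI LD0 LD)
    fix \<phi> i assume \<phi>: "\<phi> \<in> test_functions U"
    have p: "L2 U (partial i \<phi>)" "L2 U \<phi>"
      using test_functions_L2[OF \<phi> Um] test_functions_L2[OF test_functions_partial[OF \<phi>] Um] by auto
    have "(\<lambda>n. LINT x|lebesgue_on U. w n x * partial i \<phi> x) \<longlonglongrightarrow> (LINT x|lebesgue_on U. u x * partial i \<phi> x)"
    proof (rule integral_dominated_convergence[where w = "\<lambda>x. \<bar>u x * partial i \<phi> x\<bar>"])
      show "AE x in lebesgue_on U. norm (w n x * partial i \<phi> x) \<le> \<bar>u x * partial i \<phi> x\<bar>" for n
        using wb[of n] by (intro AE_I2) (simp add: abs_mult mult_right_mono)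
      show "integrable (lebesgue_on U) (\<lambda>x. \<bar>u x * partial i \<phi> x\<bar>)"
        using L2_mult_integrable[OF LD(1) p(1)] by simp
      show "AE x in lebesgue_on U. (\<lambda>n. w n x * partial i \<phi> x) \<longlonglongrightarrow> u x * partial i \<phi> x"
        by (intro AE_I2 tendsto_mult wl tendsto_const)
    qed (intro borel_measurable_times um wEm L2_measurable p)+
    moreover have "(\<lambda>n. LINT x|lebesgue_on U. E n x $ i * \<phi> x) \<longlonglongrightarrow> (LINT x|lebesgue_on U. D0 x $ i * \<phi> x)"
    proof (rule integral_dominated_convergence[where w = "\<lambda>x. \<bar>norm (D x) * \<phi> x\<bar>"])
      show "AE x in lebesgue_on U. norm (E n x $ i * \<phi> x) \<le> \<bar>norm (D x) * \<phi> x\<bar>" for n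
      proof (intro AE_I2)
        fix x
        have "\<bar>E n x $ i\<bar> \<le> norm (D x)" using component_le_norm_cart[of "E n x" i] Eb[of n x] by linarith
        then show "norm (E n x $ i * \<phi> x) \<le> \<bar>norm (D x) * \<phi> x\<bar>"
          using mult_right_mono[of _ _ "\<bar>\<phi> x\<bar>"] by (fastforce simp: abs_mult)
      qed
      have "L2 U (\<lambda>x. norm (D x))" using LD(2) L2_norm_measurable[OF LD(2)] by (simp add: L2_def)
      from L2_mult_integrable[OF this p(2)] show "integrable (lebesgue_on U) (\<lambda>x. \<bar>norm (D x) * \<phi> x\<bar>)" by simp
      show "AE x in lebesgue_on U. (\<lambda>n. E n x $ i * \<phi> x) \<longlonglongrightarrow> D0 x $ i * \<phi> x"
        by (intro AE_I2 tendsto_mult tendsto_vec_nth El tendsto_const)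
      show "(\<lambda>x. D0 x $ i * \<phi> x) \<in> borel_measurable (lebesgue_on U)"
        by (intro borel_measurable_times L2_measurable L2_component LD0 p)
      show "(\<lambda>x. E n x $ i * \<phi> x) \<in> borel_measurable (lebesgue_on U)" for n
        using wwg[of n] by (intro borel_measurable_times L2_measurable L2_component p) (simp add: has_weak_grad_def)
    qed
    moreover have "(LINT x|lebesgue_on U. w n x * partial i \<phi> x) = - (LINT x|lebesgue_on U. E n x $ i * \<phi> x)" for n
      using wwg \<phi> by (simp add: has_weak_grad_def)
    ultimately have "(\<lambda>n. - (LINT x|lebesgue_on U. E n x $ i * \<phi> x)) \<longlonglongrightarrow> (LINT x|lebesgue_on U. u x * partial i \<phi> x)"
      "(\<lambda>n. - (LINT x|lebesgue_on U. E n x $ i * \<phi> x)) \<longlonglongrightarrow> - (LINT x|lebesgue_on U. D0 x $ i * \<phi> x)"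
      by (auto intro: tendsto_minus)
    then show "(LINT x|lebesgue_on U. u x * partial i \<phi> x) = - (LINT x|lebesgue_on U. D0 x $ i * \<phi> x)"
      by (rule LIMSEQ_unique)
  qed
  then have DD0: "AE x in lebesgue_on U. D x = D0 x" by (rule has_weak_grad_unique[OF wg _ U(1)])
  have lim1: "(\<lambda>n. (l2norm U (\<lambda>x. u x - w n x))\<^sup>2) \<longlonglongrightarrow> 0"
  proof (rule l2norm_dominated_convergence[where g = "\<lambda>x. 2 * norm (u x)"])
    show "integrable (lebesgue_on U) (\<lambda>x. (2 * norm (u x))\<^sup>2)" using LD(1) by (simp add: L2_def power_mult_distrib)
    show "AE x in lebesgue_on U. norm (u x - w n x) \<le> 2 * norm (u x)" for n
    proof (intro AE_I2)
      show "norm (u x - w n x) \<le> 2 * norm (u x)" for x unfolding real_norm_def using wb[of n x] by linarith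
    qed
    have "(\<lambda>n. u x - w n x) \<longlonglongrightarrow> 0" for x using tendsto_diff[OF tendsto_const wl, of "u x" x] by simp
    then show "AE x in lebesgue_on U. (\<lambda>n. u x - w n x) \<longlonglongrightarrow> 0" by simp
  qed (intro borel_measurable_diff um wEm)
  have lim2: "(\<lambda>n. (l2norm U (\<lambda>x. D x - E n x))\<^sup>2) \<longlonglongrightarrow> 0"
  proof (rule l2norm_dominated_convergence[where g = "\<lambda>x. 2 * norm (D x)"])
    show "integrable (lebesgue_on U) (\<lambda>x. (2 * norm (D x))\<^sup>2)" using LD(2) by (simp add: L2_def power_mult_distrib)
    show "AE x in lebesgue_on U. norm (D x - E n x) \<le> 2 * norm (D x)" for n
    proof (intro AE_I2)
      show "norm (D x - E n x) \<le> 2 * norm (D x)" for x using Eb[of n x] norm_triangle_ineq4[of "D x" "E n x"] by linarith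
    qed
    show "AE x in lebesgue_on U. (\<lambda>n. D x - E n x) \<longlonglongrightarrow> 0" using DD0
    proof eventually_elim
      case (elim x)
      then show ?case using tendsto_diff[OF tendsto_const El[of x], of "D x"] by simp
    qed
  qed (intro borel_measurable_diff um wEm)
  show "H10 U u" unfolding H10_def
  proof (intro conjI allI impI)
    show "H1 U u" using wg by (auto simp: H1_def)
    fix \<epsilon> :: real assume e: "\<epsilon> > 0"
    \<comment> \<open>The thresholding error and the mollification error are combined by the squared
      triangle inequality; its factor 2 meets two errors below a quarter.\<close>
    then have e4: "\<epsilon> / 4 > 0" by simp
    have "(\<lambda>n. (l2norm U (\<lambda>x. u x - w n x))\<^sup>2 + (l2norm U (\<lambda>x. D x - E n x))\<^sup>2) \<longlonglongrightarrow> 0"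
      using tendsto_add[OF lim1 lim2] by simp
    from order_tendstoD(2)[OF this e4]
    obtain n where n: "(l2norm U (\<lambda>x. u x - w n x))\<^sup>2 + (l2norm U (\<lambda>x. D x - E n x))\<^sup>2 < \<epsilon> / 4"
      unfolding eventually_sequentially by blast
    obtain \<phi> where \<phi>: "\<phi> \<in> test_functions U"
      "(l2norm U (\<lambda>x. w n x - \<phi> x))\<^sup>2 + (l2norm U (\<lambda>x. E n x - grad \<phi> x))\<^sup>2 < \<epsilon> / 4"
      using mollify_approx[OF U wL K KU w0 Em Ed Ec e4] by blast
    have Ls: "L2 U (w n)" "L2 U (E n)" "L2 U \<phi>" "L2 U (grad \<phi>)"
      using wwg[of n] has_weak_grad_test[OF \<phi>(1) U(1)] by (auto simp: has_weak_grad_def)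
    have c: "l2norm U (\<lambda>x. \<phi> x - w n x) = l2norm U (\<lambda>x. w n x - \<phi> x)"
      "l2norm U (\<lambda>x. grad \<phi> x - E n x) = l2norm U (\<lambda>x. E n x - grad \<phi> x)"
      by (simp_all add: l2norm_def norm_minus_commute power2_commute)
    have "(l2norm U (\<lambda>x. u x - \<phi> x))\<^sup>2 + (l2norm U (\<lambda>x. D x - grad \<phi> x))\<^sup>2 < \<epsilon>"
      using l2norm_diff_sq[OF L2_diff[OF LD(1) Ls(1)] L2_diff[OF Ls(3,1)]]
        l2norm_diff_sq[OF L2_diff[OF LD(2) Ls(2)] L2_diff[OF Ls(4,2)]] n \<phi>(2) by (simp add: c)
    then show "\<exists>\<phi>\<in>test_functions U. (l2norm U (\<lambda>x. u x - \<phi> x))\<^sup>2 + (l2norm U (\<lambda>x. wgrad U u x - wgrad U \<phi> x))\<^sup>2 < \<epsilon>"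
      using wgrad_test_diff[OF U(1) wg \<phi>(1)] \<phi>(1) by (intro bexI[of _ \<phi>]) simp_all
  qed
qed

section \<open>Symmetric positive definite matrices\<close>

text \<open>The discriminant of a nonnegative quadratic polynomial. The Cauchy-Schwarz inequalities
  for matrices and for integrals are both read off from it, including the degenerate cases.\<close>

lemma discriminant_bound:
  fixes A B C :: real
  assumes q: "\<And>s. A + 2 * s * C + s\<^sup>2 * B \<ge> 0"
  shows "C\<^sup>2 \<le> A * B"
proof (cases "B = 0")
  case True
  have "C = 0"
  proof (rule ccontr)
    assume "C \<noteq> 0"
    have "A + 2 * (- (\<bar>A\<bar> + 1) / C) * C + (- (\<bar>A\<bar> + 1) / C)\<^sup>2 * B \<ge> 0" by (rule q)
    moreover have "2 * (- (\<bar>A\<bar> + 1) / C) * C = - 2 * (\<bar>A\<bar> + 1)" using \<open>C \<noteq> 0\<close> by simp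
    ultimately show False using True by simp
  qed
  then show ?thesis using True by simp
next
  case False
  have "B \<ge> 0"
  proof (rule ccontr)
    assume "\<not> B \<ge> 0"
    then have Bn: "B < 0" by simp
    define b where "b = - B"
    have b: "b > 0" using Bn by (simp add: b_def)
    \<comment> \<open>Chosen so that \<open>s\<^sup>2 * b\<close> exceeds
      \<open>A + 2 * s * C\<close>, which makes the polynomial negative at s.\<close>
    define s where "s = 1 + \<bar>A\<bar> / b + 2 * \<bar>C\<bar> / b"
    have s1: "s \<ge> 1" using b by (simp add: s_def)
    have "s * b = b + \<bar>A\<bar> + 2 * \<bar>C\<bar>" using b by (simp add: s_def field_simps)
    then have e: "s * (- B) = - B + \<bar>A\<bar> + 2 * \<bar>C\<bar>" by (simp add: b_def)
    have "s * (s * (- B)) = s * (- B) + s * \<bar>A\<bar> + 2 * s * \<bar>C\<bar>" by (subst e) (simp add: algebra_simps)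
    then have "s\<^sup>2 * B = s * B - s * \<bar>A\<bar> - 2 * s * \<bar>C\<bar>" by (simp add: power2_eq_square algebra_simps)
    moreover have "s * B < 0" using s1 Bn by (simp add: mult_pos_neg)
    moreover have "s * \<bar>A\<bar> \<ge> A" using mult_right_mono[OF s1, of "\<bar>A\<bar>"] by linarith
    moreover have "2 * s * \<bar>C\<bar> \<ge> 2 * s * C" using s1 by (simp add: mult_left_mono)
    ultimately have "A + 2 * s * C + s\<^sup>2 * B < 0" by linarith
    then show False using q[of s] by linarith
  qed
  with False have B: "B > 0" by simp
  have "A + 2 * (- C / B) * C + (- C / B)\<^sup>2 * B \<ge> 0" by (rule q)
  then have "A - C\<^sup>2 / B \<ge> 0" using B by (simp add: field_simps power2_eq_square)
  then show ?thesis using B by (simp add: field_simps)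
qed

lemma symmetric_matrix_inner:
  fixes A :: "real^'d::finite^'d"
  assumes "transpose A = A"
  shows "(A *v x) \<bullet> y = x \<bullet> (A *v y)"
  using dot_lmul_matrix[of x A y] assms by (metis transpose_matrix_vector)

text \<open>The form of A - m is positive semidefinite on S. For m the least Rayleigh quotient the
  inequality shows that a minimiser is an eigenvector; for m = 0 it is the Cauchy-Schwarz inequality
  of the energy product.\<close>

lemma matrix_Cauchy_Schwarz:
  fixes A :: "real^'d::finite^'d"
  assumes sym: "transpose A = A" and pos: "\<And>v. v \<in> S \<Longrightarrow> v \<bullet> (A *v v) \<ge> m * (v \<bullet> v)" and S: "subspace S" "x \<in> S" "y \<in> S"
  shows "(x \<bullet> (A *v y) - m * (x \<bullet> y))\<^sup>2 \<le> (x \<bullet> (A *v x) - m * (x \<bullet> x)) * (y \<bullet> (A *v y) - m * (y \<bullet> y))"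
proof (rule discriminant_bound)
  fix s
  have "(x + s *\<^sub>R y) \<in> S" using S by (simp add: subspace_add subspace_scale)
  then have "(x + s *\<^sub>R y) \<bullet> (A *v (x + s *\<^sub>R y)) - m * ((x + s *\<^sub>R y) \<bullet> (x + s *\<^sub>R y)) \<ge> 0" using pos by simp
  moreover have "y \<bullet> (A *v x) = x \<bullet> (A *v y)" using symmetric_matrix_inner[OF sym, of x y] by (simp add: inner_commute)
  ultimately show "x \<bullet> (A *v x) - m * (x \<bullet> x) + 2 * s * (x \<bullet> (A *v y) - m * (x \<bullet> y)) + s\<^sup>2 * (y \<bullet> (A *v y) - m * (y \<bullet> y)) \<ge> 0"
    by (simp add: matrix_vector_right_distrib matrix_vector_mult_scaleR inner_add power2_eq_square algebra_simps inner_commute[of y x])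
qed

text \<open>The Rayleigh quotient has a minimiser v on the compact unit sphere of S. The form of A -
  m vanishes at v, so by Cauchy-Schwarz v is orthogonal in this form to all of S, in particular to
  Av - mv, which belongs to S by invariance. Hence that vector is zero.\<close>

lemma rayleigh_minimum:
  fixes A :: "real^'d::finite^'d"
  assumes sym: "transpose A = A" and S: "subspace S" "S \<noteq> {0}" "\<And>x. x \<in> S \<Longrightarrow> A *v x \<in> S"
  obtains m v where "v \<in> S" "norm v = 1" "A *v v = m *\<^sub>R v" "\<And>x. x \<in> S \<Longrightarrow> x \<bullet> (A *v x) \<ge> m * (x \<bullet> x)"
proof -
  let ?C = "S \<inter> sphere 0 1"
  obtain x0 where x0: "x0 \<in> S" "x0 \<noteq> 0" using S subspace_0 by blast
  then have "(1 / norm x0) *\<^sub>R x0 \<in> ?C" using S(1) by (simp add: subspace_scale)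
  moreover have "compact ?C" using closed_subspace[OF S(1)] by (simp add: closed_Int_compact)
  moreover have "continuous_on ?C (\<lambda>x. x \<bullet> (A *v x))"
    by (intro continuous_intros linear_continuous_on matrix_vector_mul_bounded_linear)
  ultimately obtain v where v: "v \<in> ?C" "\<And>x. x \<in> ?C \<Longrightarrow> v \<bullet> (A *v v) \<le> x \<bullet> (A *v x)"
    using continuous_attains_inf[of ?C "\<lambda>x. x \<bullet> (A *v x)"] by blast
  define m where "m = v \<bullet> (A *v v)"
  have vv: "v \<in> S" "norm v = 1" using v by auto
  have b: "x \<bullet> (A *v x) \<ge> m * (x \<bullet> x)" if "x \<in> S" for x
  proof (cases "x = 0")
    case False
    then have "(1 / norm x) *\<^sub>R x \<in> ?C" using S(1) that by (simp add: subspace_scale)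
    from v(2)[OF this] have "m \<le> (x \<bullet> (A *v x)) / (norm x)\<^sup>2"
      by (simp add: m_def matrix_vector_mult_scaleR power2_eq_square)
    then show ?thesis using False by (simp add: pos_le_divide_eq power2_norm_eq_inner)
  qed simp
  have "A *v v = m *\<^sub>R v"
  proof -
    let ?y = "A *v v - m *\<^sub>R v"
    have y: "?y \<in> S" using S vv by (simp add: subspace_diff subspace_scale)
    have "(v \<bullet> (A *v ?y) - m * (v \<bullet> ?y))\<^sup>2 \<le> (v \<bullet> (A *v v) - m * (v \<bullet> v)) * (?y \<bullet> (A *v ?y) - m * (?y \<bullet> ?y))"
      by (rule matrix_Cauchy_Schwarz[OF sym b S(1) vv(1) y])
    also have "v \<bullet> (A *v v) - m * (v \<bullet> v) = 0"
      using vv(2) by (simp add: m_def power2_norm_eq_inner[symmetric])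
    finally have "v \<bullet> (A *v ?y) - m * (v \<bullet> ?y) = 0" by simp
    moreover have "v \<bullet> (A *v ?y) = (A *v v) \<bullet> ?y" using symmetric_matrix_inner[OF sym] by simp
    ultimately have "?y \<bullet> ?y = 0" by (simp add: inner_diff_left)
    then show ?thesis by simp
  qed
  with b vv show thesis using that by blast
qed

text \<open>The least Rayleigh quotient is an eigenvalue, and every eigenvalue is a Rayleigh
  quotient, so the \<open>LEAST\<close> in the definition exists and equals it.\<close>

lemma min_eigenvalue_bound:
  fixes A :: "real^'d::finite^'d"
  assumes sym: "transpose A = A"
  shows "x \<bullet> (A *v x) \<ge> min_eigenvalue A * (x \<bullet> x)" and "\<exists>v. norm v = 1 \<and> v \<bullet> (A *v v) = min_eigenvalue A"
proof -
  have "axis undefined 1 \<in> (UNIV :: (real^'d) set)" "(axis undefined 1 :: real^'d) \<noteq> 0" by auto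
  then have ne: "(UNIV :: (real^'d) set) \<noteq> {0}" by blast
  obtain m v where v: "norm (v :: real^'d) = 1" "A *v v = m *\<^sub>R v" "\<And>x. x \<bullet> (A *v x) \<ge> m * (x \<bullet> x)"
    using rayleigh_minimum[OF sym subspace_UNIV ne] by (metis UNIV_I)
  have "min_eigenvalue A = m" unfolding min_eigenvalue_def
  proof (rule Least_equality)
    show "\<exists>v. v \<noteq> 0 \<and> A *v v = m *\<^sub>R v" using v by (intro exI[of _ v]) auto
    fix s assume "\<exists>v. v \<noteq> 0 \<and> A *v v = s *\<^sub>R v"
    then obtain w where w: "w \<noteq> 0" "A *v w = s *\<^sub>R w" by blast
    then have "m * (w \<bullet> w) \<le> s * (w \<bullet> w)" using v(3)[of w] by simp
    then show "m \<le> s" using w by simp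
  qed
  then show "x \<bullet> (A *v x) \<ge> min_eigenvalue A * (x \<bullet> x)" "\<exists>v. norm v = 1 \<and> v \<bullet> (A *v v) = min_eigenvalue A"
    using v by (auto simp: power2_norm_eq_inner[symmetric] intro!: exI[of _ v])
qed

text \<open>Induction on the dimension. Splitting off a unit eigenvector leaves its orthogonal
  complement in S, which A maps into itself because A is symmetric.\<close>

lemma orthonormal_eigenvectors:
  fixes A :: "real^'d::finite^'d"
  assumes sym: "transpose A = A" and S: "subspace S" "\<And>x. x \<in> S \<Longrightarrow> A *v x \<in> S"
  shows "\<exists>B. finite B \<and> B \<subseteq> S \<and> (\<forall>b\<in>B. \<forall>c\<in>B. b \<bullet> c = (if b = c then 1 else 0)) \<and>
    (\<forall>b\<in>B. \<exists>m. A *v b = m *\<^sub>R b) \<and> (\<forall>x\<in>S. (\<Sum>b\<in>B. (x \<bullet> b) *\<^sub>R b) = x)"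
  using S
proof (induction "dim S" arbitrary: S rule: less_induct)
  case (less S)
  show ?case
  proof (cases "S = {0}")
    case True
    then show ?thesis by (intro exI[of _ "{}"]) auto
  next
    case False
    obtain m v where v: "v \<in> S" "norm v = 1" "A *v v = m *\<^sub>R v"
      by (rule rayleigh_minimum[OF sym less.prems(1) False less.prems(2)])
    have vv: "v \<bullet> v = 1" using v(2) by (simp add: power2_norm_eq_inner[symmetric])
    define S' where "S' = {x \<in> S. v \<bullet> x = 0}"
    have S': "subspace S'" using less.prems(1) unfolding S'_def
      by (auto simp: subspace_def inner_add_right)
    have inv: "A *v x \<in> S'" if "x \<in> S'" for x
      using that less.prems(2) v(3) symmetric_matrix_inner[OF sym, of v x] by (auto simp: S'_def)
    have "v \<notin> S'" using vv by (simp add: S'_def)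
    moreover have "S' \<subseteq> S" unfolding S'_def by blast
    ultimately have "S' \<subset> S" using v(1) by blast
    moreover have "span S' = S'" "span S = S" using S' less.prems(1) by (auto simp: span_eq_iff)
    ultimately have "dim S' < dim S" using dim_psubset by metis
    from less.hyps[OF this S' inv] obtain B where B: "finite B" "B \<subseteq> S'"
      "\<forall>b\<in>B. \<forall>c\<in>B. b \<bullet> c = (if b = c then 1 else 0)" "\<forall>b\<in>B. \<exists>m. A *v b = m *\<^sub>R b"
      "\<forall>x\<in>S'. (\<Sum>b\<in>B. (x \<bullet> b) *\<^sub>R b) = x" by blast
    have orth: "v \<bullet> b = 0" if "b \<in> B" for b using that B(2) by (auto simp: S'_def)
    then have nv: "v \<notin> B" using vv by force
    have "(\<Sum>b\<in>insert v B. (x \<bullet> b) *\<^sub>R b) = x" if "x \<in> S" for x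
    proof -
      have "x - (x \<bullet> v) *\<^sub>R v \<in> S'"
        using that v less.prems(1) vv by (auto simp: S'_def subspace_diff subspace_scale inner_diff_right inner_commute)
      with B(5) have "(\<Sum>b\<in>B. ((x - (x \<bullet> v) *\<^sub>R v) \<bullet> b) *\<^sub>R b) = x - (x \<bullet> v) *\<^sub>R v" by blast
      moreover have "(\<Sum>b\<in>B. ((x - (x \<bullet> v) *\<^sub>R v) \<bullet> b) *\<^sub>R b) = (\<Sum>b\<in>B. (x \<bullet> b) *\<^sub>R b)"
        using orth by (intro sum.cong) (auto simp: inner_diff_left)
      ultimately show ?thesis using B(1) nv by simp
    qed
    moreover have "\<forall>b\<in>insert v B. \<forall>c\<in>insert v B. b \<bullet> c = (if b = c then 1 else 0)"
      using B(3) orth nv vv by (auto simp: inner_commute)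
    ultimately show ?thesis using B v
      by (intro exI[of _ "insert v B"]) (auto simp: S'_def)
  qed
qed

lemma matrix_inv_eqI:
  fixes A B :: "real^'d::finite^'d"
  assumes "A ** B = mat 1"
  shows "matrix_inv A = B"
proof -
  have BA: "B ** A = mat 1" using assms matrix_left_right_inverse by blast
  then have "\<exists>A'. A ** A' = mat 1 \<and> A' ** A = mat 1" using assms by blast
  from someI_ex[OF this] have "A ** matrix_inv A = mat 1" unfolding matrix_inv_def by blast
  then have "B ** (A ** matrix_inv A) = B" by simp
  then show ?thesis by (simp add: matrix_mul_assoc BA)
qed

lemma sym_posdef_invertible:
  fixes A :: "real^'d::finite^'d"
  assumes "sym_posdef A"
  shows "A ** matrix_inv A = mat 1" "matrix_inv A ** A = mat 1"
proof -
  have "A *v x = 0 \<Longrightarrow> x = 0" for x using assms unfolding sym_posdef_def by (metis inner_zero_right less_irrefl)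
  then obtain B where "B ** A = mat 1" using matrix_left_invertible_ker by blast
  then have "A ** B = mat 1" using matrix_left_right_inverse by blast
  then show "A ** matrix_inv A = mat 1" "matrix_inv A ** A = mat 1"
    using matrix_inv_eqI \<open>B ** A = mat 1\<close> by auto
qed

text \<open>In an orthonormal eigenbasis the coefficient at b is divided by the square root of its
  eigenvalue \<open>m b\<close>. This witness guarantees the two properties for the matrix selected
  by the definition.\<close>

lemma inv_sqrt:
  fixes A :: "real^'d::finite^'d"
  assumes A: "sym_posdef A"
  shows "sym_posdef (inv_sqrt A)" "inv_sqrt A ** inv_sqrt A = matrix_inv A"
proof -
  have sym: "transpose A = A" and pos: "\<And>v. v \<noteq> 0 \<Longrightarrow> v \<bullet> (A *v v) > 0"
    using A by (auto simp: sym_posdef_def)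
  obtain E where E: "finite E" "\<forall>b\<in>E. \<forall>c\<in>E. b \<bullet> c = (if b = c then 1 else 0)"
    "\<forall>b\<in>E. \<exists>m. A *v b = m *\<^sub>R b" "\<And>x. (\<Sum>b\<in>E. (x \<bullet> b) *\<^sub>R b) = x"
    using orthonormal_eigenvectors[OF sym subspace_UNIV] by auto
  then obtain m where m: "\<And>b. b \<in> E \<Longrightarrow> A *v b = m b *\<^sub>R b" by metis
  have mpos: "m b > 0" if "b \<in> E" for b
  proof -
    have "b \<bullet> b = 1" using E(2) that by auto
    then have "b \<noteq> 0" by (metis inner_zero_left zero_neq_one)
    then show ?thesis using pos[of b] m[OF that] \<open>b \<bullet> b = 1\<close> by simp
  qed
  define f where "f = (\<lambda>x. \<Sum>b\<in>E. ((x \<bullet> b) / sqrt (m b)) *\<^sub>R b)"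
  have lin: "linear f"
    by (rule linearI) (simp_all add: f_def inner_add_left add_divide_distrib scaleR_add_left sum.distrib scaleR_sum_right)
  define B where "B = matrix f"
  have B: "B *v x = f x" for x unfolding B_def using matrix_vector_mul(2)[OF lin] by (rule fun_cong)
  have fx: "f x \<bullet> y = (\<Sum>b\<in>E. (x \<bullet> b) * (y \<bullet> b) / sqrt (m b))" for x y
    unfolding f_def inner_sum_left by (intro sum.cong refl) (simp add: inner_commute[of _ y])
  have fb: "f x \<bullet> b = (x \<bullet> b) / sqrt (m b)" if "b \<in> E" for x b
  proof -
    have "(\<Sum>c\<in>E. (x \<bullet> c) * (b \<bullet> c) / sqrt (m c)) = (\<Sum>c\<in>E. if c = b then (x \<bullet> c) / sqrt (m c) else 0)"
      using E(2) that by (intro sum.cong) auto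
    then show ?thesis using fx[of x b] E(1) that by simp
  qed
  have "sym_posdef B"
    unfolding sym_posdef_def
  proof (intro conjI allI impI)
    have "(transpose B *v x) \<bullet> y = (B *v x) \<bullet> y" for x y
      using dot_lmul_matrix[of x B y] by (simp add: transpose_matrix_vector B fx inner_commute[of x] mult.commute)
    then show "transpose B = B" by (metis matrix_eq vector_eq_rdot)
    fix v :: "real^'d" assume v: "v \<noteq> 0"
    have nn: "0 \<le> (v \<bullet> b) * (v \<bullet> b) / sqrt (m b)" if "b \<in> E" for b using mpos[OF that] by simp
    have "\<exists>b\<in>E. v \<bullet> b \<noteq> 0"
    proof (rule ccontr)
      assume "\<not> ?thesis"
      then have "(\<Sum>b\<in>E. (v \<bullet> b) *\<^sub>R b) = 0" by (intro sum.neutral) auto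
      then show False using E(4)[of v] v by simp
    qed
    then obtain b where b: "b \<in> E" "v \<bullet> b \<noteq> 0" by blast
    then have "0 < (v \<bullet> b) * (v \<bullet> b)" using not_real_square_gt_zero by blast
    then have "0 < (v \<bullet> b) * (v \<bullet> b) / sqrt (m b)" using mpos[OF b(1)] by simp
    then have "0 < (\<Sum>b\<in>E. (v \<bullet> b) * (v \<bullet> b) / sqrt (m b))"
      using sum_pos2[OF E(1) b(1), of "\<lambda>b. (v \<bullet> b) * (v \<bullet> b) / sqrt (m b)"] nn by blast
    then show "0 < v \<bullet> (B *v v)" by (simp add: B inner_commute[of v] fx)
  qed
  moreover have "B ** B = matrix_inv A"
  proof (rule matrix_inv_eqI[symmetric])
    have "A *v (f (f x)) = x" for x
    proof -
      have "A *v (f (f x)) = (\<Sum>b\<in>E. ((f x \<bullet> b) / sqrt (m b)) *\<^sub>R (A *v b))"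
      proof -
        have "f (f x) = (\<Sum>b\<in>E. ((f x \<bullet> b) / sqrt (m b)) *\<^sub>R b)" by (simp only: f_def)
        then show ?thesis by (simp only: linear_sum[OF matrix_vector_mul_linear] matrix_vector_mult_scaleR)
      qed
      also have "\<dots> = (\<Sum>b\<in>E. (x \<bullet> b) *\<^sub>R b)"
      proof (intro sum.cong refl)
        fix b assume b: "b \<in> E"
        have "sqrt (m b) * sqrt (m b) = m b" using mpos[OF b] by simp
        then have "(f x \<bullet> b) / sqrt (m b) * m b = x \<bullet> b"
          using mpos[OF b] by (simp add: fb[OF b])
        then show "((f x \<bullet> b) / sqrt (m b)) *\<^sub>R (A *v b) = (x \<bullet> b) *\<^sub>R b" by (simp add: m[OF b])
      qed
      finally show ?thesis using E(4) by simp
    qed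
    then have "(A ** (B ** B)) *v x = mat 1 *v x" for x
      by (simp add: matrix_vector_mul_assoc[symmetric] B)
    then show "A ** (B ** B) = mat 1" by (metis matrix_eq)
  qed
  ultimately have "\<exists>B. sym_posdef B \<and> B ** B = matrix_inv A" by blast
  from someI_ex[OF this] show "sym_posdef (inv_sqrt A)" "inv_sqrt A ** inv_sqrt A = matrix_inv A"
    unfolding inv_sqrt_def by blast+
qed

text \<open>With \<open>z = matrix_inv A *v w\<close> the squared norm is the energy of z, and
  \<open>w \<bullet> v\<close> is the energy product of z and v, so the second claim is
  Cauchy-Schwarz. It is the inequality that pairs the flux defect with the gradient of a test
  function.\<close>

lemma norm_inv_sqrt:
  fixes A :: "real^'d::finite^'d"
  assumes A: "sym_posdef A"
  shows "(norm (inv_sqrt A *v w))\<^sup>2 = w \<bullet> (matrix_inv A *v w)"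
    and "(w \<bullet> v)\<^sup>2 \<le> (norm (inv_sqrt A *v w))\<^sup>2 * (v \<bullet> (A *v v))"
    and "(\<And>v. c * (v \<bullet> v) \<le> v \<bullet> (A *v v)) \<Longrightarrow> c > 0 \<Longrightarrow> (norm (inv_sqrt A *v w))\<^sup>2 \<le> (norm w)\<^sup>2 / c"
proof -
  note B = inv_sqrt[OF A]
  have symB: "transpose (inv_sqrt A) = inv_sqrt A" and symA: "transpose A = A"
    using A B by (auto simp: sym_posdef_def)
  show 1: "(norm (inv_sqrt A *v w))\<^sup>2 = w \<bullet> (matrix_inv A *v w)"
    unfolding power2_norm_eq_inner symmetric_matrix_inner[OF symB] B(2)[symmetric] by (simp add: matrix_vector_mul_assoc)
  define z where "z = matrix_inv A *v w"
  have w: "w = A *v z" unfolding z_def matrix_vector_mul_assoc sym_posdef_invertible[OF A] by simp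
  have "w \<bullet> z = z \<bullet> (A *v z)" by (subst w) (rule inner_commute)
  then have zz: "(norm (inv_sqrt A *v w))\<^sup>2 = z \<bullet> (A *v z)" unfolding 1 z_def[symmetric] .
  have nn: "v \<bullet> (A *v v) \<ge> 0 * (v \<bullet> v)" for v using A unfolding sym_posdef_def by (cases "v = 0") (auto simp: less_imp_le)
  have "(z \<bullet> (A *v v) - 0 * (z \<bullet> v))\<^sup>2 \<le> (z \<bullet> (A *v z) - 0 * (z \<bullet> z)) * (v \<bullet> (A *v v) - 0 * (v \<bullet> v))"
    by (rule matrix_Cauchy_Schwarz[OF symA nn subspace_UNIV]) auto
  then show "(w \<bullet> v)\<^sup>2 \<le> (norm (inv_sqrt A *v w))\<^sup>2 * (v \<bullet> (A *v v))"
    unfolding zz using symmetric_matrix_inner[OF symA, of z v] w by simp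
  show "(norm (inv_sqrt A *v w))\<^sup>2 \<le> (norm w)\<^sup>2 / c" if c: "\<And>v. c * (v \<bullet> v) \<le> v \<bullet> (A *v v)" "c > 0"
  proof -
    have a: "z \<bullet> (A *v z) \<le> norm z * norm w" using w norm_cauchy_schwarz by metis
    have "c * (norm z)\<^sup>2 \<le> norm z * norm w" using c(1)[of z] a by (simp add: power2_norm_eq_inner)
    then have "norm z \<le> norm w / c"
      using c(2) by (cases "z = 0") (auto simp: power2_eq_square field_simps)
    then have "norm z * norm w \<le> norm w / c * norm w" by (rule mult_right_mono) simp
    then show ?thesis using a zz by (simp add: power2_eq_square)
  qed
qed

section \<open>Divergence theorem on a simplex\<close>

lemma nn_integral_lborel_translate:
  fixes f :: "'a::euclidean_space \<Rightarrow> ennreal"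
  assumes [measurable]: "f \<in> borel_measurable borel"
  shows "(\<integral>\<^sup>+x. f (x + c) \<partial>lborel) = (\<integral>\<^sup>+x. f x \<partial>lborel)"
proof -
  have "(\<integral>\<^sup>+x. f x \<partial>lborel) = (\<integral>\<^sup>+x. f x \<partial>distr lborel borel ((+) c))" by (simp add: lborel_distr_plus)
  also have "\<dots> = (\<integral>\<^sup>+x. f (c + x) \<partial>lborel)" by (rule nn_integral_distr) auto
  finally show ?thesis by (simp add: add.commute)
qed

text \<open>Comparing the double integrals of \<open>1\<^sub>A(x + R y) 1\<^sub>B(R y)\<close> in both orders, with \<open>B\<close> the unit
  ball, shows that the translation invariant image measure is Lebesgue measure.\<close>

lemma orthogonal_distr_lborel:
  fixes R :: "'a::euclidean_space \<Rightarrow> 'a"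
  assumes R: "orthogonal_transformation R"
  shows "distr lborel borel R = lborel"
proof (rule measure_eqI)
  have lin: "linear R" using R by (rule orthogonal_transformation_linear)
  have [measurable]: "R \<in> borel_measurable borel"
    using lin by (intro borel_measurable_continuous_onI linear_continuous_on) (simp add: linear_conv_bounded_linear)
  fix A :: "'a set" assume "A \<in> sets (distr lborel borel R)"
  then have [measurable]: "A \<in> sets borel" by simp
  define B where "B = ball (0 :: 'a) 1"
  have [measurable]: "B \<in> sets borel" by (simp add: B_def)
  obtain S where S: "\<And>x. R (S x) = x"
    using orthogonal_transformation_surj[OF R] by (metis surj_def)
  have B: "R y \<in> B \<longleftrightarrow> y \<in> B" "y - x \<in> B \<longleftrightarrow> x - y \<in> B" for x y
    using orthogonal_transformation_norm[OF R, of y] by (auto simp: B_def norm_minus_commute)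
  have "emeasure lborel A * emeasure lborel B = (\<integral>\<^sup>+y. (\<integral>\<^sup>+x. indicator A x \<partial>lborel) * indicator B (R y) \<partial>lborel)"
  proof -
    have "indicator B (R y) = (indicator B y :: ennreal)" for y using B(1) by (simp add: indicator_def)
    then have "(\<integral>\<^sup>+y. (\<integral>\<^sup>+x. indicator A x \<partial>lborel) * indicator B (R y) \<partial>lborel) =
        (\<integral>\<^sup>+y. emeasure lborel A * indicator B y \<partial>lborel)" by simp
    also have "\<dots> = emeasure lborel A * emeasure lborel B" by (rule nn_integral_cmult_indicator) simp
    finally show ?thesis by simp
  qed
  also have "\<dots> = (\<integral>\<^sup>+y. (\<integral>\<^sup>+x. indicator A (x + R y) * indicator B (R y) \<partial>lborel) \<partial>lborel)"
    by (intro nn_integral_cong) (simp add: nn_integral_multc nn_integral_lborel_translate[of "indicator A"])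
  also have "\<dots> = (\<integral>\<^sup>+x. (\<integral>\<^sup>+y. indicator A (x + R y) * indicator B (R y) \<partial>lborel) \<partial>lborel)"
    by (rule lborel_pair.Fubini') measurable
  \<comment> \<open>Translating y by \<open>- S x\<close> turns \<open>R y\<close> into
    \<open>R y - x\<close>. From here on x occurs only in the indicator of the ball, and the inner
    integral over x is the measure of the ball.\<close>
  also have "\<dots> = (\<integral>\<^sup>+x. (\<integral>\<^sup>+y. indicator A (R y) * indicator B (R y - x) \<partial>lborel) \<partial>lborel)"
  proof (rule nn_integral_cong)
    fix x
    have "R (y + - S x) = R y - x" for y using S[of x] lin by (simp add: linear_diff)
    then show "(\<integral>\<^sup>+y. indicator A (x + R y) * indicator B (R y) \<partial>lborel) = (\<integral>\<^sup>+y. indicator A (R y) * indicator B (R y - x) \<partial>lborel)"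
      using nn_integral_lborel_translate[of "\<lambda>y. indicator A (x + R y) * indicator B (R y)" "- S x"] by simp
  qed
  also have "\<dots> = (\<integral>\<^sup>+y. (\<integral>\<^sup>+x. indicator A (R y) * indicator B (R y - x) \<partial>lborel) \<partial>lborel)"
    by (rule lborel_pair.Fubini') measurable
  also have "\<dots> = (\<integral>\<^sup>+y. indicator A (R y) * emeasure lborel B \<partial>lborel)"
  proof (rule nn_integral_cong)
    fix y
    have "(\<integral>\<^sup>+x. indicator A (R y) * indicator B (R y - x) \<partial>lborel) = indicator A (R y) * (\<integral>\<^sup>+x. indicator B (x + - R y) \<partial>lborel)"
      using B(2)[of "R y"] by (subst nn_integral_cmult[symmetric]) (auto simp: indicator_def intro!: nn_integral_cong)
    then show "(\<integral>\<^sup>+x. indicator A (R y) * indicator B (R y - x) \<partial>lborel) = indicator A (R y) * emeasure lborel B"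
      using nn_integral_lborel_translate[of "indicator B" "- R y"] by simp
  qed
  also have "\<dots> = emeasure (distr lborel borel R) A * emeasure lborel B"
  proof -
    have "(\<integral>\<^sup>+y. indicator A (R y) \<partial>lborel) = emeasure (distr lborel borel R) A"
    proof -
      have "emeasure (distr lborel borel R) A = (\<integral>\<^sup>+y. indicator A y \<partial>distr lborel borel R)" by simp
      also have "\<dots> = (\<integral>\<^sup>+y. indicator A (R y) \<partial>lborel)" by (rule nn_integral_distr) auto
      finally show ?thesis by simp
    qed
    then show ?thesis by (simp add: nn_integral_multc)
  qed
  finally have "emeasure lborel A * emeasure lborel B = emeasure (distr lborel borel R) A * emeasure lborel B" .
  moreover have "emeasure lborel B \<noteq> \<infinity>" unfolding B_def using emeasure_lborel_ball_finite[of 0 1] by (simp add: less_top)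
  moreover have "emeasure lborel B \<noteq> 0"
  proof
    assume "emeasure lborel B = 0"
    then have "negligible B" by (auto simp: negligible_iff_null_sets null_sets_completion_iff B_def null_sets_def)
    then show False using open_not_negligible[of B] by (simp add: B_def)
  qed
  ultimately show "emeasure (distr lborel borel R) A = emeasure lborel A"
    by (simp add: mult.commute[of _ "emeasure lborel B"] ennreal_mult_cancel_left)
qed simp

text \<open>The substitution fixes the hyperplane orthogonal to n and multiplies by
  \<open>- \<eta>\<close> along n. The reflection is wanted because the prism over a face stands
  outside the simplex, while the strip to be compared with it lies inside. A rotation reduces the
  claim to scaling one coordinate.\<close>

lemma stretch_integral:
  fixes n :: "real^'d::finite" and f :: "real^'d \<Rightarrow> real"
  assumes n: "norm n = 1" and f[measurable]: "f \<in> borel_measurable borel" and \<eta>: "\<eta> > 0"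
  shows "integral\<^sup>L lborel f = \<eta> * (LINT x|lborel. f (x - ((1 + \<eta>) * (n \<bullet> x)) *\<^sub>R n))"
proof -
  obtain k :: 'd where True by blast
  let ?k = "axis k 1 :: real^'d"
  obtain R :: "real^'d \<Rightarrow> real^'d" where R: "orthogonal_transformation R" "R ?k = n"
    using orthogonal_transformation_exists_1[of ?k n] n by (auto simp: norm_axis_1)
  have lin: "linear R" using R(1) by (rule orthogonal_transformation_linear)
  have [measurable]: "R \<in> borel_measurable borel"
    using lin by (intro borel_measurable_continuous_onI linear_continuous_on) (simp add: linear_conv_bounded_linear)
  have inv: "integral\<^sup>L lborel g = (LINT x|lborel. g (R x))" if [measurable]: "g \<in> borel_measurable borel" for g :: "real^'d \<Rightarrow> real"
    by (subst orthogonal_distr_lborel[OF R(1), symmetric]) (simp add: integral_distr)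
  define c where "c = (\<lambda>j::real^'d. if j = ?k then - \<eta> else 1)"
  define T where "T = (\<lambda>x. 0 + (\<Sum>j\<in>Basis. (c j * (x \<bullet> j)) *\<^sub>R j))"
  have kB: "?k \<in> Basis" by (simp add: axis_in_Basis_iff)
  have Tx: "T x = x - ((1 + \<eta>) * (x \<bullet> ?k)) *\<^sub>R ?k" for x
  proof -
    have "(c j * (x \<bullet> j)) *\<^sub>R j = (x \<bullet> j) *\<^sub>R j - (if j = ?k then ((1 + \<eta>) * (x \<bullet> j)) *\<^sub>R j else 0)" for j
      by (simp add: c_def algebra_simps)
    then show ?thesis unfolding T_def using kB by (simp add: sum_subtractf euclidean_representation)
  qed
  have [measurable]: "T \<in> borel_measurable borel"
    unfolding Tx[abs_def] by (intro borel_measurable_continuous_onI continuous_intros)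
  have c0: "c j \<noteq> 0" for j using \<eta> by (simp add: c_def)
  have "(\<Prod>j\<in>Basis. \<bar>c j\<bar>) = (\<Prod>j\<in>Basis. if j = ?k then \<eta> else 1)"
    using \<eta> by (intro prod.cong) (auto simp: c_def)
  then have pc: "(\<Prod>j\<in>Basis. \<bar>c j\<bar>) = \<eta>" using kB by simp
  have T: "lborel = density (distr lborel borel T) (\<lambda>_. ennreal \<eta>)"
    unfolding T_def pc[symmetric] by (rule lborel_affine_euclidean[OF c0])
  have "integral\<^sup>L lborel g = \<eta> * (LINT x|lborel. g (T x))" if [measurable]: "g \<in> borel_measurable borel" for g :: "real^'d \<Rightarrow> real"
    by (subst T) (use \<eta> in \<open>simp add: integral_density integral_distr\<close>)
  from this[of "\<lambda>x. f (R x)"] have "integral\<^sup>L lborel f = \<eta> * (LINT x|lborel. f (R (T x)))"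
    using inv[OF f] by simp
  moreover have "R (T x) = R x - ((1 + \<eta>) * (n \<bullet> R x)) *\<^sub>R n" for x
  proof -
    have "n \<bullet> R x = x \<bullet> ?k" using R by (metis inner_commute orthogonal_transformation_def)
    then show ?thesis unfolding Tx using R(2) lin by (simp add: linear_diff linear_scale)
  qed
  moreover have "(LINT x|lborel. f (x - ((1 + \<eta>) * (n \<bullet> x)) *\<^sub>R n)) = (LINT x|lborel. f (R x - ((1 + \<eta>) * (n \<bullet> R x)) *\<^sub>R n))"
    by (rule inv) measurable
  ultimately show ?thesis by simp
qed

section \<open>Integrals over flat faces\<close>

definition prism :: "real^'d \<Rightarrow> (real^'d) set \<Rightarrow> (real^'d) set" where
  "prism n e = {x + s *\<^sub>R n |x s. x \<in> e \<and> 0 \<le> s \<and> s \<le> 1}"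

text \<open>All points of a flat face have the same height along n, so the base point chosen in the
  definition can be replaced by any other point of the face.\<close>

lemma face_integral_prism:
  assumes flat: "\<forall>x\<in>e. \<forall>y\<in>e. n \<bullet> (x - y) = 0" and a: "a \<in> e"
  shows "face_integral n e g = (LINT y|lebesgue_on (prism n e). g (y - (n \<bullet> (y - a)) *\<^sub>R n))"
proof -
  define b where "b = (SOME a. a \<in> e)"
  have "b \<in> e" unfolding b_def using a by (rule someI)
  then have "n \<bullet> (a - b) = 0" using flat a by blast
  then have "n \<bullet> (y - b) = n \<bullet> (y - a)" for y by (simp add: inner_diff_right)
  then show ?thesis unfolding face_integral_def prism_def b_def by simp
qed

lemma prism_projection:
  fixes n :: "real^'d::finite"
  assumes flat: "\<forall>x\<in>e. \<forall>y\<in>e. n \<bullet> (x - y) = 0" and n: "norm n = 1" and a: "a \<in> e"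
  shows "z \<in> prism n e \<longleftrightarrow> z - (n \<bullet> (z - a)) *\<^sub>R n \<in> e \<and> 0 \<le> n \<bullet> (z - a) \<and> n \<bullet> (z - a) \<le> 1"
proof
  have nn: "n \<bullet> n = 1" using n by (simp add: power2_norm_eq_inner[symmetric])
  assume "z \<in> prism n e"
  then obtain x s where x: "z = x + s *\<^sub>R n" "x \<in> e" "0 \<le> s" "s \<le> 1" by (auto simp: prism_def)
  have "n \<bullet> (x - a) = 0" using flat x(2) a by blast
  then have "n \<bullet> (z - a) = s" using nn x(1) by (simp add: inner_add_right inner_diff_right)
  then show "z - (n \<bullet> (z - a)) *\<^sub>R n \<in> e \<and> 0 \<le> n \<bullet> (z - a) \<and> n \<bullet> (z - a) \<le> 1" using x by simp
next
  assume "z - (n \<bullet> (z - a)) *\<^sub>R n \<in> e \<and> 0 \<le> n \<bullet> (z - a) \<and> n \<bullet> (z - a) \<le> 1"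
  then show "z \<in> prism n e" unfolding prism_def
    by (intro CollectI exI[of _ "z - (n \<bullet> (z - a)) *\<^sub>R n"] exI[of _ "n \<bullet> (z - a)"]) simp
qed

lemma compact_convex_prism:
  assumes "compact e" "convex e"
  shows "compact (prism n e)" "convex (prism n e)"
proof -
  have "prism n e = {x + y |x y. x \<in> e \<and> y \<in> (\<lambda>s. s *\<^sub>R n) ` {0..1}}" unfolding prism_def
    by (force simp: image_iff)
  moreover have "(\<lambda>s. s *\<^sub>R n) ` {0..1::real} = closed_segment 0 n" by (auto simp: closed_segment_def)
  ultimately have e: "prism n e = {x + y |x y. x \<in> e \<and> y \<in> closed_segment 0 n}" by simp
  show "compact (prism n e)" unfolding e by (rule compact_sums[OF assms(1) compact_segment])
  have "prism n e = (\<Union>x\<in>e. \<Union>y\<in>closed_segment 0 n. {x + y})" unfolding e by auto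
  then show "convex (prism n e)" using convex_sums[OF assms(2) convex_closed_segment] by simp
qed

lemma face_integral_cong:
  fixes n :: "real^'d::finite"
  assumes flat: "\<forall>x\<in>e. \<forall>y\<in>e. n \<bullet> (x - y) = 0" and n: "norm n = 1"
    and fg: "\<And>x. x \<in> e \<Longrightarrow> f x = g x"
  shows "face_integral n e f = face_integral n e g"
proof (cases "e = {}")
  case True
  have "space (lebesgue_on ({} :: (real^'d) set)) = {}" by simp
  then show ?thesis using True by (simp add: face_integral_def)
next
  case False
  then obtain a where a: "a \<in> e" by blast
  show ?thesis
  proof (rule trans[OF face_integral_prism[OF flat a] trans[OF _ face_integral_prism[OF flat a, symmetric]]])
    show "(LINT y|lebesgue_on (prism n e). f (y - (n \<bullet> (y - a)) *\<^sub>R n)) =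
        (LINT y|lebesgue_on (prism n e). g (y - (n \<bullet> (y - a)) *\<^sub>R n))"
      by (rule Bochner_Integration.integral_cong) (use prism_projection[OF flat n a] fg in auto)
  qed
qed

lemma face_integral_cmult: "face_integral n e (\<lambda>x. c * g x) = c * face_integral n e g"
  by (simp add: face_integral_def)

text \<open>The prism in direction -n is the prism in direction n translated by -n, and the
  integrand is constant along n. The two elements at a face, with opposite normals, thus see the
  same surface integral.\<close>

lemma face_integral_uminus:
  fixes n :: "real^'d::finite"
  assumes flat: "\<forall>x\<in>e. \<forall>y\<in>e. n \<bullet> (x - y) = 0" and n: "norm n = 1" and e: "compact e" "convex e"
    and g: "continuous_on UNIV g"
  shows "face_integral (- n) e g = face_integral n e g"
proof (cases "e = {}")
  case True
  then show ?thesis by (simp add: face_integral_def)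
next
  case False
  then obtain a where a: "a \<in> e" by blast
  have nn: "n \<bullet> n = 1" using n by (simp add: power2_norm_eq_inner[symmetric])
  have flat': "\<forall>x\<in>e. \<forall>y\<in>e. (- n) \<bullet> (x - y) = 0" using flat by simp
  have P: "prism n e \<in> sets lebesgue" "prism (- n) e \<in> sets lebesgue"
    using compact_convex_prism(1)[OF e] by (auto intro: compact_sets_lebesgue)
  define h where "h = (\<lambda>y. indicator (prism (- n) e) y * g (y - (n \<bullet> (y - a)) *\<^sub>R n))"
  have hm: "h \<in> borel_measurable lebesgue"
  proof -
    have "(\<lambda>y. g (y - (n \<bullet> (y - a)) *\<^sub>R n)) \<in> borel_measurable lebesgue"
      by (intro continuous_lebesgue_measurable continuous_on_compose2[OF g] continuous_intros) auto
    then show ?thesis unfolding h_def using P by simp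
  qed
  have "z + (- n) \<in> prism (- n) e \<longleftrightarrow> z \<in> prism n e" for z
    unfolding prism_def
  proof safe
    fix x and s :: real assume "z + - n = x + s *\<^sub>R - n" "x \<in> e" "0 \<le> s" "s \<le> 1"
    then have "z = x + (1 - s) *\<^sub>R n" by (simp add: algebra_simps)
    then show "\<exists>x s. z = x + s *\<^sub>R n \<and> x \<in> e \<and> 0 \<le> s \<and> s \<le> 1"
      using \<open>x \<in> e\<close> \<open>0 \<le> s\<close> \<open>s \<le> 1\<close> by (intro exI[of _ x] exI[of _ "1 - s"]) simp
  next
    fix x and s :: real assume "x \<in> e" "0 \<le> s" "s \<le> 1"
    then show "\<exists>x' s'. x + s *\<^sub>R n + - n = x' + s' *\<^sub>R - n \<and> x' \<in> e \<and> 0 \<le> s' \<and> s' \<le> 1"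
      by (intro exI[of _ x] exI[of _ "1 - s"]) (simp add: algebra_simps)
  qed
  moreover have "z + - n - (n \<bullet> (z + - n - a)) *\<^sub>R n = z - (n \<bullet> (z - a)) *\<^sub>R n" for z
  proof -
    have "n \<bullet> (z + - n - a) = n \<bullet> (z - a) - 1" using nn by (simp add: inner_diff_right inner_add_right)
    then show ?thesis by (simp only: scaleR_diff_left) simp
  qed
  ultimately have hz: "h (z + - n) = indicator (prism n e) z * g (z - (n \<bullet> (z - a)) *\<^sub>R n)" for z
    by (simp only: h_def indicator_def)
  have "face_integral (- n) e g = integral\<^sup>L lebesgue h"
    unfolding face_integral_prism[of e "- n" a, OF flat' a] integrable_indicator_lebesgue_on[OF P(2)] h_def by simp
  also have "\<dots> = (LINT z|lebesgue. h (z + - n))" by (rule lebesgue_integral_translate(1)[OF hm, symmetric])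
  also have "\<dots> = face_integral n e g"
    unfolding face_integral_prism[of e n a, OF flat a] integrable_indicator_lebesgue_on[OF P(1)] hz by simp
  finally show ?thesis .
qed

context full_simplex
begin

abbreviation facet :: "real^'d \<Rightarrow> (real^'d) set" where "facet v \<equiv> convex hull (V - {v})"

lemma facet_flat:
  assumes v: "v \<in> V"
  shows "\<forall>x\<in>facet v. \<forall>y\<in>facet v. nrm v \<bullet> (x - y) = 0"
proof (intro ballI)
  fix x y assume xy: "x \<in> facet v" "y \<in> facet v"
  have "facet v \<subseteq> convex hull V" by (simp add: hull_mono)
  then have "nrm v \<bullet> (x - y) \<le> 0" "nrm v \<bullet> (y - x) \<le> 0" using nrm_outer[OF v] xy by blast+
  then show "nrm v \<bullet> (x - y) = 0" by (simp add: inner_diff_right)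
qed

lemma facet_nonempty: "v \<in> V \<Longrightarrow> facet v \<noteq> {}"
proof -
  assume "v \<in> V"
  then have "card (V - {v}) = CARD('d)" using card_V by (simp add: card_Diff_singleton)
  then have "V - {v} \<noteq> {}" by (metis card.empty zero_less_card_finite less_irrefl)
  then show ?thesis by simp
qed

lemma bary_height:
  assumes v: "v \<in> V" and a: "a \<in> facet v"
  shows "bary V v x = - (norm (bary_grad V v) * (nrm v \<bullet> (x - a)))"
proof -
  have "bary V v (a + (x - a)) = bary_grad V v \<bullet> (x - a)" unfolding bary_affine using bary_facet[OF v a] by simp
  then show ?thesis by (subst (asm) bary_grad_nrm[OF v]) simp
qed

lemma facet_eq: "v \<in> V \<Longrightarrow> facet v = {x \<in> convex hull V. bary V v x = 0}"
  using hull_eq[of "V - {v}"] simplex_eq by auto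

lemma compact_simplex_hull: "compact (convex hull V)" "compact (facet v)"
  using finite_V by (auto intro: finite_imp_compact_convex_hull)

lemma continuous_bounded_on_simplex:
  fixes f :: "real^'d \<Rightarrow> 'b::real_normed_vector"
  assumes "continuous_on UNIV f"
  obtains M where "\<And>x. x \<in> convex hull V \<Longrightarrow> norm (f x) \<le> M"
proof -
  have "compact (f ` (convex hull V))"
    by (rule compact_continuous_image[OF continuous_on_subset[OF assms subset_UNIV] compact_simplex_hull(1)])
  then show thesis using that compact_imp_bounded bounded_iff by (metis imageI)
qed

lemma integrable_on_simplex:
  fixes f :: "real^'d \<Rightarrow> real"
  assumes f: "continuous_on UNIV f"
  shows "integrable (lebesgue_on (convex hull V)) f"
proof -
  have "bounded (convex hull V)" "convex hull V \<in> sets lebesgue"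
    using compact_simplex_hull(1) compact_imp_bounded by (auto intro: compact_sets_lebesgue)
  then interpret finite_measure "lebesgue_on (convex hull V)" by (rule finite_measure_lebesgue_on_bounded)
  obtain M where "\<And>x. x \<in> convex hull V \<Longrightarrow> norm (f x) \<le> M"
    by (rule continuous_bounded_on_simplex[OF f], rule that)
  then have "AE x in lebesgue_on (convex hull V). norm (f x) \<le> M" by (intro AE_I2) auto
  then show ?thesis
    by (rule integrable_const_bound) (rule measurable_restrict_space1[OF continuous_lebesgue_measurable[OF f]])
qed

text \<open>The surface integral is the limit of volume integrals over strips of thickness
  \<open>\<eta> k\<close> inside the simplex, divided by the thickness. Reflected to the outside and
  stretched to height 1, the strips converge to the prism at every point off its frontier, and the
  frontier of a convex set is negligible.\<close>

lemma thin_strip_limit: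
  fixes g :: "real^'d \<Rightarrow> real"
  assumes v: "v \<in> V" and g: "continuous_on UNIV g" and \<eta>: "\<eta> \<longlonglongrightarrow> 0" "\<And>k. 0 < \<eta> k" "\<And>k. \<eta> k \<le> 1" and a: "a \<in> facet v"
  shows "(\<lambda>k. (1 / \<eta> k) * (LINT x|lebesgue. indicator {x \<in> convex hull V. nrm v \<bullet> (x - a) > - \<eta> k} x * g x))
     \<longlonglongrightarrow> face_integral (nrm v) (facet v) g"
proof -
  let ?n = "nrm v" and ?t = "convex hull V" and ?F = "facet v"
  have nn: "?n \<bullet> ?n = 1" using norm_nrm[OF v] by (simp add: power2_norm_eq_inner[symmetric])
  note flat = facet_flat[OF v]
  note P = prism_projection[OF flat norm_nrm[OF v] a]
  define A where "A = (\<lambda>k. {x \<in> ?t. ?n \<bullet> (x - a) > - \<eta> k})"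
  define pr where "pr = (\<lambda>z. z - (?n \<bullet> (z - a)) *\<^sub>R ?n)"
  \<comment> \<open>\<open>pr\<close> gives the foot point in the hyperplane of the facet;
    \<open>\<Phi> k\<close> sends the point at height s to depth \<open>\<eta> k * s\<close> under
    the same foot point.\<close>
  define \<Phi> where "\<Phi> = (\<lambda>k z. z - ((1 + \<eta> k) * (?n \<bullet> (z - a))) *\<^sub>R ?n)"
  have hgt: "?n \<bullet> (x - a) \<le> 0" if "x \<in> ?t" for x using nrm_outer[OF v that a] .
  have \<Phi>h: "?n \<bullet> (\<Phi> k z - a) = - (\<eta> k * (?n \<bullet> (z - a)))" for k z
    using nn by (simp add: \<Phi>_def inner_diff_right algebra_simps)
  have \<Phi>pr: "\<Phi> k z = pr z - (\<eta> k * (?n \<bullet> (z - a))) *\<^sub>R ?n" for k z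
    by (simp add: \<Phi>_def pr_def algebra_simps)
  have prh: "?n \<bullet> (pr z - a) = 0" for z using nn by (simp add: pr_def inner_diff_right algebra_simps)
  have Ab: "A k \<in> sets borel" for k
  proof -
    have "closed ?t" using compact_simplex_hull compact_imp_closed by blast
    moreover have "open {x. ?n \<bullet> (x - a) > - \<eta> k}" by (intro open_Collect_less continuous_intros)
    moreover have "A k = ?t \<inter> {x. ?n \<bullet> (x - a) > - \<eta> k}" by (auto simp: A_def)
    ultimately show ?thesis by auto
  qed
  define h where "h = (\<lambda>k x. indicator (A k) x * g x)"
  obtain M where "\<And>x. x \<in> ?t \<Longrightarrow> norm (g x) \<le> M"
    by (rule continuous_bounded_on_simplex[OF g], rule that)
  then have M: "\<bar>g x\<bar> \<le> \<bar>M\<bar>" if "x \<in> ?t" for x using that by fastforce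
  have gm[measurable]: "g \<in> borel_measurable borel" by (rule borel_measurable_continuous_onI[OF g])
  have hb[measurable]: "h k \<in> borel_measurable borel" for k unfolding h_def using Ab by simp
  have \<Phi>b: "\<Phi> k \<in> borel_measurable borel" for k unfolding \<Phi>_def
    by (intro borel_measurable_continuous_onI continuous_intros)
  have hPi: "(\<lambda>z. h k (\<Phi> k z)) \<in> borel_measurable lebesgue" for k
    by (rule borel_lebesgue[OF measurable_compose[OF \<Phi>b hb]])
  have sub: "(1 / \<eta> k) * integral\<^sup>L lebesgue (h k) = (LINT z|lebesgue. h k (\<Phi> k z))" for k
  proof -
    let ?T = "\<lambda>x. x - ((1 + \<eta> k) * (?n \<bullet> x)) *\<^sub>R ?n"
    define b where "b = ((1 + \<eta> k) * (?n \<bullet> a)) *\<^sub>R ?n"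
    have e: "\<Phi> k z = ?T z + b" for z by (simp add: \<Phi>_def b_def inner_diff_right algebra_simps)
    have "integral\<^sup>L lebesgue (h k) = (LINT x|lebesgue. h k (x + b))"
      by (rule lebesgue_integral_translate(1)[OF borel_lebesgue[OF hb], symmetric])
    also have "\<dots> = (LINT x|lborel. h k (x + b))" by (rule integral_completion) simp
    also have "\<dots> = \<eta> k * (LINT z|lborel. h k (?T z + b))"
      by (rule stretch_integral[OF norm_nrm[OF v] _ \<eta>(2)]) simp
    also have "(LINT z|lborel. h k (?T z + b)) = (LINT z|lebesgue. h k (\<Phi> k z))"
      unfolding e[symmetric] by (rule integral_completion[symmetric]) (use measurable_compose[OF \<Phi>b hb] in simp)
    finally show ?thesis using \<eta>(2)[of k] by simp
  qed
  have Pc: "compact (prism ?n ?F)" "convex (prism ?n ?F)"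
    using compact_convex_prism compact_simplex_hull(2) convex_convex_hull by blast+
  have Pm: "prism ?n ?F \<in> sets lebesgue" using Pc(1) by (auto intro: compact_sets_lebesgue)
  have ae: "AE z in lebesgue. z \<notin> frontier (prism ?n ?F)"
    using negligible_convex_frontier[OF Pc(2)] by (auto simp: negligible_iff_null_sets intro: AE_not_in)
  obtain R where R: "\<And>x. x \<in> ?t \<Longrightarrow> norm x \<le> R" using compact_imp_bounded[OF compact_simplex_hull(1)] bounded_iff by metis
  have "(\<lambda>k. LINT z|lebesgue. h k (\<Phi> k z)) \<longlonglongrightarrow> (LINT z|lebesgue. indicator (prism ?n ?F) z * g (pr z))"
  proof (rule integral_dominated_convergence[where w = "\<lambda>z. indicat_real (cball 0 (R + 2)) z *\<^sub>R \<bar>M\<bar>"])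
    show "integrable lebesgue (\<lambda>z. indicat_real (cball 0 (R + 2)) z *\<^sub>R \<bar>M\<bar>)"
      using lmeasurable_iff_integrable[of "cball 0 (R + 2)"] by (intro integrable_scaleR_left) auto
    show "AE z in lebesgue. norm (h k (\<Phi> k z)) \<le> indicat_real (cball 0 (R + 2)) z *\<^sub>R \<bar>M\<bar>" for k
    proof (intro AE_I2)
      fix z
      show "norm (h k (\<Phi> k z)) \<le> indicat_real (cball 0 (R + 2)) z *\<^sub>R \<bar>M\<bar>"
      proof (cases "\<Phi> k z \<in> A k")
        case True
        then have t: "\<Phi> k z \<in> ?t" and s: "?n \<bullet> (\<Phi> k z - a) > - \<eta> k" by (auto simp: A_def)
        have s01: "0 \<le> ?n \<bullet> (z - a)" "?n \<bullet> (z - a) < 1"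
          using hgt[OF t] s \<eta>(2)[of k] unfolding \<Phi>h by (auto simp: zero_le_mult_iff)
        have "z = \<Phi> k z + ((1 + \<eta> k) * (?n \<bullet> (z - a))) *\<^sub>R ?n" by (simp add: \<Phi>_def)
        then have "norm z \<le> norm (\<Phi> k z) + norm (((1 + \<eta> k) * (?n \<bullet> (z - a))) *\<^sub>R ?n)"
          using norm_triangle_ineq by metis
        also have "\<dots> = norm (\<Phi> k z) + (1 + \<eta> k) * (?n \<bullet> (z - a))"
          using norm_nrm[OF v] s01 \<eta>(2)[of k] by simp
        also have "\<dots> \<le> R + 2 * 1"
          using s01 \<eta>(2,3)[of k] R[OF t] by (intro add_mono mult_mono) auto
        finally have "z \<in> cball 0 (R + 2)" by simp
        then show ?thesis using M[OF t] True by (simp add: h_def)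
      qed (simp add: h_def)
    qed
    show "AE z in lebesgue. (\<lambda>k. h k (\<Phi> k z)) \<longlonglongrightarrow> indicator (prism ?n ?F) z * g (pr z)"
      using ae
    proof (rule AE_mp, intro AE_I2 impI)
      fix z assume fz: "z \<notin> frontier (prism ?n ?F)"
      have lim: "(\<lambda>k. \<Phi> k z) \<longlonglongrightarrow> pr z"
      proof -
        have "(\<lambda>k. pr z - (\<eta> k * (?n \<bullet> (z - a))) *\<^sub>R ?n) \<longlonglongrightarrow> pr z - (0 * (?n \<bullet> (z - a))) *\<^sub>R ?n"
          by (intro tendsto_intros \<eta>(1))
        then show ?thesis by (simp add: \<Phi>pr)
      qed
      have "isCont g (pr z)" using g by (simp add: continuous_on_eq_continuous_at)
      from isCont_tendsto_compose[OF this lim] have glim: "(\<lambda>k. g (\<Phi> k z)) \<longlonglongrightarrow> g (pr z)" .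
      show "(\<lambda>k. h k (\<Phi> k z)) \<longlonglongrightarrow> indicator (prism ?n ?F) z * g (pr z)"
      proof (cases "z \<in> prism ?n ?F")
        case True
        then have "z \<in> interior (prism ?n ?F)" using fz closure_subset by (auto simp: frontier_def)
        then obtain r where r: "r > 0" "ball z r \<subseteq> prism ?n ?F" using mem_interior by blast
        have s: "0 \<le> ?n \<bullet> (z - a)" "?n \<bullet> (z - a) < 1"
        proof -
          have "z + (r / 2) *\<^sub>R ?n \<in> ball z r" using r(1) norm_nrm[OF v] by (simp add: dist_norm)
          then have "?n \<bullet> (z + (r / 2) *\<^sub>R ?n - a) \<le> 1" using r(2) P by blast
          then show "?n \<bullet> (z - a) < 1" using nn r(1) by (simp add: inner_add_right inner_diff_right)
        qed (use P True in blast)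
        have prF: "pr z \<in> ?F" using True P by (simp add: pr_def)
        \<comment> \<open>An interior point of the prism has its foot point in the relative interior
          of the facet. There the simplex is locally a half space, so the points
          \<open>\<Phi> k z\<close>, which approach from the inner side, finally belong to
          it.\<close>
        have rel: "pr z \<in> rel_interior ?F"
          unfolding mem_rel_interior_ball
        proof (intro conjI exI[of _ r] prF r(1) subsetI)
          fix y assume y: "y \<in> ball (pr z) r \<inter> affine hull ?F"
          have "?F \<subseteq> {y. ?n \<bullet> y = ?n \<bullet> a}"
          proof
            fix y assume "y \<in> ?F"
            then have "?n \<bullet> (y - a) = 0" using flat a by blast
            then show "y \<in> {y. ?n \<bullet> y = ?n \<bullet> a}" by (simp add: inner_diff_right)
          qed
          then have "affine hull ?F \<subseteq> {y. ?n \<bullet> y = ?n \<bullet> a}" by (rule hull_minimal) (rule affine_hyperplane)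
          then have ny: "?n \<bullet> (y - a) = 0" using y by (auto simp: inner_diff_right)
          have "z + (y - pr z) \<in> ball z r" using y by (simp add: dist_norm norm_minus_commute)
          then have "z + (y - pr z) \<in> prism ?n ?F" using r(2) by blast
          then have "z + (y - pr z) - (?n \<bullet> (z + (y - pr z) - a)) *\<^sub>R ?n \<in> ?F" using P by blast
          moreover have "?n \<bullet> (z + (y - pr z) - a) = ?n \<bullet> (z - a)"
            using ny prh[of z] by (simp add: inner_diff_right inner_add_right)
          ultimately show "y \<in> ?F" by (simp add: pr_def)
        qed
        obtain \<rho> where \<rho>: "\<rho> > 0" "\<And>y. dist (pr z) y < \<rho> \<Longrightarrow> ?n \<bullet> (y - pr z) \<le> 0 \<Longrightarrow> y \<in> ?t"
          "\<And>y. dist (pr z) y < \<rho> \<Longrightarrow> ?n \<bullet> (y - pr z) < 0 \<Longrightarrow> y \<in> interior ?t"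
          by (rule half_ball[OF v rel], rule that)
        have "eventually (\<lambda>k. dist (\<Phi> k z) (pr z) < \<rho>) sequentially" using lim \<rho>(1) by (rule tendstoD)
        then have "eventually (\<lambda>k. g (\<Phi> k z) = h k (\<Phi> k z)) sequentially"
        proof (rule eventually_mono)
          fix k assume k: "dist (\<Phi> k z) (pr z) < \<rho>"
          have "?n \<bullet> (\<Phi> k z - pr z) = - (\<eta> k * (?n \<bullet> (z - a)))" using nn by (simp add: \<Phi>pr)
          then have "\<Phi> k z \<in> ?t" using k s \<eta>(2)[of k] by (intro \<rho>(2)) (auto simp: dist_commute)
          moreover have "?n \<bullet> (\<Phi> k z - a) > - \<eta> k" unfolding \<Phi>h using s \<eta>(2)[of k] by simp
          ultimately show "g (\<Phi> k z) = h k (\<Phi> k z)" by (simp add: h_def A_def)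
        qed
        from Lim_transform_eventually[OF glim this] show ?thesis using True by simp
      next
        case False
        have "eventually (\<lambda>k. 0 = h k (\<Phi> k z)) sequentially"
        proof (cases "0 \<le> ?n \<bullet> (z - a) \<and> ?n \<bullet> (z - a) \<le> 1")
          case True
          \<comment> \<open>The foot point has coordinate 0 at v, so if it misses the facet it lies
            outside the closed simplex, and finally so do the points
            \<open>\<Phi> k z\<close>.\<close>
          then have "pr z \<notin> ?F" using P False by (simp add: pr_def)
          moreover have "bary V v (pr z) = 0" using bary_height[OF v a, of "pr z"] prh[of z] by simp
          ultimately have "pr z \<in> - ?t" using facet_eq[OF v] by auto
          moreover have "open (- ?t)" using compact_simplex_hull(1) compact_imp_closed by blast
          ultimately have "eventually (\<lambda>k. \<Phi> k z \<in> - ?t) sequentially" using lim topological_tendstoD by blast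
          then show ?thesis by (rule eventually_mono) (simp add: h_def A_def)
        next
          case out: False
          have "\<Phi> k z \<notin> A k" for k
          proof
            assume "\<Phi> k z \<in> A k"
            then have t: "\<Phi> k z \<in> ?t" and s: "?n \<bullet> (\<Phi> k z - a) > - \<eta> k" by (auto simp: A_def)
            then have "0 \<le> ?n \<bullet> (z - a)" "?n \<bullet> (z - a) < 1"
              using hgt[OF t] s \<eta>(2)[of k] unfolding \<Phi>h by (auto simp: zero_le_mult_iff)
            then show False using out by simp
          qed
          then show ?thesis by (simp add: h_def)
        qed
        from Lim_transform_eventually[OF tendsto_const this] show ?thesis using False by simp
      qed
    qed
    show "(\<lambda>z. indicat_real (prism ?n ?F) z * g (pr z)) \<in> borel_measurable lebesgue"
    proof -
      have "(\<lambda>z. g (pr z)) \<in> borel_measurable lebesgue" unfolding pr_def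
        by (intro continuous_lebesgue_measurable continuous_on_compose2[OF g] continuous_intros) auto
      then show ?thesis using Pm by simp
    qed
  qed (rule hPi)
  moreover have "(LINT z|lebesgue. indicator (prism ?n ?F) z * g (pr z)) = face_integral ?n ?F g"
    unfolding face_integral_prism[of ?F ?n a, OF flat a] integrable_indicator_lebesgue_on[OF Pm] pr_def by simp
  ultimately show ?thesis unfolding sub[symmetric] by (simp add: h_def A_def)
qed

text \<open>The divergence theorem for the field g(x) (x - v). Its divergence is the integrand on
  the left; its normal component vanishes on the facets through v, and on the opposite facet the
  factor of g is the height \<open>1 / norm (bary_grad V v)\<close>. The simplex is compared with
  its copy contracted towards v: the difference is a thin strip at the opposite facet.\<close>

lemma conic_divergence:
  fixes g :: "real^'d \<Rightarrow> real" and D :: "real^'d \<Rightarrow> real^'d"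
  assumes v: "v \<in> V" and d: "\<And>x. (g has_derivative (\<lambda>h. D x \<bullet> h)) (at x)" and D: "continuous_on UNIV D"
  shows "(LINT y|lebesgue_on (convex hull V). real CARD('d) * g y + D y \<bullet> (y - v)) =
    (1 / norm (bary_grad V v)) * face_integral (nrm v) (facet v) g"
proof -
  let ?n = "nrm v" and ?t = "convex hull V" and ?F = "facet v" and ?d = "CARD('d)"
  define H where "H = 1 / norm (bary_grad V v)"
  have H: "H > 0" using bary_grad_nonzero[OF v] by (simp add: H_def)
  obtain a where a: "a \<in> ?F" using facet_nonempty[OF v] by blast
  have g: "continuous_on UNIV g" using d has_derivative_continuous by (intro continuous_at_imp_continuous_on ballI) blast
  have nb: "?n \<bullet> (x - a) = - H * bary V v x" for x
    using bary_height[OF v a, of x] bary_grad_nonzero[OF v] by (simp add: H_def field_simps)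
  \<comment> \<open>Keeps \<open>\<delta> k\<close> strictly between 0 and 1 and the thickness
    \<open>H * \<delta> k\<close> of the strip at most 1, as the strip limit demands.\<close>
  define \<delta> where "\<delta> = (\<lambda>k::nat. min 1 (1 / H) / real (k + 2))"
  have \<delta>: "0 < \<delta> k" "\<delta> k < 1" "H * \<delta> k \<le> 1" for k
  proof -
    have m: "0 < min 1 (1 / H)" "min 1 (1 / H) \<le> 1" "min 1 (1 / H) \<le> 1 / H" using H by auto
    show "0 < \<delta> k" using m by (simp add: \<delta>_def)
    show "\<delta> k < 1" using m by (simp add: \<delta>_def divide_less_eq)
    have "min 1 (1 / H) / real (k + 2) \<le> min 1 (1 / H) / 1" using m(1) by (intro divide_left_mono) auto
    then have "\<delta> k \<le> min 1 (1 / H)" by (simp add: \<delta>_def)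
    then have "\<delta> k \<le> 1 / H" using m(3) by linarith
    then show "H * \<delta> k \<le> 1" using H by (simp add: field_simps)
  qed
  have \<delta>0: "\<delta> \<longlonglongrightarrow> 0" unfolding \<delta>_def
    by (rule LIMSEQ_ignore_initial_segment[OF lim_const_over_n])
  have tm: "?t \<in> sets lebesgue" using compact_simplex_hull(1) by (auto intro: compact_sets_lebesgue)
  have tb: "bounded ?t" using compact_simplex_hull(1) compact_imp_bounded by blast
  interpret finite_measure "lebesgue_on ?t" by (rule finite_measure_lebesgue_on_bounded[OF tb tm])
  \<comment> \<open>The homothety with centre v and ratio \<open>1 - \<delta> k\<close>; it maps the
    simplex onto the simplex without the strip.\<close>
  define \<Psi> where "\<Psi> = (\<lambda>k y. \<delta> k *\<^sub>R v + (1 - \<delta> k) *\<^sub>R y)"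
  have \<Psi>b: "bary V w (\<Psi> k y) = \<delta> k * (if w = v then 1 else 0) + (1 - \<delta> k) * bary V w y" if "w \<in> V" for w k y
  proof -
    have "bary V w (\<Psi> k y) = \<delta> k * bary V w v + (1 - \<delta> k) * bary V w y"
      by (simp add: \<Psi>_def bary_def inner_add_right algebra_simps)
    then show ?thesis using bary_vertex[OF independent that v] by (auto simp: eq_commute)
  qed
  have \<Psi>t: "\<Psi> k y \<in> ?t \<and> \<not> ?n \<bullet> (\<Psi> k y - a) > - (H * \<delta> k) \<longleftrightarrow> y \<in> ?t" for k y
  proof -
    have "?n \<bullet> (\<Psi> k y - a) > - (H * \<delta> k) \<longleftrightarrow> bary V v (\<Psi> k y) < \<delta> k" unfolding nb using H by simp
    also have "\<dots> \<longleftrightarrow> bary V v y < 0" unfolding \<Psi>b[OF v] using \<delta>[of k] by (simp add: mult_less_0_iff)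
    finally have s: "\<not> ?n \<bullet> (\<Psi> k y - a) > - (H * \<delta> k) \<longleftrightarrow> 0 \<le> bary V v y" by auto
    show ?thesis
    proof
      assume "\<Psi> k y \<in> ?t \<and> \<not> ?n \<bullet> (\<Psi> k y - a) > - (H * \<delta> k)"
      then have p: "0 \<le> bary V v y" "\<And>w. w \<in> V \<Longrightarrow> 0 \<le> bary V w (\<Psi> k y)" using s simplex_eq by auto
      have "0 \<le> bary V w y" if "w \<in> V" for w
        using p(1) p(2)[OF that] \<Psi>b[OF that, of k y] \<delta>[of k] by (cases "w = v") (auto simp: zero_le_mult_iff)
      then show "y \<in> ?t" using simplex_eq by auto
    next
      assume "y \<in> ?t"
      then have p: "\<And>w. w \<in> V \<Longrightarrow> 0 \<le> bary V w y" using simplex_eq by auto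
      have "0 \<le> bary V w (\<Psi> k y)" if "w \<in> V" for w
        unfolding \<Psi>b[OF that] using p[OF that] \<delta>[of k] by (intro add_nonneg_nonneg mult_nonneg_nonneg) auto
      then show "\<Psi> k y \<in> ?t \<and> \<not> ?n \<bullet> (\<Psi> k y - a) > - (H * \<delta> k)" using s p[OF v] simplex_eq by auto
    qed
  qed
  define A where "A = (\<lambda>k. {x \<in> ?t. ?n \<bullet> (x - a) > - (H * \<delta> k)})"
  have Am: "A k \<in> sets lebesgue" "A k \<subseteq> ?t" for k
  proof -
    have "open {x. ?n \<bullet> (x - a) > - (H * \<delta> k)}" by (intro open_Collect_less continuous_intros)
    moreover have "A k = ?t \<inter> {x. ?n \<bullet> (x - a) > - (H * \<delta> k)}" by (auto simp: A_def)
    ultimately show "A k \<in> sets lebesgue" using tm by auto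
  qed (auto simp: A_def)
  note ti = integrable_on_simplex
  have gi: "integrable lebesgue (\<lambda>x. indicator ?t x * g x)"
    using ti[OF g] tm by (simp add: integrable_indicator_lebesgue_on)
  have split: "(LINT x|lebesgue. indicator (A k) x * g x) =
      (LINT y|lebesgue_on ?t. g y - (1 - \<delta> k) ^ ?d * g (\<Psi> k y))" for k
  proof -
    have sub: "(\<lambda>x. indicator S x *\<^sub>R (indicator ?t x * g x)) = (\<lambda>x. indicator S x * g x)" if "S \<subseteq> ?t" for S
    proof
      fix x show "indicator S x *\<^sub>R (indicator ?t x * g x) = indicator S x * g x"
        using that by (cases "x \<in> S") auto
    qed
    have iA: "integrable lebesgue (\<lambda>x. indicator (A k) x * g x)" "integrable lebesgue (\<lambda>x. indicator (?t - A k) x * g x)"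
      using integrable_mult_indicator[OF Am(1) gi, of k] integrable_mult_indicator[OF sets.Diff[OF tm Am(1)] gi, of k]
      unfolding sub[OF Am(2)] sub[OF Diff_subset] by blast+
    have "(LINT x|lebesgue. indicator ?t x * g x) = (LINT x|lebesgue. indicator (A k) x * g x + indicator (?t - A k) x * g x)"
      using Am(2)[of k] by (intro Bochner_Integration.integral_cong) (auto simp: indicator_def)
    also have "\<dots> = (LINT x|lebesgue. indicator (A k) x * g x) + (LINT x|lebesgue. indicator (?t - A k) x * g x)"
      using iA by simp
    also have "(LINT x|lebesgue. indicator (?t - A k) x * g x) =
        (1 - \<delta> k) ^ ?d * (LINT y|lebesgue. indicator (?t - A k) (\<Psi> k y) * g (\<Psi> k y))"
      unfolding \<Psi>_def using \<delta>[of k] lebesgue_integral_affine(1)[of "1 - \<delta> k" "\<lambda>x. indicator (?t - A k) x * g x" "\<delta> k *\<^sub>R v"] iA(2)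
      by auto
    also have "(\<lambda>y. indicator (?t - A k) (\<Psi> k y) * g (\<Psi> k y)) = (\<lambda>y. indicator ?t y *\<^sub>R g (\<Psi> k y))"
      using \<Psi>t[of k] by (auto simp: fun_eq_iff indicator_def A_def)
    finally have e: "(LINT x|lebesgue. indicator (A k) x * g x) =
        (LINT y|lebesgue_on ?t. g y) - (1 - \<delta> k) ^ ?d * (LINT y|lebesgue_on ?t. g (\<Psi> k y))"
      using tm by (simp add: integrable_indicator_lebesgue_on)
    have "continuous_on UNIV (\<lambda>y. g (\<Psi> k y))" unfolding \<Psi>_def
      by (intro continuous_on_compose2[OF g] continuous_intros) auto
    from ti[OF this] ti[OF g] e show ?thesis by simp
  qed
  have lim1: "(\<lambda>k. (1 / (H * \<delta> k)) * (LINT x|lebesgue. indicator (A k) x * g x)) \<longlonglongrightarrow> face_integral ?n ?F g"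
    unfolding A_def
  proof (rule thin_strip_limit[OF v g _ _ _ a])
    show "(\<lambda>k. H * \<delta> k) \<longlonglongrightarrow> 0" using tendsto_mult_right_zero[OF \<delta>0] .
  qed (use \<delta> H in auto)
  obtain M1 where "\<And>x. x \<in> ?t \<Longrightarrow> norm (g x) \<le> M1"
    by (rule continuous_bounded_on_simplex[OF g], rule that)
  then have M1: "\<And>x. x \<in> ?t \<Longrightarrow> \<bar>g x\<bar> \<le> M1" by simp
  obtain M2 where M2: "\<And>x. x \<in> ?t \<Longrightarrow> norm (D x) \<le> M2"
    by (rule continuous_bounded_on_simplex[OF D], rule that)
  obtain R where R: "\<And>x. x \<in> ?t \<Longrightarrow> norm x \<le> R" using tb bounded_iff by metis
  have vt: "v \<in> ?t" using v by (rule hull_inc)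
  let ?z = "\<lambda>s y. s *\<^sub>R v + (1 - s) *\<^sub>R y" and ?Q = "\<lambda>k y. (g y - (1 - \<delta> k) ^ ?d * g (\<Psi> k y)) / \<delta> k"
  \<comment> \<open>The integrand in \<open>split\<close>, divided by \<open>\<delta> k\<close>, is
    minus the difference quotient of q at 0. Its limit \<open>- q' 0 y\<close> is the divergence,
    and the mean value theorem bounds the quotients uniformly.\<close>
  define q where "q = (\<lambda>s y. (1 - s) ^ ?d * g (?z s y))"
  define q' where "q' = (\<lambda>s y. - real ?d * (1 - s) ^ (?d - 1) * g (?z s y) + (1 - s) ^ ?d * (D (?z s y) \<bullet> (v - y)))"
  have qd: "((\<lambda>s. q s y) has_real_derivative q' s y) (at s)" for s y
  proof -
    have 1: "((\<lambda>s. (1 - s) ^ ?d) has_real_derivative - real ?d * (1 - s) ^ (?d - 1)) (at s)"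
      by (auto intro!: derivative_eq_intros)
    have "((\<lambda>s. ?z s y) has_derivative (\<lambda>h. h *\<^sub>R (v - y))) (at s)"
      by (auto intro!: derivative_eq_intros simp: algebra_simps)
    from has_derivative_compose[OF this d]
    have 2: "((\<lambda>s. g (?z s y)) has_real_derivative D (?z s y) \<bullet> (v - y)) (at s)"
      by (simp add: has_field_derivative_def mult.commute[of _ "D _ \<bullet> _"])
    show ?thesis unfolding q_def q'_def by (rule DERIV_cong[OF DERIV_mult[OF 1 2]]) (simp add: algebra_simps)
  qed
  have q'b: "\<bar>q' s y\<bar> \<le> real ?d * M1 + M2 * (2 * R)" if s: "0 \<le> s" "s \<le> 1" and y: "y \<in> ?t" for s y
  proof -
    have p: "?z s y \<in> ?t" using s y vt by (intro convexD[OF convex_convex_hull]) auto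
    have "\<bar>q' s y\<bar> \<le> \<bar>- real ?d * (1 - s) ^ (?d - 1) * g (?z s y)\<bar> + \<bar>(1 - s) ^ ?d * (D (?z s y) \<bullet> (v - y))\<bar>"
      unfolding q'_def by (rule abs_triangle_ineq)
    also have "\<dots> \<le> (real ?d * 1) * M1 + 1 * (M2 * (2 * R))"
    proof (rule add_mono)
      show "\<bar>- real ?d * (1 - s) ^ (?d - 1) * g (?z s y)\<bar> \<le> (real ?d * 1) * M1"
        unfolding abs_mult using s M1[OF p] by (intro mult_mono) (auto simp: power_le_one)
      have "norm (v - y) \<le> 2 * R" using norm_triangle_ineq4[of v y] R[OF vt] R[OF y] by linarith
      then have "\<bar>D (?z s y) \<bullet> (v - y)\<bar> \<le> M2 * (2 * R)"
        using Cauchy_Schwarz_ineq2[of "D (?z s y)" "v - y"] mult_mono[OF M2[OF p] _ _ norm_ge_zero]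
        by (smt (verit) norm_ge_zero M2[OF p])
      then show "\<bar>(1 - s) ^ ?d * (D (?z s y) \<bullet> (v - y))\<bar> \<le> 1 * (M2 * (2 * R))"
        unfolding abs_mult using s by (intro mult_mono) (auto simp: power_le_one)
    qed
    finally show ?thesis by simp
  qed
  have "(\<lambda>k. LINT y|lebesgue_on ?t. ?Q k y) \<longlonglongrightarrow>
      (LINT y|lebesgue_on ?t. real ?d * g y + D y \<bullet> (y - v))"
  proof (rule integral_dominated_convergence[where w = "\<lambda>y. real ?d * M1 + M2 * (2 * R)"])
    show "(\<lambda>y. real ?d * g y + D y \<bullet> (y - v)) \<in> borel_measurable (lebesgue_on ?t)"
      by (intro measurable_restrict_space1 continuous_lebesgue_measurable continuous_intros g D)
    show "(\<lambda>y. ?Q k y) \<in> borel_measurable (lebesgue_on ?t)" for k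
      unfolding \<Psi>_def using \<delta>(1)[of k]
      by (intro measurable_restrict_space1 continuous_lebesgue_measurable continuous_intros g continuous_on_compose2[OF g]) auto
    show "AE y in lebesgue_on ?t. (\<lambda>k. ?Q k y) \<longlonglongrightarrow> real ?d * g y + D y \<bullet> (y - v)"
    proof (intro AE_I2)
      fix y
      have "((\<lambda>h. (q (0 + h) y - q 0 y) / h) \<longlongrightarrow> q' 0 y) (at 0)" using qd[of y 0] unfolding DERIV_def .
      moreover have "filterlim \<delta> (at 0) sequentially" using \<delta>0 \<delta>(1) by (auto simp: filterlim_at less_imp_neq[symmetric])
      ultimately have "(\<lambda>k. (q (0 + \<delta> k) y - q 0 y) / \<delta> k) \<longlonglongrightarrow> q' 0 y" by (rule filterlim_compose)
      from tendsto_minus[OF this] have "(\<lambda>k. - ((q (\<delta> k) y - q 0 y) / \<delta> k)) \<longlonglongrightarrow> - q' 0 y" by simp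
      moreover have "- q' 0 y = real ?d * g y + D y \<bullet> (y - v)" by (simp add: q'_def inner_diff_right)
      moreover have "- ((q (\<delta> k) y - q 0 y) / \<delta> k) = ?Q k y" for k
        by (simp add: q_def \<Psi>_def minus_divide_left)
      ultimately show "(\<lambda>k. ?Q k y) \<longlonglongrightarrow> real ?d * g y + D y \<bullet> (y - v)" by simp
    qed
    show "AE y in lebesgue_on ?t. norm (?Q k y) \<le> real ?d * M1 + M2 * (2 * R)" for k
    proof (intro AE_I2)
      fix y assume "y \<in> space (lebesgue_on ?t)"
      then have y: "y \<in> ?t" by simp
      obtain z where z: "0 < z" "z < \<delta> k" "q (\<delta> k) y - q 0 y = (\<delta> k - 0) * q' z y"
        using MVT2[OF \<delta>(1)[of k], of "\<lambda>s. q s y" "\<lambda>s. q' s y"] qd by blast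
      have "?Q k y = - ((q (\<delta> k) y - q 0 y) / \<delta> k)"
        by (simp add: q_def \<Psi>_def minus_divide_left)
      also have "\<dots> = - q' z y" using z \<delta>(1)[of k] by simp
      finally show "norm (?Q k y) \<le> real ?d * M1 + M2 * (2 * R)"
        using q'b[of z y] z \<delta>(2)[of k] y by simp
    qed
  qed simp
  moreover have "(LINT y|lebesgue_on ?t. ?Q k y) =
      H * ((1 / (H * \<delta> k)) * (LINT x|lebesgue. indicator (A k) x * g x))" for k
    unfolding split using H \<delta>(1)[of k] by simp
  ultimately have "(\<lambda>k. H * ((1 / (H * \<delta> k)) * (LINT x|lebesgue. indicator (A k) x * g x))) \<longlonglongrightarrow>
      (LINT y|lebesgue_on ?t. real ?d * g y + D y \<bullet> (y - v))" by simp
  moreover have "(\<lambda>k. H * ((1 / (H * \<delta> k)) * (LINT x|lebesgue. indicator (A k) x * g x))) \<longlonglongrightarrow> H * face_integral ?n ?F g"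
    by (rule tendsto_mult_left[OF lim1])
  ultimately show ?thesis unfolding H_def by (rule LIMSEQ_unique)
qed

text \<open>The conic formula for \<open>(x - v) g\<close>, summed over the vertices \<open>v\<close> with \<open>g = - X \<bullet> \<nabla>b\<^sub>v\<close>:
  since \<open>\<Sum>\<nabla>b\<^sub>v = 0\<close> and \<open>\<Sum>(\<nabla>b\<^sub>v \<bullet> h) v = h\<close>, these fields add up to \<open>X\<close>.\<close>

theorem divergence_theorem_simplex:
  fixes X :: "real^'d \<Rightarrow> real^'d" and J :: "real^'d \<Rightarrow> real^'d^'d"
  assumes d: "\<And>x. (X has_derivative (\<lambda>h. J x *v h)) (at x)" and J: "continuous_on UNIV J"
  shows "(LINT x|lebesgue_on (convex hull V). (\<Sum>i\<in>UNIV. J x $ i $ i)) =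
    (\<Sum>v\<in>V. face_integral (nrm v) (facet v) (\<lambda>x. X x \<bullet> nrm v))"
proof -
  let ?t = "convex hull V"
  define g where "g = (\<lambda>v x. - (X x \<bullet> bary_grad V v))"
  define D where "D = (\<lambda>v x. - (bary_grad V v v* J x))"
  have Dh: "D v x \<bullet> h = - ((J x *v h) \<bullet> bary_grad V v)" for v x h
    by (simp add: D_def dot_lmul_matrix inner_commute[of "J x *v h"])
  have gd: "(g v has_derivative (\<lambda>h. D v x \<bullet> h)) (at x)" for v x
    unfolding Dh g_def by (intro has_derivative_minus has_derivative_inner_left d)
  have Dc: "continuous_on UNIV (D v)" for v
    unfolding D_def vector_matrix_mult_def by (intro continuous_intros J)
  have Xc: "continuous_on UNIV X" using d has_derivative_continuous by (intro continuous_at_imp_continuous_on ballI) blast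
  have gc: "continuous_on UNIV (g v)" for v unfolding g_def by (intro continuous_intros Xc)
  note ti = integrable_on_simplex
  have pt: "(\<Sum>v\<in>V. real CARD('d) * g v x + D v x \<bullet> (x - v)) = (\<Sum>i\<in>UNIV. J x $ i $ i)" for x
  proof -
    have 1: "(\<Sum>v\<in>V. g v x) = 0"
      using bary_grad_sum(1)[of "X x"] by (simp add: g_def sum_negf inner_commute)
    have 2: "(\<Sum>v\<in>V. D v x \<bullet> x) = 0"
      unfolding Dh using bary_grad_sum(1)[of "J x *v x"] by (simp add: sum_negf inner_commute)
    have "(\<Sum>v\<in>V. D v x \<bullet> v) = - (\<Sum>v\<in>V. \<Sum>i\<in>UNIV. (J x *v v) $ i * bary_grad V v $ i)"
      unfolding Dh by (simp add: sum_negf inner_vec_def)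
    \<comment> \<open>The gradient identity for a unit vector: the sum over the vertices returns
      \<open>axis i 1\<close>, which leaves the trace of the Jacobian.\<close>
    also have "(\<Sum>v\<in>V. \<Sum>i\<in>UNIV. (J x *v v) $ i * bary_grad V v $ i) = (\<Sum>i\<in>UNIV. (J x *v (\<Sum>v\<in>V. (bary_grad V v \<bullet> axis i 1) *\<^sub>R v)) $ i)"
      by (subst sum.swap) (simp add: linear_sum[OF matrix_vector_mul_linear] matrix_vector_mult_scaleR inner_axis mult.commute)
    also have "\<dots> = (\<Sum>i\<in>UNIV. J x $ i $ i)"
      unfolding bary_grad_sum(2) by (simp add: matrix_vector_mult_basis column_def)
    finally have 3: "(\<Sum>v\<in>V. D v x \<bullet> v) = - (\<Sum>i\<in>UNIV. J x $ i $ i)" .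
    show ?thesis using 1 2 3 by (simp add: inner_diff_right sum.distrib sum_subtractf sum_distrib_left[symmetric])
  qed
  have "(LINT x|lebesgue_on ?t. (\<Sum>i\<in>UNIV. J x $ i $ i)) = (\<Sum>v\<in>V. LINT x|lebesgue_on ?t. real CARD('d) * g v x + D v x \<bullet> (x - v))"
    unfolding pt[symmetric] by (intro Bochner_Integration.integral_sum ti continuous_intros gc Dc)
  also have "\<dots> = (\<Sum>v\<in>V. face_integral (nrm v) (facet v) (\<lambda>x. X x \<bullet> nrm v))"
  proof (intro sum.cong refl)
    fix v assume v: "v \<in> V"
    have "g v = (\<lambda>x. norm (bary_grad V v) * (X x \<bullet> nrm v))"
      unfolding g_def by (subst bary_grad_nrm[OF v]) simp
    then have "(1 / norm (bary_grad V v)) * face_integral (nrm v) (facet v) (g v) = face_integral (nrm v) (facet v) (\<lambda>x. X x \<bullet> nrm v)"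
      using bary_grad_nonzero[OF v] by (simp add: face_integral_cmult)
    then show "(LINT x|lebesgue_on ?t. real CARD('d) * g v x + D v x \<bullet> (x - v)) = face_integral (nrm v) (facet v) (\<lambda>x. X x \<bullet> nrm v)"
      using conic_divergence[OF v gd Dc] by simp
  qed
  finally show ?thesis .
qed

end

section \<open>Conforming meshes and Oswald interpolation\<close>

lemma Poly_gradient:
  fixes f :: "real^'d \<Rightarrow> real"
  assumes "f \<in> Poly k"
  obtains g where "\<And>x. (f has_derivative (\<lambda>h. g x \<bullet> h)) (at x)" "continuous_on UNIV g"
proof -
  obtain D where D: "\<forall>i. D i \<in> Poly k" "\<And>x. (f has_derivative (\<lambda>h. \<Sum>i\<in>UNIV. D i x * h $ i)) (at x)"
    using Poly_has_derivative[OF assms] by blast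
  show thesis
  proof (rule that[of "\<lambda>x. \<chi> i. D i x"])
    show "(f has_derivative (\<lambda>h. (\<chi> i. D i x) \<bullet> h)) (at x)" for x using D(2) by (simp add: inner_vec_def)
    show "continuous_on UNIV (\<lambda>x. \<chi> i. D i x)"
      using D(1) by (intro continuous_on_vec_lambda Poly_continuous[where k = k]) blast
  qed
qed

lemma Poly_lipschitz_on_compact:
  fixes f :: "real^'d::finite \<Rightarrow> real"
  assumes "f \<in> Poly k" "compact t" "convex t"
  obtains L where "L \<ge> 0" "\<And>x y. x \<in> t \<Longrightarrow> y \<in> t \<Longrightarrow> \<bar>f x - f y\<bar> \<le> L * norm (x - y)"
proof -
  obtain g where g: "\<And>x. (f has_derivative (\<lambda>h. g x \<bullet> h)) (at x)" "continuous_on UNIV g"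
    by (rule Poly_gradient[OF assms(1)], rule that)
  have "compact (g ` t)"
    by (rule compact_continuous_image[OF continuous_on_subset[OF g(2) subset_UNIV] assms(2)])
  then obtain M where M: "\<forall>y\<in>g ` t. norm y \<le> M" using compact_imp_bounded bounded_iff by metis
  have "norm (f x - f y) \<le> max M 0 * norm (x - y)" if "x \<in> t" "y \<in> t" for x y
  proof (rule differentiable_bound[OF assms(3) _ _ that])
    show "(f has_derivative (\<lambda>h. g x \<bullet> h)) (at x within t)" for x using g(1) has_derivative_at_withinI by blast
    fix x assume "x \<in> t"
    then have "norm (g x) \<le> max M 0" using M by (auto simp: le_max_iff_disj)
    show "onorm (\<lambda>h. g x \<bullet> h) \<le> max M 0"
    proof (rule onorm_bound)
      fix h
      have "\<bar>g x \<bullet> h\<bar> \<le> norm (g x) * norm h" by (rule Cauchy_Schwarz_ineq2)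
      also have "\<dots> \<le> max M 0 * norm h" using \<open>norm (g x) \<le> max M 0\<close> by (rule mult_right_mono) simp
      finally show "norm (g x \<bullet> h) \<le> max M 0 * norm h" by simp
    qed simp
  qed
  then show thesis using that[of "max M 0"] by simp
qed

lemma (in full_simplex) interior_nonempty: "interior (convex hull V) \<noteq> {}"
proof -
  let ?u = "\<lambda>v. 1 / real (Suc CARD('d))"
  have s: "sum ?u V = 1" using card_V by simp
  have "bary V v (\<Sum>w\<in>V. ?u w *\<^sub>R w) > 0" if "v \<in> V" for v
    using bary_combination[OF independent that s] by simp
  then have "(\<Sum>w\<in>V. ?u w *\<^sub>R w) \<in> interior (convex hull V)" using positive_subset_interior by blast
  then show ?thesis by blast
qed

lemma measurable_lebesgue_on_AE:
  fixes f g :: "real^'d::finite \<Rightarrow> 'b::euclidean_space"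
  assumes f: "f \<in> borel_measurable (lebesgue_on S)" and S: "S \<in> sets lebesgue" and ae: "AE x in lebesgue_on S. f x = g x"
  shows "g \<in> borel_measurable (lebesgue_on S)"
proof -
  have "(\<lambda>x. indicator S x *\<^sub>R f x) \<in> borel_measurable lebesgue"
    using f S by (simp add: borel_measurable_restrict_space_iff)
  moreover have "AE x in lebesgue. indicator S x *\<^sub>R f x = indicator S x *\<^sub>R g x"
    using ae unfolding AE_lebesgue_on[OF S] by eventually_elim (auto simp: indicator_def)
  ultimately have "(\<lambda>x. indicator S x *\<^sub>R g x) \<in> borel_measurable lebesgue" by (rule borel_measurable_AE)
  then show ?thesis using S by (simp add: borel_measurable_restrict_space_iff)
qed

section \<open>Conforming simplicial meshes\<close>

locale fem_mesh =
  fixes D :: "('d::finite, 'm::finite) dg_data"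
  assumes domain: "polygonal_domain (Omega D)" and mesh: "mesh_assms D"
begin

abbreviation vert :: "(real^'d) set \<Rightarrow> (real^'d) set" where "vert t \<equiv> {v. v extreme_point_of t}"

lemma Omega: "open (Omega D)" "bounded (Omega D)" "interior (closure (Omega D)) = Omega D"
  using domain by (auto simp: polygonal_domain_def)

lemma finite_fine: "finite (fine_mesh D)"
  using mesh by (simp add: mesh_assms_def triangulation_def)

lemma fine_simplex: "t \<in> fine_mesh D \<Longrightarrow> int CARD('d) simplex t"
  using mesh by (simp add: mesh_assms_def)

lemma fine_full: "t \<in> fine_mesh D \<Longrightarrow> full_simplex (vert t)"
  using simplex_full_simplex(1)[OF fine_simplex] .

lemma fine_hull: "t \<in> fine_mesh D \<Longrightarrow> convex hull (vert t) = t"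
  using simplex_full_simplex(2)[OF fine_simplex] by simp

lemma fine_compact: "t \<in> fine_mesh D \<Longrightarrow> compact t" and fine_convex: "t \<in> fine_mesh D \<Longrightarrow> convex t"
  and fine_interior: "t \<in> fine_mesh D \<Longrightarrow> interior t \<noteq> {}"
  using compact_simplex[OF fine_simplex] convex_simplex[OF fine_simplex]
    full_simplex.interior_nonempty[OF fine_full] fine_hull by auto

lemma fine_union: "\<Union>(fine_mesh D) = closure (Omega D)"
  using mesh by (simp add: mesh_assms_def)

lemma fine_face: "t \<in> fine_mesh D \<Longrightarrow> t' \<in> fine_mesh D \<Longrightarrow> (t \<inter> t') face_of t"
  using mesh by (auto simp: mesh_assms_def triangulation_def)

text \<open>The intersection is a face of both elements, and a proper face misses the interior. If
  the intersection were all of t, then t would be a proper face of t', although it has interior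
  points.\<close>

lemma fine_disjoint:
  assumes t: "t \<in> fine_mesh D" "t' \<in> fine_mesh D" "t \<noteq> t'"
  shows "interior t \<inter> t' = {}"
proof (rule ccontr)
  assume ne: "interior t \<inter> t' \<noteq> {}"
  have "t \<inter> t' = t"
  proof (rule ccontr)
    assume "t \<inter> t' \<noteq> t"
    then have "(t \<inter> t') \<inter> interior t = {}" by (rule face_of_disjoint_interior[OF fine_face[OF t(1,2)]])
    then show False using ne interior_subset[of t] by blast
  qed
  then have sub: "t \<subseteq> t'" by blast
  then have "t face_of t'" using fine_face[OF t(2,1)] by (simp add: Int_absorb1)
  then have "t \<inter> interior t' = {}" using t(3) by (intro face_of_disjoint_interior) auto
  then show False using interior_mono[OF sub] fine_interior[OF t(1)] interior_subset[of t] by blast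
qed

lemma fine_interior_Omega: "t \<in> fine_mesh D \<Longrightarrow> interior t \<subseteq> Omega D"
  using interior_mono[of t "closure (Omega D)"] fine_union Omega(3) by blast

text \<open>Off this null set a point of the closed domain lies inside exactly one element;
  elementwise statements are glued together there.\<close>

lemma AE_fine_interior: "AE x in lebesgue. \<forall>t\<in>fine_mesh D. x \<notin> frontier t"
proof (subst AE_ball_countable)
  show "countable (fine_mesh D)" using finite_fine by (rule countable_finite)
  show "\<forall>t\<in>fine_mesh D. AE x in lebesgue. x \<notin> frontier t"
    using negligible_convex_frontier[OF fine_convex] by (auto simp: negligible_iff_null_sets intro: AE_not_in)
qed

lemma fine_cases:
  assumes "\<forall>t\<in>fine_mesh D. x \<notin> frontier t" "x \<in> closure (Omega D)"
  obtains t where "t \<in> fine_mesh D" "x \<in> interior t"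
proof -
  obtain t where t: "t \<in> fine_mesh D" "x \<in> t" using assms(2) fine_union by blast
  then have "x \<notin> frontier t" using assms(1) by blast
  then have "x \<in> interior t" using t(2) closure_subset[of t] by (auto simp: frontier_def)
  then show thesis using that t by blast
qed

lemma the_fine: "t \<in> fine_mesh D \<Longrightarrow> x \<in> interior t \<Longrightarrow> (THE t. t \<in> fine_mesh D \<and> x \<in> interior t) = t"
  using fine_disjoint interior_subset by (intro the_equality) blast+

text \<open>If \<open>y\<close> is an interior point of the domain, so is every other relative interior point \<open>x\<close> of the
  face: all simplices at \<open>y\<close> contain the face, hence by convexity a scaled copy of their part
  near \<open>y\<close> is found near \<open>x\<close>.\<close>

lemma boundary_face_point:
  assumes t: "t \<in> fine_mesh D" and F: "F face_of t" and x: "x \<in> rel_interior F" "x \<in> frontier (Omega D)"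
  shows "F \<subseteq> frontier (Omega D)"
proof -
  have Fc: "convex F" "closed F"
    using face_of_imp_convex[OF F] face_of_imp_compact[OF fine_convex[OF t] fine_compact[OF t] F]
    by (auto intro: compact_imp_closed)
  have "y \<in> frontier (Omega D)" if y: "y \<in> rel_interior F" for y
  proof (rule ccontr)
    assume ny: "y \<notin> frontier (Omega D)"
    have yF: "y \<in> F" "x \<in> F" using y x rel_interior_subset by blast+
    have "y \<in> closure (Omega D)" using yF face_of_imp_subset[OF F] t fine_union by blast
    then have "y \<in> Omega D" using ny Omega(1) by (simp add: frontier_def interior_open)
    then obtain r where r: "r > 0" "ball y r \<subseteq> Omega D" using Omega(1) open_contains_ball by blast
    define S where "S = {t' \<in> fine_mesh D. y \<notin> t'}"
    have "closed (\<Union>S)" using finite_fine fine_compact unfolding S_def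
      by (intro closed_Union) (auto intro: compact_imp_closed)
    moreover have "y \<notin> \<Union>S" by (auto simp: S_def)
    ultimately obtain r' where r': "r' > 0" "ball y r' \<subseteq> - \<Union>S"
      by (meson ComplI open_Compl open_contains_ball)
    obtain e where e: "e > 1" "(1 - e) *\<^sub>R y + e *\<^sub>R x \<in> F"
      using x(1) yF convex_rel_interior_iff[OF Fc(1)] by blast
    define m where "m = min r r'"
    have m: "m > 0" using r r' by (simp add: m_def)
    \<comment> \<open>The homothety centred at the point
      \<open>(1 - e) *\<^sub>R y + e *\<^sub>R x\<close> of F with ratio (e - 1) / e takes y to x
      and the ball of radius m around y onto this ball. The elements at y contain F, hence the
      centre, and being convex they contain the images of their points.\<close>
    have "ball x (m * (e - 1) / e) \<subseteq> closure (Omega D)"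
    proof
      fix p assume p: "p \<in> ball x (m * (e - 1) / e)"
      define z where "z = (e / (e - 1)) *\<^sub>R (p - x)"
      have "norm z = e / (e - 1) * norm (p - x)" using e by (simp add: z_def)
      also have "\<dots> < e / (e - 1) * (m * (e - 1) / e)"
        using p e by (intro mult_strict_left_mono) (auto simp: dist_norm norm_minus_commute)
      also have "\<dots> = m" using e by simp
      finally have z: "y + z \<in> ball y r" "y + z \<in> ball y r'" by (auto simp: m_def dist_norm)
      then have "y + z \<in> closure (Omega D)" using r closure_subset by blast
      then obtain t' where t': "t' \<in> fine_mesh D" "y + z \<in> t'" using fine_union by blast
      then have "y \<in> t'" using r'(2) z(2) by (auto simp: S_def)
      then have "F \<subseteq> t \<inter> t'"
        using y yF face_of_imp_subset[OF F] by (intro subset_of_face_of[OF fine_face[OF t t'(1)]]) auto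
      then have "(1 - e) *\<^sub>R y + e *\<^sub>R x \<in> t'" using e(2) by blast
      from convexD[OF fine_convex[OF t'(1)] this t'(2), of "1 / e" "(e - 1) / e"]
      have "(1 / e) *\<^sub>R ((1 - e) *\<^sub>R y + e *\<^sub>R x) + ((e - 1) / e) *\<^sub>R (y + z) \<in> t'"
        using e(1) by (simp add: add_divide_distrib[symmetric] del: scaleR_add_right)
      also have "(1 / e) *\<^sub>R ((1 - e) *\<^sub>R y + e *\<^sub>R x) + ((e - 1) / e) *\<^sub>R (y + z) = p"
      proof -
        have "((e - 1) / e) *\<^sub>R z = p - x" using e by (simp add: z_def)
        moreover have "(1 / e) *\<^sub>R ((1 - e) *\<^sub>R y + e *\<^sub>R x) = - (((e - 1) / e) *\<^sub>R y) + x"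
          using e by (simp add: scaleR_add_right scaleR_minus_left[symmetric] minus_divide_left del: scaleR_minus_left)
        ultimately show ?thesis by (simp add: scaleR_add_right)
      qed
      finally show "p \<in> closure (Omega D)" using t'(1) fine_union by blast
    qed
    moreover have "m * (e - 1) / e > 0" using m e by simp
    ultimately have "x \<in> interior (closure (Omega D))" using mem_interior by blast
    then show False using x(2) Omega by (simp add: frontier_def interior_open)
  qed
  then have "closure (rel_interior F) \<subseteq> frontier (Omega D)" by (intro closure_minimal) auto
  then show ?thesis using convex_closure_rel_interior[OF Fc(1)] Fc(2) by simp
qed

text \<open>W consists of the vertices with positive coordinate at x. A boundary point may sit on a
  face of any dimension, and the boundary argument needs the face that has it in its relative
  interior.\<close>

lemma simplex_carrier_face:
  assumes t: "t \<in> fine_mesh D" and x: "x \<in> t"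
  obtains W where "W \<subseteq> vert t" "(convex hull W) face_of t" "x \<in> rel_interior (convex hull W)"
proof -
  interpret full_simplex "vert t" by (rule fine_full[OF t])
  define W where "W = {v \<in> vert t. bary (vert t) v x > 0}"
  have W: "W \<subseteq> vert t" by (auto simp: W_def)
  have nn: "0 \<le> bary (vert t) v x" if "v \<in> vert t" for v using that x simplex_eq fine_hull[OF t] by auto
  then have z: "bary (vert t) v x = 0" if "v \<in> vert t - W" for v using that by (force simp: W_def)
  have ind: "\<not> affine_dependent W" using W independent affine_dependent_subset by blast
  have "(\<Sum>v\<in>W. bary (vert t) v x) = (\<Sum>v\<in>vert t. bary (vert t) v x)"
    "(\<Sum>v\<in>W. bary (vert t) v x *\<^sub>R v) = (\<Sum>v\<in>vert t. bary (vert t) v x *\<^sub>R v)"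
    using z W by (auto intro!: sum.mono_neutral_left finite_V)
  then have "(\<Sum>v\<in>W. bary (vert t) v x) = 1" "(\<Sum>v\<in>W. bary (vert t) v x *\<^sub>R v) = x" by (simp_all add: bary_repr)
  then have "x \<in> rel_interior (convex hull W)"
    unfolding rel_interior_convex_hull_explicit[OF ind] by (intro CollectI exI[of _ "\<lambda>v. bary (vert t) v x"]) (auto simp: W_def)
  moreover have "(convex hull W) face_of t"
    using face_of_convex_hull_affine_independent[OF independent] W fine_hull[OF t] by auto
  ultimately show thesis using that W by blast
qed

text \<open>The common face is spanned by vertices of t; being extreme points of a face of t', they
  are vertices of t' too.\<close>

lemma common_face:
  assumes t: "t \<in> fine_mesh D" "t' \<in> fine_mesh D"
  obtains W where "finite W" "W \<subseteq> vert t" "W \<subseteq> vert t'" "t \<inter> t' = convex hull W"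
proof -
  interpret full_simplex "vert t" by (rule fine_full[OF t(1)])
  obtain W where W: "W \<subseteq> vert t" "t \<inter> t' = convex hull W"
    using fine_face[OF t] face_of_convex_hull_affine_independent[OF independent] fine_hull[OF t(1)] by metis
  have ind: "\<not> affine_dependent W" using W independent affine_dependent_subset by blast
  have f': "(t \<inter> t') face_of t'" using fine_face[OF t(2,1)] by (simp add: Int_commute)
  have "W \<subseteq> vert t'"
  proof
    fix w assume "w \<in> W"
    then have "w extreme_point_of (t \<inter> t')"
      unfolding W(2) using extreme_point_of_convex_hull_affine_independent[OF ind] by blast
    then show "w \<in> vert t'" using extreme_point_of_face[OF f'] by blast
  qed
  then show thesis using that W finite_subset[OF W(1) finite_V] by blast
qed

section \<open>The Oswald interpolant\<close>

text \<open>The polynomial that \<open>oswald\<close> uses inside t, kept on the whole space: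
  \<open>oswald\<close> has the default value 0 on the skeleton, so continuity across faces is a
  property of these polynomials.\<close>

definition nodal_poly :: "nat \<Rightarrow> (real^'d \<Rightarrow> real) \<Rightarrow> (real^'d) set \<Rightarrow> real^'d \<Rightarrow> real" where
  "nodal_poly k q t = (SOME \<pi>. \<pi> \<in> Poly k \<and> (\<forall>\<nu>\<in>lagrange_nodes k t. \<pi> \<nu> = oswald_value D k q \<nu>))"

lemma nodal_poly:
  assumes "t \<in> fine_mesh D" "k \<ge> 1"
  shows "nodal_poly k q t \<in> Poly k" "\<nu> \<in> lagrange_nodes k t \<Longrightarrow> nodal_poly k q t \<nu> = oswald_value D k q \<nu>"
proof -
  have "\<exists>\<pi>. \<pi> \<in> Poly k \<and> (\<forall>\<nu>\<in>lagrange_nodes k t. \<pi> \<nu> = oswald_value D k q \<nu>)"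
    using lagrange_interpolation[OF fine_simplex[OF assms(1)] assms(2), of "oswald_value D k q"] by blast
  from someI_ex[OF this] show "nodal_poly k q t \<in> Poly k" "\<nu> \<in> lagrange_nodes k t \<Longrightarrow> nodal_poly k q t \<nu> = oswald_value D k q \<nu>"
    unfolding nodal_poly_def by blast+
qed

lemma oswald_interior: "t \<in> fine_mesh D \<Longrightarrow> x \<in> interior t \<Longrightarrow> oswald D k q x = nodal_poly k q t x"
  unfolding oswald_def nodal_poly_def Let_def using the_fine by auto

text \<open>A nodal value depends on the node only. The difference of the two polynomials vanishes
  at all nodes of the common face and therefore on the face.\<close>

lemma nodal_poly_consistent:
  assumes t: "t \<in> fine_mesh D" "t' \<in> fine_mesh D" and k: "k \<ge> 1" and x: "x \<in> t" "x \<in> t'"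
  shows "nodal_poly k q t x = nodal_poly k q t' x"
proof -
  obtain W where W: "finite W" "W \<subseteq> vert t" "W \<subseteq> vert t'" "t \<inter> t' = convex hull W"
    by (rule common_face[OF t], rule that)
  have "(\<lambda>x. nodal_poly k q t x - nodal_poly k q t' x) x = 0"
  proof (rule Poly_vanish_on_hull[OF W(1) k])
    show "(\<lambda>x. nodal_poly k q t x - nodal_poly k q t' x) \<in> Poly k"
      by (intro Poly_diff nodal_poly(1) t k)
    show "x \<in> convex hull W" using x W(4) by blast
    fix c :: "real^'d \<Rightarrow> nat" assume c: "sum c W = k"
    show "nodal_poly k q t (\<Sum>w\<in>W. (real (c w) / real k) *\<^sub>R w) - nodal_poly k q t' (\<Sum>w\<in>W. (real (c w) / real k) *\<^sub>R w) = 0"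
      using nodal_poly(2)[OF t(1) k lagrange_node_of_face[OF fine_simplex[OF t(1)] W(2) c]]
        nodal_poly(2)[OF t(2) k lagrange_node_of_face[OF fine_simplex[OF t(2)] W(3) c]] by simp
  qed
  then show ?thesis by simp
qed

text \<open>The whole carrier face of a boundary point lies in the boundary, so all its nodes carry
  the value 0. This includes elements that touch the boundary in a low-dimensional face
  only.\<close>

lemma nodal_poly_boundary:
  assumes t: "t \<in> fine_mesh D" and k: "k \<ge> 1" and x: "x \<in> t" "x \<in> frontier (Omega D)"
  shows "nodal_poly k q t x = 0"
proof -
  obtain W where W: "W \<subseteq> vert t" "(convex hull W) face_of t" "x \<in> rel_interior (convex hull W)"
    by (rule simplex_carrier_face[OF t x(1)], rule that)
  have fW: "finite W" using W(1) full_simplex.finite_V[OF fine_full[OF t]] finite_subset by blast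
  have sub: "convex hull W \<subseteq> frontier (Omega D)" by (rule boundary_face_point[OF t W(2,3) x(2)])
  show ?thesis
  proof (rule Poly_vanish_on_hull[OF fW k nodal_poly(1)[OF t k]])
    show "x \<in> convex hull W" using W(3) rel_interior_subset by blast
    fix c :: "real^'d \<Rightarrow> nat" assume c: "sum c W = k"
    let ?\<nu> = "\<Sum>w\<in>W. (real (c w) / real k) *\<^sub>R w"
    have "(\<Sum>w\<in>W. real (c w) / real k) = 1" using c k by (simp flip: sum_divide_distrib of_nat_sum)
    then have "?\<nu> \<in> convex hull W"
      unfolding convex_hull_finite[OF fW] by (intro CollectI exI[of _ "\<lambda>w. real (c w) / real k"]) auto
    then have "oswald_value D k q ?\<nu> = 0" using sub by (auto simp: oswald_value_def)
    then show "nodal_poly k q t ?\<nu> = 0"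
      using nodal_poly(2)[OF t k lagrange_node_of_face[OF fine_simplex[OF t] W(1) c]] by simp
  qed
qed

text \<open>The continuous representative of \<open>oswald\<close>: on the skeleton it takes the
  values of the element polynomials, where consistency makes the choice of the element
  immaterial.\<close>

definition oswald_cont :: "nat \<Rightarrow> (real^'d \<Rightarrow> real) \<Rightarrow> real^'d \<Rightarrow> real" where
  "oswald_cont k q x = (if \<exists>t\<in>fine_mesh D. x \<in> t then nodal_poly k q (SOME t. t \<in> fine_mesh D \<and> x \<in> t) x else 0)"

lemma oswald_cont_eq:
  assumes "t \<in> fine_mesh D" "x \<in> t" "k \<ge> 1"
  shows "oswald_cont k q x = nodal_poly k q t x"
proof -
  have "\<exists>t. t \<in> fine_mesh D \<and> x \<in> t" using assms by blast
  note s = someI_ex[OF this]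
  have "oswald_cont k q x = nodal_poly k q (SOME t. t \<in> fine_mesh D \<and> x \<in> t) x"
    unfolding oswald_cont_def by (rule if_P) (use assms(1,2) in blast)
  also have "\<dots> = nodal_poly k q t x"
    by (rule nodal_poly_consistent[OF conjunct1[OF s] assms(1,3) conjunct2[OF s] assms(2)])
  finally show ?thesis .
qed

lemma oswald_cont_outside:
  assumes "x \<notin> Omega D" "k \<ge> 1"
  shows "oswald_cont k q x = 0"
proof (cases "x \<in> closure (Omega D)")
  case True
  then obtain t where t: "t \<in> fine_mesh D" "x \<in> t" using fine_union by blast
  have "x \<in> frontier (Omega D)" using True assms(1) Omega(1) by (simp add: frontier_def interior_open)
  then show ?thesis using oswald_cont_eq[OF t assms(2)] nodal_poly_boundary[OF t(1) assms(2) t(2)] by simp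
next
  case False
  then show ?thesis using fine_union by (auto simp: oswald_cont_def)
qed

text \<open>The segment between two points may cross several elements and leave the domain. The
  elements and the closed complement of the domain cut its parameter interval into finitely many
  closed sets, and on each of them the function is Lipschitz with the same constant.\<close>

lemma oswald_cont_lipschitz:
  assumes k: "k \<ge> 1"
  obtains L where "\<And>x y. \<bar>oswald_cont k q x - oswald_cont k q y\<bar> \<le> L * norm (x - y)"
proof -
  have "\<exists>L. L \<ge> 0 \<and> (\<forall>x\<in>t. \<forall>y\<in>t. \<bar>nodal_poly k q t x - nodal_poly k q t y\<bar> \<le> L * norm (x - y))"
    if t: "t \<in> fine_mesh D" for t
    using Poly_lipschitz_on_compact[OF nodal_poly(1)[OF t k] fine_compact[OF t] fine_convex[OF t]] by metis
  then obtain l where l: "\<And>t. t \<in> fine_mesh D \<Longrightarrow> l t \<ge> 0"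
    "\<And>t x y. t \<in> fine_mesh D \<Longrightarrow> x \<in> t \<Longrightarrow> y \<in> t \<Longrightarrow> \<bar>nodal_poly k q t x - nodal_poly k q t y\<bar> \<le> l t * norm (x - y)"
    by metis
  define L where "L = (\<Sum>t\<in>fine_mesh D. l t)"
  have lL: "l t \<le> L" if "t \<in> fine_mesh D" for t
    unfolding L_def using that l(1) finite_fine by (intro member_le_sum) auto
  have L0: "L \<ge> 0" unfolding L_def using l(1) by (rule sum_nonneg)
  have "\<bar>oswald_cont k q x - oswald_cont k q y\<bar> \<le> L * norm (x - y)" for x y
  proof -
    define c where "c = (\<lambda>s::real. x + s *\<^sub>R (y - x))"
    define S where "S = insert (- Omega D) (fine_mesh D)"
    have cc: "continuous_on UNIV c" unfolding c_def by (intro continuous_intros)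
    have "(L * norm (x - y))-lipschitz_on {0..1} (\<lambda>s. oswald_cont k q (c s))"
    proof (rule lipschitz_on_closed_Union[where U = "\<lambda>t. c -` t" and I = S])
      show "finite S" using finite_fine by (simp add: S_def)
      show "0 \<le> L * norm (x - y)" using L0 by simp
      have "UNIV \<subseteq> \<Union>S" using fine_union closure_subset[of "Omega D"] by (auto simp: S_def)
      then show "{0..1} \<subseteq> (\<Union>t\<in>S. c -` t)" by auto
      fix t assume t: "t \<in> S"
      then have "closed t" using Omega(1) fine_compact by (auto simp: S_def intro: compact_imp_closed)
      then show "closed (c -` t)" using continuous_closed_vimage cc continuous_on_eq_continuous_at by blast
      show "(L * norm (x - y))-lipschitz_on (c -` t) (\<lambda>s. oswald_cont k q (c s))"
      proof (rule lipschitz_onI)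
        show "0 \<le> L * norm (x - y)" using L0 by simp
        fix s s' assume ss: "s \<in> c -` t" "s' \<in> c -` t"
        show "dist (oswald_cont k q (c s)) (oswald_cont k q (c s')) \<le> L * norm (x - y) * dist s s'"
        proof (cases "t \<in> fine_mesh D")
          case True
          have "c s - c s' = (s - s') *\<^sub>R (y - x)" by (simp add: c_def algebra_simps)
          then have n: "norm (c s - c s') = \<bar>s - s'\<bar> * norm (x - y)" by (simp add: norm_minus_commute)
          have "\<bar>oswald_cont k q (c s) - oswald_cont k q (c s')\<bar> \<le> l t * norm (c s - c s')"
            using ss l(2)[OF True] oswald_cont_eq[OF True _ k] by auto
          also have "\<dots> \<le> L * norm (c s - c s')" using lL[OF True] by (rule mult_right_mono) simp
          finally show ?thesis unfolding n by (simp add: dist_real_def mult_ac)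
        next
          case False
          then have "c s \<notin> Omega D" "c s' \<notin> Omega D" using t ss by (auto simp: S_def)
          then show ?thesis using oswald_cont_outside[OF _ k] L0 by simp
        qed
      qed
    qed
    from lipschitz_onD[OF this, of 0 1] show ?thesis by (simp add: c_def dist_real_def)
  qed
  then show thesis using that by blast
qed

lemma oswald_cont_H10:
  assumes k: "k \<ge> 1"
  shows "H10 (Omega D) (oswald_cont k q)"
proof -
  obtain L where L: "\<And>x y. \<bar>oswald_cont k q x - oswald_cont k q y\<bar> \<le> L * norm (x - y)"
    by (rule oswald_cont_lipschitz[OF k], rule that)
  have "\<exists>g. (\<forall>x. (nodal_poly k q t has_derivative (\<lambda>h. g x \<bullet> h)) (at x)) \<and> continuous_on UNIV g" if "t \<in> fine_mesh D" for t
    using Poly_gradient[OF nodal_poly(1)[OF that k]] by metis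
  then obtain g where g: "\<And>t x. t \<in> fine_mesh D \<Longrightarrow> (nodal_poly k q t has_derivative (\<lambda>h. g t x \<bullet> h)) (at x)"
    "\<And>t. t \<in> fine_mesh D \<Longrightarrow> continuous_on UNIV (g t)" by metis
  \<comment> \<open>The elementwise gradient. It is continuous off the skeleton and 0 outside the
    closed domain, the regularity that the membership criterion for \<open>H10\<close> asks
    for.\<close>
  define E where "E = (\<lambda>x. \<Sum>t\<in>fine_mesh D. indicator (interior t) x *\<^sub>R g t x)"
  have Et: "E x = g t x" if "t \<in> fine_mesh D" "x \<in> interior t" for t x
  proof -
    have "E x = (\<Sum>t'\<in>{t}. indicator (interior t') x *\<^sub>R g t' x)"
      unfolding E_def
    proof (rule sum.mono_neutral_right[OF finite_fine], use that in blast, intro ballI)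
      fix t' assume t': "t' \<in> fine_mesh D - {t}"
      then have "interior t \<inter> t' = {}" using fine_disjoint that(1) by blast
      then have "x \<notin> interior t'" using that(2) interior_subset[of t'] by blast
      then show "indicator (interior t') x *\<^sub>R g t' x = 0" by simp
    qed
    then show ?thesis using that by simp
  qed
  have E0: "E x = 0" if "x \<notin> closure (Omega D)" for x
  proof -
    have "x \<notin> interior t" if "t \<in> fine_mesh D" for t
      using that \<open>x \<notin> _\<close> fine_union interior_subset by blast
    then show ?thesis by (simp add: E_def)
  qed
  have Em: "E \<in> borel_measurable borel" unfolding E_def
    by (intro borel_measurable_sum borel_measurable_scaleR borel_measurable_indicator borel_measurable_continuous_onI g(2)) auto
  have loc: "(oswald_cont k q has_derivative (\<lambda>h. E x \<bullet> h)) (at x) \<and> isCont E x" if nf: "\<forall>t\<in>fine_mesh D. x \<notin> frontier t" for x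
  proof (cases "x \<in> closure (Omega D)")
    case True
    obtain t where t: "t \<in> fine_mesh D" "x \<in> interior t" by (rule fine_cases[OF nf True], rule that)
    have d: "(oswald_cont k q has_derivative (\<lambda>h. g t x \<bullet> h)) (at x)"
    proof (rule has_derivative_transform_within_open[OF g(1)[OF t(1)] open_interior t(2)])
      fix y assume "y \<in> interior t"
      then show "nodal_poly k q t y = oswald_cont k q y"
        using oswald_cont_eq[OF t(1) _ k] interior_subset by fastforce
    qed
    have "isCont (g t) x" using g(2)[OF t(1)] by (simp add: continuous_on_eq_continuous_at)
    moreover have "eventually (\<lambda>y. g t y = E y) (nhds x)"
      unfolding eventually_nhds by (intro exI[of _ "interior t"]) (use t(2) Et[OF t(1)] in auto)
    ultimately have "isCont E x" using isCont_cong by blast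
    then show ?thesis using d Et[OF t] by simp
  next
    case False
    then have x: "x \<in> - closure (Omega D)" by simp
    have o: "open (- closure (Omega D))" by auto
    have "(oswald_cont k q has_derivative (\<lambda>h. 0)) (at x)"
    proof (rule has_derivative_transform_within_open[OF _ o x, of "\<lambda>y. 0"])
      fix y assume "y \<in> - closure (Omega D)"
      then have "y \<notin> Omega D" using closure_subset by blast
      then show "0 = oswald_cont k q y" using oswald_cont_outside[OF _ k] by simp
    qed simp
    moreover have "eventually (\<lambda>y. 0 = E y) (nhds x)"
      unfolding eventually_nhds by (intro exI[of _ "- closure (Omega D)"]) (use o x E0 in auto)
    then have "isCont E x" using isCont_cong[of "\<lambda>y. 0" E x] by simp
    ultimately show ?thesis using E0[OF False] by simp
  qed
  show ?thesis
  proof (rule lipschitz_zero_outside_H10(1)[OF Omega(1,2) L _ Em])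
    show "oswald_cont k q x = 0" if "x \<notin> Omega D" for x by (rule oswald_cont_outside[OF that k])
    show "AE y in lebesgue. (oswald_cont k q has_derivative (\<lambda>h. E y \<bullet> h)) (at y)" "AE y in lebesgue. isCont E y"
      using AE_fine_interior loc by (auto elim!: AE_mp)
  qed
qed

text \<open>\<open>H10\<close> is formulated with chosen gradients, so a change on a null set has to
  be carried through \<open>wgrad\<close>.\<close>

lemma H10_cong:
  fixes U :: "(real^'d) set"
  assumes u: "H10 U u" and U: "open U" and uv: "AE x in lebesgue_on U. u x = v x" and v: "v \<in> borel_measurable (lebesgue_on U)"
  shows "H10 U v"
  unfolding H10_def
proof (intro conjI allI impI)
  have wu: "has_weak_grad U u (wgrad U u)" using u by (intro H1_wgrad) (simp add: H10_def)
  then have wv: "has_weak_grad U v (wgrad U u)" by (rule has_weak_grad_cong[OF _ U uv v])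
  then show H: "H1 U v" by (auto simp: H1_def)
  have Lv: "L2 U v" "L2 U u" using wv wu by (auto simp: has_weak_grad_def)
  fix \<epsilon> :: real assume "\<epsilon> > 0"
  then obtain \<phi> where \<phi>: "\<phi> \<in> test_functions U"
    "(l2norm U (\<lambda>x. u x - \<phi> x))\<^sup>2 + (l2norm U (\<lambda>x. wgrad U u x - wgrad U \<phi> x))\<^sup>2 < \<epsilon>"
    using u by (auto simp: H10_def)
  have L\<phi>: "L2 U \<phi>" using test_functions_L2[OF \<phi>(1)] U by auto
  have "l2norm U (\<lambda>x. u x - \<phi> x) = l2norm U (\<lambda>x. v x - \<phi> x)"
    by (rule l2norm_cong_AE[OF _ L2_norm_measurable L2_norm_measurable])
       (use uv in \<open>auto elim!: AE_mp intro!: L2_diff Lv L\<phi>\<close>)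
  moreover have "l2norm U (\<lambda>x. wgrad U u x - wgrad U \<phi> x) = l2norm U (\<lambda>x. wgrad U v x - wgrad U \<phi> x)"
    using wgrad_test_diff[OF U wv \<phi>(1)] wgrad_test_diff[OF U wu \<phi>(1)] by simp
  ultimately show "\<exists>\<phi>\<in>test_functions U. (l2norm U (\<lambda>x. v x - \<phi> x))\<^sup>2 + (l2norm U (\<lambda>x. wgrad U v x - wgrad U \<phi> x))\<^sup>2 < \<epsilon>"
    using \<phi> by (intro bexI[of _ \<phi>]) simp_all
qed

theorem oswald_H10:
  assumes k: "k \<ge> 1"
  shows "H10 (Omega D) (oswald D k q)"
proof (rule H10_cong[OF oswald_cont_H10[OF k] Omega(1)])
  have Om: "Omega D \<in> sets lebesgue" using Omega(1) by auto
  obtain L where L: "\<And>x y. \<bar>oswald_cont k q x - oswald_cont k q y\<bar> \<le> L * norm (x - y)"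
    by (rule oswald_cont_lipschitz[OF k], rule that)
  have ae: "AE x in lebesgue. x \<in> Omega D \<longrightarrow> oswald_cont k q x = oswald D k q x"
    using AE_fine_interior
  proof (rule AE_mp, intro AE_I2 impI)
    fix x assume "\<forall>t\<in>fine_mesh D. x \<notin> frontier t" "x \<in> Omega D"
    then obtain t where t: "t \<in> fine_mesh D" "x \<in> interior t" using fine_cases closure_subset by blast
    then have "x \<in> t" using interior_subset by blast
    then show "oswald_cont k q x = oswald D k q x" using oswald_cont_eq[OF t(1) _ k] oswald_interior[OF t] by simp
  qed
  then show ae': "AE x in lebesgue_on (Omega D). oswald_cont k q x = oswald D k q x"
    by (simp add: AE_lebesgue_on[OF Om])
  have "oswald_cont k q \<in> borel_measurable lebesgue"
    by (rule continuous_lebesgue_measurable[OF lipschitz_continuous[OF L]])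
  then have m: "oswald_cont k q \<in> borel_measurable (lebesgue_on (Omega D))" by (rule measurable_restrict_space1)
  show "oswald D k q \<in> borel_measurable (lebesgue_on (Omega D))"
    by (rule measurable_lebesgue_on_AE[OF m Om ae'])
qed

end

lemma integral_AE_partition:
  fixes f :: "real^'d::finite \<Rightarrow> real"
  assumes fin: "finite F" and S: "S \<in> sets lebesgue" and F: "\<And>t. t \<in> F \<Longrightarrow> t \<in> sets lebesgue"
    and ind: "AE x in lebesgue. indicator S x = (\<Sum>t\<in>F. indicator t x :: real)"
    and f: "integrable (lebesgue_on S) f" "\<And>t. t \<in> F \<Longrightarrow> integrable (lebesgue_on t) f"
  shows "(LINT x|lebesgue_on S. f x) = (\<Sum>t\<in>F. LINT x|lebesgue_on t. f x)"
proof -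
  have i: "integrable lebesgue (\<lambda>x. indicator t x * f x)" if "t \<in> F" for t
    using f(2)[OF that] F[OF that] by (simp add: integrable_indicator_lebesgue_on)
  have iS: "integrable lebesgue (\<lambda>x. indicator S x * f x)"
    using f(1) S by (simp add: integrable_indicator_lebesgue_on)
  have "(LINT x|lebesgue_on S. f x) = (LINT x|lebesgue. indicator S x * f x)"
    using S by (simp add: integrable_indicator_lebesgue_on)
  also have "\<dots> = (LINT x|lebesgue. (\<Sum>t\<in>F. indicator t x * f x))"
  proof (rule integral_cong_AE)
    show "(\<lambda>x. indicator S x * f x) \<in> borel_measurable lebesgue" using iS by blast
    show "(\<lambda>x. \<Sum>t\<in>F. indicator t x * f x) \<in> borel_measurable lebesgue"
      by (intro borel_measurable_sum) (use i in blast)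
    show "AE x in lebesgue. indicator S x * f x = (\<Sum>t\<in>F. indicator t x * f x)"
      using ind by eventually_elim (simp add: sum_distrib_right)
  qed
  also have "\<dots> = (\<Sum>t\<in>F. LINT x|lebesgue. indicator t x * f x)" using i by (rule Bochner_Integration.integral_sum)
  also have "\<dots> = (\<Sum>t\<in>F. LINT x|lebesgue_on t. f x)"
    using F by (intro sum.cong) (simp_all add: integrable_indicator_lebesgue_on)
  finally show ?thesis .
qed

section \<open>One-sided traces\<close>

text \<open>The averages run over the part of a small ball in t. It has positive measure, since a
  convex set with interior points lies in the closure of its interior, and the averages converge to
  the value of the continuous representative. Every trace evaluated below is of this kind.\<close>

lemma trace_eq:
  fixes u w :: "real^'d::finite \<Rightarrow> real"
  assumes t: "compact t" "convex t" "interior t \<noteq> {}" and x: "x \<in> t"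
    and uw: "AE y in lebesgue_on t. u y = w y" and w: "continuous_on UNIV w"
    and u: "u \<in> borel_measurable (lebesgue_on t)"
  shows "trace t u x = w x"
proof -
  have tm: "t \<in> sets lebesgue" using t(1) by (auto intro: compact_sets_lebesgue)
  have lim: "((\<lambda>r. (LINT y|lebesgue_on (t \<inter> cball x r). u y) /\<^sub>R measure lebesgue (t \<inter> cball x r)) \<longlongrightarrow> w x) (at_right 0)"
    unfolding tendsto_iff
  proof (intro allI impI)
    fix e :: real assume e: "e > 0"
    have "isCont w x" using w by (simp add: continuous_on_eq_continuous_at)
    then obtain \<delta> where \<delta>: "\<delta> > 0" "\<And>y. dist y x < \<delta> \<Longrightarrow> dist (w y) (w x) < e / 2"
      using e unfolding continuous_at_eps_delta by (metis half_gt_zero dist_norm)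
    have "dist ((LINT y|lebesgue_on (t \<inter> cball x r). u y) /\<^sub>R measure lebesgue (t \<inter> cball x r)) (w x) < e"
      if r: "0 < r" "r < \<delta>" for r
    proof -
      let ?S = "t \<inter> cball x r"
      have Sc: "compact ?S" using t(1) by (simp add: compact_Int)
      have Sl: "?S \<in> lmeasurable" using Sc by (rule lmeasurable_compact)
      then have Sm: "?S \<in> sets lebesgue" by (rule fmeasurableD)
      interpret finite_measure "lebesgue_on ?S" using Sl by (rule finite_measure_lebesgue_on)
      have ms: "measure (lebesgue_on ?S) (space (lebesgue_on ?S)) = measure lebesgue ?S"
        using Sm by (simp add: measure_restrict_space)
      have pos: "measure lebesgue ?S > 0"
      proof -
        have "x \<in> closure (interior t)" using x t closure_subset by (metis convex_closure_interior subsetD)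
        then have "ball x r \<inter> interior t \<noteq> {}" using r(1) by (metis centre_in_ball disjoint_iff open_ball closure_iff_nhds_not_empty closure_subset interior_eq open_Int_closure_eq_empty)
        moreover have "open (ball x r \<inter> interior t)" by auto
        ultimately have "\<not> negligible (ball x r \<inter> interior t)" by (rule open_not_negligible[rotated])
        moreover have "ball x r \<inter> interior t \<subseteq> ?S" using interior_subset ball_subset_cball by blast
        ultimately have "\<not> negligible ?S" using negligible_subset by blast
        then show ?thesis using negligible_iff_measure[of ?S] Sl measure_nonneg[of lebesgue ?S] by linarith
      qed
      have um: "u \<in> borel_measurable (lebesgue_on ?S)" by (rule measurable_lebesgue_on_mono[OF Sm tm _ u]) simp
      have wm: "w \<in> borel_measurable (lebesgue_on ?S)"
        by (rule measurable_restrict_space1[OF continuous_lebesgue_measurable[OF w]])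
      have ae: "AE y in lebesgue_on ?S. u y = w y" by (rule AE_lebesgue_on_mono[OF Sm tm _ uw]) simp
      have wi: "integrable (lebesgue_on ?S) w"
      proof (rule integrable_const_bound[OF _ wm, of "\<bar>w x\<bar> + e / 2"])
        show "AE y in lebesgue_on ?S. norm (w y) \<le> \<bar>w x\<bar> + e / 2"
        proof (intro AE_I2)
          fix y assume "y \<in> space (lebesgue_on ?S)"
          then have "dist y x < \<delta>" using r by (simp add: dist_commute)
          then have "\<bar>w y - w x\<bar> < e / 2" using \<delta>(2) by (simp only: dist_real_def)
          then show "norm (w y) \<le> \<bar>w x\<bar> + e / 2" unfolding real_norm_def by linarith
        qed
      qed
      have "(LINT y|lebesgue_on ?S. u y) = (LINT y|lebesgue_on ?S. w y)" by (rule integral_cong_AE[OF um wm ae])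
      then have "(LINT y|lebesgue_on ?S. u y) - measure lebesgue ?S * w x = (LINT y|lebesgue_on ?S. w y - w x)"
        using wi ms by simp
      also have "\<bar>\<dots>\<bar> \<le> (LINT y|lebesgue_on ?S. e / 2)"
      proof (rule integral_abs_bound[THEN order_trans], rule integral_mono)
        fix y assume "y \<in> space (lebesgue_on ?S)"
        then have "dist y x < \<delta>" using r by (simp add: dist_commute)
        then show "\<bar>w y - w x\<bar> \<le> e / 2" using \<delta>(2)[of y] by (simp add: dist_real_def)
      qed (use wi in auto)
      also have "\<dots> = measure lebesgue ?S * (e / 2)" using ms by simp
      finally have "\<bar>(LINT y|lebesgue_on ?S. u y) - measure lebesgue ?S * w x\<bar> \<le> measure lebesgue ?S * (e / 2)" .
      then have "\<bar>(LINT y|lebesgue_on ?S. u y) - measure lebesgue ?S * w x\<bar> / measure lebesgue ?S \<le> e / 2"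
        using pos by (simp add: divide_le_eq mult.commute)
      moreover have "(LINT y|lebesgue_on ?S. u y) /\<^sub>R measure lebesgue ?S - w x =
          ((LINT y|lebesgue_on ?S. u y) - measure lebesgue ?S * w x) / measure lebesgue ?S"
        using pos by (simp add: field_simps)
      ultimately show ?thesis using pos e unfolding dist_real_def
        by (simp only: abs_divide abs_of_pos[OF pos])
    qed
    then show "eventually (\<lambda>r. dist ((LINT y|lebesgue_on (t \<inter> cball x r). u y) /\<^sub>R measure lebesgue (t \<inter> cball x r)) (w x) < e) (at_right 0)"
      unfolding eventually_at_right_field using \<delta>(1) by blast
  qed
  show ?thesis unfolding trace_def by (rule tendsto_Lim[OF _ lim]) simp
qed

lemma has_weak_grad_const:
  fixes U :: "(real^'d::finite) set"
  assumes U: "open U" "bounded U"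
  shows "has_weak_grad U (\<lambda>x. c) (\<lambda>x. 0)"
  unfolding has_weak_grad_def
proof (intro conjI ballI allI)
  have m: "U \<in> sets lebesgue" using U by auto
  show "L2 U (\<lambda>x. c)" "L2 U (\<lambda>x. 0 :: real^'d)" using L2_const[OF U(2) m] by blast+
  fix \<phi> i assume "\<phi> \<in> test_functions U"
  from test_partial_integral_zero[OF this U(1), of i]
  show "(LINT x|lebesgue_on U. c * partial i \<phi> x) = - (LINT x|lebesgue_on U. 0 $ i * \<phi> x)" by simp
qed

section \<open>Faces, fine elements and coarse elements\<close>

context fem_mesh
begin

lemma facet_facts:
  assumes t: "t \<in> fine_mesh D" and e: "e facet_of t"
  shows "norm (outer_normal t e) = 1" "\<forall>x\<in>e. \<forall>y\<in>e. outer_normal t e \<bullet> (x - y) = 0"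
    "compact e" "convex e" "e \<noteq> {}"
    "\<And>n. norm n = 1 \<Longrightarrow> \<forall>x\<in>e. \<forall>y\<in>e. n \<bullet> (x - y) = 0 \<Longrightarrow> n = outer_normal t e \<or> n = - outer_normal t e"
    "\<And>x. x \<in> rel_interior e \<Longrightarrow> \<exists>r>0. \<forall>y. dist x y < r \<longrightarrow>
       (outer_normal t e \<bullet> (y - x) \<le> 0 \<longrightarrow> y \<in> t) \<and> (outer_normal t e \<bullet> (y - x) < 0 \<longrightarrow> y \<in> interior t)"
proof -
  interpret full_simplex "vert t" by (rule fine_full[OF t])
  obtain v where v: "v \<in> vert t" "e = facet v" using e facet_iff[of e] fine_hull[OF t] by auto
  have n: "outer_normal t e = nrm v" using outer_normal_eq[OF v(1)] v(2) fine_hull[OF t] by simp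
  show "norm (outer_normal t e) = 1" unfolding n by (rule norm_nrm[OF v(1)])
  show "\<forall>x\<in>e. \<forall>y\<in>e. outer_normal t e \<bullet> (x - y) = 0" unfolding n using facet_flat[OF v(1)] v(2) by simp
  show "compact e" "convex e" "e \<noteq> {}" unfolding v(2) using compact_simplex_hull(2) facet_nonempty[OF v(1)] by auto
  show "n = outer_normal t e \<or> n = - outer_normal t e" if "norm n = 1" "\<forall>x\<in>e. \<forall>y\<in>e. n \<bullet> (x - y) = 0" for n
    unfolding n using normal_eq[OF v(1) that(1)] that(2) unfolding v(2) by blast
  show "\<exists>r>0. \<forall>y. dist x y < r \<longrightarrow> (outer_normal t e \<bullet> (y - x) \<le> 0 \<longrightarrow> y \<in> t) \<and> (outer_normal t e \<bullet> (y - x) < 0 \<longrightarrow> y \<in> interior t)"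
    if x: "x \<in> rel_interior e" for x
  proof -
    obtain r where r: "r > 0" "\<And>y. dist x y < r \<Longrightarrow> nrm v \<bullet> (y - x) \<le> 0 \<Longrightarrow> y \<in> convex hull (vert t)"
      "\<And>y. dist x y < r \<Longrightarrow> nrm v \<bullet> (y - x) < 0 \<Longrightarrow> y \<in> interior (convex hull (vert t))"
      by (rule half_ball[OF v(1) x[unfolded v(2)]], rule that)
    then show ?thesis unfolding n fine_hull[OF t] by blast
  qed
qed

lemma facet_rel_interior:
  assumes t: "t \<in> fine_mesh D" and e: "e facet_of t"
  obtains x where "x \<in> rel_interior e"
proof -
  have "rel_interior e \<noteq> {}" using facet_facts(4,5)[OF t e] rel_interior_eq_empty by blast
  then show thesis using that by blast
qed

text \<open>With equal normals both elements would contain the same open half ball at a relative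
  interior point of the facet, and their interiors would meet.\<close>

lemma shared_facet_normal:
  assumes t: "t \<in> fine_mesh D" "t' \<in> fine_mesh D" "t \<noteq> t'" and e: "e facet_of t" "e facet_of t'"
  shows "outer_normal t' e = - outer_normal t e"
proof (rule ccontr)
  let ?n = "outer_normal t e"
  assume "outer_normal t' e \<noteq> - ?n"
  then have n': "outer_normal t' e = ?n"
    using facet_facts(6)[OF t(1) e(1) facet_facts(1,2)[OF t(2) e(2)]] by blast
  obtain x where x: "x \<in> rel_interior e" by (rule facet_rel_interior[OF t(1) e(1)], rule that)
  obtain r where r: "r > 0" "\<And>y. dist x y < r \<Longrightarrow> ?n \<bullet> (y - x) < 0 \<Longrightarrow> y \<in> interior t"
    using facet_facts(7)[OF t(1) e(1) x] by blast
  obtain r' where r': "r' > 0" "\<And>y. dist x y < r' \<Longrightarrow> ?n \<bullet> (y - x) < 0 \<Longrightarrow> y \<in> interior t'"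
    using facet_facts(7)[OF t(2) e(2) x] unfolding n' by blast
  define s where "s = min r r' / 2"
  have s: "s > 0" "s < r" "s < r'" using r(1) r'(1) by (auto simp: s_def)
  define y where "y = x - s *\<^sub>R ?n"
  have "dist x y = s" using s facet_facts(1)[OF t(1) e(1)] by (simp add: y_def dist_norm)
  moreover have "?n \<bullet> (y - x) < 0"
    using s facet_facts(1)[OF t(1) e(1)] by (simp add: y_def power2_norm_eq_inner[symmetric])
  ultimately have "y \<in> interior t" "y \<in> interior t'" using r(2) r'(2) s by auto
  then show False using fine_disjoint[OF t] interior_subset by blast
qed

text \<open>Three elements at one facet would have pairwise opposite unit normals, hence n = -
  n.\<close>

lemma facet_at_most_two:
  assumes "t1 \<in> fine_mesh D" "t2 \<in> fine_mesh D" "t3 \<in> fine_mesh D" "e facet_of t1" "e facet_of t2" "e facet_of t3"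
    "t1 \<noteq> t2" "t1 \<noteq> t3"
  shows "t2 = t3"
proof (rule ccontr)
  assume ne: "t2 \<noteq> t3"
  have "outer_normal t2 e = - outer_normal t1 e" by (rule shared_facet_normal[OF assms(1,2,7,4,5)])
  moreover have "outer_normal t3 e = - outer_normal t1 e" by (rule shared_facet_normal[OF assms(1,3,8,4,6)])
  moreover have "outer_normal t3 e = - outer_normal t2 e" by (rule shared_facet_normal[OF assms(2,3) ne assms(5,6)])
  ultimately have "outer_normal t1 e = - outer_normal t1 e" by (simp only: minus_minus)
  then have "outer_normal t1 e = 0" by (metis add.right_inverse scaleR_2 scaleR_eq_0_iff zero_neq_numeral)
  then show False using facet_facts(1)[OF assms(1,4)] by simp
qed

text \<open>The half balls of the two elements on either side of the facet make up a full
  ball.\<close>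

lemma shared_facet_interior:
  assumes t: "t \<in> fine_mesh D" "t' \<in> fine_mesh D" "t \<noteq> t'" and e: "e facet_of t" "e facet_of t'"
    and x: "x \<in> rel_interior e"
  shows "x \<in> interior (t \<union> t')"
proof -
  let ?n = "outer_normal t e"
  obtain r where r: "r > 0" "\<And>y. dist x y < r \<Longrightarrow> ?n \<bullet> (y - x) \<le> 0 \<Longrightarrow> y \<in> t"
    using facet_facts(7)[OF t(1) e(1) x] by blast
  obtain r' where r': "r' > 0" "\<And>y. dist x y < r' \<Longrightarrow> - ?n \<bullet> (y - x) \<le> 0 \<Longrightarrow> y \<in> t'"
    using facet_facts(7)[OF t(2) e(2) x] unfolding shared_facet_normal[OF t e] by blast
  have "ball x (min r r') \<subseteq> t \<union> t'"
  proof
    fix y assume "y \<in> ball x (min r r')"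
    then show "y \<in> t \<union> t'" using r(2)[of y] r'(2)[of y] by (cases "?n \<bullet> (y - x) \<le> 0") auto
  qed
  moreover have "min r r' > 0" using r r' by simp
  ultimately show ?thesis using mem_interior by blast
qed

lemma elem_minus: "e \<in> fine_faces D \<Longrightarrow> elem_minus D e \<in> fine_mesh D" "e \<in> fine_faces D \<Longrightarrow> e facet_of elem_minus D e"
  and elem_plus: "e \<in> fine_faces D \<Longrightarrow> \<not> boundary_face D e \<Longrightarrow> elem_plus D e \<in> fine_mesh D"
    "e \<in> fine_faces D \<Longrightarrow> \<not> boundary_face D e \<Longrightarrow> e facet_of elem_plus D e"
    "e \<in> fine_faces D \<Longrightarrow> \<not> boundary_face D e \<Longrightarrow> elem_plus D e \<noteq> elem_minus D e"
  using mesh by (simp_all add: mesh_assms_def)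

lemma rel_interior_facet_Omega:
  assumes "t \<in> fine_mesh D" "t' \<in> fine_mesh D" "t \<noteq> t'" "e facet_of t" "e facet_of t'" "x \<in> rel_interior e"
  shows "x \<in> Omega D"
proof -
  have "interior (t \<union> t') \<subseteq> interior (closure (Omega D))" using assms(1,2) fine_union by (intro interior_mono) blast
  then show ?thesis using shared_facet_interior[OF assms] Omega(3) by blast
qed

lemma not_boundary_shared:
  assumes "t \<in> fine_mesh D" "t' \<in> fine_mesh D" "t \<noteq> t'" "e facet_of t" "e facet_of t'"
  shows "\<not> boundary_face D e"
proof
  assume b: "boundary_face D e"
  obtain x where x: "x \<in> rel_interior e" by (rule facet_rel_interior[OF assms(1,4)], rule that)
  then have "x \<in> frontier (Omega D)" using b rel_interior_subset by (auto simp: boundary_face_def)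
  moreover have "x \<in> Omega D" by (rule rel_interior_facet_Omega[OF assms x])
  ultimately show False using Omega(1) by (simp add: frontier_def interior_open)
qed

text \<open>Since a facet belongs to at most two elements, the designated elements exhaust
  them.\<close>

lemma facet_elems:
  assumes t: "t \<in> fine_mesh D" and e: "e facet_of t" and ef: "e \<in> fine_faces D"
  shows "t = elem_minus D e \<or> (\<not> boundary_face D e \<and> t = elem_plus D e)"
proof (cases "t = elem_minus D e")
  case False
  have nb: "\<not> boundary_face D e"
    by (rule not_boundary_shared[OF t elem_minus(1)[OF ef] False e elem_minus(2)[OF ef]])
  have "t = elem_plus D e"
    using facet_at_most_two[OF elem_minus(1)[OF ef] t elem_plus(1)[OF ef nb] elem_minus(2)[OF ef] e elem_plus(2)[OF ef nb]]
      False elem_plus(3)[OF ef nb] by metis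
  then show ?thesis using nb by blast
qed simp

lemma coarse_ex: "T \<in> coarse_mesh D \<Longrightarrow> \<exists>S. S \<subseteq> fine_mesh D \<and> S \<noteq> {} \<and> T = \<Union>S"
  and coarse_union: "\<Union>(coarse_mesh D) = closure (Omega D)"
  and coarse_disjoint: "T \<in> coarse_mesh D \<Longrightarrow> T' \<in> coarse_mesh D \<Longrightarrow> T \<noteq> T' \<Longrightarrow> interior T \<inter> interior T' = {}"
  using mesh by (simp_all add: mesh_assms_def)

lemma fine_inD: "t \<in> fine_in D T \<Longrightarrow> t \<in> fine_mesh D" "t \<in> fine_in D T \<Longrightarrow> t \<subseteq> T"
  and finite_fine_in: "finite (fine_in D T)"
  using finite_fine by (auto simp: fine_in_def)

lemma coarse_eq: "T \<in> coarse_mesh D \<Longrightarrow> T = \<Union>(fine_in D T)" and fine_in_nonempty: "T \<in> coarse_mesh D \<Longrightarrow> fine_in D T \<noteq> {}"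
  using coarse_ex[of T] unfolding fine_in_def by blast+

lemma coarse_compact: "T \<in> coarse_mesh D \<Longrightarrow> compact T"
  by (subst coarse_eq, assumption) (intro compact_Union finite_fine_in, use fine_compact fine_inD in blast)

lemma finite_coarse: "finite (coarse_mesh D)"
proof (rule finite_subset)
  show "coarse_mesh D \<subseteq> Union ` Pow (fine_mesh D)" using coarse_ex by blast
qed (use finite_fine in simp)

lemma fine_meets_coarse:
  assumes t: "t \<in> fine_mesh D" and T: "T \<in> coarse_mesh D" and ne: "interior t \<inter> T \<noteq> {}"
  shows "t \<subseteq> T"
proof -
  obtain x t' where "x \<in> interior t" "t' \<in> fine_in D T" "x \<in> t'" using ne coarse_eq[OF T] by blast
  then show ?thesis using fine_disjoint[OF t, of t'] fine_inD by blast
qed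

lemma coarse_unique:
  assumes t: "t \<in> fine_mesh D" and T: "T \<in> coarse_mesh D" "T' \<in> coarse_mesh D" and sub: "t \<subseteq> T" "t \<subseteq> T'"
  shows "T = T'"
proof (rule ccontr)
  assume "T \<noteq> T'"
  then have "interior T \<inter> interior T' = {}" using coarse_disjoint T by blast
  then show False using interior_mono[OF sub(1)] interior_mono[OF sub(2)] fine_interior[OF t] by blast
qed

lemma coarse_of_fine:
  assumes t: "t \<in> fine_mesh D"
  obtains T where "T \<in> coarse_mesh D" "t \<subseteq> T"
proof -
  obtain x where x: "x \<in> interior t" using fine_interior[OF t] by blast
  then have "x \<in> \<Union>(coarse_mesh D)" using fine_union coarse_union t interior_subset by blast
  then obtain T where "T \<in> coarse_mesh D" "x \<in> T" by blast
  then show thesis using that fine_meets_coarse[OF t] x by blast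
qed

text \<open>Membership of e in a coarse face is an inclusion of sets, but the bookkeeping needs an
  element of T with e as a facet. An element of T through a relative interior point of e meets
  \<open>elem_minus D e\<close> in a common face that contains e.\<close>

lemma facet_in_coarse:
  assumes e: "e \<in> fine_faces D" and T: "T \<in> coarse_mesh D" and eT: "e \<subseteq> T"
  obtains t where "t \<in> fine_mesh D" "e facet_of t" "t \<subseteq> T"
proof -
  let ?s = "elem_minus D e"
  have s: "?s \<in> fine_mesh D" "e facet_of ?s" using elem_minus e by auto
  obtain x where x: "x \<in> rel_interior e" by (rule facet_rel_interior[OF s], rule that)
  then have "x \<in> T" using eT rel_interior_subset by blast
  then obtain t where t: "t \<in> fine_mesh D" "t \<subseteq> T" "x \<in> t" using coarse_eq[OF T] fine_inD by blast
  show thesis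
  proof (cases "t = ?s")
    case True
    then show ?thesis using that s t by blast
  next
    case False
    let ?F = "?s \<inter> t"
    have Fs: "?F face_of ?s" by (rule fine_face[OF s(1) t(1)])
    have es: "e face_of ?s" "aff_dim e = aff_dim ?s - 1" "e \<noteq> {}" using s(2) by (auto simp: facet_of_def)
    have esub: "e \<subseteq> ?s" using face_of_imp_subset[OF es(1)] .
    have "e \<subseteq> ?F" by (rule subset_of_face_of[OF Fs esub]) (use x t esub rel_interior_subset in blast)
    then have eF: "e face_of ?F" using face_of_subset[OF es(1)] by blast
    have "?F \<noteq> ?s"
    proof
      assume "?F = ?s"
      then have "?s \<subseteq> t" by blast
      then show False using fine_disjoint[OF s(1) t(1)] False fine_interior[OF s(1)] interior_subset by blast
    qed
    then have l: "aff_dim ?F < aff_dim ?s" using face_of_aff_dim_lt[OF fine_convex[OF s(1)] Fs] by blast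
    \<comment> \<open>\<open>?F\<close> is a proper face of an element in which e has codimension 1,
      so its dimension is not larger than that of e; a face of \<open>?F\<close> of the same
      dimension is \<open>?F\<close>.\<close>
    have "e = ?F"
    proof (rule ccontr)
      assume "e \<noteq> ?F"
      then have "aff_dim e < aff_dim ?F"
        using face_of_aff_dim_lt[OF _ eF] convex_Int fine_convex s(1) t(1) by blast
      then show False using l es(2) by linarith
    qed
    then have "e face_of t" using fine_face[OF t(1) s(1)] by (simp add: Int_commute)
    moreover have "aff_dim t = aff_dim ?s"
      using aff_dim_simplex[OF fine_simplex[OF t(1)]] aff_dim_simplex[OF fine_simplex[OF s(1)]] by simp
    ultimately have "e facet_of t" using es by (simp add: facet_of_def)
    then show ?thesis using that t by blast
  qed
qed

lemma finite_elem_faces: "t \<in> fine_mesh D \<Longrightarrow> finite (elem_faces t)"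
  unfolding elem_faces_def using finite_polytope_facets[OF simplex_imp_polytope[OF fine_simplex]] by simp

lemma finite_fine_faces: "finite (fine_faces D)"
  unfolding fine_faces_def using finite_fine finite_elem_faces by blast

lemma fine_facesI: "t \<in> fine_mesh D \<Longrightarrow> e facet_of t \<Longrightarrow> e \<in> fine_faces D"
  by (auto simp: fine_faces_def elem_faces_def)

text \<open>The jump of the indicator function of T across e in combinatorial form, with value 1, 0
  or -1; at a boundary face the outer value counts as 0.\<close>

definition coarse_jump :: "(real^'d) set \<Rightarrow> (real^'d) set \<Rightarrow> real" where
  "coarse_jump T e = of_bool (elem_minus D e \<subseteq> T) - of_bool (\<not> boundary_face D e \<and> elem_plus D e \<subseteq> T)"

text \<open>Near a relative interior point of e each adjacent element reaches into T', so both
  elements belong to T', and any coarse indicator function has equal values on the two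
  sides.\<close>

lemma coarse_jump_interior:
  assumes e: "e \<in> interior_faces D T'" and T: "T \<in> coarse_mesh D" "T' \<in> coarse_mesh D"
  shows "coarse_jump T e = 0"
proof -
  have ef: "e \<in> fine_faces D" and ri: "rel_interior e \<subseteq> interior T'" using e by (auto simp: interior_faces_def)
  obtain x where x: "x \<in> rel_interior e" by (rule facet_rel_interior[OF elem_minus[OF ef]], rule that)
  have sub: "t \<subseteq> T'" if t: "t \<in> fine_mesh D" "e facet_of t" for t
  proof -
    obtain r where r: "r > 0" "\<And>y. dist x y < r \<Longrightarrow> outer_normal t e \<bullet> (y - x) < 0 \<Longrightarrow> y \<in> interior t"
      using facet_facts(7)[OF t x] by blast
    obtain r' where r': "r' > 0" "ball x r' \<subseteq> T'" using ri x mem_interior by blast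
    define s where "s = min r r' / 2"
    have s: "s > 0" "s < r" "s < r'" using r(1) r'(1) by (auto simp: s_def)
    define y where "y = x - s *\<^sub>R outer_normal t e"
    have d: "dist x y = s" using s facet_facts(1)[OF t] by (simp add: y_def dist_norm)
    moreover have "outer_normal t e \<bullet> (y - x) < 0"
      using s facet_facts(1)[OF t] by (simp add: y_def power2_norm_eq_inner[symmetric])
    ultimately have "y \<in> interior t" "y \<in> T'" using r(2) r'(2) s by auto
    then show ?thesis using fine_meets_coarse[OF t(1) T(2)] by blast
  qed
  have "\<not> boundary_face D e"
  proof
    assume "boundary_face D e"
    then have "x \<in> frontier (Omega D)" using x rel_interior_subset by (auto simp: boundary_face_def)
    moreover have "interior T' \<subseteq> Omega D" using interior_mono[of T' "closure (Omega D)"] coarse_union T(2) Omega(3) by blast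
    ultimately show False using ri x Omega(1) by (auto simp: frontier_def interior_open)
  qed
  moreover have "t \<subseteq> T \<longleftrightarrow> T = T'" if "t \<in> fine_mesh D" "e facet_of t" for t
    using sub[OF that] coarse_unique[OF that(1)] T by blast
  ultimately show ?thesis unfolding coarse_jump_def using elem_minus[OF ef] elem_plus(1,2)[OF ef] by auto
qed

text \<open>The double sum in \<open>b_h\<close> over coarse faces and their fine faces must count
  each relevant fine face once. If the jump does not vanish, e separates two different coarse
  elements, or one from the exterior, and this determines the coarse face.\<close>

lemma coarse_face_unique:
  assumes e: "e \<in> fine_faces D" and j: "coarse_jump T e \<noteq> 0" and T: "T \<in> coarse_mesh D"
  shows "\<exists>!E. E \<in> coarse_faces D \<and> e \<in> faces_covering D E"
proof -
  note em = elem_minus[OF e]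
  have e_sub: "e \<subseteq> t" if "e facet_of t" for t using that face_of_imp_subset by (auto simp: facet_of_def)
  show ?thesis
  proof (cases "boundary_face D e")
    case True
    then have sub: "elem_minus D e \<subseteq> T" using j by (auto simp: coarse_jump_def)
    have tm: "t = elem_minus D e" if "t \<in> fine_mesh D" "e facet_of t" for t
      using facet_elems[OF that e] True by blast
    have eT: "e \<subseteq> T \<inter> frontier (Omega D)"
      using sub e_sub[OF em(2)] True by (auto simp: boundary_face_def)
    show ?thesis
    proof (intro ex1I conjI)
      show "T \<inter> frontier (Omega D) \<in> coarse_faces D" using T eT e unfolding coarse_faces_def by blast
      show "e \<in> faces_covering D (T \<inter> frontier (Omega D))" using e eT by (simp add: faces_covering_def)
      fix E assume E: "E \<in> coarse_faces D \<and> e \<in> faces_covering D E"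
      have own: "T1 = T" if T1: "T1 \<in> coarse_mesh D" "e \<subseteq> T1" for T1
      proof -
        obtain t where t: "t \<in> fine_mesh D" "e facet_of t" "t \<subseteq> T1" by (rule facet_in_coarse[OF e T1], rule that)
        then show ?thesis using tm sub coarse_unique[OF em(1) T1(1) T] by auto
      qed
      from E consider T1 T2 where "E = T1 \<inter> T2" "T1 \<in> coarse_mesh D" "T2 \<in> coarse_mesh D" "T1 \<noteq> T2"
        | T1 where "E = T1 \<inter> frontier (Omega D)" "T1 \<in> coarse_mesh D"
        unfolding coarse_faces_def by blast
      then show "E = T \<inter> frontier (Omega D)"
      proof cases
        case 1
        then have "T1 = T" "T2 = T" using own E by (auto simp: faces_covering_def)
        then show ?thesis using 1 by simp
      next
        case 2
        then have "T1 = T" using own E by (auto simp: faces_covering_def)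
        then show ?thesis using 2 by simp
      qed
    qed
  next
    case False
    note ep = elem_plus[OF e False]
    obtain Tm where Tm: "Tm \<in> coarse_mesh D" "elem_minus D e \<subseteq> Tm" by (rule coarse_of_fine[OF em(1)], rule that)
    obtain Tp where Tp: "Tp \<in> coarse_mesh D" "elem_plus D e \<subseteq> Tp" by (rule coarse_of_fine[OF ep(1)], rule that)
    have ne: "Tm \<noteq> Tp"
    proof
      assume "Tm = Tp"
      then have "elem_minus D e \<subseteq> T \<longleftrightarrow> elem_plus D e \<subseteq> T"
        using coarse_unique[OF em(1) Tm(1) T Tm(2)] coarse_unique[OF ep(1) Tp(1) T Tp(2)] Tm(2) Tp(2) by metis
      then show False using j False by (simp add: coarse_jump_def)
    qed
    have eT: "e \<subseteq> Tm \<inter> Tp" using e_sub[OF em(2)] e_sub[OF ep(2)] Tm Tp by blast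
    show ?thesis
    proof (intro ex1I conjI)
      show "Tm \<inter> Tp \<in> coarse_faces D"
        unfolding coarse_faces_def using Tm(1) Tp(1) ne eT e
        by (intro UnI1 CollectI exI[of _ Tm] exI[of _ Tp] conjI bexI[of _ e]) auto
      show "e \<in> faces_covering D (Tm \<inter> Tp)" using e eT by (simp add: faces_covering_def)
      fix E assume E: "E \<in> coarse_faces D \<and> e \<in> faces_covering D E"
      have own: "T1 = Tm \<or> T1 = Tp" if T1: "T1 \<in> coarse_mesh D" "e \<subseteq> T1" for T1
      proof -
        obtain t where t: "t \<in> fine_mesh D" "e facet_of t" "t \<subseteq> T1" by (rule facet_in_coarse[OF e T1], rule that)
        then have "t = elem_minus D e \<or> t = elem_plus D e" using facet_elems[OF t(1,2) e] by blast
        then show ?thesis using t(3) coarse_unique[OF em(1) T1(1) Tm(1) _ Tm(2)] coarse_unique[OF ep(1) T1(1) Tp(1) _ Tp(2)] by auto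
      qed
      from E consider T1 T2 where "E = T1 \<inter> T2" "T1 \<in> coarse_mesh D" "T2 \<in> coarse_mesh D" "T1 \<noteq> T2"
        | T1 where "E = T1 \<inter> frontier (Omega D)" "T1 \<in> coarse_mesh D"
        unfolding coarse_faces_def by blast
      then show "E = Tm \<inter> Tp"
      proof cases
        case 1
        then have "T1 = Tm \<or> T1 = Tp" "T2 = Tm \<or> T2 = Tp" using own E by (auto simp: faces_covering_def)
        then show ?thesis using 1 by auto
      next
        case 2
        then show ?thesis using E False by (auto simp: faces_covering_def boundary_face_def)
      qed
    qed
  qed
qed

end

section \<open>Flux reconstruction and local conservation\<close>

lemma has_derivative_vec:
  fixes X :: "real^'d::finite \<Rightarrow> real^'n::finite"
  assumes "\<And>i. ((\<lambda>x. X x $ i) has_derivative (\<lambda>h. X' h $ i)) F"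
  shows "(X has_derivative X') F"
proof -
  have "(X has_derivative (\<lambda>h. \<Sum>i\<in>UNIV. X' h $ i *\<^sub>R axis i (1::real))) F"
  proof -
    have "((\<lambda>x. \<Sum>i\<in>UNIV. X x $ i *\<^sub>R axis i (1::real)) has_derivative (\<lambda>h. \<Sum>i\<in>UNIV. X' h $ i *\<^sub>R axis i (1::real))) F"
      by (intro has_derivative_sum has_derivative_scaleR_left assms)
    moreover have "(\<lambda>x. \<Sum>i\<in>UNIV. X x $ i *\<^sub>R axis i (1::real)) = X"
      using basis_expansion[of "X _"] by (auto simp: scalar_mult_eq_scaleR)
    ultimately show ?thesis by simp
  qed
  moreover have "(\<Sum>i\<in>UNIV. X' h $ i *\<^sub>R axis i (1::real)) = X' h" for h
    using basis_expansion[of "X' h"] by (simp add: scalar_mult_eq_scaleR)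
  ultimately show ?thesis by simp
qed

text \<open>A polynomial is not a test function but becomes one after multiplication with \<phi>;
  the integral of a partial derivative of the product is zero.\<close>

lemma Poly_test_integral:
  fixes \<pi> :: "real^'d::finite \<Rightarrow> real"
  assumes \<pi>: "\<pi> \<in> Poly k" and d: "\<And>x. (\<pi> has_derivative (\<lambda>h. \<Sum>i\<in>UNIV. D i x * h $ i)) (at x)" and D: "D i \<in> Poly k"
    and U: "open U" and \<phi>: "\<phi> \<in> test_functions U"
  shows "integrable (lebesgue_on U) (\<lambda>x. \<pi> x * partial i \<phi> x)" "integrable (lebesgue_on U) (\<lambda>x. D i x * \<phi> x)"
    "(LINT x|lebesgue_on U. \<pi> x * partial i \<phi> x) = - (LINT x|lebesgue_on U. D i x * \<phi> x)"
proof -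
  have int: "integrable (lebesgue_on U) (\<lambda>x. f x * \<psi> x)" if f: "f \<in> Poly n" and \<psi>: "\<psi> \<in> test_functions U" for f \<psi> n
  proof -
    have w: "(\<lambda>x. f x * \<psi> x) \<in> test_functions U" by (rule test_functions_mult[OF \<psi> cont_diff_Poly[OF f]])
    obtain K where K: "compact K" "K \<subseteq> U" "\<And>x. x \<notin> K \<Longrightarrow> f x * \<psi> x = 0"
      by (rule test_functions_support[OF w], rule that)
    have Km: "K \<in> sets lebesgue" "U \<in> sets lebesgue" using K(1) U by (auto intro: compact_sets_lebesgue)
    have "integrable (lebesgue_on K) (\<lambda>x. f x * \<psi> x)"
      by (rule L2_integrable_bounded[OF test_functions_L2[OF w Km(1)] compact_imp_bounded[OF K(1)] Km(1)])
    moreover have "(\<lambda>x. indicat_real K x *\<^sub>R (f x * \<psi> x)) = (\<lambda>x. indicat_real U x *\<^sub>R (f x * \<psi> x))"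
      using K by (auto simp: indicator_def fun_eq_iff)
    ultimately show ?thesis by (simp only: integrable_indicator_lebesgue_on[OF Km(1)] integrable_indicator_lebesgue_on[OF Km(2)])
  qed
  show i: "integrable (lebesgue_on U) (\<lambda>x. \<pi> x * partial i \<phi> x)" "integrable (lebesgue_on U) (\<lambda>x. D i x * \<phi> x)"
    by (rule int[OF \<pi> test_functions_partial[OF \<phi>]], rule int[OF D \<phi>])
  have w: "(\<lambda>x. \<pi> x * \<phi> x) \<in> test_functions U" by (rule test_functions_mult[OF \<phi> cont_diff_Poly[OF \<pi>]])
  have "partial i (\<lambda>x. \<pi> x * \<phi> x) x = \<pi> x * partial i \<phi> x + D i x * \<phi> x" for x
  proof -
    have "partial i \<pi> x = D i x"
      using partial_eq[OF d, of i x] by (simp add: axis_def if_distrib[of "(*) _"] cong: if_cong)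
    moreover have "\<pi> differentiable (at x)" using d differentiable_def by blast
    ultimately show ?thesis using partial_mult[OF _ test_functionsD(2)[OF \<phi>], of \<pi> x i] by simp
  qed
  then have "0 = (LINT x|lebesgue_on U. \<pi> x * partial i \<phi> x + D i x * \<phi> x)"
    using test_partial_integral_zero[OF w U, of i] by simp
  also have "\<dots> = (LINT x|lebesgue_on U. \<pi> x * partial i \<phi> x) + (LINT x|lebesgue_on U. D i x * \<phi> x)"
    by (rule Bochner_Integration.integral_add[OF i])
  finally show "(LINT x|lebesgue_on U. \<pi> x * partial i \<phi> x) = - (LINT x|lebesgue_on U. D i x * \<phi> x)" by simp
qed

lemma wdiv_weak_div: "has_weak_div U v g \<Longrightarrow> has_weak_div U v (wdiv U v)"
  unfolding wdiv_def by (rule someI[of "has_weak_div U v"])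

context fem_mesh
begin

lemma AE_interior: "t \<in> fine_mesh D \<Longrightarrow> AE x in lebesgue. x \<in> interior t \<longleftrightarrow> x \<in> t"
proof -
  assume t: "t \<in> fine_mesh D"
  show ?thesis using AE_fine_interior
  proof eventually_elim
    case (elim x)
    then show ?case using t interior_subset[of t] closure_subset[of t] by (auto simp: frontier_def)
  qed
qed

lemma fine_sets: "t \<in> fine_mesh D \<Longrightarrow> t \<in> sets lebesgue" "t \<in> fine_mesh D \<Longrightarrow> interior t \<in> sets lebesgue"
  "Omega D \<in> sets lebesgue"
  using fine_compact Omega(1) by (auto intro: compact_sets_lebesgue)

lemma fine_AE_subset_Omega: "t \<in> fine_mesh D \<Longrightarrow> AE x in lebesgue. x \<in> t \<longrightarrow> x \<in> Omega D"
  using AE_interior fine_interior_Omega by fastforce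

text \<open>Test functions supported inside an element see only the polynomial representing v there,
  so the chosen global weak divergence agrees on the element with the trace of the Jacobian.\<close>

lemma RTN_polynomial:
  assumes v: "v \<in> RTN_space D l" and t: "t \<in> fine_mesh D"
  obtains X J where "\<And>x. (X has_derivative (\<lambda>h. J x *v h)) (at x)" "continuous_on UNIV (J :: real^'d \<Rightarrow> real^'d^'d)"
    "AE x in lebesgue_on t. v x = X x"
    "AE x in lebesgue_on t. wdiv (Omega D) v x = (\<Sum>i\<in>UNIV. J x $ i $ i)"
proof -
  have wd: "has_weak_div (Omega D) v (wdiv (Omega D) v)" using v wdiv_weak_div by (auto simp: RTN_space_def)
  obtain a b where ab: "b \<in> Poly l" "\<forall>i. a i \<in> Poly l" "AE x in lebesgue_on t. v x = (\<chi> i. a i x) + b x *\<^sub>R x"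
    using v t by (auto simp: RTN_space_def)
  define X where "X = (\<lambda>x. (\<chi> i. a i x) + b x *\<^sub>R x)"
  have X: "(\<lambda>x. X x $ i) \<in> Poly (Suc l)" for i
    using Poly_add[OF Poly_mono[of "a i" l "Suc l"] Poly_coord[OF ab(1), of i]] ab(2) by (simp add: X_def mult.commute)
  then have "\<forall>i. \<exists>D. (\<forall>j. D j \<in> Poly (Suc l)) \<and> (\<forall>x. ((\<lambda>x. X x $ i) has_derivative (\<lambda>h. \<Sum>j\<in>UNIV. D j x * h $ j)) (at x))"
    using Poly_has_derivative by blast
  from choice[OF this] obtain P where "\<forall>i. (\<forall>j. P i j \<in> Poly (Suc l)) \<and>
    (\<forall>x. ((\<lambda>x. X x $ i) has_derivative (\<lambda>h. \<Sum>j\<in>UNIV. P i j x * h $ j)) (at x))" by blast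
  then have P: "\<And>i j. P i j \<in> Poly (Suc l)"
    "\<And>i x. ((\<lambda>x. X x $ i) has_derivative (\<lambda>h. \<Sum>j\<in>UNIV. P i j x * h $ j)) (at x)" by blast+
  define J :: "real^'d \<Rightarrow> real^'d^'d" where "J = (\<lambda>x. \<chi> i j. P i j x)"
  have tm: "t \<in> sets lebesgue" "interior t \<in> sets lebesgue" "Omega D \<in> sets lebesgue" using fine_sets t by auto
  have U: "open (interior t)" "interior t \<subseteq> Omega D" "bounded (interior t)"
    using fine_interior_Omega[OF t] Omega(2) bounded_subset by auto
  have vX: "AE x in lebesgue_on (interior t). v x = X x"
    using AE_lebesgue_on_mono[OF tm(2,1) interior_subset ab(3)] by (simp add: X_def)
  have "AE x in lebesgue_on (interior t). wdiv (Omega D) v x - (\<Sum>i\<in>UNIV. P i i x) = 0"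
  proof (rule test_orthogonal_imp_AE_zero[OF U(1)])
    have L: "L2 (interior t) v" "L2 (interior t) (wdiv (Omega D) v)"
      using wd L2_mono[OF _ tm(2,3) U(2)] by (auto simp: has_weak_div_def)
    have Pc: "continuous_on UNIV (\<lambda>x. \<Sum>i\<in>UNIV. P i i x)" by (intro continuous_on_sum Poly_continuous[OF P(1)])
    show "integrable (lebesgue_on (cbox r s)) (\<lambda>x. wdiv (Omega D) v x - (\<Sum>i\<in>UNIV. P i i x))" if "cbox r s \<subseteq> interior t" for r s
    proof (rule Bochner_Integration.integrable_diff)
      show "integrable (lebesgue_on (cbox r s)) (wdiv (Omega D) v)"
        by (rule integrable_lebesgue_on_mono[OF _ tm(2) that L2_integrable_bounded[OF L(2) U(3) tm(2)]]) simp
      show "integrable (lebesgue_on (cbox r s)) (\<lambda>x. \<Sum>i\<in>UNIV. P i i x)"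
        by (rule continuous_imp_integrable) (rule continuous_on_subset[OF Pc subset_UNIV])
    qed
    fix \<phi> assume \<phi>: "\<phi> \<in> test_functions (interior t)"
    obtain K where K: "compact K" "K \<subseteq> interior t" "\<And>x. x \<notin> K \<Longrightarrow> \<phi> x = 0" "\<And>x i. x \<notin> K \<Longrightarrow> partial i \<phi> x = 0"
      by (rule test_functions_support[OF \<phi>], rule that)
    note PI = Poly_test_integral[OF X P(2) P(1) U(1) \<phi>]
    have Lp: "L2 (interior t) (grad \<phi>)" using test_functions_L2[OF test_functions_partial[OF \<phi>] tm(2)] by (auto intro!: L2_vec)
    have "- (LINT x|lebesgue_on (interior t). wdiv (Omega D) v x * \<phi> x) = - (LINT x|lebesgue_on (Omega D). wdiv (Omega D) v x * \<phi> x)"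
      using K(2,3) by (subst integral_lebesgue_on_support[OF tm(2,3) U(2)]) auto
    also have "\<dots> = (LINT x|lebesgue_on (Omega D). v x \<bullet> grad \<phi> x)"
      using bspec[OF conjunct2[OF conjunct2[OF wd[unfolded has_weak_div_def]]] test_functions_mono[OF \<phi> U(2)]] by (rule sym)
    also have "\<dots> = (LINT x|lebesgue_on (interior t). v x \<bullet> grad \<phi> x)"
    proof (rule integral_lebesgue_on_support[OF tm(2,3) U(2)])
      fix x assume "x \<in> Omega D - interior t"
      then have "partial i \<phi> x = 0" for i using K(2,4) by blast
      then show "v x \<bullet> grad \<phi> x = 0" by (simp add: inner_vec_def)
    qed
    also have "\<dots> = (LINT x|lebesgue_on (interior t). (\<Sum>i\<in>UNIV. X x $ i * partial i \<phi> x))"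
    proof (rule integral_cong_AE)
      show "AE x in lebesgue_on (interior t). v x \<bullet> grad \<phi> x = (\<Sum>i\<in>UNIV. X x $ i * partial i \<phi> x)"
        using vX by eventually_elim (simp add: inner_vec_def)
    qed (use L2_inner_integrable[OF L(1) Lp] PI(1) in auto)
    also have "\<dots> = (\<Sum>i\<in>UNIV. LINT x|lebesgue_on (interior t). X x $ i * partial i \<phi> x)"
      by (rule Bochner_Integration.integral_sum[OF PI(1)])
    also have "\<dots> = - (\<Sum>i\<in>UNIV. LINT x|lebesgue_on (interior t). P i i x * \<phi> x)"
      using PI(3) by (simp add: sum_negf)
    also have "\<dots> = - (LINT x|lebesgue_on (interior t). (\<Sum>i\<in>UNIV. P i i x * \<phi> x))"
      by (simp only: Bochner_Integration.integral_sum[OF PI(2)])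
    finally have e: "(LINT x|lebesgue_on (interior t). wdiv (Omega D) v x * \<phi> x) = (LINT x|lebesgue_on (interior t). (\<Sum>i\<in>UNIV. P i i x * \<phi> x))"
      by simp
    have "(LINT x|lebesgue_on (interior t). (wdiv (Omega D) v x - (\<Sum>i\<in>UNIV. P i i x)) * \<phi> x) =
        (LINT x|lebesgue_on (interior t). wdiv (Omega D) v x * \<phi> x - (\<Sum>i\<in>UNIV. P i i x * \<phi> x))"
      by (simp only: left_diff_distrib sum_distrib_right)
    also have "\<dots> = (LINT x|lebesgue_on (interior t). wdiv (Omega D) v x * \<phi> x) - (LINT x|lebesgue_on (interior t). (\<Sum>i\<in>UNIV. P i i x * \<phi> x))"
      by (intro Bochner_Integration.integral_diff Bochner_Integration.integrable_sum PI(2)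
          L2_mult_integrable[OF L(2) test_functions_L2[OF \<phi> tm(2)]])
    finally show "(LINT x|lebesgue_on (interior t). (wdiv (Omega D) v x - (\<Sum>i\<in>UNIV. P i i x)) * \<phi> x) = 0" using e by simp
  qed
  then have w: "AE x in lebesgue_on t. wdiv (Omega D) v x = (\<Sum>i\<in>UNIV. J x $ i $ i)"
    using AE_interior[OF t] unfolding AE_lebesgue_on[OF tm(1)] AE_lebesgue_on[OF tm(2)]
    by eventually_elim (auto simp: J_def)
  show thesis
  proof (rule that[OF _ _ _ w])
    show "(X has_derivative (\<lambda>h. J x *v h)) (at x)" for x
      by (rule has_derivative_vec) (use P(2) in \<open>simp add: J_def matrix_vector_mult_def\<close>)
    show "continuous_on UNIV J" unfolding J_def by (intro continuous_on_vec_lambda Poly_continuous[OF P(1)])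
    show "AE x in lebesgue_on t. v x = X x" using ab(3) by (simp add: X_def)
  qed
qed

text \<open>The integral of the normal component that the reconstruction prescribes on e, obtained
  by testing with 1. The same number reappears when \<open>b_h\<close> is tested with a coarse
  indicator function.\<close>

definition face_flux :: "real^'m \<Rightarrow> (real^'d \<Rightarrow> real) \<Rightarrow> (real^'d) set \<Rightarrow> real" where
  "face_flux \<mu> q e = bc_face D \<mu> e q (\<lambda>x. 1) + bp_face D \<mu> e q (\<lambda>x. 1)"

text \<open>The divergence theorem on t, with each facet integral read off from the reconstruction
  condition for the polynomial 1. The sign is +1 at \<open>elem_minus\<close>, out of which the face
  normal points, and -1 at the other element.\<close>

lemma wdiv_element:
  assumes fl: "is_flux D l q \<mu> v" and t: "t \<in> fine_mesh D"
  shows "(LINT x|lebesgue_on t. wdiv (Omega D) v x) =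
    (\<Sum>e\<in>elem_faces t. (if t = elem_minus D e then 1 else -1) * face_flux \<mu> q e)"
proof -
  have v: "v \<in> RTN_space D l" using fl by (simp add: is_flux_def)
  obtain X J where X: "\<And>x. (X has_derivative (\<lambda>h. J x *v h)) (at x)" "continuous_on UNIV (J :: real^'d \<Rightarrow> real^'d^'d)"
    "AE x in lebesgue_on t. v x = X x" "AE x in lebesgue_on t. wdiv (Omega D) v x = (\<Sum>i\<in>UNIV. J x $ i $ i)"
    by (rule RTN_polynomial[OF v t], rule that)
  interpret full_simplex "vert t" by (rule fine_full[OF t])
  have Xc: "continuous_on UNIV X" using X(1) has_derivative_continuous by (intro continuous_at_imp_continuous_on ballI) blast
  have tm: "t \<in> sets lebesgue" using fine_sets t by auto
  have Om: "Omega D \<in> sets lebesgue" using fine_sets(3) .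
  have "has_weak_div (Omega D) v (wdiv (Omega D) v)" using v wdiv_weak_div by (auto simp: RTN_space_def)
  then have L: "L2 t v" "L2 t (wdiv (Omega D) v)"
    using L2_sub[OF tm Om fine_AE_subset_Omega[OF t]] by (auto simp: has_weak_div_def)
  have fi: "face_integral (nrm w) (facet w) (\<lambda>x. X x \<bullet> nrm w) =
      (if t = elem_minus D (facet w) then 1 else -1) * face_flux \<mu> q (facet w)" if w: "w \<in> vert t" for w
  proof -
    let ?e = "facet w" and ?m = "face_normal D (facet w)"
    have e: "?e facet_of t" using facet_iff[of ?e] w fine_hull[OF t] by auto
    have ef: "?e \<in> fine_faces D" by (rule fine_facesI[OF t e])
    have n: "outer_normal t ?e = nrm w" using outer_normal_eq[OF w] fine_hull[OF t] by simp
    note em = elem_minus[OF ef]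
    have m: "?m = (if t = elem_minus D ?e then nrm w else - nrm w)"
      using shared_facet_normal[OF t em(1) _ e em(2)] n by (auto simp: face_normal_def)
    note F = facet_facts[OF em, folded face_normal_def]
    have "\<forall>e\<in>elem_faces t. \<forall>r\<in>Poly l. face_integral (face_normal D e) e (\<lambda>x. trace t (\<lambda>y. v y \<bullet> face_normal D e) x * r x)
        = bc_face D \<mu> e q r + bp_face D \<mu> e q r"
      using fl t unfolding is_flux_def by blast
    from bspec[OF bspec[OF this] Poly_const[of 1]]
    have "face_flux \<mu> q ?e = face_integral ?m ?e (\<lambda>x. trace t (\<lambda>y. v y \<bullet> ?m) x * 1)"
      using e by (simp only: face_flux_def elem_faces_def mem_Collect_eq)
    also have "\<dots> = face_integral ?m ?e (\<lambda>x. X x \<bullet> ?m)"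
    proof (rule face_integral_cong[OF F(2,1)])
      fix x assume "x \<in> ?e"
      then have xt: "x \<in> t" using e face_of_imp_subset by (auto simp: facet_of_def)
      have "trace t (\<lambda>y. v y \<bullet> ?m) x = X x \<bullet> ?m"
      proof (rule trace_eq[OF fine_compact[OF t] fine_convex[OF t] fine_interior[OF t] xt])
        show "AE y in lebesgue_on t. v y \<bullet> ?m = X y \<bullet> ?m" using X(3) by eventually_elim simp
        show "continuous_on UNIV (\<lambda>y. X y \<bullet> ?m)" by (intro continuous_intros Xc)
        show "(\<lambda>y. v y \<bullet> ?m) \<in> borel_measurable (lebesgue_on t)"
          by (rule measurable_compose[OF L2_measurable[OF L(1)] borel_measurable_continuous_onI]) (intro continuous_intros)
      qed
      then show "trace t (\<lambda>y. v y \<bullet> ?m) x * 1 = X x \<bullet> ?m" by simp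
    qed
    finally have ff: "face_flux \<mu> q ?e = face_integral ?m ?e (\<lambda>x. X x \<bullet> ?m)" .
    show ?thesis
    proof (cases "t = elem_minus D ?e")
      case True
      then show ?thesis using ff m by simp
    next
      case False
      then have m': "?m = - nrm w" using m by simp
      \<comment> \<open>Reversing the normal leaves the surface integral unchanged; only the normal
        component changes its sign.\<close>
      have "face_integral (- nrm w) ?e (\<lambda>x. X x \<bullet> - nrm w) = face_integral (nrm w) ?e (\<lambda>x. X x \<bullet> - nrm w)"
        by (rule face_integral_uminus[OF facet_flat[OF w] norm_nrm[OF w] compact_simplex_hull(2) convex_convex_hull])
           (intro continuous_intros Xc)
      also have "\<dots> = - face_integral (nrm w) ?e (\<lambda>x. X x \<bullet> nrm w)"
        using face_integral_cmult[of "nrm w" ?e "-1" "\<lambda>x. X x \<bullet> nrm w"] by simp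
      finally show ?thesis using ff m' False by simp
    qed
  qed
  have inj: "inj_on facet (vert t)"
  proof
    fix w w' assume w: "w \<in> vert t" "w' \<in> vert t" "facet w = facet w'"
    show "w = w'"
    proof (rule ccontr)
      assume "w \<noteq> w'"
      then have "w \<in> facet w'" using w(1) by (intro hull_inc) auto
      then have "w \<in> facet w" using w(3) by simp
      then show False using bary_facet[OF w(1)] bary_vertex[OF independent w(1) w(1)] by auto
    qed
  qed
  have im: "elem_faces t = facet ` vert t" using facet_iff fine_hull[OF t] by (auto simp: elem_faces_def)
  have "(LINT x|lebesgue_on t. wdiv (Omega D) v x) = (LINT x|lebesgue_on t. (\<Sum>i\<in>UNIV. J x $ i $ i))"
  proof (rule integral_cong_AE[OF L2_measurable[OF L(2)] _ X(4)])
    have "continuous_on t (\<lambda>x. \<Sum>i\<in>UNIV. J x $ i $ i)"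
      by (intro continuous_intros continuous_on_sum continuous_on_subset[OF X(2) subset_UNIV])
    then show "(\<lambda>x. \<Sum>i\<in>UNIV. J x $ i $ i) \<in> borel_measurable (lebesgue_on t)"
      by (rule continuous_imp_measurable_on_sets_lebesgue[OF _ tm])
  qed
  also have "\<dots> = (\<Sum>w\<in>vert t. face_integral (nrm w) (facet w) (\<lambda>x. X x \<bullet> nrm w))"
    using divergence_theorem_simplex[OF X(1,2)] fine_hull[OF t] by simp
  also have "\<dots> = (\<Sum>w\<in>vert t. (if t = elem_minus D (facet w) then 1 else -1) * face_flux \<mu> q (facet w))"
    using fi by (rule sum.cong[OF refl])
  also have "\<dots> = (\<Sum>e\<in>elem_faces t. (if t = elem_minus D e then 1 else -1) * face_flux \<mu> q e)"
    unfolding im by (simp add: sum.reindex[OF inj])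
  finally show ?thesis .
qed

end

section \<open>Coarse indicator functions as discrete test functions\<close>

context fem_mesh
begin

lemma broken_grad_interior: "t \<in> fine_mesh D \<Longrightarrow> x \<in> interior t \<Longrightarrow> broken_grad D q x = wgrad (interior t) q x"
  unfolding broken_grad_def using the_fine[of t x] by auto

lemma AE_Omega_fine:
  assumes "\<And>t. t \<in> fine_mesh D \<Longrightarrow> AE x in lebesgue_on (interior t). P x"
  shows "AE x in lebesgue_on (Omega D). P x"
proof -
  have "AE x in lebesgue. \<forall>t\<in>fine_mesh D. x \<in> interior t \<longrightarrow> P x"
    using assms finite_fine fine_sets(2) by (subst AE_finite_all) (auto simp: AE_lebesgue_on)
  then show ?thesis unfolding AE_lebesgue_on[OF fine_sets(3)] using AE_fine_interior
  proof eventually_elim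
    case (elim x)
    show ?case
    proof
      assume "x \<in> Omega D"
      then obtain t where "t \<in> fine_mesh D" "x \<in> interior t"
        by (rule fine_cases[OF elim(2) subsetD[OF closure_subset]])
      then show "P x" using elim(1) by blast
    qed
  qed
qed

lemma coarse_sets: "T \<in> coarse_mesh D \<Longrightarrow> T \<in> sets lebesgue"
  using coarse_compact by (auto intro: compact_sets_lebesgue)

lemma coarse_AE_subset_Omega:
  assumes T: "T \<in> coarse_mesh D" shows "AE x in lebesgue. x \<in> T \<longrightarrow> x \<in> Omega D"
  using AE_fine_interior
proof eventually_elim
  case (elim x)
  show ?case
  proof
    assume "x \<in> T"
    then have "x \<in> closure (Omega D)" using coarse_union T by blast
    then obtain t where "t \<in> fine_mesh D" "x \<in> interior t" by (rule fine_cases[OF elim])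
    then show "x \<in> Omega D" using fine_interior_Omega by blast
  qed
qed

lemma coarse_indicator:
  assumes T: "T \<in> coarse_mesh D"
  shows "AE x in lebesgue. indicator T x = (\<Sum>t\<in>fine_in D T. indicator t x :: real)"
  using AE_fine_interior
proof eventually_elim
  case (elim x)
  show ?case
  proof (cases "x \<in> T")
    case True
    then obtain t where t: "t \<in> fine_in D T" "x \<in> t" using coarse_eq[OF T] by blast
    then have "x \<in> interior t" using elim fine_inD(1)[OF t(1)] closure_subset[of t] by (auto simp: frontier_def)
    then have "x \<notin> t'" if "t' \<in> fine_in D T - {t}" for t'
      using fine_disjoint[OF fine_inD(1)[OF t(1)] fine_inD(1)] that by blast
    then show ?thesis using True t finite_fine_in[of T] by (simp add: sum.remove[of _ t])
  next
    case False
    then have "(\<Sum>t\<in>fine_in D T. indicat_real t x) = 0" using fine_inD(2) by (intro sum.neutral) (auto simp: indicator_def)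
    then show ?thesis using False by simp
  qed
qed

lemma integral_coarse_fine:
  assumes T: "T \<in> coarse_mesh D" and f: "integrable (lebesgue_on (Omega D)) (f :: real^'d \<Rightarrow> real)"
  shows "(LINT x|lebesgue_on T. f x) = (\<Sum>t\<in>fine_in D T. LINT x|lebesgue_on t. f x)"
proof (rule integral_AE_partition[OF finite_fine_in coarse_sets[OF T] _ coarse_indicator[OF T]])
  show "integrable (lebesgue_on T) f"
    by (rule integrable_lebesgue_on_sub[OF coarse_sets[OF T] fine_sets(3) coarse_AE_subset_Omega[OF T] f])
  show "integrable (lebesgue_on t) f" if "t \<in> fine_in D T" for t
    by (rule integrable_lebesgue_on_sub[OF fine_sets(1) fine_sets(3) fine_AE_subset_Omega f]) (rule fine_inD(1)[OF that])+
qed (use fine_inD fine_sets in blast)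

lemma coarse_Omega_indicator: "AE x in lebesgue. indicator (Omega D) x = (\<Sum>T\<in>coarse_mesh D. indicator T x :: real)"
  using AE_fine_interior
proof eventually_elim
  case (elim x)
  show ?case
  proof (cases "x \<in> closure (Omega D)")
    case True
    obtain t where t: "t \<in> fine_mesh D" "x \<in> interior t" by (rule fine_cases[OF elim True])
    obtain T where T: "T \<in> coarse_mesh D" "t \<subseteq> T" by (rule coarse_of_fine[OF t(1)])
    have "x \<notin> T'" if "T' \<in> coarse_mesh D - {T}" for T'
      using fine_meets_coarse[OF t(1), of T'] coarse_unique[OF t(1) T(1), of T'] t(2) T(2) that by blast
    moreover have "x \<in> T" "x \<in> Omega D" using t T(2) interior_subset fine_interior_Omega by blast+
    ultimately show ?thesis using T(1) finite_coarse by (simp add: sum.remove[of _ T])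
  next
    case False
    then have "x \<notin> T" if "T \<in> coarse_mesh D" for T using coarse_union that by blast
    then have "(\<Sum>T\<in>coarse_mesh D. indicator T x :: real) = 0" by (intro sum.neutral) simp
    then show ?thesis using False closure_subset by (auto simp: indicator_def)
  qed
qed

lemma integral_Omega_coarse:
  assumes f: "integrable (lebesgue_on (Omega D)) (f :: real^'d \<Rightarrow> real)"
  shows "(LINT x|lebesgue_on (Omega D). f x) = (\<Sum>T\<in>coarse_mesh D. LINT x|lebesgue_on T. f x)"
  by (rule integral_AE_partition[OF finite_coarse fine_sets(3) coarse_sets coarse_Omega_indicator f])
    (auto intro: integrable_lebesgue_on_sub[OF coarse_sets fine_sets(3) coarse_AE_subset_Omega f])

lemma integral_Omega_indicator:
  assumes T: "T \<in> coarse_mesh D" and f: "integrable (lebesgue_on (Omega D)) (f :: real^'d \<Rightarrow> real)"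
  shows "(LINT x|lebesgue_on (Omega D). f x * indicator T x) = (LINT x|lebesgue_on T. f x)"
proof -
  have fT: "integrable (lebesgue_on T) f"
    by (rule integrable_lebesgue_on_sub[OF coarse_sets[OF T] fine_sets(3) coarse_AE_subset_Omega[OF T] f])
  have m: "(\<lambda>x. indicator (Omega D) x * f x) \<in> borel_measurable lebesgue" "(\<lambda>x. indicator T x * f x) \<in> borel_measurable lebesgue"
    using borel_measurable_integrable[OF f[unfolded integrable_indicator_lebesgue_on(2)[OF fine_sets(3)]]]
      borel_measurable_integrable[OF fT[unfolded integrable_indicator_lebesgue_on(2)[OF coarse_sets[OF T]]]] by simp_all
  have iT: "indicat_real T \<in> borel_measurable lebesgue" by (rule borel_measurable_indicator[OF coarse_sets[OF T]])
  have "(LINT x|lebesgue. indicator (Omega D) x * f x * indicator T x) = (LINT x|lebesgue. indicator T x * f x)"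
  proof (rule integral_cong_AE[OF borel_measurable_times[OF m(1) iT] m(2)])
    show "AE x in lebesgue. indicator (Omega D) x * f x * indicator T x = indicator T x * f x"
      using coarse_AE_subset_Omega[OF T] by eventually_elim (auto simp: indicator_def)
  qed
  then show ?thesis
    by (simp add: integrable_indicator_lebesgue_on(1)[OF fine_sets(3)] integrable_indicator_lebesgue_on(1)[OF coarse_sets[OF T]] mult.assoc)
qed

lemma indicator_coarse_interior:
  "T \<in> coarse_mesh D \<Longrightarrow> t \<in> fine_mesh D \<Longrightarrow> x \<in> interior t \<Longrightarrow> indicat_real T x = of_bool (t \<subseteq> T)"
  using fine_meets_coarse[of t T] interior_subset[of t] by (auto simp: indicator_def)

lemma indicator_coarse_AE:
  assumes "T \<in> coarse_mesh D" "t \<in> fine_mesh D"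
  shows "AE x in lebesgue_on t. indicat_real T x = of_bool (t \<subseteq> T)"
  unfolding AE_lebesgue_on[OF fine_sets(1)[OF assms(2)]] using AE_interior[OF assms(2)]
  by eventually_elim (use indicator_coarse_interior[OF assms] in auto)

lemma indicator_coarse_measurable:
  "T \<in> coarse_mesh D \<Longrightarrow> S \<in> sets lebesgue \<Longrightarrow> indicat_real T \<in> borel_measurable (lebesgue_on S)"
  using coarse_sets by (intro measurable_restrict_space1) auto

lemma indicator_coarse_weak_grad:
  assumes T: "T \<in> coarse_mesh D" and t: "t \<in> fine_mesh D"
  shows "has_weak_grad (interior t) (indicat_real T) (\<lambda>x. 0)"
proof (rule has_weak_grad_cong[OF has_weak_grad_const[of _ "of_bool (t \<subseteq> T)"] open_interior])
  show "bounded (interior t)" using fine_compact[OF t] compact_imp_bounded bounded_subset interior_subset by blast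
  show "AE x in lebesgue_on (interior t). of_bool (t \<subseteq> T) = indicat_real T x"
    using indicator_coarse_interior[OF T t] by (intro AE_I2) simp
qed (use indicator_coarse_measurable[OF T] fine_sets(2)[OF t] in auto)

lemma indicator_coarse_broken_grad:
  assumes T: "T \<in> coarse_mesh D"
  shows "AE x in lebesgue_on (Omega D). broken_grad D (indicat_real T) x = 0"
proof (rule AE_Omega_fine)
  fix t assume t: "t \<in> fine_mesh D"
  show "AE x in lebesgue_on (interior t). broken_grad D (indicat_real T) x = 0"
    using wgrad_eq[OF indicator_coarse_weak_grad[OF T t] open_interior] AE_space
    by eventually_elim (use broken_grad_interior[OF t] in auto)
qed

text \<open>The indicator functions of the coarse elements sum to at most 1 almost everywhere, so
  almost no point lies in two of them.\<close>

lemma indicator_coarse_const: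
  assumes T: "T \<in> coarse_mesh D" "T' \<in> coarse_mesh D"
  shows "AE x in lebesgue_on T'. indicat_real T x = of_bool (T = T')"
  unfolding AE_lebesgue_on[OF coarse_sets[OF T(2)]] using coarse_Omega_indicator
proof eventually_elim
  case (elim x)
  show ?case
  proof
    assume x: "x \<in> T'"
    have "(\<Sum>S\<in>{T, T'}. indicat_real S x) \<le> (\<Sum>S\<in>coarse_mesh D. indicat_real S x)"
      using T finite_coarse by (intro sum_mono2) auto
    then have "(\<Sum>S\<in>{T, T'}. indicat_real S x) \<le> 1"
      unfolding elim[symmetric] by (rule order_trans) (simp add: indicator_def)
    then show "indicat_real T x = of_bool (T = T')" using x
      by (cases "T = T'"; cases "x \<in> T") auto
  qed
qed

text \<open>On each coarse element the function is constant almost everywhere, so it meets the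
  polynomial condition for any degree and the continuity condition of the conforming local
  spaces.\<close>

lemma indicator_coarse_Qh:
  assumes T: "T \<in> coarse_mesh D"
  shows "indicat_real T \<in> Qh D k"
  unfolding Qh_def mem_Collect_eq
proof (intro conjI ballI)
  have L2: "L2 S (indicat_real T)" if "bounded S" "S \<in> sets lebesgue" for S
    by (rule L2_bounded[of _ _ 1]) (use that indicator_coarse_measurable[OF T] in auto)
  show "H1_broken D (indicat_real T)"
    unfolding H1_broken_def H1_def using L2[OF Omega(2) fine_sets(3)] indicator_coarse_weak_grad[OF T] by blast
  fix T' assume T': "T' \<in> coarse_mesh D"
  have c: "\<exists>g. continuous_on T' g \<and> (AE x in lebesgue_on T'. indicat_real T x = g x)"
    using indicator_coarse_const[OF T T'] by (intro exI[of _ "\<lambda>x. of_bool (T = T')"] conjI continuous_on_const)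
  have p: "\<exists>\<pi>\<in>Poly k. AE x in lebesgue_on t. indicat_real T x = \<pi> x" if "t \<in> fine_in D T'" for t
    using indicator_coarse_AE[OF T fine_inD(1)[OF that]] by (intro bexI[of _ "\<lambda>x. of_bool (t \<subseteq> T)"]) simp_all
  show "indicat_real T \<in> local_space D k T'"
    unfolding local_space_def using L2[OF compact_imp_bounded[OF coarse_compact[OF T']] coarse_sets[OF T']] c p by blast
qed

text \<open>Each local reduced space contains 1 and hence all constants; this is how the reduced
  solution inherits conservation on the coarse elements.\<close>

lemma indicator_coarse_Q_red:
  assumes T: "T \<in> coarse_mesh D" and red: "\<forall>T\<in>coarse_mesh D. reduced_space D k T (Qred T)"
  shows "indicat_real T \<in> Q_red D k Qred"
  unfolding Q_red_def mem_Collect_eq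
proof (intro conjI ballI indicator_coarse_Qh[OF T])
  fix T' assume T': "T' \<in> coarse_mesh D"
  have red': "reduced_space D k T' (Qred T')" using red T' by blast
  have one: "(\<lambda>x. 1) \<in> Qred T'" using red' by (simp add: reduced_space_def)
  have "\<forall>u\<in>Qred T'. \<forall>v\<in>Qred T'. \<forall>a b. (\<lambda>x. a * u x + b * v x) \<in> Qred T'" using conjunct2[OF conjunct2[OF red'[unfolded reduced_space_def]]] .
  from bspec[OF bspec[OF this one] one] have "(\<lambda>x. c * 1 + 0 * 1) \<in> Qred T'" for c by blast
  then have "(\<lambda>x. c) \<in> Qred T'" for c by simp
  then show "\<exists>r\<in>Qred T'. AE x in lebesgue_on T'. indicat_real T x = r x"
    using indicator_coarse_const[OF T T'] by (intro bexI[of _ "\<lambda>x. of_bool (T = T')"]) simp_all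
qed

lemma finite_coarse_faces: "finite (coarse_faces D)"
proof (rule finite_subset)
  show "coarse_faces D \<subseteq> (\<lambda>(T, T'). T \<inter> T') ` (coarse_mesh D \<times> coarse_mesh D) \<union> (\<lambda>T. T \<inter> frontier (Omega D)) ` coarse_mesh D"
    unfolding coarse_faces_def by force
qed (use finite_coarse in simp)

lemma face_flat:
  assumes e: "e \<in> fine_faces D"
  shows "norm (face_normal D e) = 1" "\<forall>x\<in>e. \<forall>y\<in>e. face_normal D e \<bullet> (x - y) = 0"
  using facet_facts(1,2)[OF elem_minus[OF e]] by (simp_all add: face_normal_def)

lemma facet_subset: "e facet_of t \<Longrightarrow> e \<subseteq> t"
  by (simp add: facet_of_imp_subset)

lemma jump_indicator_coarse:
  assumes T: "T \<in> coarse_mesh D" and e: "e \<in> fine_faces D" and x: "x \<in> e"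
  shows "jump D e (indicat_real T) x = coarse_jump T e"
proof -
  have tr: "trace t (indicat_real T) x = of_bool (t \<subseteq> T)" if t: "t \<in> fine_mesh D" "e facet_of t" for t
    by (rule trace_eq[OF fine_compact fine_convex fine_interior _ indicator_coarse_AE[OF T] continuous_on_const
          indicator_coarse_measurable[OF T fine_sets(1)]]) (use t x facet_subset in auto)
  show ?thesis unfolding jump_def coarse_jump_def using tr[OF elem_minus[OF e]] tr[OF elem_plus(1,2)[OF e]] by simp
qed

lemma average_indicator_coarse:
  assumes T: "T \<in> coarse_mesh D" and e: "e \<in> fine_faces D" and x: "x \<in> e"
  shows "average D e (\<lambda>y. (diff_tensor D \<mu> y *v broken_grad D (indicat_real T) y) \<bullet> n) x = 0"
proof -
  let ?f = "\<lambda>y. (diff_tensor D \<mu> y *v broken_grad D (indicat_real T) y) \<bullet> n"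
  have tr: "trace t ?f x = 0" if t: "t \<in> fine_mesh D" "e facet_of t" for t
  proof (rule trace_eq[OF fine_compact[OF t(1)] fine_convex[OF t(1)] fine_interior[OF t(1)] _ _ continuous_on_const])
    show "x \<in> t" using t x facet_subset by auto
    show ae: "AE y in lebesgue_on t. ?f y = 0"
      using AE_lebesgue_on_sub[OF fine_sets(1)[OF t(1)] fine_sets(3) fine_AE_subset_Omega[OF t(1)] indicator_coarse_broken_grad[OF T]]
      by eventually_elim simp
    have "AE y in lebesgue_on t. 0 = ?f y" using ae by eventually_elim simp
    then show "?f \<in> borel_measurable (lebesgue_on t)"
      by (rule measurable_lebesgue_on_AE[rotated 2, OF _ borel_measurable_const fine_sets(1)[OF t(1)]])
  qed
  show ?thesis unfolding average_def using tr[OF elem_minus[OF e]] tr[OF elem_plus(1,2)[OF e]] by simp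
qed

text \<open>The vanishing broken gradient removes the term with the indicator in the first place.
  The jump is constant along e and comes out of the other two integrals, leaving the flux number of
  e.\<close>

lemma face_terms_indicator_coarse:
  assumes T: "T \<in> coarse_mesh D" and e: "e \<in> fine_faces D"
  shows "b_c D \<mu> e (indicat_real T) q = 0"
    "b_c D \<mu> e q (indicat_real T) + b_p D \<mu> e (indicat_real T) q = coarse_jump T e * face_flux \<mu> q e"
proof -
  note F = face_flat(2,1)[OF e]
  have "b_c D \<mu> e (indicat_real T) q = face_integral (face_normal D e) e (\<lambda>x. 0 * 0)"
    unfolding b_c_def bc_face_def by (rule face_integral_cong[OF F]) (simp add: average_indicator_coarse[OF T e])
  then show "b_c D \<mu> e (indicat_real T) q = 0" unfolding face_integral_cmult by simp
  have c: "b_c D \<mu> e q (indicat_real T) = coarse_jump T e * bc_face D \<mu> e q (\<lambda>x. 1)"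
    unfolding b_c_def bc_face_def face_integral_cmult[symmetric]
    by (rule face_integral_cong[OF F]) (simp add: jump_indicator_coarse[OF T e])
  have p: "b_p D \<mu> e (indicat_real T) q = coarse_jump T e * bp_face D \<mu> e q (\<lambda>x. 1)"
    unfolding b_p_def bp_face_def face_integral_cmult[symmetric]
    by (rule face_integral_cong[OF F]) (simp add: jump_indicator_coarse[OF T e])
  show "b_c D \<mu> e q (indicat_real T) + b_p D \<mu> e (indicat_real T) q = coarse_jump T e * face_flux \<mu> q e"
    unfolding c p face_flux_def by (simp add: distrib_left)
qed

text \<open>Volume terms vanish with the broken gradient, faces inside a coarse element with the
  jump. The double sum over coarse faces becomes a sum over fine faces in which each face with
  nonzero jump occurs once.\<close>

lemma b_h_indicator_coarse:
  assumes T: "T \<in> coarse_mesh D"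
  shows "b_h D \<mu> q (indicat_real T) = (\<Sum>e\<in>fine_faces D. coarse_jump T e * face_flux \<mu> q e)"
proof -
  let ?x = "\<lambda>e. coarse_jump T e * face_flux \<mu> q e"
  have bl: "b_loc D \<mu> T' q (indicat_real T) = 0" if T': "T' \<in> coarse_mesh D" for T'
    unfolding b_loc_def
  proof (rule integral_eq_zero_AE)
    show "AE x in lebesgue_on T'. (diff_tensor D \<mu> x *v broken_grad D q x) \<bullet> broken_grad D (indicat_real T) x = 0"
      using AE_lebesgue_on_sub[OF coarse_sets[OF T'] fine_sets(3) coarse_AE_subset_Omega[OF T'] indicator_coarse_broken_grad[OF T]]
      by eventually_elim simp
  qed
  have int: "v * b_c D \<mu> e (indicat_real T) q + b_c D \<mu> e q (indicat_real T) + b_p D \<mu> e (indicat_real T) q = 0"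
    if "T' \<in> coarse_mesh D" "e \<in> interior_faces D T'" for T' e v
    using face_terms_indicator_coarse[OF T, of e \<mu> q] coarse_jump_interior[OF that(2) T that(1)] that(2)
    by (simp add: interior_faces_def)
  have cov: "b_c D \<mu> e (indicat_real T) q + b_c D \<mu> e q (indicat_real T) + b_p D \<mu> e (indicat_real T) q = ?x e"
    if "e \<in> faces_covering D E" for e E
    using face_terms_indicator_coarse[OF T, of e \<mu> q] that by (simp add: faces_covering_def)
  have "b_h D \<mu> q (indicat_real T) = (\<Sum>E\<in>coarse_faces D. \<Sum>e\<in>faces_covering D E. ?x e)"
    unfolding b_h_def using bl int cov by simp
  also have "\<dots> = (\<Sum>E\<in>coarse_faces D. \<Sum>e\<in>fine_faces D. of_bool (e \<in> faces_covering D E) * ?x e)"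
  proof (rule sum.cong[OF refl])
    fix E
    show "(\<Sum>e\<in>faces_covering D E. ?x e) = (\<Sum>e\<in>fine_faces D. of_bool (e \<in> faces_covering D E) * ?x e)"
      by (rule sum.mono_neutral_cong_left) (use finite_fine_faces in \<open>auto simp: faces_covering_def\<close>)
  qed
  also have "\<dots> = (\<Sum>e\<in>fine_faces D. \<Sum>E\<in>coarse_faces D. of_bool (e \<in> faces_covering D E) * ?x e)"
    by (rule sum.swap)
  also have "\<dots> = (\<Sum>e\<in>fine_faces D. ?x e)"
  proof (rule sum.cong[OF refl])
    fix e assume e: "e \<in> fine_faces D"
    show "(\<Sum>E\<in>coarse_faces D. of_bool (e \<in> faces_covering D E) * ?x e) = ?x e"
    proof (cases "coarse_jump T e = 0")
      case False
      obtain E0 where E0: "E0 \<in> coarse_faces D" "e \<in> faces_covering D E0"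
        "\<And>E. E \<in> coarse_faces D \<Longrightarrow> e \<in> faces_covering D E \<Longrightarrow> E = E0"
        by (rule ex1E[OF coarse_face_unique[OF e False T]], rule that) blast+
      have "of_bool (e \<in> faces_covering D E) * ?x e = (if E = E0 then ?x e else 0)" if "E \<in> coarse_faces D" for E
        using E0(3)[OF that] E0(2) by (cases "E = E0") auto
      then have "(\<Sum>E\<in>coarse_faces D. of_bool (e \<in> faces_covering D E) * ?x e) = (\<Sum>E\<in>coarse_faces D. if E = E0 then ?x e else 0)"
        by (rule sum.cong[OF refl])
      then show ?thesis using E0(1) finite_coarse_faces by simp
    qed simp
  qed
  finally show ?thesis .
qed

text \<open>Testing with the indicator function of a coarse element shows that the reconstructed
  flux conserves mass there.\<close>

lemma local_conservation:
  assumes fl: "is_flux D l q \<mu> v" and T: "T \<in> coarse_mesh D" and f: "L2 (Omega D) (rhs D)"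
    and dg: "b_h D \<mu> q (indicat_real T) = (LINT x|lebesgue_on (Omega D). rhs D x * indicat_real T x)"
  shows "(LINT x|lebesgue_on T. wdiv (Omega D) v x) = (LINT x|lebesgue_on T. rhs D x)"
proof -
  let ?s = "\<lambda>t e. if t = elem_minus D e then 1 else - 1 :: real"
  have "has_weak_div (Omega D) v (wdiv (Omega D) v)"
    using fl wdiv_weak_div by (auto simp: is_flux_def RTN_space_def)
  then have L: "L2 (Omega D) (wdiv (Omega D) v)" by (simp add: has_weak_div_def)
  have "(LINT x|lebesgue_on T. wdiv (Omega D) v x) = (\<Sum>t\<in>fine_in D T. LINT x|lebesgue_on t. wdiv (Omega D) v x)"
    by (rule integral_coarse_fine[OF T L2_integrable_bounded[OF L Omega(2) fine_sets(3)]])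
  also have "\<dots> = (\<Sum>t\<in>fine_in D T. \<Sum>e\<in>elem_faces t. ?s t e * face_flux \<mu> q e)"
    by (rule sum.cong[OF refl wdiv_element[OF fl fine_inD(1)]])
  also have "\<dots> = (\<Sum>t\<in>fine_in D T. \<Sum>e\<in>fine_faces D. (of_bool (e \<in> elem_faces t) * ?s t e) * face_flux \<mu> q e)"
  proof (rule sum.cong[OF refl])
    fix t assume t: "t \<in> fine_in D T"
    show "(\<Sum>e\<in>elem_faces t. ?s t e * face_flux \<mu> q e) = (\<Sum>e\<in>fine_faces D. (of_bool (e \<in> elem_faces t) * ?s t e) * face_flux \<mu> q e)"
      by (rule sum.mono_neutral_cong_left)
        (use finite_fine_faces fine_facesI[OF fine_inD(1)[OF t]] in \<open>auto simp: elem_faces_def\<close>)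
  qed
  also have "\<dots> = (\<Sum>e\<in>fine_faces D. (\<Sum>t\<in>fine_in D T. of_bool (e \<in> elem_faces t) * ?s t e) * face_flux \<mu> q e)"
    by (subst sum.swap) (simp only: sum_distrib_right)
  \<comment> \<open>After the exchange of the sums, e collects +1 if \<open>elem_minus\<close>
    belongs to T and -1 if \<open>elem_plus\<close> does: exactly the factor of its flux in the DG
    equation for the indicator function of T.\<close>
  also have "\<dots> = (\<Sum>e\<in>fine_faces D. coarse_jump T e * face_flux \<mu> q e)"
  proof (rule sum.cong[OF refl])
    fix e assume e: "e \<in> fine_faces D"
    have "of_bool (e \<in> elem_faces t) * ?s t e =
        of_bool (t = elem_minus D e) - of_bool (\<not> boundary_face D e \<and> t = elem_plus D e)" if "t \<in> fine_in D T" for t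
      using facet_elems[OF fine_inD(1)[OF that] _ e] elem_minus[OF e] elem_plus[OF e] by (auto simp: elem_faces_def)
    then have "(\<Sum>t\<in>fine_in D T. of_bool (e \<in> elem_faces t) * ?s t e) =
        (\<Sum>t\<in>fine_in D T. of_bool (t = elem_minus D e)) - (\<Sum>t\<in>fine_in D T. of_bool (\<not> boundary_face D e \<and> t = elem_plus D e))"
      unfolding sum_subtractf[symmetric] by (rule sum.cong[OF refl])
    also have "(\<Sum>t\<in>fine_in D T. of_bool (t = elem_minus D e)) = (of_bool (elem_minus D e \<subseteq> T) :: real)"
      using finite_fine_in[of T] elem_minus(1)[OF e] by (simp add: of_bool_def sum.delta' fine_in_def)
    also have "(\<Sum>t\<in>fine_in D T. of_bool (\<not> boundary_face D e \<and> t = elem_plus D e)) =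
        (of_bool (\<not> boundary_face D e \<and> elem_plus D e \<subseteq> T) :: real)"
      using finite_fine_in[of T] elem_plus(1)[OF e]
      by (cases "boundary_face D e") (simp_all add: of_bool_def sum.delta' fine_in_def)
    finally show "(\<Sum>t\<in>fine_in D T. of_bool (e \<in> elem_faces t) * ?s t e) * face_flux \<mu> q e = coarse_jump T e * face_flux \<mu> q e"
      by (simp add: coarse_jump_def)
  qed
  also have "\<dots> = (LINT x|lebesgue_on (Omega D). rhs D x * indicat_real T x)" using b_h_indicator_coarse[OF T] dg by simp
  also have "\<dots> = (LINT x|lebesgue_on T. rhs D x)"
    by (rule integral_Omega_indicator[OF T L2_integrable_bounded[OF f Omega(2) fine_sets(3)]])
  finally show ?thesis .
qed

end

section \<open>Error estimate\<close>

text \<open>A pointwise bound by F and G, rather than a product of two functions, admits the form of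
  a matrix in one factor and that of its inverse in the other.\<close>

lemma integral_Cauchy_Schwarz:
  fixes h F G :: "'a \<Rightarrow> real"
  assumes int: "integrable M h" "integrable M F" "integrable M G"
    and b: "AE x in M. (h x)\<^sup>2 \<le> F x * G x \<and> 0 \<le> F x \<and> 0 \<le> G x"
  shows "(LINT x|M. h x)\<^sup>2 \<le> (LINT x|M. F x) * (LINT x|M. G x)"
proof (rule discriminant_bound)
  fix s
  have "0 \<le> (LINT x|M. F x + 2 * s * h x + s\<^sup>2 * G x)"
  proof (rule integral_nonneg_AE)
    show "AE x in M. 0 \<le> F x + 2 * s * h x + s\<^sup>2 * G x" using b
    proof eventually_elim
      case (elim x)
      have "\<bar>h x\<bar> \<le> sqrt (F x) * sqrt (G x)"
        using real_sqrt_le_mono[OF conjunct1[OF elim]] by (simp add: real_sqrt_mult)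
      then have "\<bar>s\<bar> * \<bar>h x\<bar> \<le> \<bar>s\<bar> * (sqrt (F x) * sqrt (G x))" by (rule mult_left_mono) simp
      moreover have "0 \<le> (sqrt (F x) - \<bar>s\<bar> * sqrt (G x))\<^sup>2" by simp
      then have "2 * (\<bar>s\<bar> * (sqrt (F x) * sqrt (G x))) \<le> F x + s\<^sup>2 * G x"
        using elim by (simp add: power2_diff power_mult_distrib algebra_simps)
      moreover have "- (\<bar>s\<bar> * \<bar>h x\<bar>) \<le> s * h x" by (simp add: abs_mult[symmetric] minus_le_iff abs_ge_minus_self)
      ultimately show ?case by (simp add: mult.assoc)
    qed
  qed
  also have "\<dots> = (LINT x|M. F x) + 2 * s * (LINT x|M. h x) + s\<^sup>2 * (LINT x|M. G x)"
    using int by simp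
  finally show "0 \<le> \<dots>" .
qed

lemma L2_Cauchy_Schwarz:
  fixes u v :: "real^'d \<Rightarrow> 'b::{real_inner, second_countable_topology}"
  assumes u: "L2 S u" and v: "L2 S v"
  shows "\<bar>LINT x|lebesgue_on S. u x \<bullet> v x\<bar> \<le> l2norm S u * l2norm S v"
proof -
  have "(LINT x|lebesgue_on S. u x \<bullet> v x)\<^sup>2 \<le> (l2norm S u)\<^sup>2 * (l2norm S v)\<^sup>2"
    unfolding l2norm_sq
  proof (rule integral_Cauchy_Schwarz[OF L2_inner_integrable[OF u v]])
    show "AE x in lebesgue_on S. (u x \<bullet> v x)\<^sup>2 \<le> (norm (u x))\<^sup>2 * (norm (v x))\<^sup>2 \<and> 0 \<le> (norm (u x))\<^sup>2 \<and> 0 \<le> (norm (v x))\<^sup>2"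
      using power_mono[OF Cauchy_Schwarz_ineq2 abs_ge_zero, of _ _ 2] by (intro AE_I2) (simp add: power_mult_distrib)
  qed (use u v in \<open>auto simp: L2_def\<close>)
  then have "\<bar>LINT x|lebesgue_on S. u x \<bullet> v x\<bar>\<^sup>2 \<le> (l2norm S u * l2norm S v)\<^sup>2" by (simp add: power_mult_distrib)
  then show ?thesis by (rule power2_le_imp_le) (simp add: l2norm_nonneg)
qed

lemma has_weak_grad_diff:
  fixes u v :: "real^'d::finite \<Rightarrow> real"
  assumes "has_weak_grad U u g" "has_weak_grad U v h" "open U"
  shows "has_weak_grad U (\<lambda>x. u x - v x) (\<lambda>x. g x - h x)"
  using has_weak_grad_lincomb[OF assms, of 1 "-1"] by simp

lemma H1_test: "\<phi> \<in> test_functions U \<Longrightarrow> open U \<Longrightarrow> H1 U \<phi>"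
  for \<phi> :: "real^'d::finite \<Rightarrow> real"
  using has_weak_grad_test by (auto simp: H1_def)

lemma H10_diff:
  fixes u v :: "real^'d::finite \<Rightarrow> real"
  assumes U: "open U" and u: "H10 U u" and v: "H10 U v"
  shows "H10 U (\<lambda>x. u x - v x)"
  unfolding H10_def
proof (intro conjI allI impI)
  have H: "H1 U u" "H1 U v" using u v by (auto simp: H10_def)
  note gu = H1_wgrad[OF H(1)] and gv = H1_wgrad[OF H(2)]
  note guv = has_weak_grad_diff[OF gu gv U]
  then show "H1 U (\<lambda>x. u x - v x)" by (auto simp: H1_def)
  fix \<epsilon> :: real assume \<epsilon>: "\<epsilon> > 0"
  obtain \<phi> where \<phi>: "\<phi> \<in> test_functions U"
    "(l2norm U (\<lambda>x. u x - \<phi> x))\<^sup>2 + (l2norm U (\<lambda>x. wgrad U u x - wgrad U \<phi> x))\<^sup>2 < \<epsilon> / 4"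
    using u \<epsilon> unfolding H10_def by (meson divide_pos_pos zero_less_numeral)
  obtain \<psi> where \<psi>: "\<psi> \<in> test_functions U"
    "(l2norm U (\<lambda>x. v x - \<psi> x))\<^sup>2 + (l2norm U (\<lambda>x. wgrad U v x - wgrad U \<psi> x))\<^sup>2 < \<epsilon> / 4"
    using v \<epsilon> unfolding H10_def by (meson divide_pos_pos zero_less_numeral)
  note g\<phi> = H1_wgrad[OF H1_test[OF \<phi>(1) U]] and g\<psi> = H1_wgrad[OF H1_test[OF \<psi>(1) U]]
  note g\<phi>\<psi> = has_weak_grad_diff[OF g\<phi> g\<psi> U]
  note L = gu[unfolded has_weak_grad_def] gv[unfolded has_weak_grad_def] g\<phi>[unfolded has_weak_grad_def] g\<psi>[unfolded has_weak_grad_def]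
  have L1: "L2 U (\<lambda>x. u x - \<phi> x)" "L2 U (\<lambda>x. v x - \<psi> x)"
    "L2 U (\<lambda>x. wgrad U u x - wgrad U \<phi> x)" "L2 U (\<lambda>x. wgrad U v x - wgrad U \<psi> x)"
    using L by (auto intro!: L2_diff)
  have "(\<lambda>x. (-1) * \<psi> x) \<in> test_functions U" by (rule test_functions_mult[OF \<psi>(1) cont_diff_const])
  from test_functions_add[OF \<phi>(1) this] have t: "(\<lambda>x. \<phi> x - \<psi> x) \<in> test_functions U" by simp
  have e1: "(\<lambda>x. (u x - v x) - (\<phi> x - \<psi> x)) = (\<lambda>x. (u x - \<phi> x) - (v x - \<psi> x))" by auto
  have e2: "l2norm U (\<lambda>x. wgrad U (\<lambda>x. u x - v x) x - wgrad U (\<lambda>x. \<phi> x - \<psi> x) x) =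
      l2norm U (\<lambda>x. (wgrad U u x - wgrad U \<phi> x) - (wgrad U v x - wgrad U \<psi> x))"
  proof (rule l2norm_cong_AE)
    show "AE x in lebesgue_on U. norm (wgrad U (\<lambda>x. u x - v x) x - wgrad U (\<lambda>x. \<phi> x - \<psi> x) x) =
        norm ((wgrad U u x - wgrad U \<phi> x) - (wgrad U v x - wgrad U \<psi> x))"
      using wgrad_eq[OF guv U] wgrad_eq[OF g\<phi>\<psi> U] by eventually_elim (simp only:, simp add: algebra_simps)
    have "has_weak_grad U (\<lambda>x. u x - v x) (wgrad U (\<lambda>x. u x - v x))" "has_weak_grad U (\<lambda>x. \<phi> x - \<psi> x) (wgrad U (\<lambda>x. \<phi> x - \<psi> x))"
      using guv g\<phi>\<psi> H1_wgrad unfolding H1_def by blast+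
    then show "(\<lambda>x. norm (wgrad U (\<lambda>x. u x - v x) x - wgrad U (\<lambda>x. \<phi> x - \<psi> x) x)) \<in> borel_measurable (lebesgue_on U)"
      by (intro L2_norm_measurable L2_diff) (auto simp: has_weak_grad_def)
    show "(\<lambda>x. norm ((wgrad U u x - wgrad U \<phi> x) - (wgrad U v x - wgrad U \<psi> x))) \<in> borel_measurable (lebesgue_on U)"
      by (intro L2_norm_measurable L2_diff L1)
  qed
  show "\<exists>\<phi>\<in>test_functions U. (l2norm U (\<lambda>x. (u x - v x) - \<phi> x))\<^sup>2 +
      (l2norm U (\<lambda>x. wgrad U (\<lambda>x. u x - v x) x - wgrad U \<phi> x))\<^sup>2 < \<epsilon>"
  proof (rule bexI[OF _ t])
    show "(l2norm U (\<lambda>x. (u x - v x) - (\<phi> x - \<psi> x)))\<^sup>2 +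
        (l2norm U (\<lambda>x. wgrad U (\<lambda>x. u x - v x) x - wgrad U (\<lambda>x. \<phi> x - \<psi> x) x))\<^sup>2 < \<epsilon>"
      unfolding e1 e2 using l2norm_diff_sq[OF L1(1,2)] l2norm_diff_sq[OF L1(3,4)] \<phi>(2) \<psi>(2) by linarith
  qed
qed

text \<open>For test functions the identity defines the weak divergence, and both sides are
  continuous in the Sobolev norm. Integration by parts thus happens over the whole domain at once,
  without face terms.\<close>

lemma weak_div_H10:
  fixes u :: "real^'d::finite \<Rightarrow> real"
  assumes U: "open U" and v: "has_weak_div U v g" and u: "H10 U u"
  shows "(LINT x|lebesgue_on U. v x \<bullet> wgrad U u x) = - (LINT x|lebesgue_on U. g x * u x)"
proof -
  let ?d = "\<bar>(LINT x|lebesgue_on U. v x \<bullet> wgrad U u x) + (LINT x|lebesgue_on U. g x * u x)\<bar>"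
  have Lv: "L2 U v" "L2 U g" using v by (auto simp: has_weak_div_def)
  have gu: "has_weak_grad U u (wgrad U u)" using u H1_wgrad by (auto simp: H10_def)
  have Lu: "L2 U u" "L2 U (wgrad U u)" using gu by (auto simp: has_weak_grad_def)
  define M where "M = l2norm U v + l2norm U g"
  have M0: "M \<ge> 0" by (simp add: M_def l2norm_nonneg)
  have bd: "?d \<le> M * \<delta>" if \<delta>: "\<delta> > 0" for \<delta>
  proof -
    obtain \<phi> where \<phi>: "\<phi> \<in> test_functions U"
      "(l2norm U (\<lambda>x. u x - \<phi> x))\<^sup>2 + (l2norm U (\<lambda>x. wgrad U u x - wgrad U \<phi> x))\<^sup>2 < \<delta>\<^sup>2"
      using u \<delta> unfolding H10_def by (meson zero_less_power)
    have g\<phi>: "has_weak_grad U \<phi> (wgrad U \<phi>)" by (rule H1_wgrad[OF H1_test[OF \<phi>(1) U]])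
    have L\<phi>: "L2 U \<phi>" "L2 U (wgrad U \<phi>)" using g\<phi> by (auto simp: has_weak_grad_def)
    have "(LINT x|lebesgue_on U. v x \<bullet> wgrad U \<phi> x) = (LINT x|lebesgue_on U. v x \<bullet> grad \<phi> x)"
    proof (rule integral_cong_AE)
      show "AE x in lebesgue_on U. v x \<bullet> wgrad U \<phi> x = v x \<bullet> grad \<phi> x"
        using wgrad_eq[OF has_weak_grad_test[OF \<phi>(1) U] U] by eventually_elim simp
      have "L2 U (grad \<phi>)" using has_weak_grad_test[OF \<phi>(1) U] by (simp add: has_weak_grad_def)
      then show "(\<lambda>x. v x \<bullet> grad \<phi> x) \<in> borel_measurable (lebesgue_on U)"
        using L2_inner_integrable[OF Lv(1)] borel_measurable_integrable by blast
    qed (use L2_inner_integrable[OF Lv(1) L\<phi>(2)] in auto)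
    also have "\<dots> = - (LINT x|lebesgue_on U. g x * \<phi> x)"
      using bspec[OF conjunct2[OF conjunct2[OF v[unfolded has_weak_div_def]]] \<phi>(1)] .
    finally have e: "(LINT x|lebesgue_on U. v x \<bullet> wgrad U \<phi> x) = - (LINT x|lebesgue_on U. g x * \<phi> x)" .
    have s1: "(LINT x|lebesgue_on U. v x \<bullet> (wgrad U u x - wgrad U \<phi> x)) =
        (LINT x|lebesgue_on U. v x \<bullet> wgrad U u x) - (LINT x|lebesgue_on U. v x \<bullet> wgrad U \<phi> x)"
      unfolding inner_diff_right by (rule Bochner_Integration.integral_diff[OF L2_inner_integrable[OF Lv(1) Lu(2)] L2_inner_integrable[OF Lv(1) L\<phi>(2)]])
    have s2: "(LINT x|lebesgue_on U. g x \<bullet> (u x - \<phi> x)) = (LINT x|lebesgue_on U. g x * u x) - (LINT x|lebesgue_on U. g x * \<phi> x)"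
      unfolding inner_real_def right_diff_distrib by (rule Bochner_Integration.integral_diff[OF L2_mult_integrable[OF Lv(2) Lu(1)] L2_mult_integrable[OF Lv(2) L\<phi>(1)]])
    have b1: "l2norm U (\<lambda>x. u x - \<phi> x) \<le> \<delta>"
      by (rule power2_le_imp_le) (use \<phi>(2) \<delta> zero_le_power2[of "l2norm U (\<lambda>x. wgrad U u x - wgrad U \<phi> x)"] in linarith)+
    have b2: "l2norm U (\<lambda>x. wgrad U u x - wgrad U \<phi> x) \<le> \<delta>"
      by (rule power2_le_imp_le) (use \<phi>(2) \<delta> zero_le_power2[of "l2norm U (\<lambda>x. u x - \<phi> x)"] in linarith)+
    have "?d = \<bar>(LINT x|lebesgue_on U. v x \<bullet> (wgrad U u x - wgrad U \<phi> x)) + (LINT x|lebesgue_on U. g x \<bullet> (u x - \<phi> x))\<bar>"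
      unfolding s1 s2 e by simp
    also have "\<dots> \<le> l2norm U v * l2norm U (\<lambda>x. wgrad U u x - wgrad U \<phi> x) + l2norm U g * l2norm U (\<lambda>x. u x - \<phi> x)"
      using L2_Cauchy_Schwarz[OF Lv(1) L2_diff[OF Lu(2) L\<phi>(2)]] L2_Cauchy_Schwarz[OF Lv(2) L2_diff[OF Lu(1) L\<phi>(1)]]
      by (intro order_trans[OF abs_triangle_ineq add_mono])
    also have "\<dots> \<le> l2norm U v * \<delta> + l2norm U g * \<delta>"
      by (intro add_mono mult_left_mono b1 b2 l2norm_nonneg)
    finally show ?thesis by (simp add: M_def distrib_right)
  qed
  have "?d \<le> 0 + \<epsilon>" if "\<epsilon> > 0" for \<epsilon>
  proof -
    \<comment> \<open>The denominator M + 1 covers the case M = 0.\<close>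
    have "?d \<le> M * (\<epsilon> / (M + 1))" by (rule bd[OF divide_pos_pos[OF that]]) (use M0 in simp)
    also have "\<dots> \<le> \<epsilon>" using M0 that by (simp add: field_simps)
    finally show ?thesis by simp
  qed
  then have "?d \<le> 0" by (rule field_le_epsilon)
  then show ?thesis by simp
qed

lemma norm_matrix_vector_mult_le:
  fixes A :: "real^'n::finite^'m::finite"
  shows "norm (A *v x) \<le> real CARD('m) * (norm A * norm x)"
proof -
  have "norm (A *v x) \<le> (\<Sum>i\<in>UNIV. \<bar>(A *v x) $ i\<bar>)" by (rule norm_le_l1_cart)
  also have "\<dots> \<le> (\<Sum>i\<in>(UNIV :: 'm set). norm A * norm x)"
  proof (rule sum_mono)
    fix i
    have "\<bar>(A *v x) $ i\<bar> \<le> norm (A $ i) * norm x"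
      unfolding matrix_vector_mul_component by (rule Cauchy_Schwarz_ineq2)
    also have "\<dots> \<le> norm A * norm x" by (intro mult_right_mono Finite_Cartesian_Product.norm_nth_le) simp
    finally show "\<bar>(A *v x) $ i\<bar> \<le> norm A * norm x" .
  qed
  finally show ?thesis by simp
qed

lemma matrix_vector_measurable:
  fixes A :: "'a \<Rightarrow> real^'n::finite^'m::finite"
  assumes A: "A \<in> borel_measurable M" and u: "u \<in> borel_measurable M"
  shows "(\<lambda>x. A x *v u x) \<in> borel_measurable M"
proof (rule vec_measurable)
  fix i
  have "(\<lambda>x. \<Sum>j\<in>UNIV. A x $ i $ j * u x $ j) \<in> borel_measurable M"
  proof (intro borel_measurable_sum borel_measurable_times)
    fix j
    show "(\<lambda>x. A x $ i $ j) \<in> borel_measurable M"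
      by (rule measurable_compose[OF A borel_measurable_continuous_onI]) (intro continuous_intros)
    show "(\<lambda>x. u x $ j) \<in> borel_measurable M"
      by (rule measurable_compose[OF u borel_measurable_continuous_onI]) (intro continuous_intros)
  qed
  then show "(\<lambda>x. (A x *v u x) $ i) \<in> borel_measurable M" by (simp add: matrix_vector_mult_def)
qed

lemma L2_matrix_vector:
  fixes A :: "real^'d::finite \<Rightarrow> real^'n::finite^'m::finite"
  assumes A: "Linf S A" and u: "L2 S u"
  shows "L2 S (\<lambda>x. A x *v u x)"
proof -
  obtain C where C: "AE x in lebesgue_on S. norm (A x) \<le> C" using A by (auto simp: Linf_def)
  show ?thesis
  proof (rule L2_bound)
    show "(\<lambda>x. A x *v u x) \<in> borel_measurable (lebesgue_on S)"
      using A u by (intro matrix_vector_measurable) (auto simp: Linf_def L2_def)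
    show "integrable (lebesgue_on S) (\<lambda>x. (real CARD('m) * C)\<^sup>2 * (norm (u x))\<^sup>2)" using u by (simp add: L2_def)
    show "AE x in lebesgue_on S. (norm (A x *v u x))\<^sup>2 \<le> (real CARD('m) * C)\<^sup>2 * (norm (u x))\<^sup>2" using C
    proof eventually_elim
      case (elim x)
      have "norm (A x *v u x) \<le> real CARD('m) * (norm (A x) * norm (u x))" by (rule norm_matrix_vector_mult_le)
      also have "\<dots> \<le> real CARD('m) * (C * norm (u x))" using elim by (intro mult_left_mono mult_right_mono) auto
      finally have "(norm (A x *v u x))\<^sup>2 \<le> (real CARD('m) * (C * norm (u x)))\<^sup>2" by (rule power_mono) simp
      then show ?case by (simp add: power_mult_distrib mult.assoc)
    qed
  qed
qed

section \<open>Broken gradients and the residual on a coarse element\<close>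

context fem_mesh
begin

lemma Omega_fine_indicator: "AE x in lebesgue. indicator (Omega D) x = (\<Sum>t\<in>fine_mesh D. indicator (interior t) x :: real)"
  using AE_fine_interior
proof eventually_elim
  case (elim x)
  show ?case
  proof (cases "x \<in> Omega D")
    case True
    obtain t where t: "t \<in> fine_mesh D" "x \<in> interior t"
      by (rule fine_cases[OF elim subsetD[OF closure_subset True]])
    have "x \<notin> interior t'" if "t' \<in> fine_mesh D - {t}" for t'
      using fine_disjoint[OF t(1), of t'] that t(2) interior_subset[of t'] by blast
    then show ?thesis using True t finite_fine by (simp add: sum.remove[of _ t])
  next
    case False
    then have "(\<Sum>t\<in>fine_mesh D. indicat_real (interior t) x) = 0"
      using fine_interior_Omega by (intro sum.neutral) (auto simp: indicator_def)
    then show ?thesis using False by simp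
  qed
qed

lemma Omega_fine_decomposition:
  "AE x in lebesgue. (\<Sum>t\<in>fine_mesh D. indicat_real (interior t) x *\<^sub>R f x) = indicat_real (Omega D) x *\<^sub>R (f x :: 'b::real_normed_vector)"
  using Omega_fine_indicator by eventually_elim (simp add: scaleR_sum_left)

lemma measurable_Omega_fine:
  fixes f :: "real^'d \<Rightarrow> 'b::euclidean_space"
  assumes "\<And>t. t \<in> fine_mesh D \<Longrightarrow> f \<in> borel_measurable (lebesgue_on (interior t))"
  shows "f \<in> borel_measurable (lebesgue_on (Omega D))"
proof -
  have "(\<lambda>x. indicat_real (interior t) x *\<^sub>R f x) \<in> borel_measurable lebesgue" if "t \<in> fine_mesh D" for t
    using assms[OF that] fine_sets(2)[OF that] by (simp add: borel_measurable_restrict_space_iff)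
  then have "(\<lambda>x. \<Sum>t\<in>fine_mesh D. indicat_real (interior t) x *\<^sub>R f x) \<in> borel_measurable lebesgue"
    by (rule borel_measurable_sum)
  then have "(\<lambda>x. indicat_real (Omega D) x *\<^sub>R f x) \<in> borel_measurable lebesgue"
    using Omega_fine_decomposition by (rule borel_measurable_AE)
  then show ?thesis using fine_sets(3) by (simp add: borel_measurable_restrict_space_iff)
qed

lemma L2_Omega_fine:
  fixes f :: "real^'d \<Rightarrow> 'b::euclidean_space"
  assumes "\<And>t. t \<in> fine_mesh D \<Longrightarrow> L2 (interior t) f"
  shows "L2 (Omega D) f"
  unfolding L2_def
proof
  show m: "f \<in> borel_measurable (lebesgue_on (Omega D))"
    using assms by (intro measurable_Omega_fine) (auto simp: L2_def)
  have "integrable lebesgue (\<lambda>x. indicat_real (interior t) x *\<^sub>R (norm (f x))\<^sup>2)" if t: "t \<in> fine_mesh D" for t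
  proof -
    have "integrable (lebesgue_on (interior t)) (\<lambda>x. (norm (f x))\<^sup>2)" using assms[OF t] by (simp add: L2_def)
    then show ?thesis by (simp only: integrable_indicator_lebesgue_on(2)[OF fine_sets(2)[OF t]])
  qed
  then have i: "integrable lebesgue (\<lambda>x. \<Sum>t\<in>fine_mesh D. indicat_real (interior t) x *\<^sub>R (norm (f x))\<^sup>2)"
    by (rule Bochner_Integration.integrable_sum)
  have m2: "(\<lambda>x. (norm (f x))\<^sup>2) \<in> borel_measurable (lebesgue_on (Omega D))"
    by (rule measurable_compose[OF m borel_measurable_continuous_onI]) (intro continuous_intros)
  have "(\<lambda>x. indicat_real (Omega D) x *\<^sub>R (norm (f x))\<^sup>2) \<in> borel_measurable lebesgue"
    using m2 fine_sets(3) by (simp add: borel_measurable_restrict_space_iff)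
  from integrable_cong_AE_imp[OF i this Omega_fine_decomposition]
  have "integrable lebesgue (\<lambda>x. indicat_real (Omega D) x *\<^sub>R (norm (f x))\<^sup>2)" .
  then show "integrable (lebesgue_on (Omega D)) (\<lambda>x. (norm (f x))\<^sup>2)"
    by (simp only: integrable_indicator_lebesgue_on(2)[OF fine_sets(3)])
qed

lemma broken_grad_AE:
  assumes t: "t \<in> fine_mesh D" and u: "has_weak_grad (interior t) u g"
  shows "AE x in lebesgue_on (interior t). broken_grad D u x = g x"
  using wgrad_eq[OF u open_interior] AE_space by eventually_elim (use broken_grad_interior[OF t] in auto)

lemma H1_broken_weak_grad:
  assumes q: "H1_broken D q" and t: "t \<in> fine_mesh D"
  shows "has_weak_grad (interior t) q (wgrad (interior t) q)"
  using q t H1_wgrad by (auto simp: H1_broken_def)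

lemma L2_broken_grad:
  assumes q: "H1_broken D q"
  shows "L2 (Omega D) (broken_grad D q)"
proof (rule L2_Omega_fine)
  fix t assume t: "t \<in> fine_mesh D"
  note g = H1_broken_weak_grad[OF q t]
  then have L: "L2 (interior t) (wgrad (interior t) q)" by (simp add: has_weak_grad_def)
  have ae: "AE x in lebesgue_on (interior t). wgrad (interior t) q x = broken_grad D q x"
    using broken_grad_AE[OF t g] by eventually_elim simp
  show "L2 (interior t) (broken_grad D q)"
    by (rule L2_cong_AE[OF L ae measurable_lebesgue_on_AE[OF L2_measurable[OF L] fine_sets(2)[OF t] ae]])
qed

lemma broken_diff:
  assumes p: "H1_broken D p" and q: "H1_broken D q"
  shows "H1_broken D (\<lambda>x. p x - q x)"
    "AE x in lebesgue_on (Omega D). broken_grad D (\<lambda>x. p x - q x) x = broken_grad D p x - broken_grad D q x"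
proof -
  have g: "has_weak_grad (interior t) (\<lambda>x. p x - q x) (\<lambda>x. wgrad (interior t) p x - wgrad (interior t) q x)"
    if t: "t \<in> fine_mesh D" for t
    by (rule has_weak_grad_diff[OF H1_broken_weak_grad[OF p t] H1_broken_weak_grad[OF q t] open_interior])
  then show "H1_broken D (\<lambda>x. p x - q x)"
    using p q L2_diff unfolding H1_broken_def H1_def by blast
  show "AE x in lebesgue_on (Omega D). broken_grad D (\<lambda>x. p x - q x) x = broken_grad D p x - broken_grad D q x"
  proof (rule AE_Omega_fine)
    fix t assume t: "t \<in> fine_mesh D"
    show "AE x in lebesgue_on (interior t). broken_grad D (\<lambda>x. p x - q x) x = broken_grad D p x - broken_grad D q x"
      using broken_grad_AE[OF t g[OF t]] AE_space by eventually_elim (use broken_grad_interior[OF t] in auto)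
  qed
qed

lemma H1_imp_broken:
  assumes u: "H1 (Omega D) u"
  shows "H1_broken D u" "AE x in lebesgue_on (Omega D). broken_grad D u x = wgrad (Omega D) u x"
proof -
  note g = H1_wgrad[OF u]
  have gt: "has_weak_grad (interior t) u (wgrad (Omega D) u)" if "t \<in> fine_mesh D" for t
    by (rule has_weak_grad_mono[OF g Omega(1) open_interior fine_interior_Omega[OF that]])
  then show "H1_broken D u" using g unfolding H1_broken_def H1_def has_weak_grad_def by blast
  show "AE x in lebesgue_on (Omega D). broken_grad D u x = wgrad (Omega D) u x"
    by (rule AE_Omega_fine[OF broken_grad_AE[OF _ gt]])
qed

lemma AE_coarse: "T \<in> coarse_mesh D \<Longrightarrow> AE x in lebesgue_on (Omega D). P x \<Longrightarrow> AE x in lebesgue_on T. P x"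
  by (rule AE_lebesgue_on_sub[OF coarse_sets fine_sets(3) coarse_AE_subset_Omega])

lemma L2_coarse: "T \<in> coarse_mesh D \<Longrightarrow> L2 (Omega D) (u :: real^'d \<Rightarrow> 'b::euclidean_space) \<Longrightarrow> L2 T u"
  by (rule L2_sub[OF coarse_sets fine_sets(3) coarse_AE_subset_Omega])

lemma AE_coarse_interior: "T \<in> coarse_mesh D \<Longrightarrow> AE x in lebesgue. x \<in> T \<longrightarrow> x \<in> interior T"
proof -
  assume T: "T \<in> coarse_mesh D"
  show ?thesis using AE_fine_interior
  proof eventually_elim
    case (elim x)
    show ?case
    proof
      assume x: "x \<in> T"
      then have "x \<in> closure (Omega D)" using coarse_union T by blast
      then obtain t where t: "t \<in> fine_mesh D" "x \<in> interior t" by (rule fine_cases[OF elim])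
      then have "t \<subseteq> T" using fine_meets_coarse[OF t(1) T] x by blast
      then show "x \<in> interior T" using interior_mono t(2) by blast
    qed
  qed
qed

lemma AE_coarse_fine:
  assumes T: "T \<in> coarse_mesh D" and P: "\<And>t. t \<in> fine_in D T \<Longrightarrow> AE x in lebesgue_on t. P x"
  shows "AE x in lebesgue_on T. P x"
proof -
  have "AE x in lebesgue. \<forall>t\<in>fine_in D T. x \<in> t \<longrightarrow> P x"
    using P finite_fine_in[of T] fine_sets(1) fine_inD(1) by (subst AE_finite_all) (auto simp: AE_lebesgue_on)
  then show ?thesis unfolding AE_lebesgue_on[OF coarse_sets[OF T]]
    by eventually_elim (use coarse_eq[OF T] in blast)
qed

text \<open>The mean value is subtracted by means of local conservation, so any constant would do
  in place of the projection.\<close>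

lemma residual_bound:
  assumes T: "T \<in> coarse_mesh D" and C: "poincare T C" "C > 0" and u: "H1 (Omega D) u"
    and r: "L2 (Omega D) r" "(LINT x|lebesgue_on T. r x) = 0"
  shows "\<bar>LINT x|lebesgue_on T. r x * u x\<bar> \<le> l2norm T r * (sqrt C * diameter T * l2norm T (broken_grad D u))"
proof -
  let ?c = "proj_const T u"
  have Tb: "bounded T" and Tm: "T \<in> sets lebesgue" using coarse_compact[OF T] compact_imp_bounded coarse_sets[OF T] by auto
  have iT: "interior T \<subseteq> Omega D" using interior_mono[of T "closure (Omega D)"] coarse_union T Omega(3) by blast
  have g: "has_weak_grad (interior T) u (wgrad (Omega D) u)"
    by (rule has_weak_grad_mono[OF H1_wgrad[OF u] Omega(1) open_interior iT])
  have Lr: "L2 T r" by (rule L2_coarse[OF T r(1)])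
  have Lu: "L2 T u" using H1_wgrad[OF u] L2_coarse[OF T] by (auto simp: has_weak_grad_def)
  have Lc: "L2 T (\<lambda>x. u x - ?c)" by (rule L2_diff[OF Lu L2_const[OF Tb Tm]])
  \<comment> \<open>The Poincare inequality uses the gradient chosen on the interior of T, the
    energy norm the broken gradient; both agree with the gradient on the domain up to null
    sets.\<close>
  have ae: "AE x in lebesgue_on T. broken_grad D u x = wgrad (interior T) u x"
  proof -
    have "AE x in lebesgue. x \<in> interior T \<longrightarrow> wgrad (interior T) u x = wgrad (Omega D) u x"
      using wgrad_eq[OF g open_interior] by (simp add: AE_lebesgue_on)
    moreover have "AE x in lebesgue. x \<in> T \<longrightarrow> broken_grad D u x = wgrad (Omega D) u x"
      using AE_coarse[OF T H1_imp_broken(2)[OF u]] by (simp add: AE_lebesgue_on[OF Tm])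
    ultimately show ?thesis unfolding AE_lebesgue_on[OF Tm] using AE_coarse_interior[OF T]
      by eventually_elim auto
  qed
  have Lg: "L2 T (broken_grad D u)" by (rule L2_coarse[OF T L2_broken_grad[OF H1_imp_broken(1)[OF u]]])
  have "L2 T (wgrad (interior T) u)" by (rule L2_cong_AE[OF Lg ae measurable_lebesgue_on_AE[OF L2_measurable[OF Lg] Tm ae]])
  then have n: "l2norm T (wgrad (interior T) u) = l2norm T (broken_grad D u)"
    using Lg ae by (intro l2norm_cong_AE L2_norm_measurable) auto
  have "(l2norm T (\<lambda>x. u x - ?c))\<^sup>2 \<le> C * (diameter T)\<^sup>2 * (l2norm T (broken_grad D u))\<^sup>2"
    using C(1) g n by (auto simp: poincare_def H1_def)
  also have "\<dots> = (sqrt C * diameter T * l2norm T (broken_grad D u))\<^sup>2"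
    using C(2) by (simp add: power_mult_distrib)
  finally have p: "l2norm T (\<lambda>x. u x - ?c) \<le> sqrt C * diameter T * l2norm T (broken_grad D u)"
    by (rule power2_le_imp_le) (intro mult_nonneg_nonneg l2norm_nonneg diameter_ge_0[OF Tb], use C(2) in simp)
  have "(LINT x|lebesgue_on T. r x * u x) = (LINT x|lebesgue_on T. r x * u x - ?c * r x)"
    using L2_mult_integrable[OF Lr Lu] L2_integrable_bounded[OF Lr Tb Tm] r(2) by simp
  also have "\<dots> = (LINT x|lebesgue_on T. r x \<bullet> (u x - ?c))" by (simp add: algebra_simps)
  finally have "\<bar>LINT x|lebesgue_on T. r x * u x\<bar> \<le> l2norm T r * l2norm T (\<lambda>x. u x - ?c)"
    using L2_Cauchy_Schwarz[OF Lr Lc] by simp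
  also have "\<dots> \<le> l2norm T r * (sqrt C * diameter T * l2norm T (broken_grad D u))"
    by (rule mult_left_mono[OF p l2norm_nonneg])
  finally show ?thesis .
qed

end

section \<open>The diffusion tensor and its constants\<close>

lemma sym_posdef_scale:
  fixes A :: "real^'d::finite^'d"
  assumes "sym_posdef A" "c > 0" shows "sym_posdef (c *\<^sub>R A)"
  using assms by (auto simp: sym_posdef_def transpose_scalar scaleR_matrix_vector_assoc[symmetric])

lemma matrix_inv_scale:
  fixes K :: "real^'d::finite^'d"
  assumes K: "sym_posdef K" and c: "c > 0"
  shows "matrix_inv (c *\<^sub>R K) = (1 / c) *\<^sub>R matrix_inv K"
proof (rule matrix_inv_eqI)
  have "c *\<^sub>R K ** (1 / c) *\<^sub>R matrix_inv K = (1 / c) *\<^sub>R (c *\<^sub>R (K ** matrix_inv K))"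
    by (simp add: matrix_scalar_ac scalar_matrix_assoc)
  then show "c *\<^sub>R K ** (1 / c) *\<^sub>R matrix_inv K = mat 1" using c sym_posdef_invertible(1)[OF K] by simp
qed

locale fem_problem = fem_mesh D for D :: "('d::finite, 'm::finite) dg_data" +
  assumes data: "data_assms D"
begin

lemma rhs_L2: "L2 (Omega D) (rhs D)"
  using data by (simp add: data_assms_def)

lemma num_comp: "num_comp D \<ge> 1" and theta_pos: "\<xi> \<in> {1..num_comp D} \<Longrightarrow> \<mu> \<in> params D \<Longrightarrow> theta D \<xi> \<mu> > 0"
  and lam_comp_nonneg: "\<xi> \<in> {1..num_comp D} \<Longrightarrow> AE x in lebesgue_on (Omega D). lam_comp D \<xi> x \<ge> 0"
  using data by (auto simp: data_assms_def)

lemma lam: "\<mu> \<in> params D \<Longrightarrow> Linf (Omega D) (lam D \<mu>)" "\<mu> \<in> params D \<Longrightarrow> AE x in lebesgue_on (Omega D). lam D \<mu> x > 0"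
  using data by (auto simp: data_assms_def)

lemma kappa: "Linf (Omega D) (kappa D)" "AE x in lebesgue_on (Omega D). transpose (kappa D x) = kappa D x"
  "\<exists>c>0. AE x in lebesgue_on (Omega D). \<forall>v. v \<bullet> (kappa D x *v v) \<ge> c * (v \<bullet> v)"
  "t \<in> fine_mesh D \<Longrightarrow> \<exists>K. AE x in lebesgue_on t. kappa D x = K"
  using data by (auto simp: data_assms_def)

lemma tensor_bounds:
  assumes "\<mu> \<in> params D"
  obtains c C where "c > 0" "AE x in lebesgue_on (Omega D). \<forall>v.
    c * (v \<bullet> v) \<le> v \<bullet> (diff_tensor D \<mu> x *v v) \<and> v \<bullet> (diff_tensor D \<mu> x *v v) \<le> C * (v \<bullet> v)"
proof -
  have "\<forall>\<mu>\<in>params D. \<exists>c>0. \<exists>C. AE x in lebesgue_on (Omega D). \<forall>v.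
    c * (v \<bullet> v) \<le> v \<bullet> (diff_tensor D \<mu> x *v v) \<and> v \<bullet> (diff_tensor D \<mu> x *v v) \<le> C * (v \<bullet> v)"
    using data by (simp add: data_assms_def)
  then show thesis using that assms by blast
qed

lemma tensor_Linf:
  assumes \<mu>: "\<mu> \<in> params D"
  shows "Linf (Omega D) (diff_tensor D \<mu>)"
proof -
  obtain C1 where C1: "AE x in lebesgue_on (Omega D). norm (lam D \<mu> x) \<le> C1" using lam(1)[OF \<mu>] by (auto simp: Linf_def)
  obtain C2 where C2: "AE x in lebesgue_on (Omega D). norm (kappa D x) \<le> C2" using kappa(1) by (auto simp: Linf_def)
  have m: "lam D \<mu> \<in> borel_measurable (lebesgue_on (Omega D))" "kappa D \<in> borel_measurable (lebesgue_on (Omega D))"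
    using lam(1)[OF \<mu>] kappa(1) by (auto simp: Linf_def)
  have "diff_tensor D \<mu> \<in> borel_measurable (lebesgue_on (Omega D))"
    using borel_measurable_scaleR[OF m] by (simp add: diff_tensor_def[abs_def])
  moreover have "AE x in lebesgue_on (Omega D). norm (diff_tensor D \<mu> x) \<le> C1 * C2"
    using C1 C2
  proof eventually_elim
    case (elim x)
    have "\<bar>lam D \<mu> x\<bar> * norm (kappa D x) \<le> C1 * C2" using elim by (intro mult_mono) auto
    then show ?case by (simp add: diff_tensor_def)
  qed
  ultimately show ?thesis unfolding Linf_def by blast
qed

lemma tensor_inner: "v \<bullet> (diff_tensor D \<mu> x *v v) = lam D \<mu> x * (v \<bullet> (kappa D x *v v))"
  by (simp add: diff_tensor_def scaleR_matrix_vector_assoc[symmetric])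

lemma tensor_sym_posdef:
  assumes \<mu>: "\<mu> \<in> params D"
  shows "AE x in lebesgue_on (Omega D). sym_posdef (diff_tensor D \<mu> x)"
proof -
  obtain c C where c: "c > 0" "AE x in lebesgue_on (Omega D). \<forall>v.
    c * (v \<bullet> v) \<le> v \<bullet> (diff_tensor D \<mu> x *v v) \<and> v \<bullet> (diff_tensor D \<mu> x *v v) \<le> C * (v \<bullet> v)"
    by (rule tensor_bounds[OF \<mu>], rule that)
  show ?thesis using c(2) kappa(2)
  proof eventually_elim
    case (elim x)
    have "v \<bullet> (diff_tensor D \<mu> x *v v) > 0" if "v \<noteq> 0" for v
    proof -
      have "0 < c * (v \<bullet> v)" using c(1) that by simp
      then show ?thesis using elim(1) less_le_trans by blast
    qed
    moreover have "transpose (diff_tensor D \<mu> x) = diff_tensor D \<mu> x" using elim(2) by (simp add: diff_tensor_def transpose_scalar)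
    ultimately show ?case by (simp add: sym_posdef_def)
  qed
qed

lemma alpha_pos: "\<mu> \<in> params D \<Longrightarrow> \<nu> \<in> params D \<Longrightarrow> alpha D \<mu> \<nu> > 0"
  unfolding alpha_def using num_comp theta_pos by (subst Min_gr_iff) auto

lemma alpha_gamma:
  assumes "\<xi> \<in> {1..num_comp D}" "\<mu> \<in> params D" "\<nu> \<in> params D"
  shows "alpha D \<mu> \<nu> * theta D \<xi> \<nu> \<le> theta D \<xi> \<mu>" "theta D \<xi> \<mu> \<le> gamma D \<mu> \<nu> * theta D \<xi> \<nu>"
proof -
  let ?q = "theta D \<xi> \<mu> * inverse (theta D \<xi> \<nu>)"
  have "alpha D \<mu> \<nu> \<le> ?q" "?q \<le> gamma D \<mu> \<nu>"
    unfolding alpha_def gamma_def using assms(1) by (auto intro!: Min_le Max_ge)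
  then show "alpha D \<mu> \<nu> * theta D \<xi> \<nu> \<le> theta D \<xi> \<mu>" "theta D \<xi> \<mu> \<le> gamma D \<mu> \<nu> * theta D \<xi> \<nu>"
    using theta_pos[OF assms(1,3)] by (simp_all add: field_simps)
qed

lemma gamma_nonneg: "\<mu> \<in> params D \<Longrightarrow> \<nu> \<in> params D \<Longrightarrow> gamma D \<mu> \<nu> \<ge> 0"
  using alpha_gamma[of 1 \<mu> \<nu>] theta_pos[of 1 \<mu>] theta_pos[of 1 \<nu>] num_comp
  by (metis atLeastAtMost_iff less_le_trans less_eq_real_def order_refl zero_less_mult_pos2)

text \<open>\<alpha> and \<gamma> bound the quotient of each pair of coefficients. Multiplied with
  the nonnegative components and summed, the bounds pass to \<lambda>, and then to the tensor
  because the form of \<kappa> is nonnegative.\<close>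

lemma tensor_compare:
  assumes \<mu>: "\<mu> \<in> params D" "\<nu> \<in> params D"
  shows "AE x in lebesgue_on (Omega D). \<forall>v.
    alpha D \<mu> \<nu> * (v \<bullet> (diff_tensor D \<nu> x *v v)) \<le> v \<bullet> (diff_tensor D \<mu> x *v v) \<and>
    v \<bullet> (diff_tensor D \<mu> x *v v) \<le> gamma D \<mu> \<nu> * (v \<bullet> (diff_tensor D \<nu> x *v v))"
proof -
  have "AE x in lebesgue_on (Omega D). \<forall>\<xi>\<in>{1..num_comp D}. lam_comp D \<xi> x \<ge> 0"
    using lam_comp_nonneg by (subst AE_finite_all) auto
  moreover obtain c where "c > 0" "AE x in lebesgue_on (Omega D). \<forall>v. v \<bullet> (kappa D x *v v) \<ge> c * (v \<bullet> v)"
    using kappa(3) by blast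
  ultimately show ?thesis
  proof (elim AE_mp, intro AE_I2 impI allI)
    fix x v :: "real^'d"
    assume k: "\<forall>v. c * (v \<bullet> v) \<le> v \<bullet> (kappa D x *v v)" and l: "\<forall>\<xi>\<in>{1..num_comp D}. lam_comp D \<xi> x \<ge> 0"
    have "0 \<le> c * (v \<bullet> v)" using \<open>c > 0\<close> by simp
    then have k0: "0 \<le> v \<bullet> (kappa D x *v v)" using k by (blast intro: order_trans)
    have "alpha D \<mu> \<nu> * lam D \<nu> x \<le> lam D \<mu> x" "lam D \<mu> x \<le> gamma D \<mu> \<nu> * lam D \<nu> x"
      unfolding lam_def sum_distrib_left mult.assoc[symmetric]
      using alpha_gamma[OF _ \<mu>] l by (auto intro!: sum_mono mult_right_mono)
    then show "alpha D \<mu> \<nu> * (v \<bullet> (diff_tensor D \<nu> x *v v)) \<le> v \<bullet> (diff_tensor D \<mu> x *v v) \<and>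
        v \<bullet> (diff_tensor D \<mu> x *v v) \<le> gamma D \<mu> \<nu> * (v \<bullet> (diff_tensor D \<nu> x *v v))"
      unfolding tensor_inner mult.assoc[symmetric] using k0 by (auto intro: mult_right_mono)
  qed
qed

text \<open>\<open>inv_sqrt\<close> is chosen at each point separately, so measurability in x is the
  difficulty. The squared norm is the form of the inverse matrix, and where \<kappa> is a constant K
  this is \<open>1 / lam D \<mu> x\<close> times the form of \<open>matrix_inv K\<close>.\<close>

lemma L2_inv_sqrt:
  assumes \<mu>: "\<mu> \<in> params D" and w: "L2 (Omega D) w"
  shows "integrable (lebesgue_on (Omega D)) (\<lambda>x. (norm (inv_sqrt (diff_tensor D \<mu> x) *v w x))\<^sup>2)"
proof -
  let ?f = "\<lambda>x. (norm (inv_sqrt (diff_tensor D \<mu> x) *v w x))\<^sup>2"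
  have m: "?f \<in> borel_measurable (lebesgue_on (Omega D))"
  proof (rule measurable_Omega_fine)
    fix t assume t: "t \<in> fine_mesh D"
    obtain K where K: "AE x in lebesgue_on t. kappa D x = K" using kappa(4)[OF t] by blast
    have sub: "interior t \<subseteq> t" "interior t \<subseteq> Omega D" using interior_subset fine_interior_Omega[OF t] by auto
    note up = AE_lebesgue_on_mono[OF fine_sets(2)[OF t] fine_sets(3) sub(2)]
    note K' = AE_lebesgue_on_mono[OF fine_sets(2)[OF t] fine_sets(1)[OF t] sub(1) K]
    let ?g = "\<lambda>x. (1 / lam D \<mu> x) * (w x \<bullet> (matrix_inv K *v w x))"
    have wm: "w \<in> borel_measurable (lebesgue_on (interior t))" "lam D \<mu> \<in> borel_measurable (lebesgue_on (interior t))"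
      using w lam(1)[OF \<mu>] measurable_lebesgue_on_mono[OF fine_sets(2)[OF t] fine_sets(3) sub(2)] by (auto simp: L2_def Linf_def)
    have "(\<lambda>x. w x \<bullet> (matrix_inv K *v w x)) \<in> borel_measurable (lebesgue_on (interior t))"
      by (intro borel_measurable_inner wm(1) matrix_vector_measurable borel_measurable_const)
    then have gm: "?g \<in> borel_measurable (lebesgue_on (interior t))"
      using wm(2) by (intro borel_measurable_times borel_measurable_divide borel_measurable_const)
    show "?f \<in> borel_measurable (lebesgue_on (interior t))"
    proof (rule measurable_lebesgue_on_AE[OF gm fine_sets(2)[OF t]])
      show "AE x in lebesgue_on (interior t). ?g x = ?f x"
        using K' up[OF tensor_sym_posdef[OF \<mu>]] up[OF lam(2)[OF \<mu>]]
      proof eventually_elim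
        case (elim x)
        have A: "diff_tensor D \<mu> x = lam D \<mu> x *\<^sub>R K" using elim(1) by (simp add: diff_tensor_def)
        have "sym_posdef ((1 / lam D \<mu> x) *\<^sub>R diff_tensor D \<mu> x)" by (rule sym_posdef_scale) (use elim in auto)
        then have "sym_posdef K" using A elim(3) by simp
        then have "matrix_inv (diff_tensor D \<mu> x) = (1 / lam D \<mu> x) *\<^sub>R matrix_inv K"
          unfolding A using elim(3) by (rule matrix_inv_scale)
        then show ?case unfolding norm_inv_sqrt(1)[OF elim(2)] by (simp add: scaleR_matrix_vector_assoc[symmetric])
      qed
    qed
  qed
  obtain c C where c: "c > 0" "AE x in lebesgue_on (Omega D). \<forall>v.
    c * (v \<bullet> v) \<le> v \<bullet> (diff_tensor D \<mu> x *v v) \<and> v \<bullet> (diff_tensor D \<mu> x *v v) \<le> C * (v \<bullet> v)"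
    by (rule tensor_bounds[OF \<mu>], rule that)
  show ?thesis
  proof (rule Bochner_Integration.integrable_bound[OF _ m])
    show "integrable (lebesgue_on (Omega D)) (\<lambda>x. (norm (w x))\<^sup>2 / c)" using w by (simp add: L2_def)
    show "AE x in lebesgue_on (Omega D). norm (?f x) \<le> norm ((norm (w x))\<^sup>2 / c)"
      using c(2) tensor_sym_posdef[OF \<mu>]
    proof eventually_elim
      case (elim x)
      have "?f x \<le> (norm (w x))\<^sup>2 / c" by (rule norm_inv_sqrt(3)[OF elim(2) _ c(1)]) (use elim(1) in blast)
      then show ?case using c(1) by simp
    qed
  qed
qed

text \<open>The supremum in \<open>c_elem\<close> is itself an essential lower bound: each bound
  \<open>c_elem D t \<mu> - 1 / real (Suc n)\<close> holds off a null set, and countably many null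
  sets are collected. The set of bounds is bounded above because t has positive measure.\<close>

lemma c_elem_bound:
  assumes \<mu>: "\<mu> \<in> params D" and t: "t \<in> fine_mesh D"
  shows "AE x in lebesgue_on t. c_elem D t \<mu> \<le> min_eigenvalue (diff_tensor D \<mu> x)"
proof -
  let ?M = "\<lambda>x. min_eigenvalue (diff_tensor D \<mu> x)"
  define S where "S = {c. AE x in lebesgue_on t. c \<le> ?M x}"
  obtain c C where c: "c > 0" "AE x in lebesgue_on (Omega D). \<forall>v.
    c * (v \<bullet> v) \<le> v \<bullet> (diff_tensor D \<mu> x *v v) \<and> v \<bullet> (diff_tensor D \<mu> x *v v) \<le> C * (v \<bullet> v)"
    by (rule tensor_bounds[OF \<mu>], rule that)
  note sub = AE_lebesgue_on_sub[OF fine_sets(1)[OF t] fine_sets(3) fine_AE_subset_Omega[OF t]]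
  have mb: "AE x in lebesgue_on t. c \<le> ?M x \<and> ?M x \<le> C"
    using sub[OF c(2)] sub[OF tensor_sym_posdef[OF \<mu>]]
  proof eventually_elim
    case (elim x)
    obtain v where v: "norm v = 1" "v \<bullet> (diff_tensor D \<mu> x *v v) = ?M x"
      using min_eigenvalue_bound(2)[of "diff_tensor D \<mu> x"] elim(2) by (auto simp: sym_posdef_def)
    have "v \<bullet> v = 1" using v(1) by (simp add: power2_norm_eq_inner[symmetric])
    then show ?case using elim(1)[rule_format, of v] v(2) by simp
  qed
  have cS: "c \<in> S" unfolding S_def using mb by (simp add: AE_conj_iff)
  have "s \<le> C" if "s \<in> S" for s
  proof (rule ccontr)
    assume n: "\<not> s \<le> C"
    have "AE x in lebesgue_on t. s \<le> C" using that[unfolded S_def mem_Collect_eq] mb by eventually_elim linarith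
    then have "AE x in lebesgue. x \<notin> t" using n by (simp add: AE_lebesgue_on[OF fine_sets(1)[OF t]])
    then have "t \<in> null_sets lebesgue" using AE_iff_null_sets[OF fine_sets(1)[OF t]] by simp
    then have "negligible t" by (simp add: negligible_iff_null_sets)
    then show False using fine_interior[OF t] open_not_negligible[OF open_interior] negligible_subset interior_subset by metis
  qed
  then have bd: "bdd_above S" by (auto simp: bdd_above_def)
  have "c_elem D t \<mu> - 1 / real (Suc n) \<in> S" for n
  proof -
    have "c_elem D t \<mu> - 1 / real (Suc n) < Sup S" by (simp add: c_elem_def S_def)
    then obtain s where s: "s \<in> S" "c_elem D t \<mu> - 1 / real (Suc n) < s"
      using less_cSup_iff[OF _ bd] cS by blast
    from s(1)[unfolded S_def mem_Collect_eq] show ?thesis unfolding S_def mem_Collect_eq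
      by eventually_elim (use s(2) in linarith)
  qed
  then have "AE x in lebesgue_on t. \<forall>n. c_elem D t \<mu> - 1 / real (Suc n) \<le> ?M x"
    by (simp add: S_def AE_all_countable)
  then show ?thesis
  proof eventually_elim
    case (elim x)
    have "c_elem D t \<mu> \<le> ?M x + \<epsilon>" if \<epsilon>: "\<epsilon> > 0" for \<epsilon>
    proof -
      obtain n where "1 / real (Suc n) < \<epsilon>" by (rule nat_approx_posE[OF \<epsilon>])
      then show ?thesis using elim[rule_format, of n] by linarith
    qed
    then show ?case by (rule field_le_epsilon)
  qed
qed

text \<open>The minimising parameter granted by the data makes the infimum over all parameters
  positive; as a lower bound for every parameter it applies to the tensor at \<mu>.\<close>

lemma c_coarse:
  assumes T: "T \<in> coarse_mesh D" and \<mu>: "\<mu> \<in> params D"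
  shows "c_coarse D T > 0"
    "AE x in lebesgue_on T. \<forall>v. c_coarse D T * (v \<bullet> v) \<le> v \<bullet> (diff_tensor D \<mu> x *v v)"
proof -
  have e: "c_eps D t > 0 \<and> c_eps D t \<le> c_elem D t \<mu>" if t: "t \<in> fine_mesh D" for t
  proof -
    obtain \<mu>0 where m: "\<mu>0 \<in> params D" "c_elem D t \<mu>0 > 0" "\<forall>\<mu>\<in>params D. c_elem D t \<mu>0 \<le> c_elem D t \<mu>"
      using data t by (auto simp: data_assms_def)
    have "c_elem D t \<mu>0 \<le> c_eps D t" unfolding c_eps_def using m by (intro cINF_greatest) auto
    moreover have "c_eps D t \<le> c_elem D t \<mu>" unfolding c_eps_def
      using m(3) \<mu> by (intro cINF_lower) (auto simp: bdd_below_def)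
    ultimately show ?thesis using m(2) by simp
  qed
  show "c_coarse D T > 0" unfolding c_coarse_def
    using e fine_inD(1) finite_fine_in fine_in_nonempty[OF T] by (subst Min_gr_iff) auto
  have le: "c_coarse D T \<le> c_elem D t \<mu>" if "t \<in> fine_in D T" for t
  proof -
    have "c_coarse D T \<le> c_eps D t" unfolding c_coarse_def using that finite_fine_in by (intro Min_le) auto
    then show ?thesis using e[OF fine_inD(1)[OF that]] by simp
  qed
  show "AE x in lebesgue_on T. \<forall>v. c_coarse D T * (v \<bullet> v) \<le> v \<bullet> (diff_tensor D \<mu> x *v v)"
  proof (rule AE_coarse_fine[OF T])
    fix t assume t: "t \<in> fine_in D T"
    note tf = fine_inD(1)[OF t]
    show "AE x in lebesgue_on t. \<forall>v. c_coarse D T * (v \<bullet> v) \<le> v \<bullet> (diff_tensor D \<mu> x *v v)"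
      using c_elem_bound[OF \<mu> tf]
        AE_lebesgue_on_sub[OF fine_sets(1)[OF tf] fine_sets(3) fine_AE_subset_Omega[OF tf] tensor_sym_posdef[OF \<mu>]]
    proof eventually_elim
      case (elim x)
      show ?case
      proof
        fix v :: "real^'d"
        have "c_coarse D T * (v \<bullet> v) \<le> min_eigenvalue (diff_tensor D \<mu> x) * (v \<bullet> v)"
          using elim(1) le[OF t] by (intro mult_right_mono) auto
        also have "\<dots> \<le> v \<bullet> (diff_tensor D \<mu> x *v v)"
          by (rule min_eigenvalue_bound(1)) (use elim(2) in \<open>simp add: sym_posdef_def\<close>)
        finally show "c_coarse D T * (v \<bullet> v) \<le> v \<bullet> (diff_tensor D \<mu> x *v v)" .
      qed
    qed
  qed
qed

end

text \<open>For \<open>w = p - s\<close> and \<open>z = s - q\<close>, with \<open>s\<close> the Oswald interpolant, let \<open>a\<close>, \<open>c\<close>, \<open>d\<close> be the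
  energy products \<open>(w, w)\<close>, \<open>(w, z)\<close>, \<open>(z, z)\<close>. The part of \<open>p - q = w + z\<close> along \<open>w\<close> is bounded by
  \<open>b\<close>, and the orthogonal remainder by the norm of \<open>z\<close>.\<close>

lemma projection_bound:
  fixes a c d b :: real
  assumes a: "a \<ge> 0" and cs: "c\<^sup>2 \<le> a * d" and b: "b \<ge> 0" and le: "\<bar>a + c\<bar> \<le> b * sqrt a"
  shows "a + 2 * c + d \<le> b\<^sup>2 + d"
proof (cases "a = 0")
  case True
  \<comment> \<open>For a = 0 the Cauchy-Schwarz bound forces c = 0.\<close>
  then show ?thesis using cs by simp
next
  case False
  then have a0: "a > 0" using a by simp
  have "(a + c)\<^sup>2 \<le> (b * sqrt a)\<^sup>2" using power_mono[OF le abs_ge_zero, of 2] by simp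
  then have "a\<^sup>2 + 2 * a * c + c\<^sup>2 \<le> b\<^sup>2 * a" using a by (simp add: power_mult_distrib power2_sum)
  moreover have "a * (a + 2 * c) = a\<^sup>2 + 2 * a * c" by (simp add: algebra_simps power2_eq_square)
  ultimately have "a * (a + 2 * c) \<le> a * b\<^sup>2" using zero_le_power2[of c] by (simp only: mult.commute[of _ a])
  then show ?thesis using a0 by simp
qed

lemma sym_posdef_nonneg: "sym_posdef A \<Longrightarrow> 0 \<le> v \<bullet> (A *v v)"
  for A :: "real^'d::finite^'d"
  by (cases "v = 0") (auto simp: sym_posdef_def less_imp_le)

lemma AE_measurable_L2:
  fixes u v :: "real^'d::finite \<Rightarrow> 'b::euclidean_space"
  assumes S: "S \<in> sets lebesgue" and u: "L2 S u" and ae: "AE x in lebesgue_on S. u x = v x"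
  shows "L2 S v"
  by (rule L2_cong_AE[OF u ae measurable_lebesgue_on_AE[OF L2_measurable[OF u] S ae]])

section \<open>Energy products and the error estimate\<close>

context fem_problem
begin

text \<open>The energy product on vector fields instead of functions, so that broken gradients can
  be exchanged for almost everywhere equal fields such as differences of gradients.\<close>

definition tensor_form :: "real^'m \<Rightarrow> (real^'d) set \<Rightarrow> (real^'d \<Rightarrow> real^'d) \<Rightarrow> (real^'d \<Rightarrow> real^'d) \<Rightarrow> real" where
  "tensor_form \<mu> S u v = (LINT x|lebesgue_on S. (diff_tensor D \<mu> x *v u x) \<bullet> v x)"

lemma b_loc_tensor: "b_loc D \<mu> S p q = tensor_form \<mu> S (broken_grad D p) (broken_grad D q)"
  by (simp add: b_loc_def tensor_form_def)

lemma tensor_integrable: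
  assumes "\<mu> \<in> params D" "L2 (Omega D) u" "L2 (Omega D) v"
  shows "integrable (lebesgue_on (Omega D)) (\<lambda>x. (diff_tensor D \<mu> x *v u x) \<bullet> v x)"
  by (rule L2_inner_integrable[OF L2_matrix_vector[OF tensor_Linf[OF assms(1)] assms(2)] assms(3)])

lemma tensor_form_coarse_sum:
  assumes "\<mu> \<in> params D" "L2 (Omega D) u" "L2 (Omega D) v"
  shows "tensor_form \<mu> (Omega D) u v = (\<Sum>T\<in>coarse_mesh D. tensor_form \<mu> T u v)"
  unfolding tensor_form_def by (rule integral_Omega_coarse[OF tensor_integrable[OF assms]])

lemma tensor_form_cong:
  assumes \<mu>: "\<mu> \<in> params D" and u: "L2 (Omega D) u" and v: "L2 (Omega D) v"
    and uv: "AE x in lebesgue_on (Omega D). u x = u' x" "AE x in lebesgue_on (Omega D). v x = v' x"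
  shows "tensor_form \<mu> (Omega D) u v = tensor_form \<mu> (Omega D) u' v'"
  unfolding tensor_form_def
proof (rule integral_cong_AE)
  have "L2 (Omega D) u'" "L2 (Omega D) v'" using AE_measurable_L2[OF fine_sets(3)] u v uv by blast+
  then show "(\<lambda>x. (diff_tensor D \<mu> x *v u' x) \<bullet> v' x) \<in> borel_measurable (lebesgue_on (Omega D))"
    using tensor_integrable[OF \<mu>] borel_measurable_integrable by blast
  show "AE x in lebesgue_on (Omega D). (diff_tensor D \<mu> x *v u x) \<bullet> v x = (diff_tensor D \<mu> x *v u' x) \<bullet> v' x"
    using uv by eventually_elim simp
qed (use tensor_integrable[OF \<mu> u v] in auto)

lemma tensor_integrable_coarse:
  assumes T: "T \<in> coarse_mesh D" and "\<mu> \<in> params D" "L2 (Omega D) u" "L2 (Omega D) v"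
  shows "integrable (lebesgue_on T) (\<lambda>x. (diff_tensor D \<mu> x *v u x) \<bullet> v x)"
  by (rule integrable_lebesgue_on_sub[OF coarse_sets[OF T] fine_sets(3) coarse_AE_subset_Omega[OF T] tensor_integrable[OF assms(2-4)]])

lemma tensor_form_nonneg:
  assumes T: "T \<in> coarse_mesh D" and \<mu>: "\<mu> \<in> params D"
  shows "0 \<le> tensor_form \<mu> T u u"
  unfolding tensor_form_def
proof (rule integral_nonneg_AE)
  show "AE x in lebesgue_on T. 0 \<le> (diff_tensor D \<mu> x *v u x) \<bullet> u x"
    using AE_coarse[OF T tensor_sym_posdef[OF \<mu>]]
    by eventually_elim (simp add: sym_posdef_nonneg inner_commute)
qed

lemma tensor_form_compare:
  assumes \<mu>: "\<mu> \<in> params D" "\<nu> \<in> params D" and u: "L2 (Omega D) u" and T: "T \<in> coarse_mesh D"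
  shows "alpha D \<mu> \<nu> * tensor_form \<nu> T u u \<le> tensor_form \<mu> T u u"
    "tensor_form \<mu> T u u \<le> gamma D \<mu> \<nu> * tensor_form \<nu> T u u"
proof -
  note i = tensor_integrable_coarse[OF T _ u u]
  note ae = AE_coarse[OF T tensor_compare[OF \<mu>]]
  have "(LINT x|lebesgue_on T. alpha D \<mu> \<nu> * ((diff_tensor D \<nu> x *v u x) \<bullet> u x)) \<le> (LINT x|lebesgue_on T. (diff_tensor D \<mu> x *v u x) \<bullet> u x)"
    by (rule integral_mono_AE, rule integrable_mult_right[OF i[OF \<mu>(2)]], rule i[OF \<mu>(1)])
       (use ae in \<open>eventually_elim, simp add: inner_commute\<close>)
  then show "alpha D \<mu> \<nu> * tensor_form \<nu> T u u \<le> tensor_form \<mu> T u u" by (simp add: tensor_form_def)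
  have "(LINT x|lebesgue_on T. (diff_tensor D \<mu> x *v u x) \<bullet> u x) \<le> (LINT x|lebesgue_on T. gamma D \<mu> \<nu> * ((diff_tensor D \<nu> x *v u x) \<bullet> u x))"
    by (rule integral_mono_AE, rule i[OF \<mu>(1)], rule integrable_mult_right[OF i[OF \<mu>(2)]])
       (use ae in \<open>eventually_elim, simp add: inner_commute\<close>)
  then show "tensor_form \<mu> T u u \<le> gamma D \<mu> \<nu> * tensor_form \<nu> T u u" by (simp add: tensor_form_def)
qed

lemma tensor_form_sum_compare:
  assumes \<mu>: "\<mu> \<in> params D" "\<nu> \<in> params D" and u: "L2 (Omega D) u"
  shows "alpha D \<mu> \<nu> * tensor_form \<nu> (Omega D) u u \<le> tensor_form \<mu> (Omega D) u u"
    "tensor_form \<mu> (Omega D) u u \<le> gamma D \<mu> \<nu> * tensor_form \<nu> (Omega D) u u"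
  unfolding tensor_form_coarse_sum[OF \<mu>(1) u u] tensor_form_coarse_sum[OF \<mu>(2) u u] sum_distrib_left
  by (intro sum_mono tensor_form_compare[OF \<mu> u]; assumption)+

lemma tensor_form_CS:
  assumes \<mu>: "\<mu> \<in> params D" and u: "L2 (Omega D) u" and v: "L2 (Omega D) v"
  shows "(tensor_form \<mu> (Omega D) u v)\<^sup>2 \<le> tensor_form \<mu> (Omega D) u u * tensor_form \<mu> (Omega D) v v"
  unfolding tensor_form_def
proof (rule integral_Cauchy_Schwarz)
  show "AE x in lebesgue_on (Omega D). ((diff_tensor D \<mu> x *v u x) \<bullet> v x)\<^sup>2
      \<le> ((diff_tensor D \<mu> x *v u x) \<bullet> u x) * ((diff_tensor D \<mu> x *v v x) \<bullet> v x) \<and>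
      0 \<le> (diff_tensor D \<mu> x *v u x) \<bullet> u x \<and> 0 \<le> (diff_tensor D \<mu> x *v v x) \<bullet> v x"
    using tensor_sym_posdef[OF \<mu>]
  proof eventually_elim
    case (elim x)
    let ?A = "diff_tensor D \<mu> x"
    have sym: "transpose ?A = ?A" using elim by (simp add: sym_posdef_def)
    note pos = sym_posdef_nonneg[OF elim]
    have "(v x \<bullet> (?A *v u x) - 0 * (v x \<bullet> u x))\<^sup>2 \<le>
        (v x \<bullet> (?A *v v x) - 0 * (v x \<bullet> v x)) * (u x \<bullet> (?A *v u x) - 0 * (u x \<bullet> u x))"
      by (rule matrix_Cauchy_Schwarz[OF sym _ subspace_UNIV]) (use pos in auto)
    then show ?case using pos by (simp add: inner_commute mult.commute)
  qed
qed (intro tensor_integrable \<mu> u v)+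

lemma tensor_form_add:
  assumes \<mu>: "\<mu> \<in> params D" and u: "L2 (Omega D) u" and v: "L2 (Omega D) v" and w: "L2 (Omega D) w"
  shows "tensor_form \<mu> (Omega D) (\<lambda>x. u x + v x) w = tensor_form \<mu> (Omega D) u w + tensor_form \<mu> (Omega D) v w"
    "tensor_form \<mu> (Omega D) w (\<lambda>x. u x + v x) = tensor_form \<mu> (Omega D) w u + tensor_form \<mu> (Omega D) w v"
    "tensor_form \<mu> (Omega D) u v = tensor_form \<mu> (Omega D) v u"
proof -
  show "tensor_form \<mu> (Omega D) (\<lambda>x. u x + v x) w = tensor_form \<mu> (Omega D) u w + tensor_form \<mu> (Omega D) v w"
    unfolding tensor_form_def matrix_vector_right_distrib inner_add_left
    by (intro Bochner_Integration.integral_add tensor_integrable \<mu> u v w)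
  show "tensor_form \<mu> (Omega D) w (\<lambda>x. u x + v x) = tensor_form \<mu> (Omega D) w u + tensor_form \<mu> (Omega D) w v"
    unfolding tensor_form_def inner_add_right
    by (intro Bochner_Integration.integral_add tensor_integrable \<mu> u v w)
  show "tensor_form \<mu> (Omega D) u v = tensor_form \<mu> (Omega D) v u"
    unfolding tensor_form_def
  proof (rule integral_cong_AE)
    show "AE x in lebesgue_on (Omega D). (diff_tensor D \<mu> x *v u x) \<bullet> v x = (diff_tensor D \<mu> x *v v x) \<bullet> u x"
      using tensor_sym_posdef[OF \<mu>]
    proof eventually_elim
      case (elim x)
      then show ?case using symmetric_matrix_inner[of "diff_tensor D \<mu> x" "u x" "v x"] by (simp add: sym_posdef_def inner_commute)
    qed
  qed (use tensor_integrable[OF \<mu> u v] tensor_integrable[OF \<mu> v u] in auto)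
qed

lemma energy_eq:
  assumes \<mu>: "\<mu> \<in> params D" and q: "H1_broken D q"
  shows "energy D \<mu> q = sqrt (tensor_form \<mu> (Omega D) (broken_grad D q) (broken_grad D q))"
proof -
  have "(energy_loc D \<mu> T q)\<^sup>2 = tensor_form \<mu> T (broken_grad D q) (broken_grad D q)" if "T \<in> coarse_mesh D" for T
    using tensor_form_nonneg[OF that \<mu>] by (simp add: energy_loc_def b_loc_tensor)
  then show ?thesis unfolding energy_def using tensor_form_coarse_sum[OF \<mu> L2_broken_grad[OF q] L2_broken_grad[OF q]] by simp
qed

text \<open>Conservation gives the residual mean value zero on T. The eigenvalue bound
  \<open>c_coarse\<close> converts the gradient norm of the Poincare inequality into the energy
  norm, which explains the constant in \<open>eta_r\<close>.\<close>

lemma residual_estimate: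
  assumes T: "T \<in> coarse_mesh D" and \<mu>: "\<mu> \<in> params D" and C: "poincare T (CP T)" "CP T > 0" and u: "H1 (Omega D) u"
    and g: "L2 (Omega D) (wdiv (Omega D) (R q \<mu>))"
    and cons: "(LINT x|lebesgue_on T. wdiv (Omega D) (R q \<mu>) x) = (LINT x|lebesgue_on T. rhs D x)"
  shows "\<bar>LINT x|lebesgue_on T. (rhs D x - wdiv (Omega D) (R q \<mu>) x) * u x\<bar> \<le> eta_r D R CP T q \<mu> * energy_loc D \<mu> T u"
proof -
  let ?r = "\<lambda>x. rhs D x - wdiv (Omega D) (R q \<mu>) x" and ?G = "broken_grad D u"
  have Tb: "bounded T" and Tm: "T \<in> sets lebesgue" using coarse_compact[OF T] compact_imp_bounded coarse_sets[OF T] by auto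
  have "(LINT x|lebesgue_on T. ?r x) = 0"
    using L2_integrable_bounded[OF L2_coarse[OF T rhs_L2] Tb Tm] L2_integrable_bounded[OF L2_coarse[OF T g] Tb Tm] cons by simp
  note b = residual_bound[OF T C u L2_diff[OF rhs_L2 g] this]
  have LG: "L2 (Omega D) ?G" by (rule L2_broken_grad[OF H1_imp_broken(1)[OF u]])
  note c = c_coarse[OF T \<mu>]
  have "c_coarse D T * (l2norm T ?G)\<^sup>2 = (LINT x|lebesgue_on T. c_coarse D T * (norm (?G x))\<^sup>2)"
    by (simp add: l2norm_sq)
  also have "\<dots> \<le> tensor_form \<mu> T ?G ?G"
    unfolding tensor_form_def
  proof (rule integral_mono_AE)
    show "integrable (lebesgue_on T) (\<lambda>x. c_coarse D T * (norm (?G x))\<^sup>2)" using L2_coarse[OF T LG] by (simp add: L2_def)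
    show "AE x in lebesgue_on T. c_coarse D T * (norm (?G x))\<^sup>2 \<le> (diff_tensor D \<mu> x *v ?G x) \<bullet> ?G x"
      using c(2) by eventually_elim (simp add: power2_norm_eq_inner inner_commute)
  qed (rule tensor_integrable_coarse[OF T \<mu> LG LG])
  finally have "(l2norm T ?G)\<^sup>2 \<le> tensor_form \<mu> T ?G ?G / c_coarse D T" using c(1) by (simp add: field_simps)
  from real_sqrt_le_mono[OF this] have n: "l2norm T ?G \<le> energy_loc D \<mu> T u / sqrt (c_coarse D T)"
    by (simp add: l2norm_nonneg real_sqrt_divide energy_loc_def b_loc_tensor)
  have "\<bar>LINT x|lebesgue_on T. ?r x * u x\<bar> \<le> l2norm T ?r * (sqrt (CP T) * diameter T * l2norm T ?G)" by (rule b)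
  also have "\<dots> \<le> l2norm T ?r * (sqrt (CP T) * diameter T * (energy_loc D \<mu> T u / sqrt (c_coarse D T)))"
    using C(2) diameter_ge_0[OF Tb] by (intro mult_left_mono n) (auto simp: l2norm_nonneg)
  finally show ?thesis by (simp add: eta_r_def real_sqrt_divide mult_ac)
qed

text \<open>The defect is measured with the tensor at \<nu>, so Cauchy-Schwarz first produces the
  energy at \<nu>; passing to the energy at \<mu> costs the factor with
  \<open>alpha D \<mu> \<nu>\<close>.\<close>

lemma flux_estimate:
  assumes T: "T \<in> coarse_mesh D" and \<mu>: "\<mu> \<in> params D" "\<nu> \<in> params D" and q: "H1_broken D q" and u: "H1 (Omega D) u"
    and v: "L2 (Omega D) (R q \<mu>)"
  shows "\<bar>LINT x|lebesgue_on T. (diff_tensor D \<mu> x *v broken_grad D q x + R q \<mu> x) \<bullet> broken_grad D u x\<bar>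
    \<le> 1 / sqrt (alpha D \<mu> \<nu>) * eta_df D R T q \<mu> \<nu> * energy_loc D \<mu> T u"
proof -
  let ?w = "\<lambda>x. diff_tensor D \<mu> x *v broken_grad D q x + R q \<mu> x" and ?G = "broken_grad D u"
  let ?F = "\<lambda>x. (norm (inv_sqrt (diff_tensor D \<nu> x) *v ?w x))\<^sup>2"
  have LG: "L2 (Omega D) ?G" by (rule L2_broken_grad[OF H1_imp_broken(1)[OF u]])
  have Lw: "L2 (Omega D) ?w" by (intro L2_add L2_matrix_vector tensor_Linf \<mu> L2_broken_grad q v)
  note sub = integrable_lebesgue_on_sub[OF coarse_sets[OF T] fine_sets(3) coarse_AE_subset_Omega[OF T]]
  have "(LINT x|lebesgue_on T. ?w x \<bullet> ?G x)\<^sup>2 \<le> (LINT x|lebesgue_on T. ?F x) * tensor_form \<nu> T ?G ?G"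
    unfolding tensor_form_def
  proof (rule integral_Cauchy_Schwarz)
    show "integrable (lebesgue_on T) (\<lambda>x. ?w x \<bullet> ?G x)" by (rule sub[OF L2_inner_integrable[OF Lw LG]])
    show "integrable (lebesgue_on T) ?F" by (rule sub[OF L2_inv_sqrt[OF \<mu>(2) Lw]])
    show "AE x in lebesgue_on T. (?w x \<bullet> ?G x)\<^sup>2 \<le> ?F x * ((diff_tensor D \<nu> x *v ?G x) \<bullet> ?G x) \<and>
        0 \<le> ?F x \<and> 0 \<le> (diff_tensor D \<nu> x *v ?G x) \<bullet> ?G x"
      using AE_coarse[OF T tensor_sym_posdef[OF \<mu>(2)]]
    proof eventually_elim
      case (elim x)
      show ?case using sym_posdef_nonneg[OF elim, of "?G x"] norm_inv_sqrt(2)[OF elim, of "?w x" "?G x"] by (simp add: inner_commute)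
    qed
  qed (rule tensor_integrable_coarse[OF T \<mu>(2) LG LG])
  also have "(LINT x|lebesgue_on T. ?F x) = (eta_df D R T q \<mu> \<nu>)\<^sup>2" by (simp add: eta_df_def l2norm_sq)
  also have "(eta_df D R T q \<mu> \<nu>)\<^sup>2 * tensor_form \<nu> T ?G ?G \<le> (eta_df D R T q \<mu> \<nu>)\<^sup>2 * (tensor_form \<mu> T ?G ?G / alpha D \<mu> \<nu>)"
    using tensor_form_compare(1)[OF \<mu> LG T] alpha_pos[OF \<mu>]
    by (intro mult_left_mono) (simp_all add: field_simps)
  finally have "sqrt ((LINT x|lebesgue_on T. ?w x \<bullet> ?G x)\<^sup>2) \<le>
      sqrt ((eta_df D R T q \<mu> \<nu>)\<^sup>2 * (tensor_form \<mu> T ?G ?G / alpha D \<mu> \<nu>))" by (rule real_sqrt_le_mono)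
  then show ?thesis
    by (simp add: real_sqrt_mult real_sqrt_divide energy_loc_def b_loc_tensor eta_df_def l2norm_nonneg)
qed

text \<open>The field v is added and subtracted, and its product with the gradient of w is
  integrated by parts over the whole domain before the integrals are split. No face terms arise
  although q is discontinuous.\<close>

lemma broken_residual:
  assumes \<mu>: "\<mu> \<in> params D" and p: "weak_solution D \<mu> p" and q: "H1_broken D q" and w: "H10 (Omega D) w"
    and v: "has_weak_div (Omega D) v g"
  shows "tensor_form \<mu> (Omega D) (\<lambda>x. broken_grad D p x - broken_grad D q x) (broken_grad D w) =
    (\<Sum>T\<in>coarse_mesh D. (LINT x|lebesgue_on T. (rhs D x - g x) * w x) -
       (LINT x|lebesgue_on T. (diff_tensor D \<mu> x *v broken_grad D q x + v x) \<bullet> broken_grad D w x))"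
proof -
  let ?P = "broken_grad D p" and ?Q = "broken_grad D q" and ?G = "broken_grad D w"
  have Lv: "L2 (Omega D) v" "L2 (Omega D) g" using v by (auto simp: has_weak_div_def)
  have H1w: "H1 (Omega D) w" using w by (simp add: H10_def)
  have pH: "H1 (Omega D) p" using p by (simp add: weak_solution_def H10_def)
  have Lw: "L2 (Omega D) w" using H1_wgrad[OF H1w] by (simp add: has_weak_grad_def)
  have LP: "L2 (Omega D) ?P" by (rule L2_broken_grad[OF H1_imp_broken(1)[OF pH]])
  have LQ: "L2 (Omega D) ?Q" by (rule L2_broken_grad[OF q])
  have LG: "L2 (Omega D) ?G" by (rule L2_broken_grad[OF H1_imp_broken(1)[OF H1w]])
  have Lg: "L2 (Omega D) (wgrad (Omega D) w)" using H1_wgrad[OF H1w] by (simp add: has_weak_grad_def)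
  note i1 = L2_mult_integrable[OF rhs_L2 Lw] and i2 = L2_mult_integrable[OF Lv(2) Lw]
  note i3 = tensor_integrable[OF \<mu> LQ LG] and i4 = L2_inner_integrable[OF Lv(1) LG]
  have "tensor_form \<mu> (Omega D) ?P ?G = b_form D \<mu> p w"
    unfolding b_form_def b_loc_tensor by (rule tensor_form_coarse_sum[OF \<mu> LP LG])
  also have "\<dots> = (LINT x|lebesgue_on (Omega D). rhs D x * w x)" using p w by (simp add: weak_solution_def)
  finally have PG: "tensor_form \<mu> (Omega D) ?P ?G = (LINT x|lebesgue_on (Omega D). rhs D x * w x)" .
  have "(LINT x|lebesgue_on (Omega D). v x \<bullet> ?G x) = (LINT x|lebesgue_on (Omega D). v x \<bullet> wgrad (Omega D) w x)"
  proof (rule integral_cong_AE)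
    show "AE x in lebesgue_on (Omega D). v x \<bullet> ?G x = v x \<bullet> wgrad (Omega D) w x"
      using H1_imp_broken(2)[OF H1w] by eventually_elim simp
  qed (use i4 L2_inner_integrable[OF Lv(1) Lg] in auto)
  also have "\<dots> = - (LINT x|lebesgue_on (Omega D). g x * w x)" by (rule weak_div_H10[OF Omega(1) v w])
  finally have vG: "(LINT x|lebesgue_on (Omega D). v x \<bullet> ?G x) = - (LINT x|lebesgue_on (Omega D). g x * w x)" .
  have "tensor_form \<mu> (Omega D) (\<lambda>x. ?P x - ?Q x) ?G = tensor_form \<mu> (Omega D) ?P ?G - tensor_form \<mu> (Omega D) ?Q ?G"
    unfolding tensor_form_def matrix_vector_mult_diff_distrib inner_diff_left
    by (intro Bochner_Integration.integral_diff tensor_integrable \<mu> LP LQ LG)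
  also have "\<dots> = ((LINT x|lebesgue_on (Omega D). rhs D x * w x) - (LINT x|lebesgue_on (Omega D). g x * w x)) -
      ((LINT x|lebesgue_on (Omega D). (diff_tensor D \<mu> x *v ?Q x) \<bullet> ?G x) + (LINT x|lebesgue_on (Omega D). v x \<bullet> ?G x))"
    unfolding PG vG by (simp add: tensor_form_def)
  also have "\<dots> = (LINT x|lebesgue_on (Omega D). (rhs D x - g x) * w x) -
      (LINT x|lebesgue_on (Omega D). (diff_tensor D \<mu> x *v ?Q x + v x) \<bullet> ?G x)"
    unfolding left_diff_distrib inner_add_left
    by (simp only: Bochner_Integration.integral_diff[OF i1 i2] Bochner_Integration.integral_add[OF i3 i4])
  also have "(LINT x|lebesgue_on (Omega D). (rhs D x - g x) * w x) = (\<Sum>T\<in>coarse_mesh D. LINT x|lebesgue_on T. (rhs D x - g x) * w x)"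
    by (rule integral_Omega_coarse[OF L2_mult_integrable[OF L2_diff[OF rhs_L2 Lv(2)] Lw]])
  also have "(LINT x|lebesgue_on (Omega D). (diff_tensor D \<mu> x *v ?Q x + v x) \<bullet> ?G x) =
      (\<Sum>T\<in>coarse_mesh D. LINT x|lebesgue_on T. (diff_tensor D \<mu> x *v ?Q x + v x) \<bullet> ?G x)"
    by (intro integral_Omega_coarse L2_inner_integrable L2_add L2_matrix_vector tensor_Linf \<mu> LQ Lv LG)
  finally show ?thesis by (simp only: sum_subtractf)
qed

lemma sum_Cauchy_Schwarz_sqrt:
  fixes f g :: "'a \<Rightarrow> real"
  shows "(\<Sum>i\<in>I. \<bar>f i\<bar> * \<bar>g i\<bar>) \<le> sqrt (\<Sum>i\<in>I. (f i)\<^sup>2) * sqrt (\<Sum>i\<in>I. (g i)\<^sup>2)"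
  using L2_set_mult_ineq[of f g I] by (simp add: L2_set_def)

text \<open>The discrete equation is assumed for the coarse indicator functions, which both discrete
  spaces contain, so that one statement serves the DG solution and the reduced solution.\<close>

lemma error_estimate:
  assumes k: "k \<ge> 1" and \<mu>: "\<mu> \<in> params D" "\<mu>bar \<in> params D" "\<mu>hat \<in> params D"
    and q: "q \<in> Qh D k" and fl: "is_flux D l q \<mu> (R q \<mu>)" and p: "weak_solution D \<mu> p"
    and dg: "\<forall>T\<in>coarse_mesh D. b_h D \<mu> q (indicat_real T) = (LINT x|lebesgue_on (Omega D). rhs D x * indicat_real T x)"
    and CP: "\<forall>T\<in>coarse_mesh D. CP T > 0 \<and> poincare T (CP T)"
  shows "energy D \<mu>bar (\<lambda>x. p x - q x) \<le> eta D k R CP q \<mu> \<mu>bar \<mu>hat"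
proof -
  define s where "s = oswald D k q"
  define w where "w = (\<lambda>x. p x - s x)"
  have pH: "H10 (Omega D) p" using p by (simp add: weak_solution_def)
  have sH: "H10 (Omega D) s" unfolding s_def by (rule oswald_H10[OF k])
  have wH: "H10 (Omega D) w" unfolding w_def by (rule H10_diff[OF Omega(1) pH sH])
  have qB: "H1_broken D q" using q by (simp add: Qh_def)
  have sB: "H1_broken D s" and pB: "H1_broken D p" and wB: "H1_broken D w"
    using pH sH wH H1_imp_broken(1) by (auto simp: H10_def)
  let ?P = "broken_grad D p" and ?Q = "broken_grad D q" and ?S = "broken_grad D s" and ?G = "broken_grad D w"
  let ?E = "\<lambda>x. ?P x - ?Q x" and ?W = "\<lambda>x. ?P x - ?S x" and ?Z = "\<lambda>x. ?S x - ?Q x"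
  note LP = L2_broken_grad[OF pB] and LQ = L2_broken_grad[OF qB] and LS = L2_broken_grad[OF sB] and LG = L2_broken_grad[OF wB]
  note LE = L2_diff[OF LP LQ] and LW = L2_diff[OF LP LS] and LZ = L2_diff[OF LS LQ]
  have GW: "AE x in lebesgue_on (Omega D). ?G x = ?W x" unfolding w_def by (rule broken_diff(2)[OF pB sB])
  let ?B = "tensor_form \<mu> (Omega D)"
  define a c d where "a = ?B ?W ?W" and "c = ?B ?W ?Z" and "d = ?B ?Z ?Z"
  define N1 where "N1 = sqrt (\<Sum>T\<in>coarse_mesh D. (eta_nc D k T q \<mu>bar)\<^sup>2)"
  define N2 where "N2 = sqrt (\<Sum>T\<in>coarse_mesh D. (eta_r D R CP T q \<mu>)\<^sup>2)"
  define N3 where "N3 = sqrt (\<Sum>T\<in>coarse_mesh D. (eta_df D R T q \<mu> \<mu>hat)\<^sup>2)"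
  \<comment> \<open>The bound for the residual as a functional on \<open>H10\<close> with the energy
    norm at \<mu>.\<close>
  define b where "b = N2 + 1 / sqrt (alpha D \<mu> \<mu>hat) * N3"
  have N0: "N1 \<ge> 0" "N2 \<ge> 0" "N3 \<ge> 0" by (simp_all add: N1_def N2_def N3_def sum_nonneg)
  have b0: "b \<ge> 0" using N0 alpha_pos[OF \<mu>(1,3)] by (simp add: b_def)
  have nonneg: "tensor_form \<nu> (Omega D) u u \<ge> 0" if "\<nu> \<in> params D" "L2 (Omega D) u" for u \<nu>
    unfolding tensor_form_coarse_sum[OF that that(2)] using tensor_form_nonneg[OF _ that(1)] by (simp add: sum_nonneg)
  have split: "?E = (\<lambda>x. ?W x + ?Z x)" by auto
  have EE: "?B ?E ?E = a + 2 * c + d"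
    unfolding split tensor_form_add(1)[OF \<mu>(1) LW LZ L2_add[OF LW LZ]] tensor_form_add(2)[OF \<mu>(1) LW LZ LW]
      tensor_form_add(2)[OF \<mu>(1) LW LZ LZ] a_def c_def d_def
    using tensor_form_add(3)[OF \<mu>(1) LW LZ LW] by simp
  have EW: "?B ?E ?W = a + c"
    unfolding split tensor_form_add(1)[OF \<mu>(1) LW LZ LW] a_def c_def
    using tensor_form_add(3)[OF \<mu>(1) LW LZ LW] by simp
  have wd: "has_weak_div (Omega D) (R q \<mu>) (wdiv (Omega D) (R q \<mu>))"
    using fl wdiv_weak_div by (auto simp: is_flux_def RTN_space_def)
  then have Lv: "L2 (Omega D) (R q \<mu>)" "L2 (Omega D) (wdiv (Omega D) (R q \<mu>))" by (auto simp: has_weak_div_def)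
  have H1w: "H1 (Omega D) w" using wH by (simp add: H10_def)
  have aG: "a = ?B ?G ?G" unfolding a_def by (rule tensor_form_cong[OF \<mu>(1) LG LG GW GW, symmetric])
  have sa: "sqrt a = sqrt (\<Sum>T\<in>coarse_mesh D. (energy_loc D \<mu> T w)\<^sup>2)"
    unfolding aG energy_eq[OF \<mu>(1) wB, symmetric] by (simp add: energy_def)
  have "\<bar>a + c\<bar> = \<bar>?B ?E ?G\<bar>"
    unfolding EW[symmetric] using tensor_form_cong[OF \<mu>(1) LE LG AE_I2[OF refl] GW] by simp
  also have "\<dots> \<le> (\<Sum>T\<in>coarse_mesh D. \<bar>(LINT x|lebesgue_on T. (rhs D x - wdiv (Omega D) (R q \<mu>) x) * w x) -
       (LINT x|lebesgue_on T. (diff_tensor D \<mu> x *v ?Q x + R q \<mu> x) \<bullet> ?G x)\<bar>)"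
    unfolding broken_residual[OF \<mu>(1) p qB wH wd] by (rule sum_abs)
  also have "\<dots> \<le> (\<Sum>T\<in>coarse_mesh D. \<bar>eta_r D R CP T q \<mu>\<bar> * \<bar>energy_loc D \<mu> T w\<bar> +
       1 / sqrt (alpha D \<mu> \<mu>hat) * (\<bar>eta_df D R T q \<mu> \<mu>hat\<bar> * \<bar>energy_loc D \<mu> T w\<bar>))"
  proof (rule sum_mono)
    fix T assume T: "T \<in> coarse_mesh D"
    let ?I = "LINT x|lebesgue_on T. (rhs D x - wdiv (Omega D) (R q \<mu>) x) * w x"
      and ?J = "LINT x|lebesgue_on T. (diff_tensor D \<mu> x *v ?Q x + R q \<mu> x) \<bullet> ?G x"
    have cons: "(LINT x|lebesgue_on T. wdiv (Omega D) (R q \<mu>) x) = (LINT x|lebesgue_on T. rhs D x)"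
      by (rule local_conservation[OF fl T rhs_L2 bspec[OF dg T]])
    have "\<bar>?I\<bar> \<le> eta_r D R CP T q \<mu> * energy_loc D \<mu> T w"
      by (rule residual_estimate[where R = R and CP = CP, OF T \<mu>(1) _ _ H1w Lv(2) cons]) (use CP T in auto)
    also have "\<dots> \<le> \<bar>eta_r D R CP T q \<mu>\<bar> * \<bar>energy_loc D \<mu> T w\<bar>" by (simp add: abs_mult[symmetric])
    finally have I: "\<bar>?I\<bar> \<le> \<bar>eta_r D R CP T q \<mu>\<bar> * \<bar>energy_loc D \<mu> T w\<bar>" .
    have "\<bar>?J\<bar> \<le> 1 / sqrt (alpha D \<mu> \<mu>hat) * eta_df D R T q \<mu> \<mu>hat * energy_loc D \<mu> T w"
      by (rule flux_estimate[where R = R, OF T \<mu>(1,3) qB H1w Lv(1)])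
    also have "\<dots> = 1 / sqrt (alpha D \<mu> \<mu>hat) * (eta_df D R T q \<mu> \<mu>hat * energy_loc D \<mu> T w)" by (rule mult.assoc)
    also have "\<dots> \<le> 1 / sqrt (alpha D \<mu> \<mu>hat) * (\<bar>eta_df D R T q \<mu> \<mu>hat\<bar> * \<bar>energy_loc D \<mu> T w\<bar>)"
      using alpha_pos[OF \<mu>(1,3)] by (intro mult_left_mono) (auto simp: abs_mult[symmetric])
    finally have "\<bar>?J\<bar> \<le> 1 / sqrt (alpha D \<mu> \<mu>hat) * (\<bar>eta_df D R T q \<mu> \<mu>hat\<bar> * \<bar>energy_loc D \<mu> T w\<bar>)" .
    then show "\<bar>?I - ?J\<bar> \<le> \<bar>eta_r D R CP T q \<mu>\<bar> * \<bar>energy_loc D \<mu> T w\<bar> +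
        1 / sqrt (alpha D \<mu> \<mu>hat) * (\<bar>eta_df D R T q \<mu> \<mu>hat\<bar> * \<bar>energy_loc D \<mu> T w\<bar>)"
      by (rule order_trans[OF abs_triangle_ineq4 add_mono[OF I]])
  qed
  also have "\<dots> \<le> N2 * sqrt a + 1 / sqrt (alpha D \<mu> \<mu>hat) * (N3 * sqrt a)"
    unfolding sum.distrib sum_distrib_left[symmetric] sa N2_def N3_def
    using alpha_pos[OF \<mu>(1,3)] by (intro add_mono mult_left_mono sum_Cauchy_Schwarz_sqrt) simp
  finally have ac: "\<bar>a + c\<bar> \<le> b * sqrt a" by (simp add: b_def distrib_right)
  have "a + 2 * c + d \<le> b\<^sup>2 + d"
    by (rule projection_bound[OF _ _ b0 ac]) (use nonneg[OF \<mu>(1) LW] tensor_form_CS[OF \<mu>(1) LW LZ] in \<open>simp_all add: a_def c_def d_def\<close>)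
  moreover have "d \<le> gamma D \<mu> \<mu>bar * N1\<^sup>2"
  proof -
    let ?n = "\<lambda>x. q x - s x"
    note nB = broken_diff[OF qB sB]
    have "d \<le> gamma D \<mu> \<mu>bar * tensor_form \<mu>bar (Omega D) ?Z ?Z"
      unfolding d_def by (rule tensor_form_sum_compare(2)[OF \<mu>(1,2) LZ])
    also have "tensor_form \<mu>bar (Omega D) ?Z ?Z = tensor_form \<mu>bar (Omega D) (\<lambda>x. ?Q x - ?S x) (\<lambda>x. ?Q x - ?S x)"
      by (simp add: tensor_form_def matrix_vector_mult_diff_distrib inner_diff algebra_simps)
    also have "\<dots> = tensor_form \<mu>bar (Omega D) (broken_grad D ?n) (broken_grad D ?n)"
      by (rule tensor_form_cong[OF \<mu>(2) L2_broken_grad[OF nB(1)] L2_broken_grad[OF nB(1)] nB(2) nB(2), symmetric])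
    also have "\<dots> = (energy D \<mu>bar ?n)\<^sup>2"
      unfolding energy_eq[OF \<mu>(2) nB(1)] using nonneg[OF \<mu>(2) L2_broken_grad[OF nB(1)]] by simp
    also have "energy D \<mu>bar ?n = N1" unfolding energy_def N1_def eta_nc_def s_def ..
    finally show ?thesis .
  qed
  ultimately have "?B ?E ?E \<le> b\<^sup>2 + (sqrt (gamma D \<mu> \<mu>bar) * N1)\<^sup>2"
    using gamma_nonneg[OF \<mu>(1,2)] by (simp add: EE power_mult_distrib)
  \<comment> \<open>From a sum of squares to the square of a sum: the estimator has the additive
    form.\<close>
  also have "\<dots> \<le> (sqrt (gamma D \<mu> \<mu>bar) * N1 + b)\<^sup>2"
    using b0 N0(1) gamma_nonneg[OF \<mu>(1,2)] by (simp add: power2_sum)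
  finally have "sqrt (?B ?E ?E) \<le> sqrt ((sqrt (gamma D \<mu> \<mu>bar) * N1 + b)\<^sup>2)" by (rule real_sqrt_le_mono)
  then have BE: "sqrt (?B ?E ?E) \<le> sqrt (gamma D \<mu> \<mu>bar) * N1 + b"
    using b0 N0(1) gamma_nonneg[OF \<mu>(1,2)] by simp
  note eB = broken_diff[OF pB qB]
  have "energy D \<mu>bar (\<lambda>x. p x - q x) = sqrt (tensor_form \<mu>bar (Omega D) ?E ?E)"
    unfolding energy_eq[OF \<mu>(2) eB(1)]
    using tensor_form_cong[OF \<mu>(2) L2_broken_grad[OF eB(1)] L2_broken_grad[OF eB(1)] eB(2) eB(2)] by simp
  \<comment> \<open>The error has been bounded in the energy at \<mu>; the passage to the norm at
    \<open>\<mu>bar\<close> yields the outer factor of the estimator.\<close>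
  also have "\<dots> \<le> sqrt (?B ?E ?E / alpha D \<mu> \<mu>bar)"
    using tensor_form_sum_compare(1)[OF \<mu>(1,2) LE] alpha_pos[OF \<mu>(1,2)]
    by (intro real_sqrt_le_mono) (simp add: pos_le_divide_eq mult.commute)
  also have "\<dots> = 1 / sqrt (alpha D \<mu> \<mu>bar) * sqrt (?B ?E ?E)" by (simp add: real_sqrt_divide)
  also have "\<dots> \<le> 1 / sqrt (alpha D \<mu> \<mu>bar) * (sqrt (gamma D \<mu> \<mu>bar) * N1 + b)"
    using alpha_pos[OF \<mu>(1,2)] by (intro mult_left_mono BE) simp
  also have "\<dots> = eta D k R CP q \<mu> \<mu>bar \<mu>hat" by (simp add: eta_def b_def N1_def N2_def N3_def add.assoc)
  finally show ?thesis .
qed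

end

text \<open>The DG solution has degree 1, while interpolation and reconstruction are set up for
  degree k.\<close>

lemma Qh_mono: "q \<in> Qh D j \<Longrightarrow> j \<le> k \<Longrightarrow> q \<in> Qh D k"
  unfolding Qh_def local_space_def using Poly_mono by blast

theorem corollary4p5:
  fixes D :: "('d::finite, 'm::finite) dg_data"
    and k l :: nat
    and \<mu> \<mu>bar \<mu>hat :: "real^'m"
    and Qred :: "(real^'d) set \<Rightarrow> (real^'d \<Rightarrow> real) set"
    and CP :: "(real^'d) set \<Rightarrow> real"
    and R :: "(real^'d \<Rightarrow> real) \<Rightarrow> real^'m \<Rightarrow> real^'d \<Rightarrow> real^'d"
    and p ph pred :: "real^'d \<Rightarrow> real"
  assumes "CARD('d) \<in> {2, 3}"
    and "polygonal_domain (Omega D)"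
    and "mesh_assms D"
    and "data_assms D"
    and "k \<ge> 1" and "k - 1 \<le> l" and "l \<le> k"
    and "continuous_coercive D k"
    and "\<mu> \<in> params D" and "\<mu>bar \<in> params D" and "\<mu>hat \<in> params D"
    and "\<forall>T\<in>coarse_mesh D. reduced_space D k T (Qred T)"
    and "\<forall>T\<in>coarse_mesh D. CP T > 0 \<and> poincare T (CP T)"
    and "flux_reconstruction D k l R"
    and "weak_solution D \<mu> p"
    and "dg_solution D \<mu> (Qh D 1) ph"
    and "dg_solution D \<mu> (Q_red D k Qred) pred"
  shows "energy D \<mu>bar (\<lambda>x. p x - ph x) \<le> eta D k R CP ph \<mu> \<mu>bar \<mu>hat \<and>
         energy D \<mu>bar (\<lambda>x. p x - pred x) \<le> eta D k R CP pred \<mu> \<mu>bar \<mu>hat"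
proof -
  interpret fem_problem D using assms(2-4) by unfold_locales
  have flux: "is_flux D l q \<mu> (R q \<mu>)" if "q \<in> Qh D k" for q
    using assms(9,14) that by (simp add: flux_reconstruction_def)
  \<comment> \<open>The space V has to lie in \<open>Qh D k\<close> for the reconstruction and to
    contain the coarse indicator functions for conservation.\<close>
  have est: "energy D \<mu>bar (\<lambda>x. p x - q x) \<le> eta D k R CP q \<mu> \<mu>bar \<mu>hat"
    if V: "dg_solution D \<mu> V q" "V \<subseteq> Qh D k" "\<And>T. T \<in> coarse_mesh D \<Longrightarrow> indicat_real T \<in> V" for V q
  proof -
    have q: "q \<in> Qh D k" using V(1,2) by (auto simp: dg_solution_def)
    have dg: "\<forall>T\<in>coarse_mesh D. b_h D \<mu> q (indicat_real T) = (LINT x|lebesgue_on (Omega D). rhs D x * indicat_real T x)"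
      using V(1,3) by (simp add: dg_solution_def)
    show ?thesis by (rule error_estimate[where R = R, OF assms(5,9-11) q flux[OF q] assms(15) dg assms(13)])
  qed
  show ?thesis
  proof
    show "energy D \<mu>bar (\<lambda>x. p x - ph x) \<le> eta D k R CP ph \<mu> \<mu>bar \<mu>hat"
      by (rule est[OF assms(16)]) (use indicator_coarse_Qh Qh_mono[OF _ assms(5)] in auto)
    show "energy D \<mu>bar (\<lambda>x. p x - pred x) \<le> eta D k R CP pred \<mu> \<mu>bar \<mu>hat"
      by (rule est[OF assms(17)]) (use indicator_coarse_Q_red[OF _ assms(12)] in \<open>auto simp: Q_red_def\<close>)
  qed
qed

end
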